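(* Let $T\in(0,\infty)$ and let $\sigma_0:\mathbb R\times\mathcal P_2(\mathbb R)\to\mathbb R$ satisfy the regularity assumption (R) of the context for some integer $k$. Let $\phi$ be the backward flow associated with $\sigma_0$. Then there is a constant $C>0$ such that for each $m\in[0,T]$, $$\sup_{\mu\in\mathcal P_2(\mathbb R),\,y\in\mathbb R}\bigg(\sum_{i=1}^{k+1}\|\partial_x^i\phi(\cdot,\mu,m)\|_{L^\infty}+\sum_{i=1}^{k}\Big(\|\partial_x^iD_{y\mu}\phi(\cdot,\mu,m)(y)\|_{L^\infty}+\|\partial_x^iD_\mu\phi(\cdot,\mu,m)(y)\|_{L^\infty}\Big)\bigg)\le C\,e^{C|m|}.$$ The same result holds with $\phi$ replaced by the forward flow $\psi$.
   Context: **Notation.** $\mathcal P_2(\mathbb R)$ is the set of Borel probability measures on $\mathbb R$ with finite second moment. $\lambda$ is a fixed exponent, large enough that the following is finite ($\lambda>1/2$): $|\mu-\nu|_{-\lambda}^2:=\int_{\mathbb R}\frac{|F_\xi(\mu-\nu)|^2}{(1+|\xi|^2)^\lambda}d\xi$, $F_\xi(\eta):=(2\pi)^{-1/2}\int e^{i\xi x}\eta(dx)$. $\sharp$ denotes pushforward. For a function $u$ on $\mathcal P_2(\mathbb R)$, $\delta_\mu u(\mu,\cdot)$ is its linear functional derivative: it is continuous in $(\mu,y)$, of at most quadratic growth in $y$, and satisfies $u(m_1)-u(m_2)=\int_0^1\int\delta_\mu u(sm_1+(1-s)m_2,y)(m_1-m_2)(dy)ds$; $D_\mu u(\mu)(y):=\partial_y\delta_\mu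 u(\mu,y)$ is the Lions derivative and $D_{y\mu}u(\mu)(y):=\partial_yD_\mu u(\mu)(y)$. For functions of further variables these are taken in $\mu$ with the other variables fixed; $\partial_x^i$ acts on the first (spatial) argument $x$, and $\|\cdot\|_{L^\infty}$ is over $x\in\mathbb R$. **Assumption (R) on $\sigma_0$** (for some integer $k$). (a) $\sigma_0$ and $D_\mu\sigma_0$ are bounded, Borel measurable, and there is $L>0$ such that for all $x_1,x_2,y_1,y_2\in\mathbb R$, $\mu,\nu\in\mathcal P_2(\mathbb R)$: $|\sigma_0(x_1,\mu)-\sigma_0(x_2,\nu)|\le L|x_1-x_2|+L|\mu-\nu|_{-\lambda}$, and both $|D_\mu\sigma_0(x_1,\mu)(y_1)-D_\mu\sigma_0(x_2,\nu)(y_2)|$ and $|D_{y\mu}\sigma_0(x_1,\mu)(y_1)-D_{y\mu}\sigma_0(x_2,\nu)(y_2)|$ are at most $L|x_1-x_2|+L|y_1-y_2|+L|\mu-\nu|_{-\lambda}$. (b) $\sigma_0(\cdot,\mu)\in W^{k+2,\infty}(\mathbb R)$ uniformly in $\mu$, $D_\mu\sigma_0(\cdot,\mu)(y)$ exists and lies in $W^{k+1,\infty}(\mathbb R)$ uniformly in $(y,\mu)$, and $\sup_{\mu,y}\big(\sum_{i=0}^{k+2}\|\partial_x^i\sigma_0(\cdot,\mu)\|_{L^\infty}+\sum_{i=0}^{k}(\|\partial_x^iD_\mu\sigma_0(\cdot,\mu)(y)\|_{L^\infty}+\|\partial_x^iD_{y\mu}\sigma_0(\cdot,\mu)(y)\|_{L^\infty})\big)\le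 C_k$. **Flows.** The forward flow $\psi:\mathbb R\times\mathcal P_2(\mathbb R)\times\mathbb R\to\mathbb R$ is the solution of $$\partial_m\psi(x,\mu,m)=\partial_x\psi(x,\mu,m)\sigma_0(x,\mu)+\int_{\mathbb R}D_\mu\psi(x,\mu,m)(y)\sigma_0(y,\mu)\mu(dy),\quad\psi(x,\mu,0)=x$$ (equivalently $\partial_m\psi(x,\mu,m)=\sigma_0(\psi(x,\mu,m),\mu_m)$, $\mu_m:=\psi(\cdot,\mu,m)_\sharp\mu$, $\psi(x,\mu,0)=x$). The backward flow $\phi$ solves the same equation with $\sigma_0$ replaced by $-\sigma_0$; equivalently $\phi(x,\mu,m)=\psi(x,\mu,-m)$. *)

theory Defs
  imports "HOL-Probability.Probability"
begin

section \<open>The space of measures with finite second moment\<close>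

definition P2 :: "real measure set" where
  "P2 = {\<mu>. real_distribution \<mu> \<and> integrable \<mu> (\<lambda>x. x\<^sup>2)}"

definition couplings :: "real measure \<Rightarrow> real measure \<Rightarrow> (real \<times> real) measure set" where
  "couplings \<mu> \<nu> = {\<pi>. prob_space \<pi> \<and> sets \<pi> = sets (borel \<Otimes>\<^sub>M borel)
      \<and> distr \<pi> borel fst = \<mu> \<and> distr \<pi> borel snd = \<nu>}"

definition W2 :: "real measure \<Rightarrow> real measure \<Rightarrow> real" where
  "W2 \<mu> \<nu> = sqrt (INF \<pi>\<in>couplings \<mu> \<nu>. \<integral>z. (fst z - snd z)\<^sup>2 \<partial>\<pi>)"

text \<open>The Borel sigma-algebra of the Wasserstein topology.\<close>

definition P2_borel :: "real measure measure" where
  "P2_borel = sigma P2 {U. U \<subseteq> P2 \<and> (\<forall>\<mu>\<in>U. \<exists>e>0. \<forall>\<nu>\<in>P2. W2 \<nu> \<mu> < e \<longrightarrow> \<nu> \<in> U)}"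

definition fourier :: "real measure \<Rightarrow> real \<Rightarrow> complex" where
  "fourier \<mu> \<xi> = char \<mu> \<xi> / of_real (sqrt (2 * pi))"

text \<open>For \<open>lam > 1/2\<close> the integrand is integrable, because characteristic functions
  are bounded by 1.\<close>

definition neg_sobolev_dist :: "real \<Rightarrow> real measure \<Rightarrow> real measure \<Rightarrow> real" where
  "neg_sobolev_dist lam \<mu> \<nu> =
     sqrt (LBINT \<xi>. (norm (fourier \<mu> \<xi> - fourier \<nu> \<xi>))\<^sup>2 / (1 + \<xi>\<^sup>2) powr lam)"

section \<open>Derivatives in the measure argument\<close>

text \<open>The convex combination \<open>s m1 + (1 - s) m2\<close>, for \<open>0 \<le> s \<le> 1\<close>.\<close>

definition mix_measure :: "real \<Rightarrow> real measure \<Rightarrow> real measure \<Rightarrow> real measure" where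
  "mix_measure s m1 m2 = measure_of UNIV (sets borel)
     (\<lambda>A. ennreal s * emeasure m1 A + ennreal (1 - s) * emeasure m2 A)"

lemma emeasure_mix_measure:
  assumes "sets m1 = sets borel" "sets m2 = sets borel" "A \<in> sets borel"
  shows "emeasure (mix_measure s m1 m2) A
           = ennreal s * emeasure m1 A + ennreal (1 - s) * emeasure m2 A"
  unfolding mix_measure_def
proof (rule emeasure_measure_of_sigma)
  show "sigma_algebra UNIV (sets (borel :: real measure))"
    by (metis sets.sigma_algebra_axioms space_borel)
  show "positive (sets borel)
      (\<lambda>A. ennreal s * emeasure m1 A + ennreal (1 - s) * emeasure m2 A)"
    by (simp add: positive_def)
  show "countably_additive (sets borel)
      (\<lambda>A. ennreal s * emeasure m1 A + ennreal (1 - s) * emeasure m2 A)"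
    unfolding countably_additive_def
  proof (intro allI impI)
    fix F :: "nat \<Rightarrow> real set"
    assume F: "range F \<subseteq> sets borel" "disjoint_family F"
    have "(\<Sum>i. emeasure m1 (F i)) = emeasure m1 (\<Union>i. F i)"
         "(\<Sum>i. emeasure m2 (F i)) = emeasure m2 (\<Union>i. F i)"
      using F assms by (auto intro!: suminf_emeasure)
    then show "(\<Sum>i. ennreal s * emeasure m1 (F i) + ennreal (1 - s) * emeasure m2 (F i))
        = ennreal s * emeasure m1 (\<Union>i. F i) + ennreal (1 - s) * emeasure m2 (\<Union>i. F i)"
      by (simp add: suminf_add[symmetric] ennreal_suminf_cmult)
  qed
qed (use assms in auto)

text \<open>Continuity is (sequential) continuity for \<open>W2\<close> in the measure and the usual topology in
  the real variable. The quadratic growth is uniform on bounded subsets of \<^const>\<open>P2\<close>.\<close>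

definition has_linear_deriv ::
    "(real measure \<Rightarrow> real) \<Rightarrow> (real measure \<Rightarrow> real \<Rightarrow> real) \<Rightarrow> bool" where
  "has_linear_deriv u \<delta> \<longleftrightarrow>
     (\<forall>\<mu>\<in>P2. \<forall>y M z. (\<forall>n. M n \<in> P2) \<longrightarrow> (\<lambda>n. W2 (M n) \<mu>) \<longlonglongrightarrow> 0 \<longrightarrow> z \<longlonglongrightarrow> y
        \<longrightarrow> (\<lambda>n. \<delta> (M n) (z n)) \<longlonglongrightarrow> \<delta> \<mu> y) \<and>
     (\<forall>R. \<exists>K. \<forall>\<mu>\<in>P2. (\<integral>x. x\<^sup>2 \<partial>\<mu>) \<le> R \<longrightarrow> (\<forall>y. \<bar>\<delta> \<mu> y\<bar> \<le> K * (1 + y\<^sup>2))) \<and>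
     (\<forall>m1\<in>P2. \<forall>m2\<in>P2.
        ((\<lambda>s. (\<integral>y. \<delta> (mix_measure s m1 m2) y \<partial>m1) - (\<integral>y. \<delta> (mix_measure s m1 m2) y \<partial>m2))
           has_integral (u m1 - u m2)) {0..1})"

text \<open>The linear functional derivative is unique only up to an additive function of the measure;
  the Lions derivative \<open>D \<mu> y\<close> does not depend on that choice.\<close>

definition has_Lions_deriv ::
    "(real measure \<Rightarrow> real) \<Rightarrow> (real measure \<Rightarrow> real \<Rightarrow> real) \<Rightarrow> bool" where
  "has_Lions_deriv u D \<longleftrightarrow>
     (\<exists>\<delta>. has_linear_deriv u \<delta> \<and> (\<forall>\<mu>\<in>P2. \<forall>y. (\<delta> \<mu> has_real_derivative D \<mu> y) (at y)))"

section \<open>Weak derivatives on the real line\<close>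

definition test_function :: "(real \<Rightarrow> real) \<Rightarrow> bool" where
  "test_function \<eta> \<longleftrightarrow>
     (\<forall>n. (deriv ^^ n) \<eta> differentiable_on UNIV) \<and> (\<exists>R. \<forall>x. \<bar>x\<bar> > R \<longrightarrow> \<eta> x = 0)"

definition locally_integrable :: "(real \<Rightarrow> real) \<Rightarrow> bool" where
  "locally_integrable f \<longleftrightarrow> (\<forall>a b. set_integrable lborel {a..b} f)"

definition has_weak_deriv :: "nat \<Rightarrow> (real \<Rightarrow> real) \<Rightarrow> (real \<Rightarrow> real) \<Rightarrow> bool" where
  "has_weak_deriv i f g \<longleftrightarrow> locally_integrable f \<and> locally_integrable g \<and>
     (\<forall>\<eta>. test_function \<eta> \<longrightarrow>
        (LBINT x. f x * (deriv ^^ i) \<eta> x) = (-1) ^ i * (LBINT x. g x * \<eta> x))"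

text \<open>The \<open>L\<^sup>\<infinity>\<close>-norm of the \<open>i\<close>-th weak derivative of \<open>f\<close>. Weak derivatives agree almost
  everywhere, so the infimum ranges over at most one value; it is \<open>\<infinity>\<close> if \<open>f\<close> has no
  \<open>i\<close>-th weak derivative. Hence \<open>f \<in> W\<^sup>n\<^sup>,\<^sup>\<infinity>\<close> iff \<open>W_norm n f < \<infinity>\<close>.\<close>

definition weak_deriv_norm :: "nat \<Rightarrow> (real \<Rightarrow> real) \<Rightarrow> ennreal" where
  "weak_deriv_norm i f = (INF g\<in>{g. has_weak_deriv i f g}. esssup lborel (\<lambda>x. ennreal \<bar>g x\<bar>))"

definition W_norm :: "nat \<Rightarrow> (real \<Rightarrow> real) \<Rightarrow> ennreal" where
  "W_norm n f = (\<Sum>i=0..n. weak_deriv_norm i f)"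

section \<open>Regularity of the coefficient\<close>

text \<open>\<open>D x \<mu> y\<close> and \<open>Dy x \<mu> y\<close> stand for \<open>D\<^sub>\<mu>\<sigma>(x,\<mu>)(y)\<close> and \<open>D\<^sub>y\<^sub>\<mu>\<sigma>(x,\<mu>)(y)\<close>.\<close>

definition regularity_R :: "real \<Rightarrow> nat \<Rightarrow> (real \<Rightarrow> real measure \<Rightarrow> real) \<Rightarrow> bool" where
  "regularity_R lam k \<sigma> \<longleftrightarrow> (\<exists>D Dy.
     (\<forall>x. has_Lions_deriv (\<sigma> x) (D x)) \<and>
     (\<forall>x. \<forall>\<mu>\<in>P2. \<forall>y. (D x \<mu> has_real_derivative Dy x \<mu> y) (at y)) \<and>
     (\<exists>B. \<forall>x. \<forall>\<mu>\<in>P2. \<bar>\<sigma> x \<mu>\<bar> \<le> B) \<and>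
     (\<exists>B. \<forall>x. \<forall>\<mu>\<in>P2. \<forall>y. \<bar>D x \<mu> y\<bar> \<le> B) \<and>
     (\<lambda>(x, \<mu>). \<sigma> x \<mu>) \<in> borel_measurable (borel \<Otimes>\<^sub>M P2_borel) \<and>
     (\<lambda>(x, \<mu>, y). D x \<mu> y) \<in> borel_measurable (borel \<Otimes>\<^sub>M P2_borel \<Otimes>\<^sub>M borel) \<and>
     (\<exists>L>0. \<forall>x1 x2 y1 y2. \<forall>\<mu>\<in>P2. \<forall>\<nu>\<in>P2.
        \<bar>\<sigma> x1 \<mu> - \<sigma> x2 \<nu>\<bar> \<le> L * \<bar>x1 - x2\<bar> + L * neg_sobolev_dist lam \<mu> \<nu> \<and>
        \<bar>D x1 \<mu> y1 - D x2 \<nu> y2\<bar>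
          \<le> L * \<bar>x1 - x2\<bar> + L * \<bar>y1 - y2\<bar> + L * neg_sobolev_dist lam \<mu> \<nu> \<and>
        \<bar>Dy x1 \<mu> y1 - Dy x2 \<nu> y2\<bar>
          \<le> L * \<bar>x1 - x2\<bar> + L * \<bar>y1 - y2\<bar> + L * neg_sobolev_dist lam \<mu> \<nu>) \<and>
     (\<exists>B::real. \<forall>\<mu>\<in>P2. W_norm (k + 2) (\<lambda>x. \<sigma> x \<mu>) \<le> ennreal B) \<and>
     (\<exists>B::real. \<forall>\<mu>\<in>P2. \<forall>y. W_norm (k + 1) (\<lambda>x. D x \<mu> y) \<le> ennreal B) \<and>
     (\<exists>C::real. (SUP (\<mu>, y)\<in>P2 \<times> UNIV.
          (\<Sum>i=0..k+2. weak_deriv_norm i (\<lambda>x. \<sigma> x \<mu>)) +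
          (\<Sum>i=0..k. weak_deriv_norm i (\<lambda>x. D x \<mu> y) + weak_deriv_norm i (\<lambda>x. Dy x \<mu> y)))
        \<le> ennreal C))"

section \<open>Flows\<close>

text \<open>The flow in characteristic form: \<open>\<partial>\<^sub>m\<psi> = \<sigma>(\<psi>, \<mu>\<^sub>m)\<close> with \<open>\<mu>\<^sub>m\<close> the push-forward of
  \<open>\<mu>\<close> under \<open>\<psi>(\<cdot>,\<mu>,m)\<close>. This presupposes no differentiability of \<open>\<psi>\<close> in \<open>x\<close> or \<open>\<mu>\<close>, unlike
  the equivalent transport equation
  \<open>\<partial>\<^sub>m\<psi> = \<partial>\<^sub>x\<psi> \<sigma>(x,\<mu>) + \<integral> D\<^sub>\<mu>\<psi>(x,\<mu>,m)(y) \<sigma>(y,\<mu>) \<mu>(dy)\<close>.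
  The coefficient is meaningful only on \<^const>\<open>P2\<close>, so the push-forward is required to stay
  there; \<^const>\<open>distr\<close> is the push-forward only for measurable maps.\<close>

definition forward_flow ::
    "(real \<Rightarrow> real measure \<Rightarrow> real) \<Rightarrow> (real \<Rightarrow> real measure \<Rightarrow> real \<Rightarrow> real) \<Rightarrow> bool" where
  "forward_flow \<sigma> \<psi> \<longleftrightarrow> (\<forall>\<mu>\<in>P2.
     (\<forall>m. (\<lambda>x. \<psi> x \<mu> m) \<in> borel_measurable borel) \<and>
     (\<forall>m. distr \<mu> borel (\<lambda>x. \<psi> x \<mu> m) \<in> P2) \<and>
     (\<forall>x. \<psi> x \<mu> 0 = x) \<and>
     (\<forall>x m. (\<psi> x \<mu> has_real_derivative \<sigma> (\<psi> x \<mu> m) (distr \<mu> borel (\<lambda>z. \<psi> z \<mu> m))) (at m)))"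

definition backward_flow ::
    "(real \<Rightarrow> real measure \<Rightarrow> real) \<Rightarrow> (real \<Rightarrow> real measure \<Rightarrow> real \<Rightarrow> real) \<Rightarrow> bool" where
  "backward_flow \<sigma> \<phi> \<longleftrightarrow> forward_flow (\<lambda>x \<mu>. - \<sigma> x \<mu>) \<phi>"

text \<open>The estimate at time \<open>m\<close>, including the existence of the measure derivatives that occur in
  it. For \<open>k = 0\<close> the second sum is empty and \<open>D\<^sub>y\<^sub>\<mu>\<phi>\<close> does not occur (it need not exist then).\<close>

definition flow_estimate ::
    "nat \<Rightarrow> (real \<Rightarrow> real measure \<Rightarrow> real \<Rightarrow> real) \<Rightarrow> real \<Rightarrow> real \<Rightarrow> bool" where
  "flow_estimate k \<phi> m B \<longleftrightarrow> (\<exists>D Dy.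
     (\<forall>x. has_Lions_deriv (\<lambda>\<mu>. \<phi> x \<mu> m) (D x)) \<and>
     (1 \<le> k \<longrightarrow> (\<forall>x. \<forall>\<mu>\<in>P2. \<forall>y. (D x \<mu> has_real_derivative Dy x \<mu> y) (at y))) \<and>
     (SUP (\<mu>, y)\<in>P2 \<times> UNIV.
          (\<Sum>i=1..k+1. weak_deriv_norm i (\<lambda>x. \<phi> x \<mu> m)) +
          (\<Sum>i=1..k. weak_deriv_norm i (\<lambda>x. Dy x \<mu> y) + weak_deriv_norm i (\<lambda>x. D x \<mu> y)))
        \<le> ennreal B)"

end

theory Submission
  imports Defs "HOL-Computational_Algebra.Polynomial" "HOL-Real_Asymp.Real_Asymp"
begin

text \<open>
  Write \<open>\<mu>\<^sub>t\<close> for the push-forward of \<open>\<mu>\<close> under the flow. Differentiating the characteristic equation in \<open>x\<close>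
  gives \<open>\<partial>\<^sub>x\<psi> = exp (\<integral>\<^sub>0\<^sup>t \<partial>\<^sub>x\<sigma>(\<psi>, \<mu>\<^sub>s) ds)\<close>, so that regularity of \<open>\<partial>\<^sub>x\<sigma>\<close> in \<open>x\<close> passes to \<open>\<partial>\<^sub>x\<psi>\<close> one order at a time.
  Differentiating in \<open>\<mu>\<close>, one expects \<open>U = \<delta>\<^sub>\<mu>\<psi>(\<cdot>)(y)\<close> to solve the linear nonlocal equation
  \<open>\<partial>\<^sub>tU(x) = \<partial>\<^sub>x\<sigma>(\<psi>(x), \<mu>\<^sub>t) U(x) + \<delta>\<^sub>\<mu>\<sigma>(\<psi>(x), \<mu>\<^sub>t)(\<psi>(y)) + \<integral> D\<^sub>\<mu>\<sigma>(\<psi>(x), \<mu>\<^sub>t)(\<psi>(z)) U(z) \<mu>(dz)\<close>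
  with \<open>U = 0\<close> at time \<open>0\<close>. The equation is solved by a fixed point argument, and since it is linear in the source,
  bounds, continuity in \<open>\<mu>\<close> and differentiability in \<open>y\<close> of its solutions reduce to those of the source. Along
  the mixtures \<open>s m1 + (1 - s) m2\<close> the linearisation error again solves this equation, with a source that is
  \<open>o(h)\<close> for an increment \<open>h\<close> of \<open>s\<close>; hence \<open>U\<close> is indeed the linear functional derivative. The backward flow is
  the forward flow of \<open>- \<sigma>\<close>, which satisfies the same assumptions.
\<close>

section \<open>Test functions\<close>

text \<open>The hypotheses and the claim are stated with weak derivatives, while the flow argument
  is classical, so a translation in both directions is needed. A continuous function with
  essentially bounded weak derivatives up to order \<open>n + 1\<close> is \<open>n\<close> times
  classically differentiable with a Lipschitz last derivative; conversely, a Lipschitz function has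
  a bounded weak derivative. A Lipschitz bound thus stands for the top order throughout.

  In the measure argument the hypotheses use a negative Sobolev distance and the claim uses
  \<open>W2\<close>; both are compared through integrals of Lipschitz functions. This yields a
  modulus of continuity without a rate, which suffices because a remainder
  \<open>\<omega> d * d\<close> with \<open>d\<close> proportional to \<open>h\<close> is still
  \<open>o(h)\<close>.

  As \<open>T\<close> is fixed, the exponential costs nothing: any bound uniform on
  \<open>[0, T]\<close> is absorbed in \<open>C\<close>. The difficulty is the existence of the
  derivatives and uniformity in \<open>\<mu>\<close> and \<open>y\<close>. The source of the
  equation for \<open>U\<close> grows linearly in \<open>y\<close>, so uniform bounds are derived
  only after differentiating it in \<open>y\<close>.\<close>

coinductive C_infty :: "(real \<Rightarrow> real) \<Rightarrow> bool" where
  "(\<And>x. (f has_real_derivative f' x) (at x)) \<Longrightarrow> C_infty f' \<Longrightarrow> C_infty f"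

lemma C_infty_iff: "C_infty f \<longleftrightarrow> (\<exists>f'. (\<forall>x. (f has_real_derivative f' x) (at x)) \<and> C_infty f')"
  by (subst C_infty.simps) blast

lemma C_inftyD:
  assumes "C_infty f"
  shows "(f has_real_derivative deriv f x) (at x)" "C_infty (deriv f)"
proof -
  obtain f' where f': "\<And>x. (f has_real_derivative f' x) (at x)" "C_infty f'"
    using assms by (subst (asm) C_infty_iff) blast
  then have "deriv f = f'"
    by (intro ext DERIV_imp_deriv)
  with f' show "(f has_real_derivative deriv f x) (at x)" "C_infty (deriv f)"
    by auto
qed

lemma C_infty_funpow_deriv: "C_infty f \<Longrightarrow> C_infty ((deriv ^^ n) f)"
  by (induction n) (auto intro: C_inftyD)

lemma test_functionI:
  assumes "C_infty f" "\<And>x. \<bar>x\<bar> > R \<Longrightarrow> f x = 0"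
  shows "test_function f"
  unfolding test_function_def
proof (intro conjI allI exI[of _ R] impI assms(2))
  have "(deriv ^^ n) f differentiable (at x)" for n x
    using C_inftyD(1)[OF C_infty_funpow_deriv[OF assms(1)]] real_differentiable_def by blast
  then show "(deriv ^^ n) f differentiable_on UNIV" for n
    by (simp add: differentiable_on_def)
qed

text \<open>Outside the support interval the function vanishes on a neighbourhood of each point, so
  the derivative vanishes there too and the same \<open>R\<close> serves.\<close>

lemma test_functionD:
  assumes "test_function \<eta>"
  shows "(\<eta> has_real_derivative deriv \<eta> x) (at x)" "test_function (deriv \<eta>)"
proof -
  have d: "(deriv ^^ n) \<eta> differentiable_on UNIV" for n
    using assms by (auto simp: test_function_def)
  from d[of 0] have "\<eta> differentiable at x" for x
    by (auto simp: differentiable_on_def)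
  then show D: "(\<eta> has_real_derivative deriv \<eta> x) (at x)" for x
    by (simp add: DERIV_deriv_iff_real_differentiable)
  obtain R where R: "\<And>x. \<bar>x\<bar> > R \<Longrightarrow> \<eta> x = 0"
    using assms by (auto simp: test_function_def)
  have "deriv \<eta> x = 0" if "\<bar>x\<bar> > R" for x
  proof -
    have "open {x::real. R < \<bar>x\<bar>}"
      by (intro open_Collect_less continuous_intros)
    then have "eventually (\<lambda>x. \<eta> x = 0) (nhds x)"
      using that R by (intro eventually_nhds[THEN iffD2] exI[of _ "{x. \<bar>x\<bar> > R}"]) auto
    then have "(\<eta> has_real_derivative 0) (at x)"
      by (subst DERIV_cong_ev[OF refl _ refl, of _ "\<lambda>_. 0"]) auto
    then show ?thesis by (rule DERIV_imp_deriv)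
  qed
  then show "test_function (deriv \<eta>)"
    using d unfolding test_function_def
    by (metis funpow_Suc_right comp_apply)
qed

lemma test_function_continuous: "test_function \<eta> \<Longrightarrow> continuous_on A \<eta>"
  by (meson DERIV_isCont continuous_at_imp_continuous_on test_functionD(1))

text \<open>The prefactor \<open>A\<close> makes the coinduction close: differentiation turns it
  into \<open>A * b\<close> and \<open>f\<close> into \<open>f'\<close>, and leaves the form
  unchanged.\<close>

lemma C_infty_affine_comp:
  assumes "C_infty f"
  shows "C_infty (\<lambda>x. A * f (b * x + c))"
  using assms
proof (coinduction arbitrary: A f)
  case C_infty
  obtain f' where f': "\<And>x. (f has_real_derivative f' x) (at x)" "C_infty f'"
    using C_infty by (subst (asm) C_infty_iff) blast
  show ?case
    by (rule exI[of _ "\<lambda>x. A * f (b * x + c)"], rule exI[of _ "\<lambda>x. (A * b) * f' (b * x + c)"])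
      (use f' in \<open>auto intro!: derivative_eq_intros DERIV_chain2[OF f'(1)]\<close>)
qed

lemma C_infty_add:
  assumes "C_infty f" "C_infty g"
  shows "C_infty (\<lambda>x. f x + g x)"
  using assms
proof (coinduction arbitrary: f g)
  case C_infty
  obtain f' where "\<And>x. (f has_real_derivative f' x) (at x)" "C_infty f'"
    using C_infty(1) by (subst (asm) C_infty_iff) blast
  moreover obtain g' where "\<And>x. (g has_real_derivative g' x) (at x)" "C_infty g'"
    using C_infty(2) by (subst (asm) C_infty_iff) blast
  ultimately show ?case
    by (intro exI[of _ "\<lambda>x. f x + g x"] exI[of _ "\<lambda>x. f' x + g' x"])
      (auto intro!: derivative_eq_intros)
qed

text \<open>For \<open>p = 1\<close> and \<open>n = 0\<close> this is the classical smooth bump on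
  (-1, 1). The rational factor is carried along because all derivatives of the bump have this
  shape.\<close>

definition bump :: "real poly \<Rightarrow> nat \<Rightarrow> real \<Rightarrow> real" where
  "bump p n x = (if \<bar>x\<bar> < 1 then poly p x / (1 - x\<^sup>2) ^ n * exp (- 1 / (1 - x\<^sup>2)) else 0)"

text \<open>\<open>exp (- 1 / u)\<close> beats every power of \<open>u = 1 - x\<^sup>2\<close>.
  Quadratic vanishing at the endpoints is what gives the derivative 0 at
  \<open>\<bar>x\<bar> = 1\<close>.\<close>

lemma abs_bump_le: "\<exists>C\<ge>0. \<forall>x. \<bar>bump p n x\<bar> \<le> C * (1 - x\<^sup>2)\<^sup>2"
proof -
  have "compact (poly p ` {-1..1})"
    by (intro compact_continuous_image continuous_intros) auto
  then obtain B where B: "\<And>x. x \<in> {-1..1} \<Longrightarrow> \<bar>poly p x\<bar> \<le> B"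
    by (metis bounded_real compact_imp_bounded imageI)
  then have "B \<ge> 0" by (meson abs_ge_zero atLeastAtMost_iff order_trans zero_le_one neg_le_0_iff_le)
  have *: "\<bar>bump p n x\<bar> \<le> (B * fact (n + 2)) * (1 - x\<^sup>2)\<^sup>2" if x: "\<bar>x\<bar> < 1" for x
  proof -
    define u where "u = 1 - x\<^sup>2"
    have "u > 0" using x unfolding u_def by (simp add: abs_square_less_1)
    \<comment> \<open>A single term of the series of \<open>exp (1 / u)\<close>: of its
      \<open>n + 2\<close> powers, \<open>n\<close> cancel the denominator of the bump and two
      remain.\<close>
    have "(1 / u) ^ (n + 2) / fact (n + 2) \<le> exp (1 / u)"
    proof -
      have "(1 / u) ^ (n + 2) / fact (n + 2) = (\<Sum>k\<in>{n + 2}. (1 / u) ^ k /\<^sub>R fact k)"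
        by (simp only: sum.insert[OF finite.emptyI] sum.empty empty_iff not_False_eq_True add_0_right divide_inverse mult.commute real_scaleR_def)
      also have "\<dots> \<le> (\<Sum>k. (1 / u) ^ k /\<^sub>R fact k)"
        using \<open>u > 0\<close> by (intro sum_le_suminf summable_exp_generic) auto
      finally show ?thesis by (simp add: exp_def)
    qed
    then have "1 / u ^ (n + 2) / fact (n + 2) \<le> exp (1 / u)"
      by (simp only: power_divide power_one)
    moreover define c :: real where "c = fact (n + 2)"
    moreover have "c > 0" by (simp only: c_def fact_gt_zero)
    ultimately have "1 / u ^ (n + 2) \<le> c * exp (1 / u)"
      by (metis pos_divide_le_eq mult.commute)
    then have "1 / (u ^ n * u\<^sup>2) \<le> c * exp (1 / u)"
      by (simp only: power_add)
    then have "1 / u ^ n \<le> c * exp (1 / u) * u\<^sup>2"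
      using \<open>u > 0\<close> by (simp add: field_simps)
    then have "exp (- (1 / u)) * (1 / u ^ n) \<le> exp (- (1 / u)) * (c * exp (1 / u) * u\<^sup>2)"
      by (intro mult_left_mono) auto
    also have "\<dots> = c * u\<^sup>2" by (simp add: exp_minus)
    finally have "exp (- 1 / u) / u ^ n \<le> c * u\<^sup>2"
      by simp
    moreover have "\<bar>bump p n x\<bar> = \<bar>poly p x\<bar> * (exp (- 1 / u) / u ^ n)"
      using x \<open>u > 0\<close> by (simp add: bump_def abs_mult u_def)
    moreover have "\<bar>poly p x\<bar> \<le> B" using x by (intro B) auto
    ultimately have "\<bar>bump p n x\<bar> \<le> B * (c * u\<^sup>2)"
      using \<open>u > 0\<close> \<open>B \<ge> 0\<close> by (simp only:) (intro mult_mono; simp)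
    then show ?thesis by (simp only: u_def c_def mult.assoc)
  qed
  have "\<bar>bump p n x\<bar> \<le> (B * fact (n + 2)) * (1 - x\<^sup>2)\<^sup>2" for x
    using *[of x] \<open>B \<ge> 0\<close> by (cases "\<bar>x\<bar> < 1") (auto simp: bump_def)
  with \<open>B \<ge> 0\<close> show ?thesis by (intro exI[of _ "B * fact (n + 2)"]) auto
qed

lemma bump_has_derivative:
  "\<exists>q. \<forall>x. (bump p n has_real_derivative bump q (n + 2) x) (at x)"
proof (intro exI allI)
  let ?w = "[:1, 0, -1:] :: real poly"
  \<comment> \<open>With \<open>u = 1 - x\<^sup>2\<close> the product rule gives
    \<open>(p' u\<^sup>2 + 2 n x p u - 2 x p) / u ^ (n + 2)\<close> in front of the exponential;
    \<open>?w\<close> is \<open>u\<close> as a polynomial.\<close>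
  let ?q = "pderiv p * ?w\<^sup>2 + smult (2 * real n) [:0, 1:] * p * ?w - smult 2 [:0, 1:] * p"
  fix x :: real
  consider "\<bar>x\<bar> < 1" | "\<bar>x\<bar> > 1" | "\<bar>x\<bar> = 1" by linarith
  then show "(bump p n has_real_derivative bump ?q (n + 2) x) (at x)"
  proof cases
    case 1
    define u where "u = 1 - x\<^sup>2"
    have "u > 0" using 1 unfolding u_def by (simp add: abs_square_less_1)
    have w: "poly ?w x = u" by (simp add: u_def power2_eq_square)
    have u': "((\<lambda>x. 1 - x\<^sup>2) has_real_derivative - 2 * x) (at x)"
      by (auto intro!: derivative_eq_intros)
    have A: "((\<lambda>x. inverse ((1 - x\<^sup>2) ^ n)) has_real_derivative (2 * n * x) * inverse (u ^ (n + 1))) (at x)"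
    proof (cases n)
      case (Suc m)
      have "((\<lambda>x. inverse ((1 - x\<^sup>2) ^ n)) has_real_derivative
         - (inverse (u ^ n) * (n * ((- 2 * x) * u ^ (n - Suc 0))) * inverse (u ^ n))) (at x)"
        using DERIV_inverse'[OF DERIV_power[OF u', of n]] \<open>u > 0\<close> by (simp add: u_def)
      also have "- (inverse (u ^ n) * (n * ((- 2 * x) * u ^ (n - Suc 0))) * inverse (u ^ n))
          = (2 * n * x) * inverse (u ^ (n + 1))"
        using \<open>u > 0\<close> by (simp add: Suc divide_simps)
      finally show ?thesis .
    qed simp
    have B: "((\<lambda>x. exp (- 1 / (1 - x\<^sup>2))) has_real_derivative exp (- 1 / u) * (- 2 * x / u\<^sup>2)) (at x)"
      using \<open>u > 0\<close> unfolding u_def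
      by (auto intro!: derivative_eq_intros simp: power2_eq_square)
    have "((\<lambda>x. poly p x * inverse ((1 - x\<^sup>2) ^ n) * exp (- 1 / (1 - x\<^sup>2))) has_real_derivative
        (poly (pderiv p) x * inverse (u ^ n) + (2 * n * x) * inverse (u ^ (n + 1)) * poly p x) * exp (- 1 / u)
         + exp (- 1 / u) * (- 2 * x / u\<^sup>2) * (poly p x * inverse (u ^ n))) (at x)"
      using DERIV_mult[OF DERIV_mult[OF poly_DERIV[of p x] A] B] by (simp add: u_def)
    also have "(poly (pderiv p) x * inverse (u ^ n) + (2 * n * x) * inverse (u ^ (n + 1)) * poly p x) * exp (- 1 / u)
         + exp (- 1 / u) * (- 2 * x / u\<^sup>2) * (poly p x * inverse (u ^ n))
       = (poly (pderiv p) x * u\<^sup>2 + 2 * n * x * poly p x * u - 2 * x * poly p x) / u ^ (n + 2) * exp (- 1 / u)"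
      using \<open>u > 0\<close> by (simp add: divide_simps power2_eq_square) (simp add: algebra_simps)
    also have "\<dots> = bump ?q (n + 2) x"
      using 1 unfolding bump_def poly_add poly_mult poly_diff poly_power w u_def[symmetric]
      by simp
    finally show ?thesis
    proof (rule has_field_derivative_transform_within_open)
      show "open {x::real. \<bar>x\<bar> < 1}" by (intro open_Collect_less continuous_intros)
    qed (use 1 in \<open>auto simp: bump_def divide_inverse\<close>)
  next
    case 2
    have "((\<lambda>x. 0) has_real_derivative bump ?q (n + 2) x) (at x)"
      using 2 by (auto simp: bump_def)
    then show ?thesis
    proof (rule has_field_derivative_transform_within_open)
      show "open {x::real. \<bar>x\<bar> > 1}" by (intro open_Collect_less continuous_intros)
    qed (use 2 in \<open>auto simp: bump_def\<close>)
  next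
    case 3
    obtain C where C: "C \<ge> 0" "\<And>y. \<bar>bump p n y\<bar> \<le> C * (1 - y\<^sup>2)\<^sup>2"
      using abs_bump_le by blast
    have x2: "x\<^sup>2 = 1" using 3 by (metis power2_abs one_power2)
    have z: "bump p n x = 0" "bump ?q (n + 2) x = 0" using 3 by (auto simp: bump_def)
    \<comment> \<open>At an endpoint the quadratic bound forces the difference quotient to 0 from
      both sides.\<close>
    have "(\<lambda>y. bump p n y / (y - x)) \<midarrow>x\<rightarrow> 0"
    proof (rule Lim_null_comparison)
      have "((\<lambda>y. C * (\<bar>y - x\<bar> * \<bar>y + x\<bar>\<^sup>2)) \<longlongrightarrow> C * (\<bar>x - x\<bar> * \<bar>x + x\<bar>\<^sup>2)) (at x)"
        by (intro tendsto_intros)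
      then show "((\<lambda>y. C * (\<bar>y - x\<bar> * \<bar>y + x\<bar>\<^sup>2)) \<longlongrightarrow> 0) (at x)" by simp
      have "\<bar>bump p n y / (y - x)\<bar> \<le> C * (\<bar>y - x\<bar> * \<bar>y + x\<bar>\<^sup>2)" if "y \<noteq> x" for y
      proof -
        have "1 - y\<^sup>2 = (x - y) * (x + y)" using x2 by (simp add: algebra_simps power2_eq_square)
        then have "(1 - y\<^sup>2)\<^sup>2 = \<bar>y - x\<bar> * (\<bar>y - x\<bar> * \<bar>y + x\<bar>\<^sup>2)"
          by (simp add: power_mult_distrib power2_commute[of x y] add.commute[of x y] flip: power2_eq_square mult.assoc)
        then show ?thesis
          using that C(2)[of y] by (simp add: divide_simps abs_mult mult_ac)
      qed
      then show "\<forall>\<^sub>F y in at x. norm (bump p n y / (y - x)) \<le> C * (\<bar>y - x\<bar> * \<bar>y + x\<bar>\<^sup>2)"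
        by (auto simp: eventually_at_filter)
    qed
    then show ?thesis
      unfolding has_field_derivative_iff z by simp
  qed
qed

text \<open>The family of all \<open>bump p n\<close> is closed under differentiation, which is what
  the coinduction asks for.\<close>

lemma C_infty_bump: "C_infty (bump p n)"
proof (coinduction arbitrary: p n)
  case C_infty
  obtain q where q: "\<forall>x. (bump p n has_real_derivative bump q (n + 2) x) (at x)"
    using bump_has_derivative[of p n] ..
  have e: "\<exists>p' n'. bump q (n + 2) = bump p' n'" by (intro exI) (rule refl)
  show ?case
    by (rule exI[of _ "bump p n"], rule exI[of _ "bump q (n + 2)"], intro conjI refl q disjI1 e)
qed

text \<open>The two cases of \<open>F\<close> form the oriented integral from 0. Near
  \<open>x\<close> it differs by a constant from an integral whose base point lies to the left of
  both 0 and \<open>x\<close>, and there the fundamental theorem on an interval applies.\<close>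

lemma has_real_derivative_integral_upper:
  fixes f :: "real \<Rightarrow> real"
  assumes "continuous_on UNIV f"
  defines "F \<equiv> \<lambda>x. if 0 \<le> x then integral {0..x} f else - integral {x..0} f"
  shows "(F has_real_derivative f x) (at x)"
proof -
  define c where "c = - \<bar>x\<bar> - 1"
  have int: "f integrable_on {a..b}" for a b
    by (rule integrable_continuous_interval[OF continuous_on_subset[OF assms(1) subset_UNIV]])
  have F: "F y = integral {c..y} f - integral {c..0} f" if "y \<in> {c<..<\<bar>x\<bar> + 1}" for y
  proof (cases "0 \<le> y")
    case True
    have "integral {c..0} f + integral {0..y} f = integral {c..y} f"
      by (rule Henstock_Kurzweil_Integration.integral_combine[OF _ True int]) (simp add: c_def)
    with True show ?thesis by (simp add: F_def)
  next
    case False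
    have "integral {c..y} f + integral {y..0} f = integral {c..0} f"
      by (rule Henstock_Kurzweil_Integration.integral_combine[OF _ _ int]) (use False that in \<open>auto simp: c_def\<close>)
    with False show ?thesis by (simp add: F_def)
  qed
  have "((\<lambda>y. integral {c..y} f) has_real_derivative f x) (at x within {c..\<bar>x\<bar> + 1})"
    by (rule integral_has_real_derivative[OF continuous_on_subset[OF assms(1) subset_UNIV]]) (auto simp: c_def)
  then have "((\<lambda>y. integral {c..y} f - integral {c..0} f) has_real_derivative f x) (at x within {c..\<bar>x\<bar> + 1})"
    by (auto intro!: derivative_eq_intros)
  then have "((\<lambda>y. integral {c..y} f - integral {c..0} f) has_real_derivative f x) (at x)"
    by (simp add: at_within_Icc_at c_def)
  then show ?thesis
    by (rule has_field_derivative_transform_within_open[of _ _ _ "{c<..<\<bar>x\<bar> + 1}"])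
      (auto simp: F c_def)
qed

text \<open>A smooth step \<open>\<Theta>\<close> and its primitive \<open>\<Xi>\<close> supply all the test functions needed.\<close>

lemma smooth_step_exists:
  obtains \<theta> \<Theta> \<Xi> :: "real \<Rightarrow> real" and c :: real
  where "C_infty \<Theta>" "C_infty \<Xi>" "continuous_on UNIV \<theta>"
    "\<And>x. (\<Xi> has_real_derivative \<Theta> x) (at x)" "\<And>x. (\<Theta> has_real_derivative \<theta> x) (at x)"
    "\<And>x. x \<le> 0 \<Longrightarrow> \<Theta> x = 0" "\<And>x. x \<ge> 1 \<Longrightarrow> \<Theta> x = 1" "\<And>x. 0 \<le> \<Theta> x" "\<And>x. \<Theta> x \<le> 1"
    "\<And>x. x \<le> 0 \<Longrightarrow> \<Xi> x = 0" "\<And>x. x \<ge> 1 \<Longrightarrow> \<Xi> x = x - c"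
proof -
  \<comment> \<open>The bump is moved from (-1, 1) to (0, 1); its normalised primitive is the
    step.\<close>
  define b where "b = (\<lambda>x. bump 1 0 (2 * x - 1))"
  have bC: "C_infty b"
    using C_infty_affine_comp[OF C_infty_bump, of 1 1 0 2 "-1"] by (simp add: b_def)
  then have cb: "continuous_on UNIV b"
    by (meson C_inftyD(1) DERIV_isCont continuous_at_imp_continuous_on)
  have b0: "b x \<ge> 0" for x by (simp add: b_def bump_def)
  have bz: "b x = 0" if "x \<le> 0 \<or> x \<ge> 1" for x using that by (auto simp: b_def bump_def)
  define G where "G = (\<lambda>x. if 0 \<le> x then integral {0..x} b else - integral {x..0} b)"
  have GD: "(G has_real_derivative b x) (at x)" for x
    unfolding G_def by (rule has_real_derivative_integral_upper[OF cb])
  have mono: "G x \<le> G y" if "x \<le> y" for x y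
    by (rule DERIV_nonneg_imp_nondecreasing[OF that]) (use GD b0 in auto)
  have G0: "G 0 = 0" by (simp add: G_def)
  have GconstR: "G x = G 1" if "x \<ge> 1" for x
  proof (cases "x = 1")
    case False
    with that have "1 < x" by simp
    then obtain z where "1 < z" "G x - G 1 = (x - 1) * b z"
      using MVT2[of 1 x G b] GD by blast
    then show ?thesis using bz by auto
  qed auto
  have GconstL: "G x = 0" if "x \<le> 0" for x
  proof (cases "x = 0")
    case False
    with that have "x < 0" by simp
    then obtain z where "z < 0" "G 0 - G x = (0 - x) * b z"
      using MVT2[of x 0 G b] GD by blast
    then show ?thesis using bz G0 by auto
  qed (use G0 in auto)
  have "b (1/2) > 0" by (simp add: b_def bump_def)
  have "G 1 \<noteq> 0"
  proof
    assume "G 1 = 0"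
    then have "G x = 0" for x
      using mono[of x 1] mono[of 0 x] GconstL[of x] GconstR[of x] G0
      by (cases "x \<le> 0"; cases "x \<ge> 1") auto
    then have "G = (\<lambda>_. 0)" by auto
    then have "(G has_real_derivative 0) (at (1/2))" by simp
    from DERIV_unique[OF this GD[of "1/2"]] \<open>b (1/2) > 0\<close> show False by linarith
  qed
  then have G1: "G 1 > 0" using mono[of 0 1] G0 by auto
  define \<Theta> where "\<Theta> = (\<lambda>x. G x / G 1)"
  define \<theta> where "\<theta> = (\<lambda>x. b x / G 1)"
  have "C_infty \<theta>" using C_infty_affine_comp[OF bC, of "1 / G 1" 1 0] by (simp add: \<theta>_def)
  have TD: "(\<Theta> has_real_derivative \<theta> x) (at x)" for x
    unfolding \<Theta>_def \<theta>_def using GD G1 by (auto intro!: derivative_eq_intros)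
  have TC: "C_infty \<Theta>" using TD \<open>C_infty \<theta>\<close> by (rule C_infty.intros)
  have cT: "continuous_on UNIV \<Theta>"
    by (meson TD DERIV_isCont continuous_at_imp_continuous_on)
  define \<Xi> where "\<Xi> = (\<lambda>x. if 0 \<le> x then integral {0..x} \<Theta> else - integral {x..0} \<Theta>)"
  have XD: "(\<Xi> has_real_derivative \<Theta> x) (at x)" for x
    unfolding \<Xi>_def by (rule has_real_derivative_integral_upper[OF cT])
  have XC: "C_infty \<Xi>" using XD TC by (rule C_infty.intros)
  have T0: "\<Theta> x = 0" if "x \<le> 0" for x using GconstL[OF that] by (simp add: \<Theta>_def)
  have T1: "\<Theta> x = 1" if "x \<ge> 1" for x using GconstR[OF that] G1 by (simp add: \<Theta>_def)
  have T01: "0 \<le> \<Theta> x" "\<Theta> x \<le> 1" for x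
    using mono[of 0 x] mono[of x 1] G0 G1 GconstL[of x] GconstR[of x]
    by (cases "x \<le> 0"; cases "x \<ge> 1"; auto simp: \<Theta>_def)+
  have X0: "\<Xi> x = 0" if "x \<le> 0" for x
  proof (cases "x = 0")
    case False
    with that have "x < 0" by simp
    then obtain z where "z < 0" "\<Xi> 0 - \<Xi> x = (0 - x) * \<Theta> z"
      using MVT2[of x 0 \<Xi> \<Theta>] XD by blast
    with T0[of z] show ?thesis by (simp add: \<Xi>_def)
  qed (simp add: \<Xi>_def)
  have X1: "\<Xi> x = x - (1 - \<Xi> 1)" if "x \<ge> 1" for x
  proof (cases "x = 1")
    case False
    with that have "1 < x" by simp
    then obtain z where "1 < z" "\<Xi> x - \<Xi> 1 = (x - 1) * \<Theta> z"
      using MVT2[of 1 x \<Xi> \<Theta>] XD by blast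
    then show ?thesis using T1 by auto
  qed auto
  have "continuous_on UNIV \<theta>"
    using \<open>C_infty \<theta>\<close> by (meson C_inftyD(1) DERIV_isCont continuous_at_imp_continuous_on)
  then show ?thesis by (intro that[OF TC XC _ XD TD T0 T1 T01 X0 X1])
qed

section \<open>Weak derivatives\<close>

lemma set_integrable_locally:
  assumes "locally_integrable f" "A \<in> sets borel" "A \<subseteq> {a..b}"
  shows "set_integrable lborel A f"
  by (rule set_integrable_subset[of _ "{a..b}"]) (use assms in \<open>auto simp: locally_integrable_def\<close>)

lemma integrable_indicator_Ioc:
  fixes f :: "real \<Rightarrow> real"
  assumes "locally_integrable f"
  shows "integrable lborel (\<lambda>x. indicator {a<..b} x * f x)"
proof -
  have "{a<..b} \<subseteq> {a..b}" by auto
  from set_integrable_locally[OF assms _ this] show ?thesis by (simp add: set_integrable_def)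
qed

lemma locally_integrable_measurable:
  assumes "locally_integrable f"
  shows "f \<in> borel_measurable borel"
proof (rule borel_measurable_LIMSEQ_real)
  show "(\<lambda>x. indicator {- real n..real n} x *\<^sub>R f x) \<in> borel_measurable borel" for n
    using assms[unfolded locally_integrable_def set_integrable_def, rule_format, of "- real n" "real n", THEN borel_measurable_integrable]
    by simp
  show "(\<lambda>n. indicator {- real n..real n} x *\<^sub>R f x) \<longlonglongrightarrow> f x" for x
  proof (rule tendsto_eventually)
    show "eventually (\<lambda>n. indicator {- real n..real n} x *\<^sub>R f x = f x) sequentially"
      using eventually_ge_at_top[of "nat \<lceil>\<bar>x\<bar>\<rceil>"]
    proof eventually_elim
      case (elim n)
      then have "\<bar>x\<bar> \<le> real n" by linarith
      then show ?case by (auto simp: indicator_def)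
    qed
  qed
qed

lemma locally_integrable_bounded:
  assumes "f \<in> borel_measurable borel" "AE x in lborel. \<bar>f x\<bar> \<le> B"
  shows "locally_integrable f"
  unfolding locally_integrable_def set_integrable_def
proof (intro allI)
  fix a b :: real
  have "integrable lborel (\<lambda>x. indicator {a..b} x *\<^sub>R B)"
    by (intro integrable_scaleR_left integrable_real_indicator) (auto simp: emeasure_lborel_Icc_eq)
  then show "integrable lborel (\<lambda>x. indicator {a..b} x *\<^sub>R f x)"
    by (rule Bochner_Integration.integrable_bound)
      (use assms in \<open>auto simp: indicator_def elim!: eventually_mono\<close>)
qed

lemma locally_integrable_continuous:
  "continuous_on UNIV f \<Longrightarrow> locally_integrable f"
  unfolding locally_integrable_def set_integrable_def
  by (intro allI borel_integrable_compact[OF compact_Icc]) (erule continuous_on_subset[OF _ subset_UNIV])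

lemma locally_integrable_diff:
  "locally_integrable f \<Longrightarrow> locally_integrable g \<Longrightarrow> locally_integrable (\<lambda>x. f x - g x)"
  unfolding locally_integrable_def by (intro allI set_integral_diff) auto

lemma integrable_mult_compact_support:
  assumes "locally_integrable f" "continuous_on UNIV \<eta>" "\<And>x. \<bar>x\<bar> > R \<Longrightarrow> \<eta> x = 0"
  shows "integrable lborel (\<lambda>x. f x * \<eta> x)"
proof -
  have "compact (\<eta> ` {-R..R})"
    by (intro compact_continuous_image continuous_on_subset[OF assms(2)]) auto
  then obtain K where K: "\<And>x. x \<in> {-R..R} \<Longrightarrow> \<bar>\<eta> x\<bar> \<le> K"
    by (metis bounded_real compact_imp_bounded imageI)
  have [measurable]: "f \<in> borel_measurable borel" "\<eta> \<in> borel_measurable borel"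
    using locally_integrable_measurable[OF assms(1)] borel_measurable_continuous_onI[OF assms(2)] by auto
  have "integrable lborel (\<lambda>x. K * (indicator {-R..R} x *\<^sub>R f x))"
    using assms(1) by (intro integrable_mult_right) (auto simp: locally_integrable_def set_integrable_def)
  then show ?thesis
  proof (rule Bochner_Integration.integrable_bound)
    have "norm (f x * \<eta> x) \<le> norm (K * (indicator {-R..R} x *\<^sub>R f x))" for x
    proof (cases "\<bar>x\<bar> \<le> R")
      case True
      then have "\<bar>\<eta> x\<bar> \<le> \<bar>K\<bar>" using K[of x] by (auto simp: abs_le_iff)
      moreover have "indicator {-R..R} x = (1 :: real)" using True by (auto simp: indicator_def)
      ultimately show ?thesis by (simp add: abs_mult mult.commute[of "\<bar>f x\<bar>"] mult_right_mono)
    qed (use assms(3) in auto)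
    then show "AE x in lborel. norm (f x * \<eta> x) \<le> norm (K * (indicator {-R..R} x *\<^sub>R f x))" by simp
  qed simp
qed

text \<open>The positive and negative parts of \<open>k\<close>, cut off to
  \<open>{- n<..n}\<close>, are densities of two finite measures that agree on all half-lines and
  hence coincide. The densities are then equal almost everywhere, and as one of them vanishes at
  every point, so does \<open>k\<close> almost everywhere.\<close>

lemma AE_zero_if_interval_integrals_zero:
  assumes k: "locally_integrable k"
    and zero: "\<And>a b. a \<le> b \<Longrightarrow> (LBINT x:{a<..b}. k x) = 0"
  shows "AE x in lborel. k x = 0"
proof -
  have [measurable]: "k \<in> borel_measurable borel" by (rule locally_integrable_measurable[OF k])
  have *: "AE x in lborel. indicator {- real n<..real n} x * k x = 0" for n
  proof -
    define K where "K = (\<lambda>x. indicator {- real n<..real n} x * k x)"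
    have [measurable]: "K \<in> borel_measurable borel" by (auto simp: K_def)
    have int: "integrable lborel (\<lambda>x. indicator {- real n<..real n} x * k x * indicator {a<..} x)" for a
      using integrable_indicator_Ioc[OF k, of "- real n" "real n", THEN integrable_real_mult_indicator[rotated], of "{a<..}"]
      by (simp add: mult_ac)
    have eq: "(\<integral>\<^sup>+x. ennreal (K x * indicator {a<..} x) \<partial>lborel) = (\<integral>\<^sup>+x. ennreal (- (K x * indicator {a<..} x)) \<partial>lborel)
      \<and> (\<integral>\<^sup>+x. ennreal (K x * indicator {a<..} x) \<partial>lborel) < \<infinity>" for a
    proof -
      \<comment> \<open>The outer maximum makes the interval empty, with endpoints still in order,
        when \<open>a\<close> exceeds \<open>n\<close>, so that \<open>zero\<close> applies.\<close>
      have "(\<lambda>x. K x * indicator {a<..} x) = (\<lambda>x. indicator {max a (- real n)<..max (max a (- real n)) (real n)} x *\<^sub>R k x)"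
        by (auto simp: K_def indicator_def fun_eq_iff)
      then have "(LBINT x. K x * indicator {a<..} x) = (LBINT x:{max a (- real n)<..max (max a (- real n)) (real n)}. k x)"
        by (simp add: set_lebesgue_integral_def)
      also have "\<dots> = 0" by (rule zero) auto
      finally have z: "(LBINT x. K x * indicator {a<..} x) = 0" .
      have i: "integrable lborel (\<lambda>x. K x * indicator {a<..} x)"
        unfolding K_def by (rule int)
      from i show ?thesis
        using real_lebesgue_integral_def[OF i] z unfolding real_integrable_def
        by (cases "\<integral>\<^sup>+x. ennreal (K x * indicator {a<..} x) \<partial>lborel" rule: ennreal_cases;
            cases "\<integral>\<^sup>+x. ennreal (- (K x * indicator {a<..} x)) \<partial>lborel" rule: ennreal_cases) auto
    qed
    have split: "ennreal (K x * indicator A x) = ennreal (K x) * indicator A x"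
      "ennreal (- (K x * indicator A x)) = ennreal (- K x) * indicator A x" for A x
      by (auto simp: indicator_def)
    have "density lborel (\<lambda>x. ennreal (K x)) = density lborel (\<lambda>x. ennreal (- K x))"
    proof (intro measure_eqI_lessThan)
      show "emeasure (density lborel (\<lambda>x. ennreal (K x))) {a<..} < \<infinity>"
        "emeasure (density lborel (\<lambda>x. ennreal (K x))) {a<..} = emeasure (density lborel (\<lambda>x. ennreal (- K x))) {a<..}" for a
        using eq[of a] unfolding split by (simp_all add: emeasure_density, metis)
    qed auto
    then have "AE x in lborel. ennreal (K x) = ennreal (- K x)"
      by (rule sigma_finite_measure.density_unique[OF sigma_finite_lborel, rotated -1]) auto
    then show ?thesis
      unfolding K_def
      by (rule eventually_mono) (metis ennreal_eq_0_iff ennreal_neg linorder_linear neg_0_le_iff_le neg_le_0_iff_le order_antisym)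
  qed
  then have "AE x in lborel. \<forall>n. indicator {- real n<..real n} x * k x = 0"
    by (subst AE_all_countable) blast
  then show ?thesis
  proof (rule eventually_mono)
    fix x assume "\<forall>n. indicator {- real n<..real n} x * k x = 0"
    moreover obtain n where "\<bar>x\<bar> < real n" using reals_Archimedean2 by blast
    ultimately show "k x = 0" by (auto simp: indicator_def dest!: spec[of _ n] split: if_splits)
  qed
qed

section \<open>Primitives of locally integrable functions and integration by parts\<close>

definition is_primitive :: "(real \<Rightarrow> real) \<Rightarrow> (real \<Rightarrow> real) \<Rightarrow> bool" where
  "is_primitive G g \<longleftrightarrow> locally_integrable g \<and> (\<forall>a b. a \<le> b \<longrightarrow> G b - G a = (LBINT x:{a<..b}. g x))"

lemma set_integral_Ioc_add:
  assumes "locally_integrable g" "a \<le> b" "b \<le> c"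
  shows "(LBINT x:{a<..c}. g x) = (LBINT x:{a<..b}. g x) + (LBINT x:{b<..c}. g x)"
proof -
  have "{a<..c} = {a<..b} \<union> {b<..c}" using assms by auto
  moreover have "set_integrable lborel {a<..b} g" "set_integrable lborel {b<..c} g"
    by (rule set_integrable_locally[OF assms(1), of _ a c]; use assms in auto)+
  ultimately show ?thesis by (simp add: set_integral_Un)
qed

lemma primitive_exists:
  assumes "locally_integrable g"
  shows "\<exists>G. is_primitive G g"
proof -
  define G where "G = (\<lambda>x. if 0 \<le> x then (LBINT y:{0<..x}. g y) else - (LBINT y:{x<..0}. g y))"
  have "G b - G a = (LBINT x:{a<..b}. g x)" if "a \<le> b" for a b
    using that set_integral_Ioc_add[OF assms, of a 0 b] set_integral_Ioc_add[OF assms, of 0 a b]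
      set_integral_Ioc_add[OF assms, of a b 0]
    by (auto simp: G_def)
  with assms show ?thesis by (auto simp: is_primitive_def)
qed

lemma primitive_lipschitz:
  assumes "is_primitive G g" "AE x in lborel. \<bar>g x\<bar> \<le> B"
  shows "\<bar>G x - G y\<bar> \<le> B * \<bar>x - y\<bar>"
proof -
  have *: "\<bar>G b - G a\<bar> \<le> B * \<bar>b - a\<bar>" if "a \<le> b" for a b
  proof -
    have i: "integrable lborel (\<lambda>x. indicator {a<..b} x *\<^sub>R g x)"
      using integrable_indicator_Ioc assms(1) by (auto simp: is_primitive_def)
    have "\<bar>LBINT x:{a<..b}. g x\<bar> \<le> (LBINT x. \<bar>indicator {a<..b} x *\<^sub>R g x\<bar>)"
      unfolding set_lebesgue_integral_def by (rule integral_abs_bound)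
    also have "\<dots> \<le> (LBINT x. indicator {a<..b} x *\<^sub>R B)"
    proof (rule integral_mono_AE)
      show "integrable lborel (\<lambda>x. indicator {a<..b} x *\<^sub>R B)"
        using that by (intro integrable_scaleR_left integrable_real_indicator) auto
      show "AE x in lborel. \<bar>indicator {a<..b} x *\<^sub>R g x\<bar> \<le> indicator {a<..b} x *\<^sub>R B"
        using assms(2) by (rule eventually_mono) (auto simp: indicator_def)
    qed (use i in auto)
    also have "\<dots> = B * \<bar>b - a\<bar>" using that by simp
    finally show ?thesis using assms(1) that by (auto simp: is_primitive_def)
  qed
  show ?thesis
    using *[of x y] *[of y x] by (cases "x \<le> y") (auto simp: abs_minus_commute)
qed

lemma lipschitz_continuous_on:
  assumes "\<And>x y. \<bar>G x - G y\<bar> \<le> B * \<bar>x - y :: real\<bar>"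
  shows "continuous_on UNIV (G :: real \<Rightarrow> real)"
proof -
  have "\<bar>B\<bar>-lipschitz_on UNIV G"
    by (rule lipschitz_onI) (auto simp: dist_real_def intro!: order.trans[OF assms] mult_right_mono)
  then show ?thesis by (rule lipschitz_on_continuous_on)
qed

lemma primitive_of_continuous:
  assumes "\<And>x. (G has_real_derivative g x) (at x)" "continuous_on UNIV g"
  shows "is_primitive G g"
proof -
  have "(LBINT x:{a<..b}. g x) = G b - G a" if "a \<le> b" for a b
    using interval_integral_FTC_finite[of a b g G] that assms
    by (simp add: interval_integral_Ioc continuous_on_subset has_real_derivative_iff_has_vector_derivative[symmetric]
        has_field_derivative_at_within)
  then show ?thesis
    using locally_integrable_continuous[OF assms(2)] by (simp add: is_primitive_def)
qed

text \<open>The oriented integral of \<open>g\<close> is another primitive, and two primitives of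
  one function differ by a constant.\<close>

lemma primitive_has_derivative:
  assumes "is_primitive G g" "continuous_on UNIV g"
  shows "(G has_real_derivative g x) (at x)"
proof -
  define F where "F = (\<lambda>x. if 0 \<le> x then integral {0..x} g else - integral {x..0} g)"
  have FD: "(F has_real_derivative g x) (at x)" for x
    unfolding F_def by (rule has_real_derivative_integral_upper[OF assms(2)])
  from primitive_of_continuous[OF FD assms(2)] have "is_primitive F g" .
  then have eq: "G b - G a = F b - F a" if "a \<le> b" for a b
    using assms(1) that by (simp add: is_primitive_def)
  have "G y = F y + (G 0 - F 0)" for y
    using eq[of 0 y] eq[of y 0] by (cases "0 \<le> y") auto
  then have "G = (\<lambda>y. F y + (G 0 - F 0))" by blast
  moreover have "((\<lambda>y. F y + (G 0 - F 0)) has_real_derivative g x) (at x)"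
    using FD[of x] by (auto intro!: derivative_eq_intros)
  ultimately show ?thesis by simp
qed

text \<open>Fubini on the triangle \<open>- R < u \<le> x \<le> R\<close>.\<close>

lemma primitive_by_parts:
  assumes G: "is_primitive G g" and cG: "continuous_on UNIV G" and \<eta>: "test_function \<eta>"
  shows "(LBINT x. G x * deriv \<eta> x) = - (LBINT x. g x * \<eta> x)"
proof -
  have g: "locally_integrable g" using G by (simp add: is_primitive_def)
  obtain R0 where R0: "\<And>x. \<bar>x\<bar> > R0 \<Longrightarrow> \<eta> x = 0"
    using \<eta> by (auto simp: test_function_def)
  obtain R1 where R1: "\<And>x. \<bar>x\<bar> > R1 \<Longrightarrow> deriv \<eta> x = 0"
    using test_functionD(2)[OF \<eta>] by (auto simp: test_function_def)
  \<comment> \<open>The added 1 makes \<open>\<eta>\<close> and \<open>deriv \<eta>\<close> vanish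
    also at the endpoints \<open>-R\<close> and \<open>R\<close> of the window.\<close>
  define R where "R = \<bar>R0\<bar> + \<bar>R1\<bar> + 1"
  have R: "R > 0" "\<eta> x = 0" "deriv \<eta> x = 0" if "\<bar>x\<bar> \<ge> R" for x
    using R0[of x] R1[of x] that by (auto simp: R_def)
  have "R > 0" by (simp add: R_def)
  have c\<eta>: "continuous_on UNIV \<eta>" and c\<eta>': "continuous_on UNIV (deriv \<eta>)"
    using \<eta> by (auto intro: test_function_continuous test_functionD)
  have [measurable]: "g \<in> borel_measurable borel" "\<eta> \<in> borel_measurable borel"
    "deriv \<eta> \<in> borel_measurable borel" "G \<in> borel_measurable borel"
    using locally_integrable_measurable[OF g] borel_measurable_continuous_onI c\<eta> c\<eta>' cG by auto
  define I where "I = (\<lambda>x. indicator {-R<..R} x :: real)"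
  have [measurable]: "I \<in> borel_measurable borel" by (simp add: I_def)
  define f where "f = (\<lambda>(x, u). (I u * g u) * (I x * deriv \<eta> x) * (if u \<le> x then 1 else 0 :: real))"
  have [measurable]: "f \<in> borel_measurable (lborel \<Otimes>\<^sub>M lborel)"
    unfolding f_def by measurable
  have ig: "integrable lborel (\<lambda>u. I u * g u)"
    unfolding I_def by (rule integrable_indicator_Ioc[OF g])
  have i\<eta>: "integrable lborel (\<lambda>x. I x * deriv \<eta> x)"
    unfolding I_def by (rule integrable_indicator_Ioc[OF locally_integrable_continuous[OF c\<eta>']])
  have fin: "integrable lborel (\<lambda>u. f (x, u))" for x
  proof (rule Bochner_Integration.integrable_bound)
    show "integrable lborel (\<lambda>u. (I u * g u) * (I x * deriv \<eta> x))"
      by (intro integrable_mult_left ig)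
  qed (auto simp: f_def)
  have int_f: "integrable (lborel \<Otimes>\<^sub>M lborel) f"
  proof (rule lborel_pair.Fubini_integrable)
    have le: "(LBINT u. norm (f (x, u))) \<le> (LBINT u. \<bar>I u * g u\<bar>) * \<bar>I x * deriv \<eta> x\<bar>" for x
    proof -
      have "(LBINT u. norm (f (x, u))) \<le> (LBINT u. \<bar>I u * g u\<bar> * \<bar>I x * deriv \<eta> x\<bar>)"
        using ig by (intro integral_mono integrable_norm fin integrable_mult_left integrable_abs)
          (auto simp: f_def abs_mult)
      then show ?thesis by simp
    qed
    show "integrable lborel (\<lambda>x. LBINT u. norm (f (x, u)))"
    proof (rule Bochner_Integration.integrable_bound)
      show "integrable lborel (\<lambda>x. (LBINT u. \<bar>I u * g u\<bar>) * \<bar>I x * deriv \<eta> x\<bar>)"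
        by (intro integrable_mult_right integrable_abs i\<eta>)
      show "AE x in lborel. norm (LBINT u. norm (f (x, u))) \<le> norm ((LBINT u. \<bar>I u * g u\<bar>) * \<bar>I x * deriv \<eta> x\<bar>)"
        using le by (auto intro!: AE_I2 order.trans[OF le] simp: integral_nonneg_AE)
    qed measurable
  qed (auto simp: fin)
  have FG: "I x * (G x - G (-R)) = (LBINT u. I x * (I u * g u) * (if u \<le> x then 1 else 0))" for x
  proof (cases "x \<in> {-R<..R}")
    case True
    then have "G x - G (-R) = (LBINT u:{-R<..x}. g u)"
      using G by (auto simp: is_primitive_def)
    also have "\<dots> = (LBINT u. I x * (I u * g u) * (if u \<le> x then 1 else 0))"
      unfolding set_lebesgue_integral_def
      by (rule Bochner_Integration.integral_cong) (use True in \<open>auto simp: I_def indicator_def\<close>)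
    finally show ?thesis using True by (simp add: I_def)
  qed (simp add: I_def)
  have F\<eta>: "(LBINT x:{u<..R}. deriv \<eta> x) = - \<eta> u" if "u \<le> R" for u
    using primitive_of_continuous[OF test_functionD(1)[OF \<eta>] c\<eta>'] that R(2)[of R] \<open>R > 0\<close>
    by (simp add: is_primitive_def) (metis diff_0)
  have iG: "integrable lborel (\<lambda>x. G x * deriv \<eta> x)"
    by (rule integrable_mult_compact_support[OF locally_integrable_continuous[OF cG] c\<eta>', of R]) (auto simp: R)
  \<comment> \<open>The constant \<open>G (-R)\<close> is split off so that the remaining factor is
    an integral of \<open>g\<close> over \<open>{-R<..x}\<close>; the constant contributes nothing,
    since \<open>deriv \<eta>\<close> integrates to 0 over the window.\<close>
  have "(LBINT x. G x * deriv \<eta> x) = (LBINT x. I x * (G x - G (-R)) * deriv \<eta> x + G (-R) * (I x * deriv \<eta> x))"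
  proof (rule Bochner_Integration.integral_cong[OF refl])
    fix x show "G x * deriv \<eta> x = I x * (G x - G (-R)) * deriv \<eta> x + G (-R) * (I x * deriv \<eta> x)"
    proof (cases "x \<in> {-R<..R}")
      case False
      then have "\<bar>x\<bar> \<ge> R" by auto
      then show ?thesis using False R(3) by (simp add: I_def)
    qed (simp add: I_def algebra_simps)
  qed
  also have "\<dots> = (LBINT x. I x * (G x - G (-R)) * deriv \<eta> x) + (LBINT x. G (-R) * (I x * deriv \<eta> x))"
  proof (rule Bochner_Integration.integral_add)
    have "(\<lambda>x. I x * (G x - G (-R)) * deriv \<eta> x) = (\<lambda>x. G x * deriv \<eta> x - G (-R) * (I x * deriv \<eta> x))"
    proof
      fix x show "I x * (G x - G (-R)) * deriv \<eta> x = G x * deriv \<eta> x - G (-R) * (I x * deriv \<eta> x)"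
        using R(3)[of x] by (cases "\<bar>x\<bar> < R") (auto simp: I_def algebra_simps indicator_def)
    qed
    then show "integrable lborel (\<lambda>x. I x * (G x - G (-R)) * deriv \<eta> x)"
      using iG i\<eta> by (simp add: Bochner_Integration.integrable_diff)
  qed (intro integrable_mult_right i\<eta>)
  also have "(LBINT x. G (-R) * (I x * deriv \<eta> x)) = G (-R) * (LBINT x:{-R<..R}. deriv \<eta> x)"
    by (simp add: set_lebesgue_integral_def I_def)
  also have "\<dots> = 0" using F\<eta>[of "-R"] R[of "-R"] \<open>R > 0\<close> by simp
  also have "(LBINT x. I x * (G x - G (-R)) * deriv \<eta> x) = (LBINT x. LBINT u. f (x, u))"
  proof (rule Bochner_Integration.integral_cong[OF refl])
    fix x
    have "I x * (G x - G (-R)) * deriv \<eta> x = (LBINT u. I x * (I u * g u) * (if u \<le> x then 1 else 0) * deriv \<eta> x)"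
      unfolding FG by simp
    also have "\<dots> = (LBINT u. f (x, u))"
      by (rule Bochner_Integration.integral_cong) (auto simp: f_def)
    finally show "I x * (G x - G (-R)) * deriv \<eta> x = (LBINT u. f (x, u))" .
  qed
  also have "\<dots> = (LBINT u. LBINT x. f (x, u))"
    using lborel_pair.Fubini_integral[of "\<lambda>x u. f (x, u)"] int_f by simp
  also have "\<dots> = (LBINT u. - (g u * \<eta> u))"
  proof (rule Bochner_Integration.integral_cong[OF refl])
    fix u
    show "(LBINT x. f (x, u)) = - (g u * \<eta> u)"
    proof (cases "u \<in> {-R<..R}")
      case True
      have "(LBINT x. f (x, u)) = (LBINT x. g u * (indicator {u<..R} x *\<^sub>R deriv \<eta> x))"
      \<comment> \<open>The triangle contains the diagonal point \<open>x = u\<close> while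
        \<open>{u<..R}\<close> does not; a single point is a null set.\<close>
      proof (rule integral_cong_AE)
        show "AE x in lborel. f (x, u) = g u * (indicator {u<..R} x *\<^sub>R deriv \<eta> x)"
          using AE_lborel_singleton[of u]
          by (rule eventually_mono) (use True in \<open>auto simp: f_def I_def indicator_def\<close>)
      qed measurable
      also have "\<dots> = g u * (LBINT x:{u<..R}. deriv \<eta> x)" by (simp add: set_lebesgue_integral_def)
      finally show ?thesis using F\<eta>[of u] True by simp
    next
      case False
      then have "\<bar>u\<bar> \<ge> R" by auto
      then show ?thesis using R(2)[of u] False by (simp add: f_def I_def)
    qed
  qed
  finally show ?thesis by simp
qed

text \<open>The constant has to be the integral of \<open>h * \<theta>\<close> for a weight
  \<open>\<theta>\<close> of mass 1. A function \<open>\<phi>\<close> of compact support and mass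
  \<open>b - a\<close> becomes the derivative of a test function once
  \<open>(b - a) * \<theta>\<close> is subtracted. Letting such \<open>\<phi>\<close> tend to the
  indicator of \<open>{a<..b}\<close> determines all interval integrals of \<open>h\<close>.\<close>

lemma du_Bois_Reymond:
  assumes h: "locally_integrable h"
    and zero: "\<And>\<eta>. test_function \<eta> \<Longrightarrow> (LBINT x. h x * deriv \<eta> x) = 0"
  shows "\<exists>c. AE x in lborel. h x = c"
proof -
  obtain \<theta> \<Theta> \<Xi> :: "real \<Rightarrow> real" and c0 :: real where
    sm: "C_infty \<Theta>" "C_infty \<Xi>" "continuous_on UNIV \<theta>"
    and D: "\<And>x. (\<Xi> has_real_derivative \<Theta> x) (at x)" "\<And>x. (\<Theta> has_real_derivative \<theta> x) (at x)"
    and T: "\<And>x. x \<le> 0 \<Longrightarrow> \<Theta> x = 0" "\<And>x. x \<ge> 1 \<Longrightarrow> \<Theta> x = 1" "\<And>x. 0 \<le> \<Theta> x" "\<And>x. \<Theta> x \<le> 1"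
    and X: "\<And>x. x \<le> 0 \<Longrightarrow> \<Xi> x = 0" "\<And>x. x \<ge> 1 \<Longrightarrow> \<Xi> x = x - c0"
    by (rule smooth_step_exists) blast
  have \<theta>0: "\<theta> x = 0" if "\<bar>x\<bar> > 1" for x
  proof -
    have "(\<Theta> has_real_derivative 0) (at x)"
    proof (cases "x > 0")
      case True
      have "((\<lambda>x. 1) has_real_derivative 0) (at x)" by simp
      then show ?thesis
        by (rule has_field_derivative_transform_within_open[of _ _ _ "{1<..}"]) (use True that T in auto)
    next
      case False
      have "((\<lambda>x. 0) has_real_derivative 0) (at x)" by simp
      then show ?thesis
        by (rule has_field_derivative_transform_within_open[of _ _ _ "{..<0}"]) (use False that T in auto)
    qed
    then show ?thesis using D(2) DERIV_unique by blast
  qed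
  have i\<theta>: "integrable lborel (\<lambda>x. h x * \<theta> x)"
    by (rule integrable_mult_compact_support[OF h sm(3) \<theta>0])
  have cT: "continuous_on UNIV \<Theta>"
    by (meson D DERIV_isCont continuous_at_imp_continuous_on)
  define c where "c = (LBINT x. h x * \<theta> x)"
  have [measurable]: "h \<in> borel_measurable borel" "\<Theta> \<in> borel_measurable borel"
    using locally_integrable_measurable[OF h] borel_measurable_continuous_onI[OF cT] by auto
  have key: "(LBINT x:{a<..b}. h x) = c * (b - a)" if "a \<le> b" for a b
  proof -
    \<comment> \<open>The steps get steeper with \<open>n\<close>, but the difference has mass
      exactly \<open>b - a\<close> for every \<open>n\<close>.\<close>
    define \<phi> where "\<phi> = (\<lambda>(n::nat) x. \<Theta> (Suc n * (x - a)) - \<Theta> (Suc n * (x - b)))"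
    have \<phi>0: "\<phi> n x = 0" if "x \<notin> {a..b + 1}" for n x
    proof (cases "x < a")
      case True
      have "Suc n * (x - a) \<le> 0" "Suc n * (x - b) \<le> 0"
        using True \<open>a \<le> b\<close> by (auto intro!: mult_nonneg_nonpos)
      then show ?thesis by (simp add: \<phi>_def T)
    next
      case False
      then have "x - b > 1" "x - a > 1" using that \<open>a \<le> b\<close> by auto
      then have "Suc n * (x - a) \<ge> 1 * 1" "Suc n * (x - b) \<ge> 1 * 1"
        by (intro mult_mono; simp)+
      then show ?thesis by (simp add: \<phi>_def T)
    qed
    have \<phi>01: "\<bar>\<phi> n x\<bar> \<le> 1" for n x
      using T(3,4)[of "Suc n * (x - a)"] T(3,4)[of "Suc n * (x - b)"] by (auto simp: \<phi>_def)
    have c\<phi>: "continuous_on UNIV (\<phi> n)" for n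
      unfolding \<phi>_def by (intro continuous_intros continuous_on_compose2[OF cT]) auto
    have supp: "\<phi> n x = 0" if "\<bar>x\<bar> > \<bar>a\<bar> + \<bar>b\<bar> + 1" for n x
      by (rule \<phi>0) (use that in auto)
    have i\<phi>: "integrable lborel (\<lambda>x. h x * \<phi> n x)" for n
      by (rule integrable_mult_compact_support[OF h c\<phi> supp])
    have eq: "(LBINT x. h x * \<phi> n x) = c * (b - a)" for n
    proof -
      \<comment> \<open>A primitive of \<open>\<phi> n - (b - a) * \<theta>\<close>. To the right of
        the support the quotient equals \<open>b - a\<close>, because \<open>c0\<close> cancels, and
        \<open>(b - a) * \<Theta>\<close> removes it.\<close>
      define \<eta> where "\<eta> = (\<lambda>x. (\<Xi> (Suc n * (x - a)) - \<Xi> (Suc n * (x - b))) / Suc n - (b - a) * \<Theta> x)"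
      have D\<eta>: "(\<eta> has_real_derivative \<phi> n x - (b - a) * \<theta> x) (at x)" for x
        unfolding \<eta>_def \<phi>_def
        by (auto intro!: derivative_eq_intros DERIV_chain2[OF D(1)] D(2) simp: field_simps simp del: of_nat_Suc)
      have "C_infty \<eta>"
      proof -
        have "C_infty (\<lambda>x. (1 / real (Suc n)) * \<Xi> (real (Suc n) * x + (- real (Suc n) * a)) +
            (- 1 / real (Suc n)) * \<Xi> (real (Suc n) * x + (- real (Suc n) * b)) + - (b - a) * \<Theta> (1 * x + 0))"
          by (intro C_infty_add C_infty_affine_comp sm)
        also have "(\<lambda>x. (1 / real (Suc n)) * \<Xi> (real (Suc n) * x + (- real (Suc n) * a)) +
            (- 1 / real (Suc n)) * \<Xi> (real (Suc n) * x + (- real (Suc n) * b)) + - (b - a) * \<Theta> (1 * x + 0)) = \<eta>"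
          unfolding \<eta>_def right_diff_distrib diff_divide_distrib
          by (rule ext) (simp add: left_diff_distrib del: of_nat_Suc)
        finally show ?thesis .
      qed
      moreover have "\<eta> x = 0" if x: "\<bar>x\<bar> > \<bar>a\<bar> + \<bar>b\<bar> + 1" for x
      proof (cases "x > 0")
        case False
        then have "Suc n * (x - a) \<le> 0" "Suc n * (x - b) \<le> 0" using x
          by (intro mult_nonneg_nonpos; auto)+
        then show ?thesis using False by (simp add: \<eta>_def X T)
      next
        case True
        then have "x - b > 1" "x - a > 1" "x > 1" using x by auto
        moreover from this have "Suc n * (x - a) \<ge> 1 * 1" "Suc n * (x - b) \<ge> 1 * 1"
          by (intro mult_mono; simp)+
        ultimately show ?thesis by (simp add: \<eta>_def X T field_simps del: of_nat_Suc)
      qed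
      ultimately have "test_function \<eta>" by (rule test_functionI)
      from zero[OF this] have "0 = (LBINT x. h x * (\<phi> n x - (b - a) * \<theta> x))"
        using DERIV_imp_deriv[OF D\<eta>] by simp
      also have "\<dots> = (LBINT x. h x * \<phi> n x - (b - a) * (h x * \<theta> x))"
        by (rule Bochner_Integration.integral_cong) (auto simp: algebra_simps)
      also have "\<dots> = (LBINT x. h x * \<phi> n x) - (b - a) * c"
        unfolding c_def using i\<phi> i\<theta> by (subst Bochner_Integration.integral_diff) auto
      finally show ?thesis by (simp add: mult.commute)
    qed
    have "(\<lambda>n. LBINT x. h x * \<phi> n x) \<longlonglongrightarrow> (LBINT x. h x * indicator {a<..b} x)"
    proof (rule integral_dominated_convergence)
      show "integrable lborel (\<lambda>x. indicator {a..b+1} x *\<^sub>R \<bar>h x\<bar>)"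
        using h unfolding locally_integrable_def set_integrable_def[symmetric] by (intro set_integrable_abs) auto
      show "AE x in lborel. norm (h x * \<phi> n x) \<le> indicator {a..b+1} x *\<^sub>R \<bar>h x\<bar>" for n
        using \<phi>0[of _ n] \<phi>01[of n] by (auto simp: indicator_def abs_mult mult_left_le)
      show "AE x in lborel. (\<lambda>n. h x * \<phi> n x) \<longlonglongrightarrow> h x * indicator {a<..b} x"
      proof (intro AE_I2 tendsto_mult_left)
        fix x :: real
        \<comment> \<open>At \<open>x = e\<close> the argument is 0 and
          \<open>\<Theta> 0 = 0\<close>; hence the limit is the indicator of an interval open on the
          left and closed on the right.\<close>
        have lim: "(\<lambda>n. \<Theta> (Suc n * (x - e))) \<longlonglongrightarrow> (if x > e then 1 else 0)" for e
        proof (cases "x > e")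
          case True
          have "eventually (\<lambda>n. \<Theta> (Suc n * (x - e)) = 1) sequentially"
            using eventually_ge_at_top[of "nat \<lceil>1 / (x - e)\<rceil>"]
          proof eventually_elim
            case (elim n)
            then have "1 / (x - e) \<le> Suc n" by linarith
            then have "1 \<le> Suc n * (x - e)" using True by (simp add: field_simps)
            then show ?case by (rule T(2))
          qed
          then show ?thesis using True by (simp add: tendsto_eventually)
        next
          case False
          then have "Suc n * (x - e) \<le> 0" for n by (intro mult_nonneg_nonpos) auto
          then show ?thesis using False T(1) by simp
        qed
        have "(\<lambda>n. \<phi> n x) \<longlonglongrightarrow> (if x > a then 1 else 0) - (if x > b then 1 else 0)"
          unfolding \<phi>_def by (intro tendsto_diff lim)
        also have "(if x > a then 1 else 0) - (if x > b then 1 else 0) = (indicator {a<..b} x :: real)"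
          using \<open>a \<le> b\<close> by (auto simp: indicator_def)
        finally show "(\<lambda>n. \<phi> n x) \<longlonglongrightarrow> indicator {a<..b} x" .
      qed
    qed (auto simp: \<phi>_def)
    then have "(LBINT x. h x * indicator {a<..b} x) = c * (b - a)"
      unfolding eq by (simp add: LIMSEQ_const_iff)
    then show ?thesis by (simp add: set_lebesgue_integral_def mult.commute)
  qed
  have lc: "locally_integrable (\<lambda>x. c)" by (intro locally_integrable_continuous continuous_intros)
  have "AE x in lborel. h x - c = 0"
  proof (rule AE_zero_if_interval_integrals_zero)
    show "locally_integrable (\<lambda>x. h x - c)"
      by (rule locally_integrable_diff[OF h lc])
    fix a b :: real assume "a \<le> b"
    have "(LBINT x:{a<..b}. h x - c) = (LBINT x:{a<..b}. h x) - (LBINT x:{a<..b}. c)"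
      by (rule set_integral_diff) (rule set_integrable_locally[of _ _ a b]; use h lc in auto)+
    also have "(LBINT x:{a<..b}. c) = c * (b - a)"
      using \<open>a \<le> b\<close> by (simp add: set_lebesgue_integral_def)
    finally show "(LBINT x:{a<..b}. h x - c) = 0" using key[OF \<open>a \<le> b\<close>] by simp
  qed
  then show ?thesis by auto
qed

section \<open>Weak derivatives compared with classical ones\<close>

lemma continuous_AE_eq:
  fixes f g :: "real \<Rightarrow> real"
  assumes "continuous_on UNIV f" "continuous_on UNIV g" "AE x in lborel. f x = g x"
  shows "f = g"
proof (rule ccontr)
  assume "f \<noteq> g"
  define S where "S = {x. f x \<noteq> g x}"
  have "open S" unfolding S_def by (intro open_Collect_neq assms)
  moreover have "S \<noteq> {}" using \<open>f \<noteq> g\<close> by (auto simp: S_def)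
  ultimately have "\<not> negligible S" by (rule open_not_negligible)
  moreover have "S \<in> null_sets lborel"
    using assms(3) \<open>open S\<close> by (subst AE_iff_null_sets) (auto simp: S_def)
  then have "negligible S" by (simp add: negligible_iff_null_sets null_sets_completionI)
  ultimately show False by blast
qed

lemma has_weak_deriv_0: "locally_integrable f \<Longrightarrow> has_weak_deriv 0 f f"
  by (simp add: has_weak_deriv_def)

lemma test_function_funpow: "test_function \<eta> \<Longrightarrow> test_function ((deriv ^^ i) \<eta>)"
  by (induction i) (auto intro: test_functionD)

text \<open>One integration by parts moves one derivative from the test function to
  \<open>f\<close>. This is the step of every induction on the order of the weak derivative.\<close>

lemma has_weak_deriv_Suc_iff:
  assumes "is_primitive f f'" "continuous_on UNIV f"
  shows "has_weak_deriv (Suc i) f g \<longleftrightarrow> has_weak_deriv i f' g"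
proof -
  have "(LBINT x. f x * (deriv ^^ Suc i) \<eta> x) = - (LBINT x. f' x * (deriv ^^ i) \<eta> x)" if "test_function \<eta>" for \<eta>
    using primitive_by_parts[OF assms test_function_funpow[OF that, of i]] by simp
  then show ?thesis
    using assms(1) locally_integrable_continuous[OF assms(2)]
    by (auto simp: has_weak_deriv_def is_primitive_def)
qed

lemma weak_deriv_primitive:
  assumes w: "has_weak_deriv 1 f g" and B: "AE x in lborel. \<bar>g x\<bar> \<le> B"
  obtains F where "is_primitive F g" "\<And>x y. \<bar>F x - F y\<bar> \<le> B * \<bar>x - y\<bar>" "AE x in lborel. f x = F x"
proof -
  have f: "locally_integrable f" and g: "locally_integrable g" using w by (auto simp: has_weak_deriv_def)
  obtain G where G: "is_primitive G g" using primitive_exists[OF g] by blast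
  have lip: "\<bar>G x - G y\<bar> \<le> B * \<bar>x - y\<bar>" for x y by (rule primitive_lipschitz[OF G B])
  have cG: "continuous_on UNIV G" by (rule lipschitz_continuous_on[OF lip])
  have "\<exists>c. AE x in lborel. f x - G x = c"
  proof (rule du_Bois_Reymond)
    show "locally_integrable (\<lambda>x. f x - G x)"
      by (intro locally_integrable_diff f locally_integrable_continuous cG)
    fix \<eta> assume \<eta>: "test_function \<eta>"
    obtain R where R: "\<And>x. \<bar>x\<bar> > R \<Longrightarrow> deriv \<eta> x = 0"
      using test_functionD(2)[OF \<eta>] by (auto simp: test_function_def)
    have c: "continuous_on UNIV (deriv \<eta>)" by (intro test_function_continuous test_functionD \<eta>)
    have "(LBINT x. (f x - G x) * deriv \<eta> x) = (LBINT x. f x * deriv \<eta> x - G x * deriv \<eta> x)"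
      by (simp add: left_diff_distrib)
    also have "\<dots> = (LBINT x. f x * deriv \<eta> x) - (LBINT x. G x * deriv \<eta> x)"
      by (intro Bochner_Integration.integral_diff integrable_mult_compact_support[OF _ c R] f
          locally_integrable_continuous cG)
    also have "\<dots> = 0"
      using w \<eta> primitive_by_parts[OF G cG \<eta>] by (simp add: has_weak_deriv_def)
    finally show "(LBINT x. (f x - G x) * deriv \<eta> x) = 0" .
  qed
  then obtain c where c: "AE x in lborel. f x - G x = c" by blast
  show ?thesis
  proof (rule that[of "\<lambda>x. G x + c"])
    show "is_primitive (\<lambda>x. G x + c) g" using G by (simp add: is_primitive_def)
    show "AE x in lborel. f x = G x + c" using c by (auto elim!: eventually_mono)
  qed (use lip in auto)
qed

text \<open>Testing against derivatives first shows that \<open>f - g\<close> is constant; one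
  nonnegative test function with nonzero integral then shows that the constant is 0.\<close>

lemma has_weak_deriv_0_AE_eq:
  assumes w: "has_weak_deriv 0 f g"
  shows "AE x in lborel. f x = g x"
proof -
  have f: "locally_integrable f" and g: "locally_integrable g" using w by (auto simp: has_weak_deriv_def)
  have z: "(LBINT x. (f x - g x) * \<eta> x) = 0" if \<eta>: "test_function \<eta>" for \<eta>
  proof -
    obtain R where R: "\<And>x. \<bar>x\<bar> > R \<Longrightarrow> \<eta> x = 0" using \<eta> by (auto simp: test_function_def)
    have c: "continuous_on UNIV \<eta>" by (intro test_function_continuous \<eta>)
    have "(LBINT x. (f x - g x) * \<eta> x) = (LBINT x. f x * \<eta> x - g x * \<eta> x)"
      by (simp add: left_diff_distrib)
    also have "\<dots> = (LBINT x. f x * \<eta> x) - (LBINT x. g x * \<eta> x)"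
      by (intro Bochner_Integration.integral_diff integrable_mult_compact_support[OF _ c R] f g)
    finally show ?thesis using w \<eta> by (simp add: has_weak_deriv_def)
  qed
  have "\<exists>c. AE x in lborel. f x - g x = c"
    by (rule du_Bois_Reymond) (auto intro!: locally_integrable_diff f g z test_functionD)
  then obtain c where c: "AE x in lborel. f x - g x = c" by blast
  obtain \<theta> \<Theta> \<Xi> :: "real \<Rightarrow> real" and c0 :: real where
    sm: "C_infty \<Theta>" and T: "\<And>x. x \<le> 0 \<Longrightarrow> \<Theta> x = 0" "\<And>x. x \<ge> 1 \<Longrightarrow> \<Theta> x = 1" "\<And>x. 0 \<le> \<Theta> x" "\<And>x. \<Theta> x \<le> 1"
    by (rule smooth_step_exists) blast
  \<comment> \<open>A plateau made of two shifted steps: it is nonnegative and equals 1 at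
    0.\<close>
  define \<eta> where "\<eta> = (\<lambda>x. 1 * \<Theta> (1 * x + 1) + (-1) * \<Theta> (1 * x + (-1)))"
  have "C_infty \<eta>" unfolding \<eta>_def by (intro C_infty_add C_infty_affine_comp sm)
  then have \<eta>: "test_function \<eta>"
    by (rule test_functionI[of _ 2]) (auto simp: \<eta>_def T abs_if split: if_splits)
  have cont: "continuous_on UNIV \<eta>" by (intro test_function_continuous \<eta>)
  have \<eta>0: "0 \<le> \<eta> x" for x
  proof (cases "x \<le> 0")
    case True then show ?thesis using T(1)[of "x - 1"] T(3)[of "x + 1"] by (simp add: \<eta>_def)
  next
    case False then show ?thesis using T(2)[of "x + 1"] T(4)[of "x - 1"] by (simp add: \<eta>_def)
  qed
  have "\<eta> 0 = 1" using T by (simp add: \<eta>_def)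
  have [measurable]: "f \<in> borel_measurable borel" "g \<in> borel_measurable borel" "\<eta> \<in> borel_measurable borel"
    using locally_integrable_measurable[OF f] locally_integrable_measurable[OF g] borel_measurable_continuous_onI[OF cont] by auto
  have "0 = (LBINT x. (f x - g x) * \<eta> x)" using z[OF \<eta>] by simp
  also have "\<dots> = (LBINT x. c * \<eta> x)"
    by (rule integral_cong_AE) (use c in \<open>auto elim!: eventually_mono\<close>)
  finally have "c * (LBINT x. \<eta> x) = 0" by simp
  moreover have "(LBINT x. \<eta> x) \<noteq> 0"
  proof
    assume "(LBINT x. \<eta> x) = 0"
    moreover obtain R where "\<And>x. \<bar>x\<bar> > R \<Longrightarrow> \<eta> x = 0" using \<eta> by (auto simp: test_function_def)
    then have "integrable lborel \<eta>"
      using integrable_mult_compact_support[OF locally_integrable_continuous[of "\<lambda>_. 1"] cont] by auto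
    ultimately have "AE x in lborel. \<eta> x = 0"
      using integral_nonneg_eq_0_iff_AE[of lborel \<eta>] \<eta>0 by auto
    from continuous_AE_eq[OF cont _ this] \<open>\<eta> 0 = 1\<close> show False by auto
  qed
  ultimately have "c = 0" by simp
  with c show ?thesis by simp
qed

text \<open>The weak derivative \<open>g1\<close> itself has the bounded weak derivative
  \<open>g2\<close>, so it has a Lipschitz representative \<open>f'\<close>. As \<open>f\<close> is
  a primitive of \<open>g1\<close>, it is one of \<open>f'\<close>, and the fundamental theorem
  applies.\<close>

lemma weak_deriv_classical:
  assumes cf: "continuous_on UNIV f"
    and w: "has_weak_deriv 1 f g1" "has_weak_deriv 2 f g2"
    and B: "AE x in lborel. \<bar>g1 x\<bar> \<le> B" "AE x in lborel. \<bar>g2 x\<bar> \<le> B"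
  obtains f' where "\<And>x. (f has_real_derivative f' x) (at x)" "continuous_on UNIV f'"
proof -
  have "has_weak_deriv 1 g1 g2"
    unfolding has_weak_deriv_def
  proof (intro conjI allI impI)
    fix \<eta> assume \<eta>: "test_function \<eta>"
    have "(LBINT x. f x * deriv (deriv \<eta>) x) = - (LBINT x. g1 x * deriv \<eta> x)"
      using w(1) test_functionD(2)[OF \<eta>] by (simp add: has_weak_deriv_def)
    moreover have "(LBINT x. f x * deriv (deriv \<eta>) x) = (LBINT x. g2 x * \<eta> x)"
      using w(2) \<eta> by (simp add: has_weak_deriv_def numeral_2_eq_2)
    ultimately show "(LBINT x. g1 x * (deriv ^^ 1) \<eta> x) = (- 1) ^ 1 * (LBINT x. g2 x * \<eta> x)" by simp
  qed (use w in \<open>auto simp: has_weak_deriv_def\<close>)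
  then obtain f' where f': "\<And>x y. \<bar>f' x - f' y\<bar> \<le> B * \<bar>x - y\<bar>" "AE x in lborel. g1 x = f' x"
    by (rule weak_deriv_primitive[OF _ B(2)]) blast
  have cf': "continuous_on UNIV f'" by (rule lipschitz_continuous_on[OF f'(1)])
  obtain F where F: "is_primitive F g1" "\<And>x y. \<bar>F x - F y\<bar> \<le> B * \<bar>x - y\<bar>" "AE x in lborel. f x = F x"
    by (rule weak_deriv_primitive[OF w(1) B(1)]) blast
  have "f = F" by (rule continuous_AE_eq[OF cf lipschitz_continuous_on[OF F(2)] F(3)])
  have [measurable]: "g1 \<in> borel_measurable borel" "f' \<in> borel_measurable borel"
    using locally_integrable_measurable[of g1] F(1) borel_measurable_continuous_onI[OF cf']
    by (auto simp: is_primitive_def)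
  have "(LBINT x:{a<..b}. g1 x) = (LBINT x:{a<..b}. f' x)" for a b
    unfolding set_lebesgue_integral_def
    by (rule integral_cong_AE) (use f'(2) in \<open>auto elim!: eventually_mono\<close>)
  then have "is_primitive f f'"
    using F(1) locally_integrable_continuous[OF cf'] by (simp add: is_primitive_def \<open>f = F\<close>)
  then show ?thesis using that primitive_has_derivative cf' by blast
qed

text \<open>Radon--Nikodym replaces Rademacher's theorem: for a 1-Lipschitz \<open>f\<close> the Stieltjes measures of the
  monotone functions \<open>x + f x\<close> and \<open>x - f x\<close> have Lebesgue measure as their mean.\<close>

lemma lipschitz1_has_primitive:
  assumes lip: "\<And>x y. \<bar>f x - f y\<bar> \<le> \<bar>x - y :: real\<bar>"
  obtains g where "is_primitive f g" "\<And>x. \<bar>g x\<bar> \<le> 1"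
proof -
  have cf: "continuous_on UNIV f" using lipschitz_continuous_on[of f 1] lip by auto
  define F where "F = (\<lambda>x. x + f x)"
  define F' where "F' = (\<lambda>x. x - f x)"
  have F: "F x \<le> F y" "F' x \<le> F' y" if "x \<le> y" for x y
    using lip[of x y] that by (auto simp: F_def F'_def)
  have cF: "continuous_on UNIV F" "continuous_on UNIV F'"
    unfolding F_def F'_def by (intro continuous_intros cf)+
  then have rF: "continuous (at_right a) F" "continuous (at_right a) F'" for a
    by (auto simp: continuous_on_eq_continuous_at continuous_at_imp_continuous_at_within)
  define M where "M = interval_measure F"
  define M' where "M' = interval_measure F'"
  have sM[simp, measurable_cong]: "sets M = sets borel" "sets M' = sets borel" by (simp_all add: M_def M'_def)
  have mean: "(emeasure M A + emeasure M' A) / 2 = emeasure lborel A" if "A \<in> sets borel" for A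
  proof -
    have half: "(emeasure M A + emeasure M' A) / 2 = emeasure (mix_measure (1/2) M M') A" if "A \<in> sets borel" for A
    proof -
      have "emeasure (mix_measure (1/2) M M') A = ennreal (1/2) * (emeasure M A + emeasure M' A)"
        using that by (subst emeasure_mix_measure) (auto simp: distrib_left)
      also have "ennreal (1/2) = inverse 2"
        by (metis divide_ennreal_def ennreal_1 ennreal_divide_numeral ennreal_numeral inverse_eq_divide mult_1 one_add_one one_le_numeral zero_le_one)
      finally show ?thesis by (simp add: divide_ennreal_def mult.commute)
    qed
    \<comment> \<open>Here \<open>mix_measure\<close> is applied to measures that need not be
      finite. The increments of \<open>F\<close> and \<open>F'\<close> add up to twice the length,
      which identifies Lebesgue measure by its values on intervals.\<close>
    have "lborel = mix_measure (1/2) M M'"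
    proof (rule lborel_eqI)
      show "sets (mix_measure (1/2) M M') = sets borel"
        by (simp add: mix_measure_def) (metis sets.sigma_sets_eq space_borel)
      fix l u :: real assume "\<And>b. b \<in> Basis \<Longrightarrow> l \<bullet> b \<le> u \<bullet> b"
      then have lu: "l \<le> u" by simp
      have p: "emeasure M {x} = 0" "emeasure M' {x} = 0" for x
        using emeasure_interval_measure_Icc[of x x F] emeasure_interval_measure_Icc[of x x F'] F cF
        by (auto simp: M_def M'_def)
      have n: "{u} \<in> null_sets M" "{u} \<in> null_sets M'" using p by (auto simp: null_sets_def)
      have "emeasure M {l<..<u} = emeasure M {l<..u} \<and> emeasure M' {l<..<u} = emeasure M' {l<..u}"
      proof (cases "l = u")
        case False
        then have "{l<..u} = {l<..<u} \<union> {u}" using lu by auto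
        then show ?thesis using n by (simp only:) (simp add: emeasure_Un_null_set del: Un_insert_right)
      qed simp
      then have "emeasure M {l<..<u} = ennreal (F u - F l)" "emeasure M' {l<..<u} = ennreal (F' u - F' l)"
        using emeasure_interval_measure_Ioc[OF lu, of F] emeasure_interval_measure_Ioc[OF lu, of F'] F rF
        by (auto simp: M_def M'_def)
      then have "(emeasure M {l<..<u} + emeasure M' {l<..<u}) / 2 = ennreal (F u - F l + (F' u - F' l)) / 2"
        using F[OF lu] by (simp add: ennreal_plus)
      also have "F u - F l + (F' u - F' l) = 2 * (u - l)" by (simp add: F_def F'_def)
      also have "ennreal (2 * (u - l)) / 2 = ennreal (u - l)"
        using lu by (subst ennreal_divide_numeral) auto
      finally show "emeasure (mix_measure (1/2) M M') (box l u) = ennreal (\<Prod>b\<in>Basis. (u - l) \<bullet> b)"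
        using half[of "{l<..<u}"] by (simp add: box_real)
    qed
    then show ?thesis using half[OF that] by simp
  qed
  have null: "emeasure M A = 0 \<and> emeasure M' A = 0" if "A \<in> null_sets lborel" for A
    using mean[of A] that by (auto simp: null_sets_def divide_ennreal_def)
  have "absolutely_continuous lborel M" "absolutely_continuous lborel M'"
    unfolding absolutely_continuous_def using null by (auto simp: null_sets_def)
  then obtain h h' where [measurable]: "h \<in> borel_measurable borel" "h' \<in> borel_measurable borel"
    and h: "density lborel h = M" "density lborel h' = M'"
    using sigma_finite_measure.Radon_Nikodym[OF sigma_finite_lborel, of M]
      sigma_finite_measure.Radon_Nikodym[OF sigma_finite_lborel, of M'] by auto
  \<comment> \<open>Since \<open>M + M'\<close> is twice Lebesgue measure, the two densities add up
    to 2, which gives both the finiteness of \<open>h\<close> and the bound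
    \<open>h \<le> 2\<close>.\<close>
  have "density lborel (\<lambda>x. h x + h' x) = density lborel (\<lambda>_. 2)"
  proof (rule measure_eqI)
    fix A assume "A \<in> sets (density lborel (\<lambda>x. h x + h' x))"
    then have [measurable]: "A \<in> sets borel" by simp
    have "emeasure (density lborel (\<lambda>x. h x + h' x)) A = emeasure (density lborel h) A + emeasure (density lborel h') A"
      by (simp add: emeasure_density distrib_right nn_integral_add)
    also have "\<dots> = 2 * ((emeasure M A + emeasure M' A) / 2)"
    proof -
      have "2 * (x / 2) = x" for x :: ennreal
        by (subst ennreal_times_divide, subst mult.commute, rule mult_divide_eq_ennreal) auto
      then show ?thesis by (simp add: h)
    qed
    also have "\<dots> = emeasure (density lborel (\<lambda>_. 2)) A"
      by (simp add: mean emeasure_density nn_integral_cmult_indicator)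
    finally show "emeasure (density lborel (\<lambda>x. h x + h' x)) A = emeasure (density lborel (\<lambda>_. 2)) A" .
  qed simp
  then have "AE x in lborel. h x + h' x = 2"
    by (rule sigma_finite_measure.density_unique[OF sigma_finite_lborel, rotated -1]) auto
  then have h2: "AE x in lborel. h x \<le> 2"
    by (rule eventually_mono) (metis le_iff_add)
  \<comment> \<open>\<open>F = x + f\<close> has density \<open>h\<close>, so \<open>f\<close> has
    density \<open>h - 1\<close>. Cutting off at 2 turns the almost everywhere bound into one at
    every point.\<close>
  define g where "g = (\<lambda>x. enn2real (min 2 (h x)) - 1)"
  have g1: "\<bar>g x\<bar> \<le> 1" for x
  proof -
    have "enn2real (min 2 (h x)) \<le> enn2real 2" by (intro enn2real_mono) auto
    then show ?thesis by (auto simp: g_def abs_le_iff)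
  qed
  have gm[measurable]: "g \<in> borel_measurable borel" unfolding g_def by measurable
  have lg: "locally_integrable g" by (rule locally_integrable_bounded[of _ 1]) (use g1 in auto)
  have "is_primitive f g"
    unfolding is_primitive_def
  proof (intro conjI allI impI lg)
    fix a b :: real assume ab: "a \<le> b"
    have "ennreal (F b - F a) = emeasure M {a<..b}"
      using emeasure_interval_measure_Ioc[OF ab, of F] F rF by (simp add: M_def)
    also have "\<dots> = (\<integral>\<^sup>+x. h x * indicator {a<..b} x \<partial>lborel)"
      by (simp add: h(1)[symmetric] emeasure_density)
    also have "\<dots> = (\<integral>\<^sup>+x. ennreal ((g x + 1) * indicator {a<..b} x) \<partial>lborel)"
    proof (rule nn_integral_cong_AE)
      show "AE x in lborel. h x * indicator {a<..b} x = ennreal ((g x + 1) * indicator {a<..b} x)"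
        using h2
      proof eventually_elim
        case (elim x)
        then have "h x < \<top>" by (metis ennreal_numeral_less_top le_less_trans)
        then show ?case using elim by (auto simp: g_def indicator_def min_absorb2)
      qed
    qed
    also have "\<dots> = ennreal (LBINT x. (g x + 1) * indicator {a<..b} x)"
    proof (rule nn_integral_eq_integral)
      show "integrable lborel (\<lambda>x. (g x + 1) * indicator {a<..b} x)"
      proof -
        have "\<bar>g x + 1\<bar> \<le> 2" for x using g1[of x] by linarith
        then have "locally_integrable (\<lambda>x. g x + 1)" by (intro locally_integrable_bounded[of _ 2]) auto
        from integrable_indicator_Ioc[OF this] show ?thesis by (simp add: mult.commute)
      qed
      show "AE x in lborel. 0 \<le> (g x + 1) * indicator {a<..b} x"
        using g1 by (auto simp: abs_le_iff intro!: AE_I2 mult_nonneg_nonneg) (metis add.commute diff_ge_0_iff_ge diff_minus_eq_add minus_le_iff)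
    qed
    finally have "F b - F a = (LBINT x. (g x + 1) * indicator {a<..b} x)"
      using F[OF ab] g1 by (subst (asm) ennreal_inj) (auto intro!: integral_nonneg_AE AE_I2 simp: abs_le_iff indicator_def, metis add.commute diff_ge_0_iff_ge diff_minus_eq_add minus_le_iff)
    also have "\<dots> = (LBINT x. indicator {a<..b} x * g x + indicator {a<..b} x * 1)"
      by (simp add: algebra_simps)
    also have "\<dots> = (LBINT x:{a<..b}. g x) + (b - a)"
      using ab integrable_indicator_Ioc[OF lg, of a b] by (subst Bochner_Integration.integral_add) (auto simp: set_lebesgue_integral_def)
    finally show "f b - f a = (LBINT x:{a<..b}. g x)" by (simp add: F_def)
  qed
  with g1 show ?thesis using that by blast
qed

lemma lipschitz_has_primitive:
  assumes lip: "\<And>x y. \<bar>f x - f y\<bar> \<le> L * \<bar>x - y :: real\<bar>" and L: "L > 0"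
  obtains g where "is_primitive f g" "\<And>x. \<bar>g x\<bar> \<le> L"
proof -
  have "\<bar>f x / L - f y / L\<bar> \<le> \<bar>x - y\<bar>" for x y
    using lip[of x y] L by (simp add: field_simps flip: diff_divide_distrib)
  then obtain g where g: "is_primitive (\<lambda>x. f x / L) g" "\<And>x. \<bar>g x\<bar> \<le> 1"
    by (rule lipschitz1_has_primitive) blast
  have "locally_integrable (\<lambda>x. L * g x)"
    using g(1) by (auto simp: is_primitive_def locally_integrable_def)
  moreover have "f b - f a = (LBINT x:{a<..b}. L * g x)" if "a \<le> b" for a b
    using g(1) that L by (auto simp: is_primitive_def set_lebesgue_integral_def field_simps)
  ultimately show ?thesis
    using g(2) L by (intro that[of "\<lambda>x. L * g x"]) (auto simp: is_primitive_def abs_mult mult_left_le)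
qed

section \<open>Uniformly smooth families\<close>

text \<open>Families in \<open>W\<^sup>n\<^sup>+\<^sup>1\<^sup>,\<^sup>\<infinity>\<close>, uniformly in the index.\<close>

fun bdd_smooth :: "nat \<Rightarrow> 'i set \<Rightarrow> ('i \<Rightarrow> real \<Rightarrow> real) \<Rightarrow> bool" where
  "bdd_smooth 0 \<Omega> f \<longleftrightarrow> (\<exists>C. \<forall>\<omega>\<in>\<Omega>. \<forall>x y. \<bar>f \<omega> x\<bar> \<le> C \<and> \<bar>f \<omega> x - f \<omega> y\<bar> \<le> C * \<bar>x - y\<bar>)"
| "bdd_smooth (Suc n) \<Omega> f \<longleftrightarrow> (\<exists>C. \<forall>\<omega>\<in>\<Omega>. \<forall>x. \<bar>f \<omega> x\<bar> \<le> C) \<and>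
     (\<exists>f'. (\<forall>\<omega>\<in>\<Omega>. \<forall>x. (f \<omega> has_real_derivative f' \<omega> x) (at x)) \<and> bdd_smooth n \<Omega> f')"

lemma bdd_smooth_SucI:
  assumes "\<And>\<omega> x. \<omega> \<in> \<Omega> \<Longrightarrow> \<bar>f \<omega> x\<bar> \<le> C"
    and "\<And>\<omega> x. \<omega> \<in> \<Omega> \<Longrightarrow> (f \<omega> has_real_derivative f' \<omega> x) (at x)" "bdd_smooth n \<Omega> f'"
  shows "bdd_smooth (Suc n) \<Omega> f"
  unfolding bdd_smooth.simps using assms by blast

lemma bdd_smooth_SucE:
  assumes "bdd_smooth (Suc n) \<Omega> f"
  obtains C f' where "\<And>\<omega> x. \<omega> \<in> \<Omega> \<Longrightarrow> \<bar>f \<omega> x\<bar> \<le> C"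
    "\<And>\<omega> x. \<omega> \<in> \<Omega> \<Longrightarrow> (f \<omega> has_real_derivative f' \<omega> x) (at x)" "bdd_smooth n \<Omega> f'"
proof -
  from assms obtain C f' where "\<forall>\<omega>\<in>\<Omega>. \<forall>x. \<bar>f \<omega> x\<bar> \<le> C"
    "\<forall>\<omega>\<in>\<Omega>. \<forall>x. (f \<omega> has_real_derivative f' \<omega> x) (at x)" "bdd_smooth n \<Omega> f'"
    unfolding bdd_smooth.simps by blast
  then show ?thesis by (intro that[of C f']) auto
qed

lemma DERIV_bounded_imp_lipschitz:
  assumes "\<And>x. (f has_real_derivative f' x) (at x)" "\<And>x. \<bar>f' x\<bar> \<le> C"
  shows "\<bar>f x - f y\<bar> \<le> C * \<bar>x - y\<bar>"
  using field_differentiable_bound[of UNIV f f' C y x] assms by (auto simp: abs_minus_commute)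

lemma bdd_smooth_bounded:
  assumes "bdd_smooth n \<Omega> f"
  obtains C where "C > 0" "\<And>\<omega> x. \<omega> \<in> \<Omega> \<Longrightarrow> \<bar>f \<omega> x\<bar> \<le> C"
proof -
  obtain C where C: "\<And>\<omega> x. \<omega> \<in> \<Omega> \<Longrightarrow> \<bar>f \<omega> x\<bar> \<le> C"
    using assms by (cases n) auto
  have "\<bar>f \<omega> x\<bar> \<le> max C 1" if "\<omega> \<in> \<Omega>" for \<omega> x
    using C[OF that, of x] by (rule order.trans) auto
  then show ?thesis by (intro that[of "max C 1"]) auto
qed

lemma bdd_smooth_0I:
  assumes "\<And>\<omega> x. \<omega> \<in> \<Omega> \<Longrightarrow> \<bar>f \<omega> x\<bar> \<le> C" "\<And>\<omega> x y. \<omega> \<in> \<Omega> \<Longrightarrow> \<bar>f \<omega> x - f \<omega> y\<bar> \<le> L * \<bar>x - y\<bar>"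
  shows "bdd_smooth 0 \<Omega> f"
proof -
  have "\<bar>f \<omega> x\<bar> \<le> max C L \<and> \<bar>f \<omega> x - f \<omega> y\<bar> \<le> max C L * \<bar>x - y\<bar>" if "\<omega> \<in> \<Omega>" for \<omega> x y
    using assms(1)[OF that, of x] assms(2)[OF that, of x y]
    by (auto intro: order.trans[OF _ mult_right_mono[of L "max C L" "\<bar>x - y\<bar>"]])
  then show ?thesis by auto
qed

lemma bdd_smooth_Suc_imp: "bdd_smooth (Suc n) \<Omega> f \<Longrightarrow> bdd_smooth n \<Omega> f"
proof (induction n arbitrary: f)
  case 0
  then obtain C f' where f': "\<And>\<omega> x. \<omega> \<in> \<Omega> \<Longrightarrow> \<bar>f \<omega> x\<bar> \<le> C"
    "\<And>\<omega> x. \<omega> \<in> \<Omega> \<Longrightarrow> (f \<omega> has_real_derivative f' \<omega> x) (at x)" "bdd_smooth 0 \<Omega> f'"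
    by (rule bdd_smooth_SucE) blast
  from f'(3) obtain C' where "\<And>\<omega> x. \<omega> \<in> \<Omega> \<Longrightarrow> \<bar>f' \<omega> x\<bar> \<le> C'"
    by (rule bdd_smooth_bounded) blast
  then show ?case
    using f' by (intro bdd_smooth_0I[of _ _ C C']) (auto intro!: DERIV_bounded_imp_lipschitz)
next
  case (Suc n)
  from Suc.prems obtain C f' where f': "\<And>\<omega> x. \<omega> \<in> \<Omega> \<Longrightarrow> \<bar>f \<omega> x\<bar> \<le> C"
    "\<And>\<omega> x. \<omega> \<in> \<Omega> \<Longrightarrow> (f \<omega> has_real_derivative f' \<omega> x) (at x)" "bdd_smooth (Suc n) \<Omega> f'"
    by (rule bdd_smooth_SucE) blast
  show ?case by (rule bdd_smooth_SucI[OF f'(1,2) Suc.IH[OF f'(3)]])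
qed

lemma bdd_smooth_le:
  assumes "bdd_smooth n \<Omega> f" "m \<le> n"
  shows "bdd_smooth m \<Omega> f"
  using assms(2,1)
  by (induction rule: inc_induct) (auto intro: bdd_smooth_Suc_imp simp del: bdd_smooth.simps)

lemma bdd_smooth_lipschitz:
  assumes "bdd_smooth n \<Omega> f"
  obtains L where "L > 0" "\<And>\<omega> x y. \<omega> \<in> \<Omega> \<Longrightarrow> \<bar>f \<omega> x - f \<omega> y\<bar> \<le> L * \<bar>x - y\<bar>"
proof -
  have "bdd_smooth 0 \<Omega> f" using assms by (rule bdd_smooth_le) simp
  then obtain C where C: "\<And>\<omega> x y. \<omega> \<in> \<Omega> \<Longrightarrow> \<bar>f \<omega> x - f \<omega> y\<bar> \<le> C * \<bar>x - y\<bar>" by auto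
  show ?thesis
    by (rule that[of "max C 1"]) (auto intro!: order.trans[OF C mult_right_mono])
qed

lemma bdd_smooth_0E:
  assumes "bdd_smooth 0 \<Omega> f"
  obtains C where "C \<ge> 0" "\<And>\<omega> x. \<omega> \<in> \<Omega> \<Longrightarrow> \<bar>f \<omega> x\<bar> \<le> C"
    "\<And>\<omega> x y. \<omega> \<in> \<Omega> \<Longrightarrow> \<bar>f \<omega> x - f \<omega> y\<bar> \<le> C * \<bar>x - y\<bar>"
proof -
  obtain C where C: "C > 0" "\<And>\<omega> x. \<omega> \<in> \<Omega> \<Longrightarrow> \<bar>f \<omega> x\<bar> \<le> C"
    using bdd_smooth_bounded[OF assms] by blast
  obtain L where L: "\<And>\<omega> x y. \<omega> \<in> \<Omega> \<Longrightarrow> \<bar>f \<omega> x - f \<omega> y\<bar> \<le> L * \<bar>x - y\<bar>"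
    by (rule bdd_smooth_lipschitz[OF assms]) blast
  have "\<bar>f \<omega> x - f \<omega> y\<bar> \<le> max C L * \<bar>x - y\<bar>" if "\<omega> \<in> \<Omega>" for \<omega> x y
    using L[OF that] by (rule order.trans) (auto intro!: mult_right_mono)
  moreover have "\<bar>f \<omega> x\<bar> \<le> max C L" if "\<omega> \<in> \<Omega>" for \<omega> x
    using C(2)[OF that] by (rule order.trans) simp
  ultimately show ?thesis using C(1) by (intro that[of "max C L"]) auto
qed

text \<open>The bounds are uniform in the index, so indices can be substituted by any map. In this
  way a family indexed by measures becomes one indexed by initial measures and times, through the
  push-forward.\<close>

lemma bdd_smooth_reindex:
  assumes "bdd_smooth n \<Omega> f" "\<And>\<omega>. \<omega> \<in> \<Omega>' \<Longrightarrow> h \<omega> \<in> \<Omega>" "\<And>\<omega> x. \<omega> \<in> \<Omega>' \<Longrightarrow> g \<omega> x = f (h \<omega>) x"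
  shows "bdd_smooth n \<Omega>' g"
  using assms(1,3)
proof (induction n arbitrary: f g)
  case 0
  then show ?case using assms(2) by simp metis
next
  case (Suc n)
  from Suc.prems(1) obtain C f' where f': "\<And>\<omega> x. \<omega> \<in> \<Omega> \<Longrightarrow> \<bar>f \<omega> x\<bar> \<le> C"
    "\<And>\<omega> x. \<omega> \<in> \<Omega> \<Longrightarrow> (f \<omega> has_real_derivative f' \<omega> x) (at x)" "bdd_smooth n \<Omega> f'"
    by (rule bdd_smooth_SucE) blast
  show ?case
  proof (rule bdd_smooth_SucI[of _ _ C "\<lambda>\<omega>. f' (h \<omega>)"])
    fix \<omega> x assume w: "\<omega> \<in> \<Omega>'"
    then have "g \<omega> = f (h \<omega>)" using Suc.prems(2) by blast
    then show "\<bar>g \<omega> x\<bar> \<le> C" "(g \<omega> has_real_derivative f' (h \<omega>) x) (at x)"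
      using f'(1,2) assms(2)[OF w] by auto
  qed (rule Suc.IH[OF f'(3)], simp)
qed

section \<open>Algebra, composition and averaging of smooth families\<close>

lemma bdd_smooth_const:
  assumes "\<And>\<omega>. \<omega> \<in> \<Omega> \<Longrightarrow> \<bar>c \<omega>\<bar> \<le> C"
  shows "bdd_smooth n \<Omega> (\<lambda>\<omega> x. c \<omega>)"
  using assms
proof (induction n arbitrary: c C)
  case 0
  then show ?case by (intro bdd_smooth_0I[of _ _ C 0]) auto
next
  case (Suc n)
  show ?case
    by (rule bdd_smooth_SucI[of _ _ C "\<lambda>_ _. 0"]) (use Suc.prems in \<open>auto intro!: Suc.IH[of "\<lambda>_. 0" 0]\<close>)
qed

lemma bdd_smooth_add:
  assumes "bdd_smooth n \<Omega> f" "bdd_smooth n \<Omega> g"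
  shows "bdd_smooth n \<Omega> (\<lambda>\<omega> x. f \<omega> x + g \<omega> x)"
  using assms
proof (induction n arbitrary: f g)
  case 0
  obtain C where C: "\<And>\<omega> x. \<omega> \<in> \<Omega> \<Longrightarrow> \<bar>f \<omega> x\<bar> \<le> C"
    "\<And>\<omega> x y. \<omega> \<in> \<Omega> \<Longrightarrow> \<bar>f \<omega> x - f \<omega> y\<bar> \<le> C * \<bar>x - y\<bar>"
    by (rule bdd_smooth_0E[OF 0(1)]) blast
  obtain D where D: "\<And>\<omega> x. \<omega> \<in> \<Omega> \<Longrightarrow> \<bar>g \<omega> x\<bar> \<le> D"
    "\<And>\<omega> x y. \<omega> \<in> \<Omega> \<Longrightarrow> \<bar>g \<omega> x - g \<omega> y\<bar> \<le> D * \<bar>x - y\<bar>"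
    by (rule bdd_smooth_0E[OF 0(2)]) blast
  show ?case
  proof (rule bdd_smooth_0I[of _ _ "C + D" "C + D"])
    fix \<omega> x y assume w: "\<omega> \<in> \<Omega>"
    show "\<bar>f \<omega> x + g \<omega> x\<bar> \<le> C + D" using C(1)[OF w, of x] D(1)[OF w, of x] by linarith
    show "\<bar>f \<omega> x + g \<omega> x - (f \<omega> y + g \<omega> y)\<bar> \<le> (C + D) * \<bar>x - y\<bar>"
      using C(2)[OF w, of x y] D(2)[OF w, of x y] unfolding distrib_right by linarith
  qed
next
  case (Suc n)
  from Suc.prems(1) obtain C f' where f': "\<And>\<omega> x. \<omega> \<in> \<Omega> \<Longrightarrow> \<bar>f \<omega> x\<bar> \<le> C"
    "\<And>\<omega> x. \<omega> \<in> \<Omega> \<Longrightarrow> (f \<omega> has_real_derivative f' \<omega> x) (at x)" "bdd_smooth n \<Omega> f'"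
    by (rule bdd_smooth_SucE) blast
  from Suc.prems(2) obtain D g' where g': "\<And>\<omega> x. \<omega> \<in> \<Omega> \<Longrightarrow> \<bar>g \<omega> x\<bar> \<le> D"
    "\<And>\<omega> x. \<omega> \<in> \<Omega> \<Longrightarrow> (g \<omega> has_real_derivative g' \<omega> x) (at x)" "bdd_smooth n \<Omega> g'"
    by (rule bdd_smooth_SucE) blast
  show ?case
  proof (rule bdd_smooth_SucI[OF _ _ Suc.IH[OF f'(3) g'(3)]])
    fix \<omega> x assume w: "\<omega> \<in> \<Omega>"
    show "\<bar>f \<omega> x + g \<omega> x\<bar> \<le> C + D" using f'(1)[OF w, of x] g'(1)[OF w, of x] by linarith
  qed (use f'(2) g'(2) in \<open>auto intro!: derivative_eq_intros\<close>)
qed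

lemma abs_mult_diff_le:
  fixes a b c d :: real
  assumes "\<bar>a\<bar> \<le> A" "\<bar>d\<bar> \<le> D" "\<bar>b - d\<bar> \<le> p" "\<bar>a - c\<bar> \<le> q"
  shows "\<bar>a * b - c * d\<bar> \<le> A * p + q * D"
proof -
  have "a * b - c * d = a * (b - d) + (a - c) * d" by (simp add: algebra_simps)
  then have "\<bar>a * b - c * d\<bar> \<le> \<bar>a\<bar> * \<bar>b - d\<bar> + \<bar>a - c\<bar> * \<bar>d\<bar>"
    by (metis abs_mult abs_triangle_ineq)
  also have "\<dots> \<le> A * p + q * D"
    using assms by (intro add_mono mult_mono) auto
  finally show ?thesis .
qed

lemma bdd_smooth_mult:
  assumes "bdd_smooth n \<Omega> f" "bdd_smooth n \<Omega> g"
  shows "bdd_smooth n \<Omega> (\<lambda>\<omega> x. f \<omega> x * g \<omega> x)"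
  using assms
proof (induction n arbitrary: f g)
  case 0
  obtain C where C: "C \<ge> 0" "\<And>\<omega> x. \<omega> \<in> \<Omega> \<Longrightarrow> \<bar>f \<omega> x\<bar> \<le> C"
    "\<And>\<omega> x y. \<omega> \<in> \<Omega> \<Longrightarrow> \<bar>f \<omega> x - f \<omega> y\<bar> \<le> C * \<bar>x - y\<bar>"
    by (rule bdd_smooth_0E[OF 0(1)]) blast
  obtain D where D: "D \<ge> 0" "\<And>\<omega> x. \<omega> \<in> \<Omega> \<Longrightarrow> \<bar>g \<omega> x\<bar> \<le> D"
    "\<And>\<omega> x y. \<omega> \<in> \<Omega> \<Longrightarrow> \<bar>g \<omega> x - g \<omega> y\<bar> \<le> D * \<bar>x - y\<bar>"
    by (rule bdd_smooth_0E[OF 0(2)]) blast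
  show ?case
  proof (rule bdd_smooth_0I[of _ _ "C * D" "2 * C * D"])
    fix \<omega> x y assume w: "\<omega> \<in> \<Omega>"
    show "\<bar>f \<omega> x * g \<omega> x\<bar> \<le> C * D"
      unfolding abs_mult using C(2)[OF w, of x] D(2)[OF w, of x] C(1) D(1) by (intro mult_mono) auto
    show "\<bar>f \<omega> x * g \<omega> x - f \<omega> y * g \<omega> y\<bar> \<le> 2 * C * D * \<bar>x - y\<bar>"
    proof -
      have "\<bar>f \<omega> x * g \<omega> x - f \<omega> y * g \<omega> y\<bar> \<le> C * (D * \<bar>x - y\<bar>) + (C * \<bar>x - y\<bar>) * D"
        by (rule abs_mult_diff_le[OF C(2)[OF w] D(2)[OF w] D(3)[OF w] C(3)[OF w]])
      then show ?thesis by (simp add: algebra_simps)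
    qed
  qed
next
  case (Suc n)
  from Suc.prems(1) obtain C f' where f': "\<And>\<omega> x. \<omega> \<in> \<Omega> \<Longrightarrow> \<bar>f \<omega> x\<bar> \<le> C"
    "\<And>\<omega> x. \<omega> \<in> \<Omega> \<Longrightarrow> (f \<omega> has_real_derivative f' \<omega> x) (at x)" "bdd_smooth n \<Omega> f'"
    by (rule bdd_smooth_SucE) blast
  from Suc.prems(2) obtain D g' where g': "\<And>\<omega> x. \<omega> \<in> \<Omega> \<Longrightarrow> \<bar>g \<omega> x\<bar> \<le> D"
    "\<And>\<omega> x. \<omega> \<in> \<Omega> \<Longrightarrow> (g \<omega> has_real_derivative g' \<omega> x) (at x)" "bdd_smooth n \<Omega> g'"
    by (rule bdd_smooth_SucE) blast
  have s: "bdd_smooth n \<Omega> (\<lambda>\<omega> x. f' \<omega> x * g \<omega> x + g' \<omega> x * f \<omega> x)"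
    by (intro bdd_smooth_add Suc.IH f'(3) g'(3) Suc.prems[THEN bdd_smooth_Suc_imp])
  show ?case
  proof (rule bdd_smooth_SucI[OF _ _ s])
    fix \<omega> x assume w: "\<omega> \<in> \<Omega>"
    show "\<bar>f \<omega> x * g \<omega> x\<bar> \<le> C * D"
      unfolding abs_mult using f'(1)[OF w] g'(1)[OF w] by (intro mult_mono) (auto intro: order.trans[OF abs_ge_zero])
  qed (use f'(2) g'(2) in \<open>auto intro!: derivative_eq_intros\<close>)
qed

lemma bdd_smooth_uminus: "bdd_smooth n \<Omega> f \<Longrightarrow> bdd_smooth n \<Omega> (\<lambda>\<omega> x. - f \<omega> x)"
  using bdd_smooth_mult[OF bdd_smooth_const[of \<Omega> "\<lambda>_. -1" 1]] by fastforce

text \<open>For an inner function of which only a Lipschitz bound is known; this starts the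
  bootstrapping for the flow.\<close>

lemma bdd_smooth_comp_0:
  assumes "bdd_smooth 0 \<Omega> f" "\<And>\<omega> x y. \<omega> \<in> \<Omega> \<Longrightarrow> \<bar>g \<omega> x - g \<omega> y\<bar> \<le> L * \<bar>x - y :: real\<bar>"
  shows "bdd_smooth 0 \<Omega> (\<lambda>\<omega> x. f \<omega> (g \<omega> x))"
proof -
  obtain C where C: "C \<ge> 0" "\<And>\<omega> x. \<omega> \<in> \<Omega> \<Longrightarrow> \<bar>f \<omega> x\<bar> \<le> C"
    "\<And>\<omega> x y. \<omega> \<in> \<Omega> \<Longrightarrow> \<bar>f \<omega> x - f \<omega> y\<bar> \<le> C * \<bar>x - y\<bar>"
    using bdd_smooth_0E[OF assms(1)] by blast
  show ?thesis
  proof (rule bdd_smooth_0I[of _ _ C "C * L"])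
    fix \<omega> x y assume w: "\<omega> \<in> \<Omega>"
    have "\<bar>f \<omega> (g \<omega> x) - f \<omega> (g \<omega> y)\<bar> \<le> C * \<bar>g \<omega> x - g \<omega> y\<bar>" using C(3)[OF w] by blast
    also have "\<dots> \<le> C * (L * \<bar>x - y\<bar>)" using assms(2)[OF w] \<open>C \<ge> 0\<close> by (intro mult_left_mono)
    finally show "\<bar>f \<omega> (g \<omega> x) - f \<omega> (g \<omega> y)\<bar> \<le> C * L * \<bar>x - y\<bar>" by simp
  qed (use C in blast)
qed

text \<open>The inner function is typically unbounded, like the flow itself, so the assumption is on
  its derivative.\<close>

lemma bdd_smooth_comp:
  assumes "bdd_smooth n \<Omega> f" "bdd_smooth n \<Omega> g'"
    and "\<And>\<omega> x. \<omega> \<in> \<Omega> \<Longrightarrow> (g \<omega> has_real_derivative g' \<omega> x) (at x)"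
  shows "bdd_smooth n \<Omega> (\<lambda>\<omega> x. f \<omega> (g \<omega> x))"
  using assms(1,2)
proof (induction n arbitrary: f)
  case 0
  from 0(2) obtain L where L: "\<And>\<omega> x. \<omega> \<in> \<Omega> \<Longrightarrow> \<bar>g' \<omega> x\<bar> \<le> L"
    by (rule bdd_smooth_bounded) blast
  show ?case
    by (rule bdd_smooth_comp_0[OF 0(1)]) (rule DERIV_bounded_imp_lipschitz[OF assms(3) L])
next
  case (Suc n)
  from Suc.prems(1) obtain C f' where f': "\<And>\<omega> x. \<omega> \<in> \<Omega> \<Longrightarrow> \<bar>f \<omega> x\<bar> \<le> C"
    "\<And>\<omega> x. \<omega> \<in> \<Omega> \<Longrightarrow> (f \<omega> has_real_derivative f' \<omega> x) (at x)" "bdd_smooth n \<Omega> f'"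
    by (rule bdd_smooth_SucE) blast
  have "bdd_smooth n \<Omega> g'" by (rule bdd_smooth_Suc_imp[OF Suc.prems(2)])
  then have "bdd_smooth n \<Omega> (\<lambda>\<omega> x. f' \<omega> (g \<omega> x) * g' \<omega> x)"
    by (intro bdd_smooth_mult Suc.IH f'(3))
  then show ?case
    by (rule bdd_smooth_SucI[of _ _ C, rotated -1]) (auto intro!: f'(1) DERIV_chain2[OF f'(2) assms(3)])
qed

text \<open>Compared with \<open>bdd_smooth_comp\<close> the result has one order more than
  \<open>g'\<close>: in the derivative \<open>f' (g x) * g' x\<close> both factors have order
  \<open>n\<close>. This gain of one order drives the bootstrapping for the flow.\<close>

lemma bdd_smooth_comp_Suc:
  assumes "bdd_smooth (Suc n) \<Omega> f" "bdd_smooth n \<Omega> g'"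
    and "\<And>\<omega> x. \<omega> \<in> \<Omega> \<Longrightarrow> (g \<omega> has_real_derivative g' \<omega> x) (at x)"
  shows "bdd_smooth (Suc n) \<Omega> (\<lambda>\<omega> x. f \<omega> (g \<omega> x))"
proof -
  from assms(1) obtain C f' where f': "\<And>\<omega> x. \<omega> \<in> \<Omega> \<Longrightarrow> \<bar>f \<omega> x\<bar> \<le> C"
    "\<And>\<omega> x. \<omega> \<in> \<Omega> \<Longrightarrow> (f \<omega> has_real_derivative f' \<omega> x) (at x)" "bdd_smooth n \<Omega> f'"
    by (rule bdd_smooth_SucE) blast
  have "bdd_smooth n \<Omega> (\<lambda>\<omega> x. f' \<omega> (g \<omega> x) * g' \<omega> x)"
    by (intro bdd_smooth_mult bdd_smooth_comp[OF f'(3) assms(2,3)] assms(2))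
  then show ?thesis
    by (rule bdd_smooth_SucI[of _ _ C, rotated -1]) (auto intro!: f'(1) DERIV_chain2[OF f'(2) assms(3)])
qed

lemma bdd_smooth_exp:
  assumes "bdd_smooth n \<Omega> f"
  shows "bdd_smooth n \<Omega> (\<lambda>\<omega> x. exp (f \<omega> x))"
  using assms
proof (induction n)
  case 0
  then obtain C where C: "C \<ge> 0" "\<And>\<omega> x. \<omega> \<in> \<Omega> \<Longrightarrow> \<bar>f \<omega> x\<bar> \<le> C"
    "\<And>\<omega> x y. \<omega> \<in> \<Omega> \<Longrightarrow> \<bar>f \<omega> x - f \<omega> y\<bar> \<le> C * \<bar>x - y\<bar>"
    using bdd_smooth_0E by blast
  show ?case
  proof (rule bdd_smooth_0I[of _ _ "exp C" "exp C * C"])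
    fix \<omega> x y assume w: "\<omega> \<in> \<Omega>"
    show "\<bar>exp (f \<omega> x)\<bar> \<le> exp C" using C(2)[OF w, of x] by auto
    have D: "(exp has_real_derivative exp z) (at z within A)" for z :: real and A
      by (rule DERIV_exp[THEN has_field_derivative_at_within])
    have "\<bar>exp u - exp v\<bar> \<le> exp C * \<bar>u - v\<bar>" if "\<bar>u\<bar> \<le> C" "\<bar>v\<bar> \<le> C" for u v
      using field_differentiable_bound[of "{-C..C}" exp exp "exp C" u v] that D
      by (auto simp: abs_le_iff)
    then have "\<bar>exp (f \<omega> x) - exp (f \<omega> y)\<bar> \<le> exp C * \<bar>f \<omega> x - f \<omega> y\<bar>" using C(2)[OF w] by blast
    also have "\<dots> \<le> exp C * (C * \<bar>x - y\<bar>)" using C(3)[OF w] by (intro mult_left_mono) auto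
    finally show "\<bar>exp (f \<omega> x) - exp (f \<omega> y)\<bar> \<le> exp C * C * \<bar>x - y\<bar>" by simp
  qed
next
  case (Suc n)
  from Suc.prems obtain C f' where f': "\<And>\<omega> x. \<omega> \<in> \<Omega> \<Longrightarrow> \<bar>f \<omega> x\<bar> \<le> C"
    "\<And>\<omega> x. \<omega> \<in> \<Omega> \<Longrightarrow> (f \<omega> has_real_derivative f' \<omega> x) (at x)" "bdd_smooth n \<Omega> f'"
    by (rule bdd_smooth_SucE) blast
  have s: "bdd_smooth n \<Omega> (\<lambda>\<omega> x. exp (f \<omega> x) * f' \<omega> x)"
    by (intro bdd_smooth_mult f'(3) Suc.IH bdd_smooth_Suc_imp[OF Suc.prems])
  show ?case
  proof (rule bdd_smooth_SucI[OF _ _ s])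
    fix \<omega> x assume w: "\<omega> \<in> \<Omega>"
    show "\<bar>exp (f \<omega> x)\<bar> \<le> exp C" using f'(1)[OF w, of x] by auto
  qed (auto intro!: DERIV_chain2[OF DERIV_exp] f'(2))
qed

text \<open>The mean value inequality for \<open>f z - z * f' x\<close> on the interval between
  \<open>x\<close> and \<open>y\<close>, where the derivative is at most
  \<open>L * \<bar>y - x\<bar>\<close>.\<close>

lemma DERIV_remainder_bound:
  assumes D: "\<And>x. (f has_real_derivative f' x) (at x)" and L: "\<And>x y. \<bar>f' x - f' y\<bar> \<le> L * \<bar>x - y\<bar>"
  shows "\<bar>f y - f x - (y - x) * f' x\<bar> \<le> L * (y - x)\<^sup>2"
proof -
  have "\<bar>(f y - y * f' x) - (f x - x * f' x)\<bar> \<le> (L * \<bar>y - x\<bar>) * \<bar>y - x\<bar>"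
  proof (rule field_differentiable_bound[of "{min x y..max x y}" "\<lambda>z. f z - z * f' x" "\<lambda>z. f' z - f' x" "L * \<bar>y - x\<bar>" y x, unfolded real_norm_def])
    fix z assume "z \<in> {min x y..max x y}"
    then have "\<bar>z - x\<bar> \<le> \<bar>y - x\<bar>" by (auto simp: min_def max_def split: if_splits)
    moreover have "L \<ge> 0" using order.trans[OF abs_ge_zero L[of 0 1]] by simp
    ultimately show "\<bar>f' z - f' x\<bar> \<le> L * \<bar>y - x\<bar>"
      using order.trans[OF L mult_left_mono] by blast
  qed (auto intro!: derivative_eq_intros has_field_derivative_at_within[OF D])
  then show ?thesis by (simp add: algebra_simps power2_eq_square)
qed

text \<open>Quadratic remainder bounds survive integration and the solution of linear equations, so
  derivatives can be taken through both by this criterion.\<close>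

lemma DERIV_from_remainder_bound:
  fixes f :: "real \<Rightarrow> real"
  assumes "\<And>y. \<bar>f y - f x - (y - x) * D\<bar> \<le> L * (y - x)\<^sup>2"
  shows "(f has_real_derivative D) (at x)"
  unfolding has_field_derivative_iff
proof (rule LIM_zero_cancel)
  have "((\<lambda>y. L * \<bar>y - x\<bar>) \<longlongrightarrow> L * \<bar>x - x\<bar>) (at x)" by (intro tendsto_intros)
  then have "((\<lambda>y. L * \<bar>y - x\<bar>) \<longlongrightarrow> 0) (at x)" by simp
  then show "((\<lambda>y. (f y - f x) / (y - x) - D) \<longlongrightarrow> 0) (at x)"
  proof (rule Lim_null_comparison[rotated])
    have "\<bar>(f y - f x) / (y - x) - D\<bar> \<le> L * \<bar>y - x\<bar>" if "y \<noteq> x" for y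
    proof -
      have "(f y - f x) / (y - x) - D = (f y - f x - (y - x) * D) / (y - x)"
        using that by (simp add: field_simps)
      then have "\<bar>(f y - f x) / (y - x) - D\<bar> = \<bar>f y - f x - (y - x) * D\<bar> / \<bar>y - x\<bar>" by simp
      also have "\<dots> \<le> L * (y - x)\<^sup>2 / \<bar>y - x\<bar>" by (intro divide_right_mono assms) auto
      also have "L * (y - x)\<^sup>2 = L * \<bar>y - x\<bar> * \<bar>y - x\<bar>" by (simp add: power2_eq_square abs_mult_self_eq mult.assoc)
      also have "\<dots> / \<bar>y - x\<bar> = L * \<bar>y - x\<bar>" using that by simp
      finally show ?thesis .
    qed
    then show "\<forall>\<^sub>F y in at x. norm ((f y - f x) / (y - x) - D) \<le> L * \<bar>y - x\<bar>"
      by (auto simp: eventually_at_filter)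
  qed
qed

text \<open>The derivative is a pointwise limit of difference quotients along a sequence of
  increments.\<close>

lemma borel_measurable_deriv_param:
  fixes g :: "'a \<Rightarrow> real \<Rightarrow> real"
  assumes "\<And>x. (\<lambda>z. g z x) \<in> borel_measurable M"
    and "\<And>z. z \<in> space M \<Longrightarrow> (g z has_real_derivative g' z) (at x)"
  shows "g' \<in> borel_measurable M"
proof (rule borel_measurable_LIMSEQ_real)
  define h where "h = (\<lambda>n. 1 / real (Suc n))"
  show "(\<lambda>z. (g z (x + h n) - g z x) / h n) \<in> borel_measurable M" for n
    using assms(1) by measurable
  fix z assume "z \<in> space M"
  then have "((\<lambda>h. (g z (x + h) - g z x) / h) \<longlongrightarrow> g' z) (at 0)"
    using assms(2) by (simp add: DERIV_def)
  moreover have "filterlim h (at 0) sequentially"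
    unfolding h_def by real_asymp
  ultimately show "(\<lambda>n. (g z (x + h n) - g z x) / h n) \<longlonglongrightarrow> g' z"
    by (rule filterlim_compose)
qed

text \<open>Each index is paired with the integration variable, so that the bounds on
  \<open>g\<close> are uniform in both. Differentiation under the integral goes through quadratic
  remainders, which integrate to quadratic remainders; the measures may vary with the index as long
  as their masses are bounded.\<close>

lemma bdd_smooth_average:
  assumes "bdd_smooth n \<Omega>' g"
    and "\<And>\<omega>. \<omega> \<in> \<Omega> \<Longrightarrow> finite_measure (M \<omega>)"
    and "\<And>\<omega>. \<omega> \<in> \<Omega> \<Longrightarrow> measure (M \<omega>) (space (M \<omega>)) \<le> c"
    and "\<And>\<omega> z. \<omega> \<in> \<Omega> \<Longrightarrow> z \<in> space (M \<omega>) \<Longrightarrow> (\<omega>, z) \<in> \<Omega>'"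
    and "\<And>\<omega> x. \<omega> \<in> \<Omega> \<Longrightarrow> (\<lambda>z. g (\<omega>, z) x) \<in> borel_measurable (M \<omega>)"
  shows "bdd_smooth n \<Omega> (\<lambda>\<omega> x. \<integral>z. g (\<omega>, z) x \<partial>M \<omega>)"
  using assms(1,5)
proof (induction n arbitrary: g)
  have le: "\<bar>\<integral>z. h z \<partial>M \<omega>\<bar> \<le> c * B" if "\<omega> \<in> \<Omega>" "h \<in> borel_measurable (M \<omega>)" "\<And>z. z \<in> space (M \<omega>) \<Longrightarrow> \<bar>h z\<bar> \<le> B" "B \<ge> 0" for \<omega> h B
  proof -
    interpret finite_measure "M \<omega>" by (rule assms(2)[OF that(1)])
    have "\<bar>\<integral>z. h z \<partial>M \<omega>\<bar> \<le> (\<integral>z. \<bar>h z\<bar> \<partial>M \<omega>)" by (rule integral_abs_bound)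
    also have "\<dots> \<le> (\<integral>z. B \<partial>M \<omega>)"
      by (intro integral_mono integrable_const_bound[of _ B] AE_I2) (use that in auto)
    also have "\<dots> \<le> c * B" using assms(3)[OF that(1)] that(4) by (simp add: mult_right_mono)
    finally show ?thesis .
  qed
  have int: "integrable (M \<omega>) h" if "\<omega> \<in> \<Omega>" "h \<in> borel_measurable (M \<omega>)" "\<And>z. z \<in> space (M \<omega>) \<Longrightarrow> \<bar>h z\<bar> \<le> B" for \<omega> h and B :: real
    using finite_measure.integrable_const_bound[OF assms(2)[OF that(1)], of h B] that by auto
  {
    case 0
    obtain B where B: "B > 0" "\<And>\<omega> x. \<omega> \<in> \<Omega>' \<Longrightarrow> \<bar>g \<omega> x\<bar> \<le> B"
      using bdd_smooth_bounded[OF 0(1)] by blast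
    obtain L where L: "L > 0" "\<And>\<omega> x y. \<omega> \<in> \<Omega>' \<Longrightarrow> \<bar>g \<omega> x - g \<omega> y\<bar> \<le> L * \<bar>x - y\<bar>"
      using bdd_smooth_lipschitz[OF 0(1)] by blast
    show ?case
    proof (rule bdd_smooth_0I[of _ _ "c * B" "c * L"])
      fix \<omega> x y assume w: "\<omega> \<in> \<Omega>"
      show "\<bar>\<integral>z. g (\<omega>, z) x \<partial>M \<omega>\<bar> \<le> c * B"
        by (rule le[OF w 0(2)[OF w]]) (use B assms(4)[OF w] in auto)
      have "(\<integral>z. g (\<omega>, z) x \<partial>M \<omega>) - (\<integral>z. g (\<omega>, z) y \<partial>M \<omega>) = (\<integral>z. g (\<omega>, z) x - g (\<omega>, z) y \<partial>M \<omega>)"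
        by (intro Bochner_Integration.integral_diff[symmetric] int[OF w 0(2)[OF w], where B=B]) (use B assms(4)[OF w] in auto)
      then show "\<bar>(\<integral>z. g (\<omega>, z) x \<partial>M \<omega>) - (\<integral>z. g (\<omega>, z) y \<partial>M \<omega>)\<bar> \<le> c * L * \<bar>x - y\<bar>"
        using le[OF w, of "\<lambda>z. g (\<omega>, z) x - g (\<omega>, z) y" "L * \<bar>x - y\<bar>"] 0(2)[OF w] L assms(4)[OF w] by (simp add: mult.assoc)
    qed
  next
    case (Suc n)
    from Suc.prems(1) obtain B g' where g': "\<And>\<omega> x. \<omega> \<in> \<Omega>' \<Longrightarrow> \<bar>g \<omega> x\<bar> \<le> B"
      "\<And>\<omega> x. \<omega> \<in> \<Omega>' \<Longrightarrow> (g \<omega> has_real_derivative g' \<omega> x) (at x)" "bdd_smooth n \<Omega>' g'"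
      by (rule bdd_smooth_SucE) blast
    obtain B' where B': "B' > 0" "\<And>\<omega> x. \<omega> \<in> \<Omega>' \<Longrightarrow> \<bar>g' \<omega> x\<bar> \<le> B'"
      using bdd_smooth_bounded[OF g'(3)] by blast
    obtain L where L: "L > 0" "\<And>\<omega> x y. \<omega> \<in> \<Omega>' \<Longrightarrow> \<bar>g' \<omega> x - g' \<omega> y\<bar> \<le> L * \<bar>x - y\<bar>"
      using bdd_smooth_lipschitz[OF g'(3)] by blast
    have m': "(\<lambda>z. g' (\<omega>, z) x) \<in> borel_measurable (M \<omega>)" if w: "\<omega> \<in> \<Omega>" for \<omega> x
      by (rule borel_measurable_deriv_param[of "\<lambda>z. g (\<omega>, z)", OF Suc.prems(2)[OF w]]) (rule g'(2)[OF assms(4)[OF w]])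
    show ?case
    proof (rule bdd_smooth_SucI[OF _ _ Suc.IH[OF g'(3) m']])
      fix \<omega> x assume w: "\<omega> \<in> \<Omega>"
      show "\<bar>\<integral>z. g (\<omega>, z) x \<partial>M \<omega>\<bar> \<le> c * \<bar>B\<bar>"
        by (rule le[OF w Suc.prems(2)[OF w]]) (use order.trans[OF g'(1)[OF assms(4)[OF w]] abs_ge_self] in auto)
      show "((\<lambda>x. \<integral>z. g (\<omega>, z) x \<partial>M \<omega>) has_real_derivative (\<integral>z. g' (\<omega>, z) x \<partial>M \<omega>)) (at x)"
      proof (rule DERIV_from_remainder_bound[of _ _ _ "c * L"])
        fix y
        have i: "integrable (M \<omega>) (\<lambda>z. g (\<omega>, z) x)" "integrable (M \<omega>) (\<lambda>z. g (\<omega>, z) y)" "integrable (M \<omega>) (\<lambda>z. g' (\<omega>, z) x)"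
          using int[OF w Suc.prems(2)[OF w], where B=B] int[OF w m'[OF w], where B=B'] g'(1) B'(2) assms(4)[OF w] by auto
        have "(\<integral>z. g (\<omega>, z) y \<partial>M \<omega>) - (\<integral>z. g (\<omega>, z) x \<partial>M \<omega>) - (y - x) * (\<integral>z. g' (\<omega>, z) x \<partial>M \<omega>)
          = (\<integral>z. g (\<omega>, z) y - g (\<omega>, z) x - (y - x) * g' (\<omega>, z) x \<partial>M \<omega>)"
          using i by simp
        moreover have "\<bar>\<dots>\<bar> \<le> c * (L * (y - x)\<^sup>2)"
          by (rule le[OF w]) (use i L assms(4)[OF w] in \<open>auto intro!: DERIV_remainder_bound g'(2)\<close>)
        ultimately show "\<bar>(\<integral>z. g (\<omega>, z) y \<partial>M \<omega>) - (\<integral>z. g (\<omega>, z) x \<partial>M \<omega>) - (y - x) * (\<integral>z. g' (\<omega>, z) x \<partial>M \<omega>)\<bar> \<le> c * L * (y - x)\<^sup>2"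
          by (simp add: mult.assoc)
      qed
    qed
  }
qed

text \<open>At the top order there is no classical derivative left: there
  \<open>lipschitz_has_primitive\<close> turns the Lipschitz bound into a bounded weak
  derivative.\<close>

lemma bdd_smooth_weak_deriv_ex:
  assumes "bdd_smooth n \<Omega> f"
  shows "\<exists>C. \<forall>\<omega>\<in>\<Omega>. \<forall>i\<le>Suc n. \<exists>g. has_weak_deriv i (f \<omega>) g \<and> (\<forall>x. \<bar>g x\<bar> \<le> C)"
  using assms
proof (induction n arbitrary: f)
  case 0
  obtain B where B: "B > 0" "\<And>\<omega> x. \<omega> \<in> \<Omega> \<Longrightarrow> \<bar>f \<omega> x\<bar> \<le> B" using bdd_smooth_bounded[OF 0] by blast
  obtain L where L: "L > 0" "\<And>\<omega> x y. \<omega> \<in> \<Omega> \<Longrightarrow> \<bar>f \<omega> x - f \<omega> y\<bar> \<le> L * \<bar>x - y\<bar>" using bdd_smooth_lipschitz[OF 0] by blast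
  show ?case
  proof (intro exI[of _ "max B L"] ballI allI impI)
    fix \<omega> i assume w: "\<omega> \<in> \<Omega>" and "i \<le> Suc 0"
    have c: "continuous_on UNIV (f \<omega>)" by (rule lipschitz_continuous_on[OF L(2)[OF w]])
    obtain g where g: "is_primitive (f \<omega>) g" "\<And>x. \<bar>g x\<bar> \<le> L"
      by (rule lipschitz_has_primitive[OF L(2)[OF w] L(1)]) blast
    then have "has_weak_deriv (Suc 0) (f \<omega>) g"
      by (subst has_weak_deriv_Suc_iff[OF g(1) c]) (auto simp: is_primitive_def intro: has_weak_deriv_0)
    moreover have "has_weak_deriv 0 (f \<omega>) (f \<omega>)" by (intro has_weak_deriv_0 locally_integrable_continuous c)
    moreover have "i = 0 \<or> i = Suc 0" using \<open>i \<le> Suc 0\<close> by linarith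
    ultimately show "\<exists>g. has_weak_deriv i (f \<omega>) g \<and> (\<forall>x. \<bar>g x\<bar> \<le> max B L)"
      using B(2)[OF w] g(2) by (metis max.coboundedI1 max.coboundedI2)
  qed
next
  case (Suc n)
  from Suc.prems obtain B f' where f': "\<And>\<omega> x. \<omega> \<in> \<Omega> \<Longrightarrow> \<bar>f \<omega> x\<bar> \<le> B"
    "\<And>\<omega> x. \<omega> \<in> \<Omega> \<Longrightarrow> (f \<omega> has_real_derivative f' \<omega> x) (at x)" "bdd_smooth n \<Omega> f'"
    by (rule bdd_smooth_SucE) blast
  from Suc.IH[OF f'(3)] obtain C where C: "\<And>\<omega> i. \<omega> \<in> \<Omega> \<Longrightarrow> i \<le> Suc n \<Longrightarrow> \<exists>g. has_weak_deriv i (f' \<omega>) g \<and> (\<forall>x. \<bar>g x\<bar> \<le> C)"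
    by blast
  obtain L where L: "L > 0" "\<And>\<omega> x y. \<omega> \<in> \<Omega> \<Longrightarrow> \<bar>f' \<omega> x - f' \<omega> y\<bar> \<le> L * \<bar>x - y\<bar>"
    using bdd_smooth_lipschitz[OF f'(3)] by blast
  show ?case
  proof (intro exI[of _ "max B C"] ballI allI impI)
    fix \<omega> i assume w: "\<omega> \<in> \<Omega>" and i: "i \<le> Suc (Suc n)"
    have c': "continuous_on UNIV (f' \<omega>)" by (rule lipschitz_continuous_on[OF L(2)[OF w]])
    have c: "continuous_on UNIV (f \<omega>)"
      using f'(2)[OF w] by (meson DERIV_isCont continuous_at_imp_continuous_on)
    show "\<exists>g. has_weak_deriv i (f \<omega>) g \<and> (\<forall>x. \<bar>g x\<bar> \<le> max B C)"
    proof (cases i)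
      case 0
      then show ?thesis using has_weak_deriv_0[OF locally_integrable_continuous[OF c]] f'(1)[OF w]
        by (metis max.coboundedI1)
    next
      case (Suc j)
      then obtain g where "has_weak_deriv j (f' \<omega>) g" "\<And>x. \<bar>g x\<bar> \<le> C" using C[OF w, of j] i by auto
      then show ?thesis
        using has_weak_deriv_Suc_iff[OF primitive_of_continuous[OF f'(2)[OF w] c'] c] Suc by (metis max.coboundedI2)
    qed
  qed
qed

lemma weak_deriv_norm_le:
  assumes "has_weak_deriv i f g" "\<And>x. \<bar>g x\<bar> \<le> C"
  shows "weak_deriv_norm i f \<le> ennreal C"
proof -
  have [measurable]: "g \<in> borel_measurable borel"
    using assms(1) by (auto simp: has_weak_deriv_def intro: locally_integrable_measurable)
  have "weak_deriv_norm i f \<le> esssup lborel (\<lambda>x. ennreal \<bar>g x\<bar>)"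
    unfolding weak_deriv_norm_def by (rule INF_lower) (use assms in auto)
  also have "\<dots> \<le> ennreal C"
    by (rule esssup_I) (auto intro!: ennreal_leI assms)
  finally show ?thesis .
qed

lemma bdd_smooth_weak_deriv_norm:
  assumes "bdd_smooth n \<Omega> f"
  obtains C where "\<And>\<omega> i. \<omega> \<in> \<Omega> \<Longrightarrow> i \<le> Suc n \<Longrightarrow> weak_deriv_norm i (f \<omega>) \<le> ennreal C"
  using bdd_smooth_weak_deriv_ex[OF assms] weak_deriv_norm_le by metis

text \<open>For functions such as the flow, which are unbounded but have a smooth bounded
  derivative; hence the orders start at 1.\<close>

lemma bdd_smooth_weak_deriv_norm_primitive:
  assumes "bdd_smooth n \<Omega> f'" "\<And>\<omega> x. \<omega> \<in> \<Omega> \<Longrightarrow> (f \<omega> has_real_derivative f' \<omega> x) (at x)"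
  obtains C where "\<And>\<omega> i. \<omega> \<in> \<Omega> \<Longrightarrow> i \<in> {1..n + 2} \<Longrightarrow> weak_deriv_norm i (f \<omega>) \<le> ennreal C"
proof -
  obtain C where C: "\<And>\<omega> i. \<omega> \<in> \<Omega> \<Longrightarrow> i \<le> Suc n \<Longrightarrow> \<exists>g. has_weak_deriv i (f' \<omega>) g \<and> (\<forall>x. \<bar>g x\<bar> \<le> C)"
    using bdd_smooth_weak_deriv_ex[OF assms(1)] by blast
  obtain L where L: "L > 0" "\<And>\<omega> x y. \<omega> \<in> \<Omega> \<Longrightarrow> \<bar>f' \<omega> x - f' \<omega> y\<bar> \<le> L * \<bar>x - y\<bar>"
    using bdd_smooth_lipschitz[OF assms(1)] by blast
  have "weak_deriv_norm i (f \<omega>) \<le> ennreal C" if w: "\<omega> \<in> \<Omega>" and i: "i \<in> {1..n + 2}" for \<omega> i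
  proof -
    have c': "continuous_on UNIV (f' \<omega>)" by (rule lipschitz_continuous_on[OF L(2)[OF w]])
    have c: "continuous_on UNIV (f \<omega>)"
      using assms(2)[OF w] by (meson DERIV_isCont continuous_at_imp_continuous_on)
    obtain j where j: "i = Suc j" "j \<le> Suc n" using i by (cases i) auto
    then obtain g where "has_weak_deriv j (f' \<omega>) g" "\<And>x. \<bar>g x\<bar> \<le> C" using C[OF w] by blast
    then show ?thesis
      unfolding j using has_weak_deriv_Suc_iff[OF primitive_of_continuous[OF assms(2)[OF w] c'] c]
      by (intro weak_deriv_norm_le) auto
  qed
  then show ?thesis by (rule that)
qed

text \<open>Picking \<open>g\<close> from an infimum takes a strict bound, hence the added 1; the
  absolute value appears because \<open>ennreal\<close> sends negative reals to 0.\<close>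

lemma weak_deriv_norm_leD:
  assumes "weak_deriv_norm i f \<le> ennreal B"
  obtains g where "has_weak_deriv i f g" "AE x in lborel. \<bar>g x\<bar> \<le> \<bar>B\<bar> + 1"
proof -
  have "weak_deriv_norm i f < ennreal (\<bar>B\<bar> + 1)"
    by (rule le_less_trans[OF assms], rule ennreal_lessI) auto
  then obtain g where g: "has_weak_deriv i f g" "esssup lborel (\<lambda>x. ennreal \<bar>g x\<bar>) < ennreal (\<bar>B\<bar> + 1)"
    unfolding weak_deriv_norm_def INF_less_iff by auto
  have "AE x in lborel. \<bar>g x\<bar> \<le> \<bar>B\<bar> + 1"
    using esssup_AE[where M=lborel and f="\<lambda>x. ennreal \<bar>g x\<bar>"]
  proof eventually_elim
    case (elim x)
    then have "ennreal \<bar>g x\<bar> \<le> ennreal (\<bar>B\<bar> + 1)" using g(2) by auto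
    then show ?case by (subst (asm) ennreal_le_iff) auto
  qed
  with g(1) show ?thesis by (rule that)
qed

lemma continuous_AE_bounded:
  fixes f :: "real \<Rightarrow> real"
  assumes "continuous_on UNIV f" "AE x in lborel. \<bar>f x\<bar> \<le> B"
  shows "\<bar>f x\<bar> \<le> B"
proof -
  have "(\<lambda>x. max (\<bar>f x\<bar>) B) = (\<lambda>x. B)"
    by (rule continuous_AE_eq) (use assms in \<open>auto intro!: continuous_intros elim!: eventually_mono\<close>)
  then show ?thesis by (metis max.cobounded1)
qed

text \<open>Two consecutive bounded weak derivatives make a continuous function classically
  differentiable, and its further weak derivatives are then those of the classical derivative; so
  the order drops by one. At order 0 the Lipschitz bound comes from a primitive of the first weak
  derivative.\<close>

lemma bdd_smooth_if_weak_deriv_bounded: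
  assumes "\<And>\<omega>. \<omega> \<in> \<Omega> \<Longrightarrow> continuous_on UNIV (f \<omega>)"
    and "\<And>\<omega> i. \<omega> \<in> \<Omega> \<Longrightarrow> i \<le> Suc n \<Longrightarrow> \<exists>g. has_weak_deriv i (f \<omega>) g \<and> (AE x in lborel. \<bar>g x\<bar> \<le> B)"
  shows "bdd_smooth n \<Omega> f"
  using assms
proof (induction n arbitrary: f)
  have bound: "\<bar>f \<omega> x\<bar> \<le> B" if "continuous_on UNIV (f \<omega>)" "has_weak_deriv 0 (f \<omega>) g" "AE x in lborel. \<bar>g x\<bar> \<le> B" for f \<omega> g x
  proof (rule continuous_AE_bounded[OF that(1)])
    show "AE x in lborel. \<bar>f \<omega> x\<bar> \<le> B"
      using has_weak_deriv_0_AE_eq[OF that(2)] that(3) by eventually_elim simp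
  qed
  {
    case 0
    show ?case
    proof (rule bdd_smooth_0I[of _ _ B B])
      fix \<omega> x y assume w: "\<omega> \<in> \<Omega>"
      show "\<bar>f \<omega> x\<bar> \<le> B" using bound 0 w by (metis zero_le)
      obtain g where g: "has_weak_deriv 1 (f \<omega>) g" "AE x in lborel. \<bar>g x\<bar> \<le> B" using 0(2)[OF w, of 1] by auto
      obtain F where F: "\<And>x y. \<bar>F x - F y\<bar> \<le> B * \<bar>x - y\<bar>" "AE x in lborel. f \<omega> x = F x"
        by (rule weak_deriv_primitive[OF g]) blast
      have "f \<omega> = F" by (rule continuous_AE_eq[OF 0(1)[OF w] lipschitz_continuous_on[OF F(1)] F(2)])
      then show "\<bar>f \<omega> x - f \<omega> y\<bar> \<le> B * \<bar>x - y\<bar>" using F(1) by simp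
    qed
  next
    case (Suc n)
    have "\<exists>f'. (\<forall>x. (f \<omega> has_real_derivative f' x) (at x)) \<and> continuous_on UNIV f'" if w: "\<omega> \<in> \<Omega>" for \<omega>
    proof -
      obtain g1 where g1: "has_weak_deriv 1 (f \<omega>) g1" "AE x in lborel. \<bar>g1 x\<bar> \<le> B" using Suc.prems(2)[OF w, of 1] by auto
      obtain g2 where g2: "has_weak_deriv 2 (f \<omega>) g2" "AE x in lborel. \<bar>g2 x\<bar> \<le> B" using Suc.prems(2)[OF w, of 2] by auto
      show ?thesis
        by (rule weak_deriv_classical[OF Suc.prems(1)[OF w] g1(1) g2(1) g1(2) g2(2)]) blast
    qed
    then obtain f' where f': "\<And>\<omega> x. \<omega> \<in> \<Omega> \<Longrightarrow> (f \<omega> has_real_derivative f' \<omega> x) (at x)"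
      "\<And>\<omega>. \<omega> \<in> \<Omega> \<Longrightarrow> continuous_on UNIV (f' \<omega>)" by metis
    have "bdd_smooth n \<Omega> f'"
    proof (rule Suc.IH[OF f'(2)])
      fix \<omega> i assume w: "\<omega> \<in> \<Omega>" and i: "i \<le> Suc n"
      show "\<exists>g. has_weak_deriv i (f' \<omega>) g \<and> (AE x in lborel. \<bar>g x\<bar> \<le> B)"
        using has_weak_deriv_Suc_iff[OF primitive_of_continuous[OF f'(1)[OF w] f'(2)[OF w]] Suc.prems(1)[OF w]]
          Suc.prems(2)[OF w, of "Suc i"] i by auto
    qed
    moreover have "\<bar>f \<omega> x\<bar> \<le> B" if w: "\<omega> \<in> \<Omega>" for \<omega> x
      using bound Suc.prems w by (metis zero_le)
    ultimately show ?case by (intro bdd_smooth_SucI[OF _ f'(1)])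
  }
qed

lemma bdd_smooth_if_weak_deriv_norm_bounded:
  assumes "\<And>\<omega>. \<omega> \<in> \<Omega> \<Longrightarrow> continuous_on UNIV (f \<omega>)"
    and "\<And>\<omega> i. \<omega> \<in> \<Omega> \<Longrightarrow> i \<le> Suc n \<Longrightarrow> weak_deriv_norm i (f \<omega>) \<le> ennreal B"
  shows "bdd_smooth n \<Omega> f"
  using assms(1)
proof (rule bdd_smooth_if_weak_deriv_bounded)
  fix \<omega> i assume "\<omega> \<in> \<Omega>" "i \<le> Suc n"
  from weak_deriv_norm_leD[OF assms(2)[OF this]]
  show "\<exists>g. has_weak_deriv i (f \<omega>) g \<and> (AE x in lborel. \<bar>g x\<bar> \<le> \<bar>B\<bar> + 1)" by blast
qed

section \<open>Integration against measures with finite second moment\<close>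

lemma P2D:
  assumes "\<mu> \<in> P2"
  shows "prob_space \<mu>" "sets \<mu> = sets borel" "space \<mu> = UNIV" "integrable \<mu> (\<lambda>x. x\<^sup>2)"
    "integrable \<mu> (\<lambda>x. \<bar>x\<bar>)" "integrable \<mu> (\<lambda>x. x)"
proof -
  interpret real_distribution \<mu> using assms by (simp add: P2_def)
  show "prob_space \<mu>" "sets \<mu> = sets borel" "space \<mu> = UNIV" "integrable \<mu> (\<lambda>x. x\<^sup>2)"
    using assms by (auto simp: P2_def prob_space_axioms)
  have "integrable \<mu> (\<lambda>x. 1 + x\<^sup>2)" using assms by (auto simp: P2_def)
  then show "integrable \<mu> (\<lambda>x. \<bar>x\<bar>)"
  proof (rule Bochner_Integration.integrable_bound)
    have "norm \<bar>x\<bar> \<le> norm (1 + x\<^sup>2)" for x :: real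
      using sum_power2_ge_zero[of "\<bar>x\<bar> - 1" 0] by (simp add: power2_diff)
    then show "AE x in \<mu>. norm \<bar>x\<bar> \<le> norm (1 + x\<^sup>2)" by simp
  qed simp
  then show "integrable \<mu> (\<lambda>x. x)" by (subst (asm) integrable_abs_iff) auto
qed

lemma measurable_if_sets_borel:
  "sets M = sets borel \<Longrightarrow> f \<in> borel_measurable borel \<Longrightarrow> f \<in> borel_measurable M"
  by (subst measurable_cong_sets[of M borel]) auto

lemma P2_measurable: "\<mu> \<in> P2 \<Longrightarrow> f \<in> borel_measurable borel \<Longrightarrow> f \<in> borel_measurable \<mu>"
  by (rule measurable_if_sets_borel[OF P2D(2)])

lemma lipschitz_measurable:
  fixes f :: "real \<Rightarrow> real"
  assumes "\<And>x y. \<bar>f x - f y\<bar> \<le> c * \<bar>x - y\<bar>"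
  shows "f \<in> borel_measurable borel"
  by (intro borel_measurable_continuous_onI lipschitz_continuous_on[OF assms])

lemma integrable_linear_growth_P2:
  fixes f :: "real \<Rightarrow> real"
  assumes "\<mu> \<in> P2" "f \<in> borel_measurable borel" "\<And>x. \<bar>f x\<bar> \<le> a + b * \<bar>x\<bar>"
  shows "integrable \<mu> f"
proof -
  interpret prob_space \<mu> using P2D[OF assms(1)] by blast
  have "integrable \<mu> (\<lambda>x. a + b * \<bar>x\<bar>)"
    using P2D[OF assms(1)] by (intro Bochner_Integration.integrable_add integrable_mult_right) auto
  then show ?thesis
    by (rule Bochner_Integration.integrable_bound)
      (use assms in \<open>auto intro: P2_measurable order.trans[OF assms(3) abs_ge_self]\<close>)
qed

lemma integrable_bounded_P2:
  fixes f :: "real \<Rightarrow> real"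
  assumes "\<mu> \<in> P2" "f \<in> borel_measurable borel" "\<And>x. \<bar>f x\<bar> \<le> a"
  shows "integrable \<mu> f"
  by (rule integrable_linear_growth_P2[OF assms(1,2), of a 0]) (use assms(3) in auto)

lemma integrable_lipschitz_P2:
  assumes "\<mu> \<in> P2" and lip: "\<And>x y. \<bar>f x - f y\<bar> \<le> c * \<bar>x - y :: real\<bar>"
  shows "integrable \<mu> (f :: real \<Rightarrow> real)"
proof (rule integrable_linear_growth_P2[OF assms(1) lipschitz_measurable[OF lip], of "\<bar>f 0\<bar>" c])
  show "\<bar>f x\<bar> \<le> \<bar>f 0\<bar> + c * \<bar>x\<bar>" for x using lip[of x 0] by simp
qed

lemma integral_P2_bound:
  fixes f :: "real \<Rightarrow> real"
  assumes "\<mu> \<in> P2" "f \<in> borel_measurable borel" "\<And>x. \<bar>f x\<bar> \<le> a"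
  shows "\<bar>\<integral>x. f x \<partial>\<mu>\<bar> \<le> a"
proof -
  interpret prob_space \<mu> using P2D[OF assms(1)] by blast
  have "\<bar>\<integral>x. f x \<partial>\<mu>\<bar> \<le> (\<integral>x. \<bar>f x\<bar> \<partial>\<mu>)" by (rule integral_abs_bound)
  also have "\<dots> \<le> (\<integral>x. a \<partial>\<mu>)"
    using integrable_bounded_P2[OF assms] assms(3) by (intro integral_mono) auto
  also have "\<dots> = a" by (simp add: prob_space)
  finally show ?thesis .
qed

lemma lipschitz_const_nonneg:
  assumes "\<And>x y. \<bar>f x - f y\<bar> \<le> c * \<bar>x - y :: real\<bar>"
  shows "0 \<le> (c::real)"
  using order.trans[OF abs_ge_zero assms[of 1 0]] by simp

text \<open>By Kantorovich duality, an upper bound for the 1-Wasserstein distance.\<close>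

definition w1_le :: "real measure \<Rightarrow> real measure \<Rightarrow> real \<Rightarrow> bool" where
  "w1_le P Q d \<longleftrightarrow> (\<forall>f c. (\<forall>x y. \<bar>f x - f y\<bar> \<le> c * \<bar>x - y\<bar>) \<longrightarrow> \<bar>(\<integral>x. f x \<partial>P) - (\<integral>x. f x \<partial>Q)\<bar> \<le> c * d)"

lemma w1_leD:
  assumes "w1_le P Q d" "\<And>x y. \<bar>f x - f y\<bar> \<le> c * \<bar>x - y\<bar>"
  shows "\<bar>(\<integral>x. f x \<partial>P) - (\<integral>x. f x \<partial>Q)\<bar> \<le> c * d"
  using assms unfolding w1_le_def by blast

lemma w1_le_nonneg: "w1_le P Q d \<Longrightarrow> 0 \<le> d"
  using w1_leD[of P Q d "\<lambda>x. x" 1] by simp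

text \<open>\<open>L * d\<close> is the cost of moving the measure under the Lipschitz map
  \<open>f\<close>, and \<open>e\<close> the cost of replacing \<open>f\<close> by \<open>g\<close>
  under \<open>Q\<close>; so \<open>g\<close> may be merely measurable.\<close>

lemma w1_le_distr:
  assumes PQ: "w1_le P Q d" and P: "P \<in> P2" "Q \<in> P2"
    and f: "\<And>x y. \<bar>f x - f y\<bar> \<le> L * \<bar>x - y\<bar>" and g: "g \<in> borel_measurable borel" "\<And>x. \<bar>f x - g x\<bar> \<le> e"
  shows "w1_le (distr P borel f) (distr Q borel g) (L * d + e)"
  unfolding w1_le_def
proof (intro allI impI)
  fix h c assume "\<forall>x y. \<bar>h x - h y\<bar> \<le> c * \<bar>x - y :: real\<bar>"
  then have h: "\<And>x y. \<bar>h x - h y\<bar> \<le> c * \<bar>x - y\<bar>" by blast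
  have c: "c \<ge> 0" by (rule lipschitz_const_nonneg[OF h])
  have [measurable]: "h \<in> borel_measurable borel" "f \<in> borel_measurable borel" "g \<in> borel_measurable borel"
    using lipschitz_measurable[OF h] lipschitz_measurable[OF f] g(1) by auto
  have hf: "\<bar>h (f x) - h (f y)\<bar> \<le> (c * L) * \<bar>x - y\<bar>" for x y
    using order.trans[OF h mult_left_mono[OF f c]] by (simp add: mult.assoc)
  have hg: "\<bar>h (f x) - h (g x)\<bar> \<le> c * e" for x
    by (rule order.trans[OF h mult_left_mono[OF g(2) c]])
  have i: "integrable Q (\<lambda>x. h (f x))" by (rule integrable_lipschitz_P2[OF P(2) hf])
  have i': "integrable Q (\<lambda>x. h (f x) - h (g x))" by (rule integrable_bounded_P2[OF P(2) _ hg]) measurable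
  have eq: "(\<integral>x. h x \<partial>distr P borel f) = (\<integral>x. h (f x) \<partial>P)" "(\<integral>x. h x \<partial>distr Q borel g) = (\<integral>x. h (g x) \<partial>Q)"
    by (rule integral_distr; use P2_measurable[OF P(1)] P2_measurable[OF P(2)] lipschitz_measurable[OF h] lipschitz_measurable[OF f] g(1) in blast)+
  have "(\<integral>x. h (g x) \<partial>Q) = (\<integral>x. h (f x) \<partial>Q) - (\<integral>x. h (f x) - h (g x) \<partial>Q)"
    using Bochner_Integration.integral_diff[OF i i'] by simp
  moreover have "\<bar>(\<integral>x. h (f x) \<partial>P) - (\<integral>x. h (f x) \<partial>Q)\<bar> \<le> (c * L) * d" by (rule w1_leD[OF PQ hf])
  moreover have "\<bar>\<integral>x. h (f x) - h (g x) \<partial>Q\<bar> \<le> c * e" by (rule integral_P2_bound[OF P(2) _ hg]) measurable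
  ultimately show "\<bar>(\<integral>x. h x \<partial>distr P borel f) - (\<integral>x. h x \<partial>distr Q borel g)\<bar> \<le> c * (L * d + e)"
    unfolding eq by (simp add: algebra_simps)
qed

lemma w1_le_refl: "w1_le P P 0"
  by (simp add: w1_le_def)

text \<open>Some coupling has cost below \<open>d\<^sup>2\<close>, and by Jensen's inequality its
  mean of \<open>\<bar>fst z - snd z\<bar>\<close> is below \<open>d\<close>. The strict inequality
  avoids the existence of optimal couplings.\<close>

lemma W2_lessD:
  assumes P: "P \<in> P2" "Q \<in> P2" and d: "W2 P Q < d"
  shows "w1_le P Q d"
proof -
  interpret P: prob_space P using P2D[OF P(1)] by blast
  interpret Q: prob_space Q using P2D[OF P(2)] by blast
  interpret PQ: pair_prob_space P Q ..
  \<comment> \<open>The product coupling shows that the infimum in \<open>W2\<close> is over a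
    nonempty set, hence a genuine infimum.\<close>
  have "P \<Otimes>\<^sub>M Q \<in> couplings P Q"
  proof -
    have "distr (P \<Otimes>\<^sub>M Q) borel fst = distr (P \<Otimes>\<^sub>M Q) P fst" "distr (P \<Otimes>\<^sub>M Q) borel snd = distr (P \<Otimes>\<^sub>M Q) Q snd"
      using P2D(2)[OF P(1)] P2D(2)[OF P(2)] by (auto intro!: distr_cong)
    moreover have "distr (P \<Otimes>\<^sub>M Q) P fst = P" by (rule Q.distr_pair_fst)
    moreover have "distr (P \<Otimes>\<^sub>M Q) Q snd = Q"
    proof -
      have "distr (P \<Otimes>\<^sub>M Q) Q snd = distr (distr (Q \<Otimes>\<^sub>M P) (P \<Otimes>\<^sub>M Q) (\<lambda>(x, y). (y, x))) Q snd"
        by (subst PQ.distr_pair_swap) simp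
      also have "\<dots> = distr (Q \<Otimes>\<^sub>M P) Q (snd \<circ> (\<lambda>(x, y). (y, x)))"
        by (rule distr_distr) measurable
      also have "snd \<circ> (\<lambda>(x, y). (y, x)) = (fst :: real \<times> real \<Rightarrow> real)" by auto
      finally show ?thesis by (simp add: P.distr_pair_fst)
    qed
    ultimately show ?thesis
      using P2D(2)[OF P(1)] P2D(2)[OF P(2)] PQ.prob_space_axioms
      by (auto simp: couplings_def intro: sets_pair_measure_cong)
  qed
  then have ne: "couplings P Q \<noteq> {}" by auto
  have nn: "0 \<le> (\<integral>z. (fst z - snd z)\<^sup>2 \<partial>\<pi>)" for \<pi> :: "(real \<times> real) measure" by simp
  then have bdd: "bdd_below ((\<lambda>\<pi>. \<integral>z. (fst z - snd z)\<^sup>2 \<partial>\<pi>) ` couplings P Q)"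
    by (intro bdd_belowI[of _ 0]) auto
  have I0: "0 \<le> (INF \<pi>\<in>couplings P Q. \<integral>z. (fst z - snd z)\<^sup>2 \<partial>\<pi>)"
    by (rule cINF_greatest[OF ne nn])
  then have "0 \<le> W2 P Q" unfolding W2_def by simp
  with d have "d > 0" by simp
  have "(W2 P Q)\<^sup>2 < d\<^sup>2" using d \<open>0 \<le> W2 P Q\<close> by (intro power_strict_mono) auto
  then have "(INF \<pi>\<in>couplings P Q. \<integral>z. (fst z - snd z)\<^sup>2 \<partial>\<pi>) < d\<^sup>2"
    using I0 by (simp add: W2_def)
  then obtain \<pi> where \<pi>: "\<pi> \<in> couplings P Q" "(\<integral>z. (fst z - snd z)\<^sup>2 \<partial>\<pi>) < d\<^sup>2"
    using cINF_less_iff[OF ne bdd] by blast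
  interpret prob_space \<pi> using \<pi>(1) by (simp add: couplings_def)
  have s: "sets \<pi> = sets (borel \<Otimes>\<^sub>M borel)" and fs: "distr \<pi> borel fst = P" "distr \<pi> borel snd = Q"
    using \<pi>(1) by (auto simp: couplings_def)
  have [measurable]: "fst \<in> \<pi> \<rightarrow>\<^sub>M borel" "snd \<in> \<pi> \<rightarrow>\<^sub>M borel"
    using s by (auto simp: measurable_cong_sets[OF s refl])
  have i2: "integrable \<pi> (\<lambda>z. (fst z)\<^sup>2)" "integrable \<pi> (\<lambda>z. (snd z)\<^sup>2)"
    using P2D(4)[OF P(1)] P2D(4)[OF P(2)] fs
      integrable_distr_eq[of fst \<pi> borel "\<lambda>x. x\<^sup>2"] integrable_distr_eq[of snd \<pi> borel "\<lambda>x. x\<^sup>2"] by auto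
  have id2: "integrable \<pi> (\<lambda>z. (fst z - snd z)\<^sup>2)"
  proof (rule Bochner_Integration.integrable_bound)
    show "integrable \<pi> (\<lambda>z. 2 * (fst z)\<^sup>2 + 2 * (snd z)\<^sup>2)" using i2 by auto
    have "(a - b)\<^sup>2 \<le> 2 * a\<^sup>2 + 2 * b\<^sup>2" for a b :: real
      using sum_power2_ge_zero[of "a + b" 0] by (simp add: power2_sum power2_diff)
    then show "AE z in \<pi>. norm ((fst z - snd z)\<^sup>2) \<le> norm (2 * (fst z)\<^sup>2 + 2 * (snd z)\<^sup>2)" by simp
  qed measurable
  have id: "integrable \<pi> (\<lambda>z. \<bar>fst z - snd z\<bar>)"
  proof (rule Bochner_Integration.integrable_bound)
    show "integrable \<pi> (\<lambda>z. 1 + (fst z - snd z)\<^sup>2)" using id2 by auto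
    have "norm \<bar>x\<bar> \<le> norm (1 + x\<^sup>2)" for x :: real
      using sum_power2_ge_zero[of "\<bar>x\<bar> - 1" 0] by (simp add: power2_diff)
    then show "AE z in \<pi>. norm \<bar>fst z - snd z\<bar> \<le> norm (1 + (fst z - snd z)\<^sup>2)" by simp
  qed measurable
  \<comment> \<open>Jensen's inequality as nonnegativity of a variance.\<close>
  have "(\<integral>z. \<bar>fst z - snd z\<bar> \<partial>\<pi>)\<^sup>2 \<le> (\<integral>z. (\<bar>fst z - snd z\<bar>)\<^sup>2 \<partial>\<pi>)"
    using variance_eq[of "\<lambda>z. \<bar>fst z - snd z\<bar>"] variance_positive[of "\<lambda>z. \<bar>fst z - snd z\<bar>"] id id2 by simp
  also have "\<dots> < d\<^sup>2" using \<pi>(2) by simp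
  finally have e: "(\<integral>z. \<bar>fst z - snd z\<bar> \<partial>\<pi>) < d"
    using \<open>d > 0\<close> power_less_imp_less_base by fastforce
  show ?thesis
    unfolding w1_le_def
  proof (intro allI impI)
    fix f c assume "\<forall>x y. \<bar>f x - f y\<bar> \<le> c * \<bar>x - y :: real\<bar>"
    then have lip: "\<And>x y. \<bar>f x - f y\<bar> \<le> c * \<bar>x - y\<bar>" by blast
    have c: "c \<ge> 0" by (rule lipschitz_const_nonneg[OF lip])
    have [measurable]: "f \<in> borel_measurable borel" by (rule lipschitz_measurable[OF lip])
    have i: "integrable \<pi> (\<lambda>z. f (fst z))" "integrable \<pi> (\<lambda>z. f (snd z))"
      using integrable_lipschitz_P2[OF P(1) lip] integrable_lipschitz_P2[OF P(2) lip] fs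
        integrable_distr_eq[of fst \<pi> borel f] integrable_distr_eq[of snd \<pi> borel f] by auto
    have "(\<integral>x. f x \<partial>P) - (\<integral>x. f x \<partial>Q) = (\<integral>z. f (fst z) \<partial>\<pi>) - (\<integral>z. f (snd z) \<partial>\<pi>)"
      using integral_distr[of fst \<pi> borel f] integral_distr[of snd \<pi> borel f] fs by simp
    also have "\<dots> = (\<integral>z. f (fst z) - f (snd z) \<partial>\<pi>)" using i by simp
    also have "\<bar>\<dots>\<bar> \<le> (\<integral>z. \<bar>f (fst z) - f (snd z)\<bar> \<partial>\<pi>)" by (rule integral_abs_bound)
    also have "\<dots> \<le> (\<integral>z. c * \<bar>fst z - snd z\<bar> \<partial>\<pi>)"
      using i id by (intro integral_mono) (auto intro: lip)
    also have "\<dots> \<le> c * d" using e c by (simp add: mult_left_mono)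
    finally show "\<bar>(\<integral>x. f x \<partial>P) - (\<integral>x. f x \<partial>Q)\<bar> \<le> c * d" .
  qed
qed

section \<open>Mixtures of measures\<close>

lemma sets_mix_measure: "sets (mix_measure r P Q) = sets borel" "space (mix_measure r P Q) = UNIV"
  by (simp_all add: mix_measure_def) (metis sets.sigma_sets_eq space_borel)

lemma nn_integral_mix_measure:
  assumes PQ: "sets P = sets borel" "sets Q = sets borel" and f: "f \<in> borel_measurable borel"
  shows "(\<integral>\<^sup>+x. f x \<partial>mix_measure r P Q) = ennreal r * (\<integral>\<^sup>+x. f x \<partial>P) + ennreal (1 - r) * (\<integral>\<^sup>+x. f x \<partial>Q)"
  using f
proof (induction rule: borel_measurable_induct)
  case (cong f g)
  then have "f = g" by auto
  with cong show ?case by simp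
next
  case (set A)
  then show ?case
    using PQ by (simp add: nn_integral_indicator sets_mix_measure emeasure_mix_measure)
next
  case (mult u c)
  have [measurable]: "u \<in> borel_measurable P" "u \<in> borel_measurable Q" "u \<in> borel_measurable (mix_measure r P Q)"
    by (fact measurable_if_sets_borel[OF PQ(1) mult(2)] measurable_if_sets_borel[OF PQ(2) mult(2)] measurable_if_sets_borel[OF sets_mix_measure(1) mult(2)])+
  show ?case by (simp add: nn_integral_cmult mult distrib_left mult_ac)
next
  case (add u v)
  have [measurable]: "u \<in> borel_measurable P" "u \<in> borel_measurable Q" "u \<in> borel_measurable (mix_measure r P Q)"
    "v \<in> borel_measurable P" "v \<in> borel_measurable Q" "v \<in> borel_measurable (mix_measure r P Q)"
    by (fact measurable_if_sets_borel[OF PQ(1) add(1)] measurable_if_sets_borel[OF PQ(2) add(1)] measurable_if_sets_borel[OF sets_mix_measure(1) add(1)]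
        measurable_if_sets_borel[OF PQ(1) add(3)] measurable_if_sets_borel[OF PQ(2) add(3)] measurable_if_sets_borel[OF sets_mix_measure(1) add(3)])+
  show ?case by (simp add: nn_integral_add add distrib_left add_ac)
next
  case (seq U)
  have [measurable]: "U i \<in> borel_measurable P" "U i \<in> borel_measurable Q" "U i \<in> borel_measurable (mix_measure r P Q)" for i
    by (fact measurable_if_sets_borel[OF PQ(1) seq(1)] measurable_if_sets_borel[OF PQ(2) seq(1)] measurable_if_sets_borel[OF sets_mix_measure(1) seq(1)])+
  have *: "(\<integral>\<^sup>+x. (SUP i. U i x) \<partial>M) = (SUP i. \<integral>\<^sup>+x. U i x \<partial>M)" if "\<And>i. U i \<in> borel_measurable M" for M
    by (rule nn_integral_monotone_convergence_SUP[OF seq(3) that])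
  have inc: "incseq (\<lambda>i. ennreal c * (\<integral>\<^sup>+x. U i x \<partial>M))" for c M
    using seq(3) by (intro monoI mult_left_mono nn_integral_mono) (auto dest: incseqD le_funD)
  show ?case
    unfolding seq(4) SUP_apply
    using ennreal_SUP_add[OF inc inc] by (simp add: * seq SUP_mult_left_ennreal)
qed

lemma integral_mix_measure:
  assumes PQ: "sets P = sets borel" "sets Q = sets borel" and f: "integrable P f" "integrable Q f" and r: "0 \<le> r" "r \<le> 1"
  shows "integrable (mix_measure r P Q) f"
    "(\<integral>x. f x \<partial>mix_measure r P Q) = r * (\<integral>x. f x \<partial>P) + (1 - r) * (\<integral>x. f x \<partial>Q :: real)"
proof -
  have fm: "f \<in> borel_measurable borel"
    using borel_measurable_integrable[OF f(1)] by (simp add: measurable_cong_sets[OF PQ(1) refl])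
  then have [measurable]: "f \<in> borel_measurable (mix_measure r P Q)"
    by (rule measurable_if_sets_borel[OF sets_mix_measure(1)])
  have [measurable]: "(\<lambda>x. ennreal (f x)) \<in> borel_measurable borel" "(\<lambda>x. ennreal (- f x)) \<in> borel_measurable borel"
    using fm by auto
  note nn = nn_integral_mix_measure[OF PQ, of "\<lambda>x. ennreal (f x)"] nn_integral_mix_measure[OF PQ, of "\<lambda>x. ennreal (- f x)"]
  have fin: "\<exists>a\<ge>0. (\<integral>\<^sup>+x. ennreal (h x) \<partial>M) = ennreal a" if "(\<integral>\<^sup>+x. ennreal (h x) \<partial>M) \<noteq> \<infinity>" for h :: "real \<Rightarrow> real" and M
    using that by (cases "\<integral>\<^sup>+x. ennreal (h x) \<partial>M" rule: ennreal_cases) auto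
  obtain a where a: "0 \<le> a" "(\<integral>\<^sup>+x. ennreal (f x) \<partial>P) = ennreal a"
    using fin[of P f] f(1) by (auto simp: real_integrable_def)
  obtain b where b: "0 \<le> b" "(\<integral>\<^sup>+x. ennreal (- f x) \<partial>P) = ennreal b"
    using fin[of P "\<lambda>x. - f x"] f(1) by (auto simp: real_integrable_def)
  obtain c where c: "0 \<le> c" "(\<integral>\<^sup>+x. ennreal (f x) \<partial>Q) = ennreal c"
    using fin[of Q f] f(2) by (auto simp: real_integrable_def)
  obtain d where d: "0 \<le> d" "(\<integral>\<^sup>+x. ennreal (- f x) \<partial>Q) = ennreal d"
    using fin[of Q "\<lambda>x. - f x"] f(2) by (auto simp: real_integrable_def)
  note abcd = a(1) b(1) c(1) d(1) a(2) b(2) c(2) d(2)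
  have nn0: "0 \<le> r * a + (1 - r) * c" "0 \<le> r * b + (1 - r) * d" using abcd r by simp_all
  have e: "(\<integral>\<^sup>+x. ennreal (f x) \<partial>mix_measure r P Q) = ennreal (r * a + (1 - r) * c)"
    "(\<integral>\<^sup>+x. ennreal (- f x) \<partial>mix_measure r P Q) = ennreal (r * b + (1 - r) * d)"
    using nn abcd r by (simp_all add: ennreal_mult ennreal_plus)
  show i: "integrable (mix_measure r P Q) f"
    unfolding real_integrable_def by (simp add: e)
  show "(\<integral>x. f x \<partial>mix_measure r P Q) = r * (\<integral>x. f x \<partial>P) + (1 - r) * (\<integral>x. f x \<partial>Q)"
    unfolding real_lebesgue_integral_def[OF i] real_lebesgue_integral_def[OF f(1)] real_lebesgue_integral_def[OF f(2)] e abcd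
    using nn0 abcd(1-4) by (simp only: enn2real_ennreal) (simp add: algebra_simps)
qed

lemma mix_measure_P2:
  assumes "P \<in> P2" "Q \<in> P2" "0 \<le> r" "r \<le> 1"
  shows "mix_measure r P Q \<in> P2"
proof -
  interpret P: prob_space P using P2D[OF assms(1)] by blast
  interpret Q: prob_space Q using P2D[OF assms(2)] by blast
  have "emeasure (mix_measure r P Q) UNIV = 1"
    using emeasure_mix_measure[OF P2D(2)[OF assms(1)] P2D(2)[OF assms(2)], of UNIV r] P.emeasure_space_1 Q.emeasure_space_1
      P2D(3)[OF assms(1)] P2D(3)[OF assms(2)] assms(3,4) by (simp flip: ennreal_plus)
  then have "prob_space (mix_measure r P Q)" by (intro prob_spaceI) (simp add: sets_mix_measure)
  then have "real_distribution (mix_measure r P Q)"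
    by (simp add: real_distribution_def real_distribution_axioms_def sets_mix_measure)
  then show ?thesis
    using integral_mix_measure(1)[OF P2D(2)[OF assms(1)] P2D(2)[OF assms(2)] P2D(4)[OF assms(1)] P2D(4)[OF assms(2)] assms(3,4)]
    by (simp add: P2_def)
qed

text \<open>The difference of the two integrals is \<open>r - s\<close> times the difference of the
  integrals over \<open>P\<close> and \<open>Q\<close>, and each of the latter differs from
  \<open>f 0\<close> by at most \<open>c\<close> times a first absolute moment.\<close>

lemma w1_le_mix:
  assumes PQ: "P \<in> P2" "Q \<in> P2" and r: "0 \<le> r" "r \<le> 1" and s: "0 \<le> s" "s \<le> 1"
  shows "w1_le (mix_measure r P Q) (mix_measure s P Q) (\<bar>r - s\<bar> * ((\<integral>x. \<bar>x\<bar> \<partial>P) + (\<integral>x. \<bar>x\<bar> \<partial>Q)))"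
  unfolding w1_le_def
proof (intro allI impI)
  interpret P: prob_space P using P2D[OF PQ(1)] by blast
  interpret Q: prob_space Q using P2D[OF PQ(2)] by blast
  fix f c assume "\<forall>x y. \<bar>f x - f y\<bar> \<le> c * \<bar>x - y :: real\<bar>"
  then have lip: "\<And>x y. \<bar>f x - f y\<bar> \<le> c * \<bar>x - y\<bar>" by blast
  have i: "integrable P f" "integrable Q f" using integrable_lipschitz_P2[OF _ lip] PQ by auto
  have b: "\<bar>(\<integral>x. f x \<partial>M) - f 0\<bar> \<le> c * (\<integral>x. \<bar>x\<bar> \<partial>M)" if M: "M \<in> P2" for M
  proof -
    interpret prob_space M using P2D[OF M] by blast
    have iM: "integrable M f" by (rule integrable_lipschitz_P2[OF M lip])
    have "(\<integral>x. f x \<partial>M) - f 0 = (\<integral>x. f x - f 0 \<partial>M)" using iM by (simp add: prob_space)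
    also have "\<bar>\<dots>\<bar> \<le> (\<integral>x. \<bar>f x - f 0\<bar> \<partial>M)" by (rule integral_abs_bound)
    also have "\<dots> \<le> (\<integral>x. c * \<bar>x\<bar> \<partial>M)"
      using iM P2D(5)[OF M] lip[of _ 0] by (intro integral_mono) auto
    finally show ?thesis by simp
  qed
  have "(\<integral>x. f x \<partial>mix_measure r P Q) - (\<integral>x. f x \<partial>mix_measure s P Q) = (r - s) * ((\<integral>x. f x \<partial>P) - (\<integral>x. f x \<partial>Q))"
    using integral_mix_measure(2)[OF P2D(2)[OF PQ(1)] P2D(2)[OF PQ(2)] i] r s by (simp add: algebra_simps)
  then have "\<bar>(\<integral>x. f x \<partial>mix_measure r P Q) - (\<integral>x. f x \<partial>mix_measure s P Q)\<bar> = \<bar>r - s\<bar> * \<bar>(\<integral>x. f x \<partial>P) - (\<integral>x. f x \<partial>Q)\<bar>"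
    by (simp add: abs_mult)
  also have "\<dots> \<le> \<bar>r - s\<bar> * (c * ((\<integral>x. \<bar>x\<bar> \<partial>P) + (\<integral>x. \<bar>x\<bar> \<partial>Q)))"
    using b[OF PQ(1)] b[OF PQ(2)] by (intro mult_left_mono) (auto simp: distrib_left)
  finally show "\<bar>(\<integral>x. f x \<partial>mix_measure r P Q) - (\<integral>x. f x \<partial>mix_measure s P Q)\<bar>
      \<le> c * (\<bar>r - s\<bar> * ((\<integral>x. \<bar>x\<bar> \<partial>P) + (\<integral>x. \<bar>x\<bar> \<partial>Q)))" by (simp add: mult_ac)
qed

text \<open>It keeps the whole segment from \<open>Q\<close> to \<open>P\<close> within distance
  \<open>d\<close> of \<open>Q\<close>, so that an integral over mixtures can be compared with the
  value of its integrand at \<open>Q\<close>.\<close>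

lemma w1_le_mix_right:
  assumes PQ: "P \<in> P2" "Q \<in> P2" and w: "w1_le P Q d" and r: "0 \<le> r" "r \<le> 1"
  shows "w1_le (mix_measure r P Q) Q d"
  unfolding w1_le_def
proof (intro allI impI)
  fix f c assume "\<forall>x y. \<bar>f x - f y\<bar> \<le> c * \<bar>x - y :: real\<bar>"
  then have lip: "\<And>x y. \<bar>f x - f y\<bar> \<le> c * \<bar>x - y\<bar>" by blast
  have i: "integrable P f" "integrable Q f" using integrable_lipschitz_P2[OF _ lip] PQ by auto
  have "(\<integral>x. f x \<partial>mix_measure r P Q) - (\<integral>x. f x \<partial>Q) = r * ((\<integral>x. f x \<partial>P) - (\<integral>x. f x \<partial>Q))"
    using integral_mix_measure(2)[OF P2D(2)[OF PQ(1)] P2D(2)[OF PQ(2)] i r] by (simp add: algebra_simps)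
  then have "\<bar>(\<integral>x. f x \<partial>mix_measure r P Q) - (\<integral>x. f x \<partial>Q)\<bar> = r * \<bar>(\<integral>x. f x \<partial>P) - (\<integral>x. f x \<partial>Q)\<bar>"
    using r by (simp add: abs_mult)
  also have "\<dots> \<le> 1 * (c * d)" by (intro mult_mono w1_leD[OF w lip]) (use r in auto)
  finally show "\<bar>(\<integral>x. f x \<partial>mix_measure r P Q) - (\<integral>x. f x \<partial>Q)\<bar> \<le> c * d" by simp
qed

text \<open>An upper bound for \<open>neg_sobolev_dist\<close> at Wasserstein distance
  \<open>d\<close>: characteristic functions differ by at most 2, and by at most
  \<open>2 * \<bar>\<xi>\<bar> * d\<close> since \<open>cos (\<xi> * x)\<close> and
  \<open>sin (\<xi> * x)\<close> are \<open>\<bar>\<xi>\<bar>\<close>-Lipschitz in \<open>x\<close>.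
  The minimum keeps the integral finite for every \<open>lam > 1/2\<close> and lets it vanish with
  \<open>d\<close>.\<close>

definition sobolev_modulus :: "real \<Rightarrow> real \<Rightarrow> real" where
  "sobolev_modulus lam d = sqrt (LBINT \<xi>. (min 2 (2 * \<bar>\<xi>\<bar> * d))\<^sup>2 / (1 + \<xi>\<^sup>2) powr lam)"

text \<open>The function is at most 1 on [-1, 1] and at most
  \<open>\<bar>x\<bar> powr (- 2 * lam)\<close> outside, where the exponent is below -1.\<close>

lemma integrable_inverse_powr:
  fixes lam :: real
  assumes "1 / 2 < lam"
  shows "integrable lborel (\<lambda>\<xi>::real. 1 / (1 + \<xi>\<^sup>2) powr lam)"
proof -
  have "(\<lambda>x::real. x powr (- 2 * lam)) integrable_on {1..}"
    using has_integral_powr_to_inf[of "- 2 * lam" 1] assms by (auto simp: integrable_on_def)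
  then have "(\<lambda>x::real. x powr (- 2 * lam)) absolutely_integrable_on {1..}"
    by (rule nonnegative_absolutely_integrable_1) auto
  then have p: "integrable lborel (\<lambda>x::real. indicator {1..} x * x powr (- 2 * lam))"
    by (simp add: set_integrable_def integrable_completion)
  then have n: "integrable lborel (\<lambda>x::real. indicator {1..} (-x) * (-x) powr (- 2 * lam))"
    using lborel_integrable_real_affine[OF p, of "-1" 0] by simp
  have c: "integrable lborel (\<lambda>x::real. indicator {-1..1} x :: real)"
    by (rule integrable_real_indicator) (auto simp: emeasure_lborel_Icc_eq)
  have ge1: "(1 + x\<^sup>2) powr lam \<ge> 1" for x :: real using assms by (intro ge_one_powr_ge_zero) auto
  show ?thesis
  proof (rule Bochner_Integration.integrable_bound)
    show "integrable lborel (\<lambda>x::real. indicator {-1..1} x + (indicator {1..} x * x powr (- 2 * lam) + indicator {1..} (-x) * (-x) powr (- 2 * lam)))"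
      by (intro Bochner_Integration.integrable_add c p n)
    have "1 / (1 + x\<^sup>2) powr lam \<le> indicator {-1..1} x + (indicator {1..} x * x powr (- 2 * lam) + indicator {1..} (-x) * (-x) powr (- 2 * lam))" for x :: real
    proof (cases "\<bar>x\<bar> \<le> 1")
      case True
      have "1 / (1 + x\<^sup>2) powr lam \<le> 1" using ge1[of x] by (simp add: divide_le_eq)
      then show ?thesis using True by (auto simp: indicator_def abs_le_iff intro: add_increasing2)
    next
      case False
      have "\<bar>x\<bar> powr (2 * lam) = (x\<^sup>2) powr lam"
        using False by (simp add: powr_powr[symmetric] powr_numeral)
      also have "\<dots> \<le> (1 + x\<^sup>2) powr lam" using assms by (intro powr_mono2) auto
      finally have "1 / (1 + x\<^sup>2) powr lam \<le> 1 / \<bar>x\<bar> powr (2 * lam)"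
        using False ge1[of x] by (intro divide_left_mono mult_pos_pos) auto
      also have "\<dots> = \<bar>x\<bar> powr (- 2 * lam)" by (simp add: powr_minus_divide)
      finally show ?thesis using False by (auto simp: indicator_def abs_if split: if_splits)
    qed
    then show "AE x in lborel. norm (1 / (1 + x\<^sup>2) powr lam) \<le> norm (indicator {-1..1} x + (indicator {1..} x * x powr (- 2 * lam) + indicator {1..} (-x) * (-x) powr (- 2 * lam)))"
      by (auto intro: order.trans[OF _ abs_ge_self])
  qed measurable
qed

lemma integrable_sobolev_modulus:
  fixes lam :: real
  assumes "1 / 2 < lam" "0 \<le> d"
  shows "integrable lborel (\<lambda>\<xi>. (min 2 (2 * \<bar>\<xi>\<bar> * d))\<^sup>2 / (1 + \<xi>\<^sup>2) powr lam)"
proof (rule Bochner_Integration.integrable_bound)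
  show "integrable lborel (\<lambda>\<xi>::real. 4 * (1 / (1 + \<xi>\<^sup>2) powr lam))"
    by (intro integrable_mult_right integrable_inverse_powr assms)
  have "(min 2 (2 * \<bar>x\<bar> * d))\<^sup>2 \<le> 2\<^sup>2" for x
    using assms(2) by (intro power_mono) auto
  then show "AE x in lborel. norm ((min 2 (2 * \<bar>x\<bar> * d))\<^sup>2 / (1 + x\<^sup>2) powr lam) \<le> norm (4 * (1 / (1 + x\<^sup>2) powr lam))"
    by (auto intro!: divide_right_mono)
qed measurable

lemma sobolev_modulus_tendsto_0:
  fixes lam :: real
  assumes "1 / 2 < lam" "\<And>n. 0 \<le> d n" "d \<longlonglongrightarrow> 0"
  shows "(\<lambda>n. sobolev_modulus lam (d n)) \<longlonglongrightarrow> 0"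
proof -
  have "(\<lambda>n. LBINT \<xi>. (min 2 (2 * \<bar>\<xi>\<bar> * d n))\<^sup>2 / (1 + \<xi>\<^sup>2) powr lam) \<longlonglongrightarrow> (LBINT \<xi>::real. 0)"
  proof (rule integral_dominated_convergence)
    show "integrable lborel (\<lambda>\<xi>::real. 4 * (1 / (1 + \<xi>\<^sup>2) powr lam))"
      by (intro integrable_mult_right integrable_inverse_powr assms)
    have "(min 2 (2 * \<bar>x\<bar> * d n))\<^sup>2 \<le> 2\<^sup>2" for x n
      using assms(2)[of n] by (intro power_mono) auto
    then show "AE x in lborel. norm ((min 2 (2 * \<bar>x\<bar> * d n))\<^sup>2 / (1 + x\<^sup>2) powr lam) \<le> 4 * (1 / (1 + x\<^sup>2) powr lam)" for n
      by (auto intro!: divide_right_mono)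
    have "(\<lambda>n. (min 2 (2 * \<bar>x\<bar> * d n))\<^sup>2 / (1 + x\<^sup>2) powr lam) \<longlonglongrightarrow> (min 2 (2 * \<bar>x\<bar> * 0))\<^sup>2 / (1 + x\<^sup>2) powr lam" for x
      by (intro tendsto_intros assms(3)) (auto simp: add_nonneg_eq_0_iff)
    then show "AE x in lborel. (\<lambda>n. (min 2 (2 * \<bar>x\<bar> * d n))\<^sup>2 / (1 + x\<^sup>2) powr lam) \<longlonglongrightarrow> 0" by simp
  qed measurable
  then show ?thesis unfolding sobolev_modulus_def using tendsto_real_sqrt by force
qed

lemma neg_sobolev_dist_le_modulus:
  fixes lam :: real
  assumes "1 / 2 < lam" and PQ: "P \<in> P2" "Q \<in> P2" and w: "w1_le P Q d"
  shows "neg_sobolev_dist lam P Q \<le> sobolev_modulus lam d"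
proof -
  have d: "0 \<le> d" by (rule w1_le_nonneg[OF w])
  interpret P: real_distribution P using PQ by (simp add: P2_def)
  interpret Q: real_distribution Q using PQ by (simp add: P2_def)
  have le: "norm (char P \<xi> - char Q \<xi>) \<le> min 2 (2 * \<bar>\<xi>\<bar> * d)" for \<xi>
  proof -
    have i: "integrable M (\<lambda>x. iexp (\<xi> * x))" if "M \<in> P2" for M
    proof -
      interpret real_distribution M using that by (simp add: P2_def)
      show ?thesis by (rule integrable_const_bound[of _ 1]) auto
    qed
    have Re: "Re (char M \<xi>) = (\<integral>x. cos (\<xi> * x) \<partial>M)" and Im: "Im (char M \<xi>) = (\<integral>x. sin (\<xi> * x) \<partial>M)" if "M \<in> P2" for M
      unfolding char_def using integral_Re[OF i[OF that]] integral_Im[OF i[OF that]]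
      by (simp_all add: Re_exp Im_exp)
    have "\<bar>cos a - cos b\<bar> \<le> \<bar>a - b\<bar>" "\<bar>sin a - sin b\<bar> \<le> \<bar>a - b\<bar>" for a b :: real
      using DERIV_bounded_imp_lipschitz[of cos "\<lambda>x. - sin x" 1 a b] DERIV_bounded_imp_lipschitz[of sin cos 1 a b]
      by (auto intro!: derivative_eq_intros)
    from this[of "\<xi> * x" "\<xi> * y" for x y] have "\<bar>cos (\<xi> * x) - cos (\<xi> * y)\<bar> \<le> \<bar>\<xi>\<bar> * \<bar>x - y\<bar>" "\<bar>sin (\<xi> * x) - sin (\<xi> * y)\<bar> \<le> \<bar>\<xi>\<bar> * \<bar>x - y\<bar>" for x y
      by (metis abs_mult right_diff_distrib)+
    then have "\<bar>Re (char P \<xi> - char Q \<xi>)\<bar> \<le> \<bar>\<xi>\<bar> * d" "\<bar>Im (char P \<xi> - char Q \<xi>)\<bar> \<le> \<bar>\<xi>\<bar> * d"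
      using w1_leD[OF w, of "\<lambda>x. cos (\<xi> * x)" "\<bar>\<xi>\<bar>"] w1_leD[OF w, of "\<lambda>x. sin (\<xi> * x)" "\<bar>\<xi>\<bar>"]
      by (simp_all add: Re Im PQ)
    then have "norm (char P \<xi> - char Q \<xi>) \<le> 2 * \<bar>\<xi>\<bar> * d"
      using cmod_le[of "char P \<xi> - char Q \<xi>"] by linarith
    moreover have "norm (char P \<xi> - char Q \<xi>) \<le> 2"
      using norm_triangle_ineq4[of "char P \<xi>" "char Q \<xi>"] P.cmod_char_le_1[of \<xi>] Q.cmod_char_le_1[of \<xi>] by linarith
    ultimately show ?thesis by simp
  qed
  have [measurable]: "char P \<in> borel_measurable borel" "char Q \<in> borel_measurable borel"
    by (intro borel_measurable_continuous_onI continuous_at_imp_continuous_on ballI P.isCont_char Q.isCont_char)+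
  have fl: "(norm (fourier P \<xi> - fourier Q \<xi>))\<^sup>2 \<le> (min 2 (2 * \<bar>\<xi>\<bar> * d))\<^sup>2" for \<xi>
  proof (rule power_mono)
    have "fourier P \<xi> - fourier Q \<xi> = (char P \<xi> - char Q \<xi>) / of_real (sqrt (2 * pi))"
      by (simp add: fourier_def diff_divide_distrib)
    then have "norm (fourier P \<xi> - fourier Q \<xi>) = norm (char P \<xi> - char Q \<xi>) / sqrt (2 * pi)"
      by (simp add: norm_divide)
    also have "\<dots> \<le> norm (char P \<xi> - char Q \<xi>)"
    proof -
      have "sqrt (2 * pi) \<ge> 1" using pi_ge_two by (simp add: real_le_rsqrt)
      then show ?thesis using divide_left_mono[of 1 "sqrt (2 * pi)" "norm (char P \<xi> - char Q \<xi>)"] by simp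
    qed
    finally show "norm (fourier P \<xi> - fourier Q \<xi>) \<le> min 2 (2 * \<bar>\<xi>\<bar> * d)" using le order.trans by blast
  qed simp
  have i: "integrable lborel (\<lambda>\<xi>. (norm (fourier P \<xi> - fourier Q \<xi>))\<^sup>2 / (1 + \<xi>\<^sup>2) powr lam)"
    by (rule Bochner_Integration.integrable_bound[OF integrable_sobolev_modulus[OF assms(1) d]])
      (use fl in \<open>auto intro!: divide_right_mono simp: fourier_def\<close>)
  show ?thesis
    unfolding neg_sobolev_dist_def sobolev_modulus_def
    by (intro real_sqrt_le_mono integral_mono i integrable_sobolev_modulus[OF assms(1) d] divide_right_mono fl) simp
qed

section \<open>Linear nonlocal equations\<close>

text \<open>Both \<open>g - f\<close> and \<open>g + f\<close> are nondecreasing.\<close>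

lemma abs_diff_le_if_deriv_le:
  fixes f g :: "real \<Rightarrow> real"
  assumes f: "\<And>t. t \<in> {0..T} \<Longrightarrow> (f has_real_derivative f' t) (at t within {0..T})"
    and g: "\<And>t. t \<in> {0..T} \<Longrightarrow> (g has_real_derivative g' t) (at t within {0..T})"
    and le: "\<And>t. t \<in> {0..T} \<Longrightarrow> \<bar>f' t\<bar> \<le> g' t" and t: "t \<in> {0..T}"
  shows "\<bar>f t - f 0\<bar> \<le> g t - g 0"
proof -
  have mono: "h 0 \<le> h t" if h: "\<And>t. t \<in> {0..T} \<Longrightarrow> (h has_real_derivative h' t) (at t within {0..T})"
    and h0: "\<And>t. t \<in> {0..T} \<Longrightarrow> 0 \<le> h' t" for h h' :: "real \<Rightarrow> real"
  proof (rule DERIV_nonneg_imp_increasing_open[of 0 t h])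
    show "0 \<le> t" using t by simp
    have "continuous_on {0..T} h"
      using h by (meson DERIV_continuous continuous_on_eq_continuous_within)
    then show "continuous_on {0..t} h" by (rule continuous_on_subset) (use t in auto)
    fix s assume "0 < s" "s < t"
    then have "s \<in> {0<..<T}" "s \<in> {0..T}" using t by auto
    then have "(h has_real_derivative h' s) (at s)"
      using h[of s] by (simp add: at_within_Icc_at)
    then show "\<exists>y. (h has_real_derivative y) (at s) \<and> 0 \<le> y" using h0 \<open>s \<in> {0..T}\<close> by blast
  qed
  have "g 0 - f 0 \<le> g t - f t"
  proof (rule mono)
    show "((\<lambda>t. g t - f t) has_real_derivative g' t - f' t) (at t within {0..T})" if "t \<in> {0..T}" for t
      using f[OF that] g[OF that] by (auto intro!: derivative_eq_intros)
    show "0 \<le> g' t - f' t" if "t \<in> {0..T}" for t using le[OF that] by linarith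
  qed
  moreover have "g 0 + f 0 \<le> g t + f t"
  proof (rule mono)
    show "((\<lambda>t. g t + f t) has_real_derivative g' t + f' t) (at t within {0..T})" if "t \<in> {0..T}" for t
      using f[OF that] g[OF that] by (auto intro!: derivative_eq_intros)
    show "0 \<le> g' t + f' t" if "t \<in> {0..T}" for t using le[OF that] by linarith
  qed
  ultimately show ?thesis by linarith
qed

text \<open>Any bound \<open>N exp (2bt)\<close> on the whole family improves to \<open>(A + aT + N/2) exp (2bt)\<close>; the best such
  \<open>N\<close> is thus at most \<open>2 (A + aT)\<close>. No measurability of the supremum over the index is needed.\<close>

lemma sup_gronwall:
  fixes e e' :: "'i \<Rightarrow> real \<Rightarrow> real"
  assumes e0: "\<And>i. i \<in> I \<Longrightarrow> \<bar>e i 0\<bar> \<le> A"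
    and D: "\<And>i t. i \<in> I \<Longrightarrow> t \<in> {0..T} \<Longrightarrow> (e i has_real_derivative e' i t) (at t within {0..T})"
    and M: "\<And>i t. i \<in> I \<Longrightarrow> t \<in> {0..T} \<Longrightarrow> \<bar>e i t\<bar> \<le> M"
    and le: "\<And>i t B. i \<in> I \<Longrightarrow> t \<in> {0..T} \<Longrightarrow> (\<And>j. j \<in> I \<Longrightarrow> \<bar>e j t\<bar> \<le> B) \<Longrightarrow> \<bar>e' i t\<bar> \<le> a + b * B"
    and nonneg: "0 \<le> a" "0 < b" and it: "i \<in> I" "t \<in> {0..T}"
  shows "\<bar>e i t\<bar> \<le> 2 * (A + a * T) * exp (2 * b * t)"
proof -
  \<comment> \<open>The rate \<open>2 * b\<close> of the weight is chosen so that integrating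
    \<open>b * N * exp (2 * b * s)\<close> returns only half of \<open>N\<close>.\<close>
  define X where "X = {\<bar>e j s\<bar> * exp (- 2 * b * s) |j s. j \<in> I \<and> s \<in> {0..T}}"
  define N where "N = Sup X"
  have "T \<ge> 0" using it by auto
  have "M \<ge> 0" using M[OF it] by linarith
  have A: "A \<ge> 0" using e0[OF it(1)] by linarith
  have "bdd_above X"
  proof (rule bdd_aboveI[of _ M])
    fix x assume "x \<in> X"
    then obtain j s where js: "x = \<bar>e j s\<bar> * exp (- 2 * b * s)" "j \<in> I" "s \<in> {0..T}" by (auto simp: X_def)
    have "x \<le> M * 1" unfolding js using js nonneg M[OF js(2,3)] \<open>M \<ge> 0\<close> by (intro mult_mono) auto
    then show "x \<le> M" by simp
  qed
  have N: "\<bar>e j s\<bar> \<le> N * exp (2 * b * s)" if "j \<in> I" "s \<in> {0..T}" for j s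
  proof -
    have "\<bar>e j s\<bar> * exp (- 2 * b * s) \<le> N"
      unfolding N_def by (rule cSup_upper[OF _ \<open>bdd_above X\<close>]) (use that in \<open>auto simp: X_def\<close>)
    then have "\<bar>e j s\<bar> * exp (- 2 * b * s) * exp (2 * b * s) \<le> N * exp (2 * b * s)" by (rule mult_right_mono) simp
    then show ?thesis by (simp add: mult.assoc flip: exp_add)
  qed
  have better: "\<bar>e j s\<bar> \<le> A + a * s + N / 2 * (exp (2 * b * s) - 1)" if "j \<in> I" "s \<in> {0..T}" for j s
  proof -
    have "\<bar>e j s - e j 0\<bar> \<le> (a * s + N / 2 * exp (2 * b * s)) - (a * 0 + N / 2 * exp (2 * b * 0))"
    proof (rule abs_diff_le_if_deriv_le[OF D[OF that(1)] _ _ that(2)])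
      fix s assume s: "s \<in> {0..T}"
      show "((\<lambda>s. a * s + N / 2 * exp (2 * b * s)) has_real_derivative a + b * (N * exp (2 * b * s))) (at s within {0..T})"
        by (auto intro!: derivative_eq_intros)
      show "\<bar>e' j s\<bar> \<le> a + b * (N * exp (2 * b * s))"
        using N s by (intro le that) auto
    qed auto
    then show ?thesis using e0[OF that(1)] by (simp add: right_diff_distrib)
  qed
  have "N \<ge> 0"
    using N[OF it] by (metis abs_ge_zero exp_gt_zero order.trans zero_le_mult_iff not_le)
  have "N \<le> A + a * T + N / 2"
    unfolding N_def
  proof (rule cSup_least)
    show "X \<noteq> {}" using it by (auto simp: X_def)
    fix x assume "x \<in> X"
    then obtain j s where js: "x = \<bar>e j s\<bar> * exp (- 2 * b * s)" "j \<in> I" "s \<in> {0..T}" by (auto simp: X_def)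
    have e1: "exp (- 2 * b * s) \<le> 1" "exp (2 * b * s) * exp (- 2 * b * s) = 1" using js nonneg by (auto simp flip: exp_add)
    have "x \<le> (A + a * s + N / 2 * exp (2 * b * s)) * exp (- 2 * b * s)"
      unfolding js(1) using better[OF js(2,3)] \<open>N \<ge> 0\<close> by (intro mult_right_mono) (auto simp: right_diff_distrib)
    also have "\<dots> = (A + a * s) * exp (- 2 * b * s) + N / 2 * (exp (2 * b * s) * exp (- 2 * b * s))"
      by (simp add: algebra_simps)
    also have "\<dots> \<le> (A + a * T) * 1 + N / 2"
      unfolding e1 using e1 js nonneg A \<open>T \<ge> 0\<close> by (intro add_mono mult_mono) (auto intro: mult_left_mono)
    finally show "x \<le> A + a * T + Sup X / 2" by (simp add: N_def)
  qed
  then have "N \<le> 2 * (A + a * T)" by simp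
  then have "N * exp (2 * b * t) \<le> 2 * (A + a * T) * exp (2 * b * t)" by (rule mult_right_mono) simp
  then show ?thesis using N[OF it] by linarith
qed

lemma continuous_on_integral_param:
  fixes f :: "'a::metric_space \<Rightarrow> 'b \<Rightarrow> real"
  assumes c: "\<And>z. z \<in> space M \<Longrightarrow> continuous_on A (\<lambda>p. f p z)" and m: "\<And>p. p \<in> A \<Longrightarrow> f p \<in> borel_measurable M"
    and w: "integrable M w" "\<And>p z. p \<in> A \<Longrightarrow> z \<in> space M \<Longrightarrow> \<bar>f p z\<bar> \<le> w z"
  shows "continuous_on A (\<lambda>p. \<integral>z. f p z \<partial>M)"
  unfolding continuous_on_sequentially
proof (intro allI impI ballI)
  fix x p assume p: "p \<in> A" and x: "(\<forall>n. x n \<in> A) \<and> x \<longlonglongrightarrow> p"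
  have "(\<lambda>n. \<integral>z. f (x n) z \<partial>M) \<longlonglongrightarrow> (\<integral>z. f p z \<partial>M)"
  proof (rule integral_dominated_convergence[OF _ _ w(1)])
    show "AE z in M. (\<lambda>n. f (x n) z) \<longlonglongrightarrow> f p z"
    proof (rule AE_I2)
      fix z assume "z \<in> space M"
      from c[OF this] p x show "(\<lambda>n. f (x n) z) \<longlonglongrightarrow> f p z"
        unfolding continuous_on_sequentially comp_def by blast
    qed
  qed (use w(2) m p x in auto)
  then show "((\<lambda>p. \<integral>z. f p z \<partial>M) \<circ> x) \<longlonglongrightarrow> (\<integral>z. f p z \<partial>M)" by (simp add: comp_def)
qed

text \<open>Boundedness is part of the notion because \<open>sup_gronwall\<close> starts from an a
  priori bound; joint continuity makes the integral over \<open>z\<close> meaningful and continuous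
  in time.\<close>

definition lin_sol :: "real measure \<Rightarrow> real \<Rightarrow> (real \<Rightarrow> real \<Rightarrow> real) \<Rightarrow> (real \<Rightarrow> real \<Rightarrow> real \<Rightarrow> real) \<Rightarrow>
    (real \<Rightarrow> real \<Rightarrow> real) \<Rightarrow> (real \<Rightarrow> real \<Rightarrow> real) \<Rightarrow> bool" where
  "lin_sol \<mu> T a K S U \<longleftrightarrow> (\<forall>x. U x 0 = 0) \<and> continuous_on (UNIV \<times> {0..T}) (\<lambda>(x, t). U x t) \<and>
     (\<exists>M. \<forall>x. \<forall>t\<in>{0..T}. \<bar>U x t\<bar> \<le> M) \<and>
     (\<forall>x. \<forall>t\<in>{0..T}. (U x has_real_derivative a x t * U x t + S x t + (\<integral>z. K x z t * U z t \<partial>\<mu>)) (at t within {0..T}))"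

text \<open>The coefficients are given for all times, although solutions live on [0, T], so that the
  fixed point can be sought among functions on the whole plane.\<close>

locale lin_eq =
  fixes \<mu> :: "real measure" and T :: real and a :: "real \<Rightarrow> real \<Rightarrow> real" and K :: "real \<Rightarrow> real \<Rightarrow> real \<Rightarrow> real" and b :: real
  assumes \<mu>: "\<mu> \<in> P2" and T: "0 < T" and b: "0 < b"
    and a_cont: "continuous_on UNIV (\<lambda>(x, t). a x t)" and a_bound: "\<And>x t. \<bar>a x t\<bar> \<le> b"
    and K_cont: "continuous_on UNIV (\<lambda>(x, z, t). K x z t)" and K_bound: "\<And>x z t. \<bar>K x z t\<bar> \<le> b"
begin

lemma K_cont_z: "continuous_on UNIV (\<lambda>z. K x z t)"
  by (rule continuous_on_compose2[OF K_cont, of UNIV "\<lambda>z. (x, z, t)", simplified]) (intro continuous_intros)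

lemma KU_integral_bound:
  assumes "u \<in> borel_measurable borel" "\<And>z. \<bar>u z\<bar> \<le> M"
  shows "\<bar>\<integral>z. K x z t * u z \<partial>\<mu>\<bar> \<le> b * M" "integrable \<mu> (\<lambda>z. K x z t * u z)"
proof -
  have [measurable]: "(\<lambda>z. K x z t) \<in> borel_measurable borel" "u \<in> borel_measurable borel"
    using borel_measurable_continuous_onI[OF K_cont_z] assms by auto
  have le: "\<bar>K x z t * u z\<bar> \<le> b * M" for z
    unfolding abs_mult using K_bound b assms(2) by (intro mult_mono) auto
  show "\<bar>\<integral>z. K x z t * u z \<partial>\<mu>\<bar> \<le> b * M" by (rule integral_P2_bound[OF \<mu> _ le]) measurable
  show "integrable \<mu> (\<lambda>z. K x z t * u z)" by (rule integrable_bounded_P2[OF \<mu> _ le]) measurable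
qed

lemma KU_integral_continuous:
  assumes V: "continuous_on (UNIV \<times> A) (\<lambda>(z, t). V z t)" and M: "\<And>z t. t \<in> A \<Longrightarrow> \<bar>V z t\<bar> \<le> M"
  shows "continuous_on (UNIV \<times> A) (\<lambda>(x, t). \<integral>z. K x z t * V z t \<partial>\<mu>)"
proof -
  interpret prob_space \<mu> using P2D[OF \<mu>] by blast
  have "continuous_on (UNIV \<times> A) (\<lambda>p. \<integral>z. K (fst p) z (snd p) * V z (snd p) \<partial>\<mu>)"
  proof (rule continuous_on_integral_param)
    show "continuous_on (UNIV \<times> A) (\<lambda>p. K (fst p) z (snd p) * V z (snd p))" for z
      by (intro continuous_on_mult
          continuous_on_compose2[OF K_cont, of "UNIV \<times> A" "\<lambda>p. (fst p, z, snd p)", simplified]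
          continuous_on_compose2[OF V, of "UNIV \<times> A" "\<lambda>p. (z, snd p)", simplified] continuous_intros) auto
    show "(\<lambda>z. K (fst p) z (snd p) * V z (snd p)) \<in> borel_measurable \<mu>" if "p \<in> UNIV \<times> A" for p
    proof (rule P2_measurable[OF \<mu>], rule borel_measurable_continuous_onI)
      show "continuous_on UNIV (\<lambda>z. K (fst p) z (snd p) * V z (snd p))"
        using that by (intro continuous_on_mult K_cont_z
          continuous_on_compose2[OF V, of UNIV "\<lambda>z. (z, snd p)", simplified] continuous_intros) auto
    qed
    show "integrable \<mu> (\<lambda>z. b * M)" by simp
    show "\<bar>K (fst p) z (snd p) * V z (snd p)\<bar> \<le> b * M" if "p \<in> UNIV \<times> A" for p z
      unfolding abs_mult using K_bound b M that by (intro mult_mono) auto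
  qed
  then show ?thesis by (simp add: case_prod_unfold)
qed

text \<open>Banach's fixed point theorem for \<open>V = exp (- l * t) * U\<close>: the exponential
  weight makes the integral operator a contraction on the whole of [0, T] at once.\<close>

lemma lin_sol_exists:
  assumes S_cont: "continuous_on (UNIV \<times> {0..T}) (\<lambda>(x, t). S x t)" and S_bound: "\<And>x t. t \<in> {0..T} \<Longrightarrow> \<bar>S x t\<bar> \<le> s"
  shows "\<exists>U. lin_sol \<mu> T a K S U"
proof -
  \<comment> \<open>The local and the nonlocal coefficient contribute \<open>2 * b\<close> together,
    so this choice gives the contraction factor \<open>2 * b / l = 1/2\<close>.\<close>
  define l where "l = 4 * b"
  \<comment> \<open>The source is controlled on [0, T] only, so time is clamped to this
    interval.\<close>
  define c where "c = (\<lambda>t. max 0 (min T t))"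
  have c: "c t \<in> {0..T}" for t using T by (auto simp: c_def)
  have c_id: "c t = t" if "t \<in> {0..T}" for t using that by (auto simp: c_def)
  have cr: "c t * r \<in> {0..T}" if "r \<in> {0..1}" for t r
    using c[of t] that mult_mono[of "c t" T r 1] by auto
  have c_cont: "continuous_on A (\<lambda>x. c (f x))" if "continuous_on A f" for A and f :: "_ \<Rightarrow> real"
    unfolding c_def by (intro continuous_intros that)
  have S'_cont: "continuous_on UNIV (\<lambda>(x, t). S x (c t))"
    unfolding case_prod_unfold
    by (rule continuous_on_compose2[OF S_cont, of UNIV "\<lambda>p. (fst p, c (snd p))", simplified])
      (use c in \<open>auto intro!: continuous_intros c_cont\<close>)
  define H where "H = (\<lambda>(V :: (real \<times> real) \<Rightarrow>\<^sub>C real) x t.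
     exp (l * t) * (a x t * V (x, t) + (\<integral>z. K x z t * V (z, t) \<partial>\<mu>)) + S x (c t))"
  \<comment> \<open>The integral over \<open>{0..c t}\<close> rescaled to \<open>{0..1}\<close>:
    with a fixed domain, joint continuity in \<open>x\<close> and \<open>t\<close> is continuity of
    a parameter integral.\<close>
  define J where "J = (\<lambda>V x t. integral {0..1} (\<lambda>r. c t * H V x (c t * r)))"
  have V_bound: "\<exists>M. \<forall>p. \<bar>apply_bcontfun V p\<bar> \<le> M" for V :: "(real \<times> real) \<Rightarrow>\<^sub>C real"
    using bounded_apply_bcontfun[of V] by (auto simp: bounded_real)
  have V_cont: "continuous_on A (\<lambda>x. apply_bcontfun V (f x))" if "continuous_on A f" for V :: "(real \<times> real) \<Rightarrow>\<^sub>C real" and A and f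
    by (rule continuous_on_compose2[OF continuous_on_apply_bcontfun[of UNIV V] that]) simp
  have V_meas: "(\<lambda>z. apply_bcontfun V (z, t)) \<in> borel_measurable borel" for V :: "(real \<times> real) \<Rightarrow>\<^sub>C real" and t
    by (intro borel_measurable_continuous_onI V_cont continuous_intros)
  have H_cont: "continuous_on UNIV (\<lambda>(x, t). H V x t)" for V
  proof -
    obtain M where M: "\<And>p. \<bar>apply_bcontfun V p\<bar> \<le> M" using V_bound by blast
    have "continuous_on (UNIV \<times> UNIV) (\<lambda>(x, t). \<integral>z. K x z t * V (z, t) \<partial>\<mu>)"
      by (rule KU_integral_continuous[of UNIV "\<lambda>z t. V (z, t)" M]) (auto simp: M)
    then show ?thesis
      using a_cont S'_cont continuous_on_apply_bcontfun[of UNIV V]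
      unfolding H_def case_prod_unfold by (auto intro!: continuous_intros)
  qed
  have H_bound: "\<bar>H V x t\<bar> \<le> exp (l * T) * (2 * b * M) + s" if M: "\<And>p. \<bar>apply_bcontfun V p\<bar> \<le> M" and t: "t \<in> {0..T}" for V x t M
  proof -
    have "M \<ge> 0" using M[of "(0, 0)"] by linarith
    have "\<bar>a x t * V (x, t)\<bar> \<le> b * M" unfolding abs_mult using a_bound M b by (intro mult_mono) auto
    moreover have "\<bar>\<integral>z. K x z t * V (z, t) \<partial>\<mu>\<bar> \<le> b * M" by (rule KU_integral_bound[OF V_meas M])
    ultimately have "\<bar>a x t * V (x, t) + (\<integral>z. K x z t * V (z, t) \<partial>\<mu>)\<bar> \<le> 2 * b * M" by linarith
    moreover have "exp (l * t) \<le> exp (l * T)" using t b by (simp add: l_def)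
    ultimately have "\<bar>exp (l * t) * (a x t * V (x, t) + (\<integral>z. K x z t * V (z, t) \<partial>\<mu>))\<bar> \<le> exp (l * T) * (2 * b * M)"
      unfolding abs_mult by (intro mult_mono) auto
    moreover have "\<bar>S x (c t)\<bar> \<le> s" using S_bound c by blast
    ultimately show ?thesis unfolding H_def by linarith
  qed
  have r_cont: "continuous_on {0..1} (\<lambda>r. c t * H V x (c t * r))" for V x t
    by (intro continuous_intros continuous_on_compose2[OF H_cont, of _ "\<lambda>r. (x, c t * r)", simplified])
  have r_int: "(\<lambda>r. c t * H V x (c t * r)) integrable_on {0..1}" for V x t
    by (rule integrable_continuous_interval[OF r_cont])
  have J_cont: "continuous_on UNIV (\<lambda>(x, t). J V x t)" for V
  proof -
    have "continuous_on UNIV (\<lambda>p. integral (cbox 0 1) (\<lambda>r. c (snd p) * H V (fst p) (c (snd p) * r)))"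
    proof (rule integral_continuous_on_param)
      show "continuous_on (UNIV \<times> cbox 0 1) (\<lambda>(p, r). c (snd p) * H V (fst p) (c (snd p) * r))"
        unfolding case_prod_unfold
        by (intro continuous_intros c_cont continuous_on_compose2[OF H_cont, of _ "\<lambda>q. (fst (fst q), c (snd (fst q)) * snd q)", simplified case_prod_unfold fst_conv snd_conv]) auto
    qed
    then show ?thesis unfolding J_def case_prod_unfold by simp
  qed
  have J_bound: "\<bar>J V x t\<bar> \<le> T * (exp (l * T) * (2 * b * M) + s)" if M: "\<And>p. \<bar>apply_bcontfun V p\<bar> \<le> M" for V x t M
  proof -
    have "\<bar>J V x t\<bar> \<le> T * (exp (l * T) * (2 * b * M) + s) * (1 - 0)"
      unfolding J_def real_norm_def[symmetric]
    proof (rule integral_bound[OF _ r_cont])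
      fix r :: real assume r: "r \<in> {0..1}"
      show "norm (c t * H V x (c t * r)) \<le> T * (exp (l * T) * (2 * b * M) + s)"
        unfolding real_norm_def abs_mult using c[of t] H_bound[OF M cr[OF r]] T by (intro mult_mono) auto
    qed simp
    then show ?thesis by simp
  qed
  define \<Phi> where "\<Phi> = (\<lambda>V. Bcontfun (\<lambda>(x, t). exp (- l * c t) * J V x t))"
  have \<Phi>: "apply_bcontfun (\<Phi> V) (x, t) = exp (- l * c t) * J V x t" for V x t
  proof -
    obtain M where M: "\<And>p. \<bar>apply_bcontfun V p\<bar> \<le> M" using V_bound by blast
    have "(\<lambda>(x, t). exp (- l * c t) * J V x t) \<in> bcontfun"
      unfolding bcontfun_def
    proof (intro CollectI conjI)
      show "continuous_on UNIV (\<lambda>(x, t). exp (- l * c t) * J V x t)"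
        using J_cont[of V] unfolding case_prod_unfold by (auto intro!: continuous_intros c_cont)
      have "\<bar>exp (- l * c t) * J V x t\<bar> \<le> 1 * (T * (exp (l * T) * (2 * b * M) + s))" for x t
        unfolding abs_mult using J_bound[OF M] c[of t] b by (intro mult_mono) (auto simp: l_def)
      then show "bounded (range (\<lambda>(x, t). exp (- l * c t) * J V x t))"
        by (auto simp: bounded_real)
    qed
    then show ?thesis by (simp add: \<Phi>_def Bcontfun_inverse)
  qed
  have "\<exists>!V. \<Phi> V = V"
  proof (rule banach_fix_type[of "1/2"])
    show "\<forall>V W. dist (\<Phi> V) (\<Phi> W) \<le> 1 / 2 * dist V W"
    proof (intro allI dist_bound)
      fix V W :: "(real \<times> real) \<Rightarrow>\<^sub>C real" and p :: "real \<times> real"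
      obtain x t where p: "p = (x, t)" by (cases p)
      define d where "d = dist V W"
      have d: "\<bar>apply_bcontfun V q - W q\<bar> \<le> d" for q
        using dist_bounded[of V q W] by (simp add: d_def dist_real_def)
      have "d \<ge> 0" by (simp add: d_def)
      have Hd: "\<bar>H V x r - H W x r\<bar> \<le> exp (l * r) * (2 * b * d)" for r
      proof -
        obtain M where M: "\<And>p. \<bar>apply_bcontfun V p\<bar> \<le> M" using V_bound by blast
        obtain M' where M': "\<And>p. \<bar>apply_bcontfun W p\<bar> \<le> M'" using V_bound by blast
        have "(\<integral>z. K x z r * V (z, r) \<partial>\<mu>) - (\<integral>z. K x z r * W (z, r) \<partial>\<mu>) = (\<integral>z. K x z r * V (z, r) - K x z r * W (z, r) \<partial>\<mu>)"
          by (intro Bochner_Integration.integral_diff[symmetric] KU_integral_bound(2)[OF V_meas M] KU_integral_bound(2)[OF V_meas M'])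
        also have "\<dots> = (\<integral>z. K x z r * (V (z, r) - W (z, r)) \<partial>\<mu>)" by (simp add: right_diff_distrib)
        also have "\<bar>\<dots>\<bar> \<le> b * d" using d by (intro KU_integral_bound(1) borel_measurable_diff V_meas)
        finally have k: "\<bar>(\<integral>z. K x z r * V (z, r) \<partial>\<mu>) - (\<integral>z. K x z r * W (z, r) \<partial>\<mu>)\<bar> \<le> b * d" .
        have "\<bar>a x r * (V (x, r) - W (x, r))\<bar> \<le> b * d"
          unfolding abs_mult using a_bound d b by (intro mult_mono) auto
        then have "\<bar>a x r * (V (x, r) - W (x, r)) + ((\<integral>z. K x z r * V (z, r) \<partial>\<mu>) - (\<integral>z. K x z r * W (z, r) \<partial>\<mu>))\<bar> \<le> 2 * b * d"
          using k by linarith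
        moreover have "H V x r - H W x r = exp (l * r) * (a x r * (V (x, r) - W (x, r)) + ((\<integral>z. K x z r * V (z, r) \<partial>\<mu>) - (\<integral>z. K x z r * W (z, r) \<partial>\<mu>)))"
          by (simp add: H_def algebra_simps)
        ultimately show ?thesis by (simp add: abs_mult)
      qed
      have e_int: "((\<lambda>r. c t * (exp (l * (c t * r)) * (2 * b * d))) has_integral
          (exp (l * (c t * 1)) * (2 * b * d / l) - exp (l * (c t * 0)) * (2 * b * d / l))) {0..1}"
        using b by (intro fundamental_theorem_of_calculus)
          (auto intro!: derivative_eq_intros simp: l_def simp flip: has_real_derivative_iff_has_vector_derivative)
      have J_diff: "J V x t - J W x t = integral {0..1} (\<lambda>r. c t * H V x (c t * r) - c t * H W x (c t * r))"
        unfolding J_def by (rule integral_diff[symmetric, OF r_int r_int])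
      have "\<bar>J V x t - J W x t\<bar> \<le> integral {0..1} (\<lambda>r. c t * (exp (l * (c t * r)) * (2 * b * d)))"
        unfolding J_diff real_norm_def[symmetric]
      proof (rule integral_norm_bound_integral)
        fix r :: real assume "r \<in> {0..1}"
        have "\<bar>c t * (H V x (c t * r) - H W x (c t * r))\<bar> \<le> c t * (exp (l * (c t * r)) * (2 * b * d))"
          unfolding abs_mult using c[of t] Hd by (intro mult_mono) auto
        then show "norm (c t * H V x (c t * r) - c t * H W x (c t * r)) \<le> c t * (exp (l * (c t * r)) * (2 * b * d))"
          by (simp add: right_diff_distrib)
      qed (use e_int in \<open>auto intro!: integrable_diff r_int\<close>)
      also have "\<dots> = (exp (l * c t) - 1) * (2 * b * d / l)"
        unfolding integral_unique[OF e_int] by (simp add: left_diff_distrib diff_divide_distrib)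
      also have "\<dots> \<le> exp (l * c t) * (1 / 2 * d)"
        using b \<open>d \<ge> 0\<close> by (simp add: l_def left_diff_distrib)
      finally have "exp (- l * c t) * \<bar>J V x t - J W x t\<bar> \<le> exp (- l * c t) * (exp (l * c t) * (1 / 2 * d))"
        by (rule mult_left_mono) simp
      also have "\<dots> = 1 / 2 * d" by (simp flip: mult.assoc exp_add)
      finally show "dist (apply_bcontfun (\<Phi> V) p) (apply_bcontfun (\<Phi> W) p) \<le> 1 / 2 * dist V W"
        unfolding p \<Phi> dist_real_def right_diff_distrib[symmetric] abs_mult by (simp add: d_def)
    qed
  qed auto
  then obtain V where V: "\<Phi> V = V" by blast
  obtain M where M: "\<And>p. \<bar>apply_bcontfun V p\<bar> \<le> M" using V_bound by blast
  define U where "U = (\<lambda>x t. J V x t)"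
  have UV: "U x t = exp (l * c t) * V (x, t)" for x t
  proof -
    have "V (x, t) = exp (- l * c t) * J V x t" using \<Phi>[of V x t] V by simp
    then show ?thesis by (simp add: U_def flip: mult.assoc exp_add)
  qed
  \<comment> \<open>The rescaling is undone on [0, T], so that the fixed point satisfies the usual
    integral equation and can be differentiated in time.\<close>
  have J_eq: "J V x t = integral {0..t} (H V x)" if t: "t \<in> {0..T}" for x t
  proof -
    have cH: "continuous_on {0..T} (H V x)"
      by (rule continuous_on_compose2[OF H_cont, of _ "\<lambda>t. (x, t)", simplified]) (auto intro!: continuous_intros)
    have "((\<lambda>r. t * H V x (t * r)) has_integral (integral {0..t * 1} (H V x) - integral {0..t * 0} (H V x))) {0..1}"
    proof (rule fundamental_theorem_of_calculus)
      fix r :: real assume r: "r \<in> {0..1}"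
      have m: "t * r' \<in> {0..T}" if "r' \<in> {0..1}" for r' using t that mult_mono[of t T r' 1] by auto
      have "((\<lambda>t. integral {0..t} (H V x)) has_real_derivative H V x (t * r)) (at (t * r) within {0..T})"
        by (rule integral_has_real_derivative[OF cH m[OF r]])
      then have "((\<lambda>t. integral {0..t} (H V x)) has_real_derivative H V x (t * r)) (at (t * r) within (\<lambda>r. t * r) ` {0..1})"
        by (rule DERIV_subset) (use m in blast)
      moreover have "((\<lambda>r. t * r) has_real_derivative t) (at r within {0..1})"
        by (auto intro!: derivative_eq_intros)
      ultimately have "((\<lambda>t. integral {0..t} (H V x)) \<circ> (\<lambda>r. t * r) has_real_derivative H V x (t * r) * t) (at r within {0..1})"
        by (rule DERIV_image_chain)
      then show "((\<lambda>r. integral {0..t * r} (H V x)) has_vector_derivative t * H V x (t * r)) (at r within {0..1})"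
        by (simp add: comp_def mult.commute has_real_derivative_iff_has_vector_derivative)
    qed simp
    then have "integral {0..1} (\<lambda>r. t * H V x (t * r)) = integral {0..t * 1} (H V x) - integral {0..t * 0} (H V x)"
      by (rule integral_unique)
    then show ?thesis by (simp add: J_def c_id[OF t] del: integral_mult_right)
  qed
  have "lin_sol \<mu> T a K S U"
    unfolding lin_sol_def
  proof (intro conjI allI ballI)
    show "U x 0 = 0" for x using T by (simp add: U_def J_eq)
    show "continuous_on (UNIV \<times> {0..T}) (\<lambda>(x, t). U x t)"
      unfolding U_def by (rule continuous_on_subset[OF J_cont]) simp
    show "\<exists>M. \<forall>x. \<forall>t\<in>{0..T}. \<bar>U x t\<bar> \<le> M"
      unfolding U_def using J_bound[OF M] by blast
    fix x t assume t: "t \<in> {0..T}"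
    have cH: "continuous_on {0..T} (H V x)"
      by (rule continuous_on_compose2[OF H_cont, of _ "\<lambda>t. (x, t)", simplified]) (auto intro!: continuous_intros)
    have "((\<lambda>t. integral {0..t} (H V x)) has_real_derivative H V x t) (at t within {0..T})"
      by (rule integral_has_real_derivative[OF cH t])
    then have "(U x has_real_derivative H V x t) (at t within {0..T})"
      by (rule has_field_derivative_transform_within[OF _ zero_less_one t]) (simp add: U_def J_eq)
    also have "H V x t = a x t * U x t + S x t + (\<integral>z. K x z t * U z t \<partial>\<mu>)"
    proof -
      have "(\<integral>z. K x z t * U z t \<partial>\<mu>) = (\<integral>z. exp (l * t) * (K x z t * V (z, t)) \<partial>\<mu>)"
        unfolding UV c_id[OF t] by (simp add: mult_ac)
      also have "\<dots> = exp (l * t) * (\<integral>z. K x z t * V (z, t) \<partial>\<mu>)" by simp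
      finally have "(\<integral>z. K x z t * U z t \<partial>\<mu>) = \<dots>" .
      then show ?thesis by (simp only: H_def c_id[OF t]) (simp add: UV c_id[OF t] algebra_simps)
    qed
    finally show "(U x has_real_derivative a x t * U x t + S x t + (\<integral>z. K x z t * U z t \<partial>\<mu>)) (at t within {0..T})" .
  qed
  then show ?thesis by blast
qed

lemma lin_sol_measurable:
  assumes "lin_sol \<mu> T a K S U" "t \<in> {0..T}"
  shows "continuous_on UNIV (\<lambda>z. U z t)" "(\<lambda>z. U z t) \<in> borel_measurable borel"
proof -
  have c: "continuous_on (UNIV \<times> {0..T}) (\<lambda>(x, t). U x t)" using assms by (simp add: lin_sol_def)
  have "continuous_on UNIV (\<lambda>z. (\<lambda>(x, t). U x t) (z, t))"
    by (rule continuous_on_compose2[OF c]) (use assms(2) in \<open>auto intro!: continuous_intros\<close>)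
  then show "continuous_on UNIV (\<lambda>z. U z t)" by simp
  then show "(\<lambda>z. U z t) \<in> borel_measurable borel" by (rule borel_measurable_continuous_onI)
qed

text \<open>The local and the nonlocal term contribute \<open>b\<close> each, so
  \<open>sup_gronwall\<close> is applied with \<open>2 * b\<close>. By linearity, this bound of a
  solution by its source is also a stability statement.\<close>

lemma lin_sol_bound:
  assumes U: "lin_sol \<mu> T a K S U" and S: "\<And>x t. t \<in> {0..T} \<Longrightarrow> \<bar>S x t\<bar> \<le> s" and t: "t \<in> {0..T}"
  shows "\<bar>U x t\<bar> \<le> 2 * s * T * exp (4 * b * T)"
proof -
  obtain M where M: "\<And>x t. t \<in> {0..T} \<Longrightarrow> \<bar>U x t\<bar> \<le> M" using U unfolding lin_sol_def by metis
  have "s \<ge> 0" using S[OF t, of 0] by linarith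
  have "\<bar>U x t\<bar> \<le> 2 * (0 + s * T) * exp (2 * (2 * b) * t)"
  proof (rule sup_gronwall[where I = UNIV and e = U and M = M and e' = "\<lambda>x t. a x t * U x t + S x t + (\<integral>z. K x z t * U z t \<partial>\<mu>)"])
    fix x t B assume t: "t \<in> {0..T}" and B: "\<And>j. j \<in> UNIV \<Longrightarrow> \<bar>U j t\<bar> \<le> B"
    have "\<bar>a x t * U x t\<bar> \<le> b * B" unfolding abs_mult using a_bound B b by (intro mult_mono) auto
    moreover have "\<bar>\<integral>z. K x z t * U z t \<partial>\<mu>\<bar> \<le> b * B"
      using B by (intro KU_integral_bound(1) lin_sol_measurable[OF U t]) auto
    ultimately show "\<bar>a x t * U x t + S x t + (\<integral>z. K x z t * U z t \<partial>\<mu>)\<bar> \<le> s + 2 * b * B"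
      using S[OF t, of x] by linarith
  qed (use U M b t \<open>s \<ge> 0\<close> in \<open>auto simp: lin_sol_def\<close>)
  also have "\<dots> \<le> 2 * s * T * exp (4 * b * T)"
    using t b T \<open>s \<ge> 0\<close> by (simp add: mult_left_mono)
  finally show ?thesis .
qed

lemma lin_sol_lincomb:
  assumes U: "lin_sol \<mu> T a K S U" and V: "lin_sol \<mu> T a K R V"
  shows "lin_sol \<mu> T a K (\<lambda>x t. p * S x t + q * R x t) (\<lambda>x t. p * U x t + q * V x t)"
  unfolding lin_sol_def
proof (intro conjI allI ballI)
  show "p * U x 0 + q * V x 0 = 0" for x using U V by (simp add: lin_sol_def)
  show "continuous_on (UNIV \<times> {0..T}) (\<lambda>(x, t). p * U x t + q * V x t)"
    using U V unfolding lin_sol_def case_prod_unfold by (auto intro!: continuous_intros)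
  obtain M where M: "\<And>x t. t \<in> {0..T} \<Longrightarrow> \<bar>U x t\<bar> \<le> M" using U unfolding lin_sol_def by metis
  obtain N where N: "\<And>x t. t \<in> {0..T} \<Longrightarrow> \<bar>V x t\<bar> \<le> N" using V unfolding lin_sol_def by metis
  show "\<exists>M. \<forall>x. \<forall>t\<in>{0..T}. \<bar>p * U x t + q * V x t\<bar> \<le> M"
  proof (intro exI allI ballI)
    fix x t assume t: "t \<in> {0..T}"
    show "\<bar>p * U x t + q * V x t\<bar> \<le> \<bar>p\<bar> * M + \<bar>q\<bar> * N"
      by (rule order.trans[OF abs_triangle_ineq]) (simp add: abs_mult add_mono mult_left_mono M[OF t] N[OF t])
  qed
  fix x t assume t: "t \<in> {0..T}"
  have i: "integrable \<mu> (\<lambda>z. K x z t * U z t)" "integrable \<mu> (\<lambda>z. K x z t * V z t)"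
    using KU_integral_bound(2)[OF lin_sol_measurable(2)[OF U t] M[OF t]]
      KU_integral_bound(2)[OF lin_sol_measurable(2)[OF V t] N[OF t]] by auto
  have "(\<integral>z. K x z t * (p * U z t + q * V z t) \<partial>\<mu>) = (\<integral>z. p * (K x z t * U z t) + q * (K x z t * V z t) \<partial>\<mu>)"
    by (simp add: algebra_simps)
  also have "\<dots> = p * (\<integral>z. K x z t * U z t \<partial>\<mu>) + q * (\<integral>z. K x z t * V z t \<partial>\<mu>)" using i by simp
  finally have eq: "(\<integral>z. K x z t * (p * U z t + q * V z t) \<partial>\<mu>) = \<dots>" .
  have "(U x has_real_derivative a x t * U x t + S x t + (\<integral>z. K x z t * U z t \<partial>\<mu>)) (at t within {0..T})"
    "(V x has_real_derivative a x t * V x t + R x t + (\<integral>z. K x z t * V z t \<partial>\<mu>)) (at t within {0..T})"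
    using U V t by (auto simp: lin_sol_def)
  then have "((\<lambda>t. p * U x t + q * V x t) has_real_derivative
     p * (a x t * U x t + S x t + (\<integral>z. K x z t * U z t \<partial>\<mu>)) + q * (a x t * V x t + R x t + (\<integral>z. K x z t * V z t \<partial>\<mu>))) (at t within {0..T})"
    by (auto intro!: derivative_eq_intros)
  then show "((\<lambda>t. p * U x t + q * V x t) has_real_derivative
     a x t * (p * U x t + q * V x t) + (p * S x t + q * R x t) + (\<integral>z. K x z t * (p * U z t + q * V z t) \<partial>\<mu>)) (at t within {0..T})"
    unfolding eq by (rule DERIV_cong) (simp add: algebra_simps)
qed

text \<open>The difference of two solutions solves the equation with the difference of the
  sources.\<close>

lemma lin_sol_lipschitz_param:
  assumes U: "\<And>y. lin_sol \<mu> T a K (S y) (U y)"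
    and S: "\<And>x t y y'. t \<in> {0..T} \<Longrightarrow> \<bar>S y x t - S y' x t\<bar> \<le> L * \<bar>y - y' :: real\<bar>" and t: "t \<in> {0..T}"
  shows "\<bar>U y x t - U y' x t\<bar> \<le> (2 * L * T * exp (4 * b * T)) * \<bar>y - y'\<bar>"
  using lin_sol_bound[OF lin_sol_lincomb[OF U U, of 1 y "-1" y'], of "L * \<bar>y - y'\<bar>" t x] S t by (simp add: mult_ac)

text \<open>By linearity the first-order remainder of \<open>U\<close> solves the equation whose
  source is the first-order remainder of \<open>S\<close>, which is quadratic in the
  increment.\<close>

lemma lin_sol_deriv_param:
  assumes U: "\<And>y. lin_sol \<mu> T a K (S y) (U y)" and U': "\<And>y. lin_sol \<mu> T a K (S' y) (U' y)"
    and D: "\<And>x t y. t \<in> {0..T} \<Longrightarrow> ((\<lambda>y. S y x t) has_real_derivative S' y x t) (at y)"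
    and L: "\<And>x t y y'. t \<in> {0..T} \<Longrightarrow> \<bar>S' y x t - S' y' x t\<bar> \<le> L * \<bar>y - y'\<bar>" and t: "t \<in> {0..T}"
  shows "((\<lambda>y. U y x t) has_real_derivative U' y x t) (at y)"
proof (rule DERIV_from_remainder_bound)
  fix y'
  have "\<bar>S y' x t - S y x t - (y' - y) * S' y x t\<bar> \<le> L * (y' - y)\<^sup>2" if "t \<in> {0..T}" for x t
    by (rule DERIV_remainder_bound[OF D[OF that] L[OF that]])
  then show "\<bar>U y' x t - U y x t - (y' - y) * U' y x t\<bar> \<le> (2 * L * T * exp (4 * b * T)) * (y' - y)\<^sup>2"
    using lin_sol_bound[OF lin_sol_lincomb[OF lin_sol_lincomb[OF U U, of 1 y' "-1" y] U', of 1 "- (y' - y)" y], of "L * (y' - y)\<^sup>2" t x] t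
    by (simp add: mult_ac left_diff_distrib right_diff_distrib algebra_simps)
qed

end

section \<open>Consequences of the regularity assumption\<close>

text \<open>The consequences of the regularity assumption that the flow estimates use. Unlike that assumption,
  they refer to the Wasserstein distance only, through a modulus of continuity, and are invariant under \<open>\<sigma> \<mapsto> - \<sigma>\<close>;
  \<open>s1\<close> is \<open>\<partial>\<^sub>x\<sigma>\<close>, and \<open>\<delta>\<close> is the linear derivative normalised by \<open>\<delta> x \<mu> 0 = 0\<close>.\<close>

locale regular_coeff =
  fixes \<sigma> s1 :: "real \<Rightarrow> real measure \<Rightarrow> real" and D Dy \<delta> :: "real \<Rightarrow> real measure \<Rightarrow> real \<Rightarrow> real"
    and B :: real and \<omega> :: "real \<Rightarrow> real" and k :: nat
  assumes B: "0 < B"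
    and \<sigma>_bound: "\<And>x \<mu>. \<mu> \<in> P2 \<Longrightarrow> \<bar>\<sigma> x \<mu>\<bar> \<le> B"
    and s1: "\<And>x \<mu>. \<mu> \<in> P2 \<Longrightarrow> ((\<lambda>x. \<sigma> x \<mu>) has_real_derivative s1 x \<mu>) (at x)"
    and s1_smooth: "bdd_smooth k P2 (\<lambda>\<mu> x. s1 x \<mu>)"
    and s1_bound: "\<And>x \<mu>. \<mu> \<in> P2 \<Longrightarrow> \<bar>s1 x \<mu>\<bar> \<le> B"
    and s1_lip: "\<And>x x' \<mu>. \<mu> \<in> P2 \<Longrightarrow> \<bar>s1 x \<mu> - s1 x' \<mu>\<bar> \<le> B * \<bar>x - x'\<bar>"
    and D_smooth: "bdd_smooth k (P2 \<times> UNIV) (\<lambda>p x. D x (fst p) (snd p))"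
    and D_bound: "\<And>x \<mu> y. \<mu> \<in> P2 \<Longrightarrow> \<bar>D x \<mu> y\<bar> \<le> B"
    and D_lip: "\<And>x x' \<mu> y y'. \<mu> \<in> P2 \<Longrightarrow> \<bar>D x \<mu> y - D x' \<mu> y'\<bar> \<le> B * \<bar>x - x'\<bar> + B * \<bar>y - y'\<bar>"
    and Dy: "\<And>x \<mu> y. \<mu> \<in> P2 \<Longrightarrow> (D x \<mu> has_real_derivative Dy x \<mu> y) (at y)"
    and Dy_smooth: "1 \<le> k \<Longrightarrow> bdd_smooth (k - 1) (P2 \<times> UNIV) (\<lambda>p x. Dy x (fst p) (snd p))"
    and Dy_bound: "\<And>x \<mu> y. \<mu> \<in> P2 \<Longrightarrow> \<bar>Dy x \<mu> y\<bar> \<le> B"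
    and Dy_lip: "\<And>x x' \<mu> y y'. \<mu> \<in> P2 \<Longrightarrow> \<bar>Dy x \<mu> y - Dy x' \<mu> y'\<bar> \<le> B * \<bar>x - x'\<bar> + B * \<bar>y - y'\<bar>"
    and \<delta>: "\<And>x \<mu> y. \<mu> \<in> P2 \<Longrightarrow> (\<delta> x \<mu> has_real_derivative D x \<mu> y) (at y)" "\<And>x \<mu>. \<delta> x \<mu> 0 = 0"
    and \<omega>: "\<And>d. (\<And>n::nat. 0 \<le> d n) \<Longrightarrow> d \<longlonglongrightarrow> 0 \<Longrightarrow> (\<lambda>n. \<omega> (d n)) \<longlonglongrightarrow> 0"
    and \<sigma>_mod: "\<And>P Q d x. P \<in> P2 \<Longrightarrow> Q \<in> P2 \<Longrightarrow> w1_le P Q d \<Longrightarrow> \<bar>\<sigma> x P - \<sigma> x Q\<bar> \<le> B * d"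
    and s1_mod: "\<And>P Q d x. P \<in> P2 \<Longrightarrow> Q \<in> P2 \<Longrightarrow> w1_le P Q d \<Longrightarrow> \<bar>s1 x P - s1 x Q\<bar> \<le> \<omega> d"
    and D_mod: "\<And>P Q d x y. P \<in> P2 \<Longrightarrow> Q \<in> P2 \<Longrightarrow> w1_le P Q d \<Longrightarrow> \<bar>D x P y - D x Q y\<bar> \<le> \<omega> d"
    and Dy_mod: "\<And>P Q d x y. P \<in> P2 \<Longrightarrow> Q \<in> P2 \<Longrightarrow> w1_le P Q d \<Longrightarrow> \<bar>Dy x P y - Dy x Q y\<bar> \<le> \<omega> d"
    and \<sigma>_lin: "\<And>P Q d x. P \<in> P2 \<Longrightarrow> Q \<in> P2 \<Longrightarrow> w1_le P Q d \<Longrightarrow>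
        \<bar>\<sigma> x P - \<sigma> x Q - ((\<integral>y. \<delta> x Q y \<partial>P) - (\<integral>y. \<delta> x Q y \<partial>Q))\<bar> \<le> \<omega> d * d"

lemma (in regular_coeff) regular_coeff_uminus:
  "regular_coeff (\<lambda>x \<mu>. - \<sigma> x \<mu>) (\<lambda>x \<mu>. - s1 x \<mu>) (\<lambda>x \<mu> y. - D x \<mu> y) (\<lambda>x \<mu> y. - Dy x \<mu> y) (\<lambda>x \<mu> y. - \<delta> x \<mu> y) B \<omega> k"
proof
  show "\<bar>- D x \<mu> y - - D x' \<mu> y'\<bar> \<le> B * \<bar>x - x'\<bar> + B * \<bar>y - y'\<bar>" if "\<mu> \<in> P2" for x x' \<mu> y y'
    using D_lip[OF that, of x y x' y'] by (simp add: abs_minus_commute)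
  show "\<bar>- Dy x \<mu> y - - Dy x' \<mu> y'\<bar> \<le> B * \<bar>x - x'\<bar> + B * \<bar>y - y'\<bar>" if "\<mu> \<in> P2" for x x' \<mu> y y'
    using Dy_lip[OF that, of x y x' y'] by (simp add: abs_minus_commute)
  show "\<bar>- s1 x \<mu> - - s1 x' \<mu>\<bar> \<le> B * \<bar>x - x'\<bar>" if "\<mu> \<in> P2" for x x' \<mu>
    using s1_lip[OF that, of x x'] by (simp add: abs_minus_commute)
  fix P Q d x y assume PQ: "P \<in> P2" "Q \<in> P2" "w1_le P Q d"
  show "\<bar>- \<sigma> x P - - \<sigma> x Q\<bar> \<le> B * d" using \<sigma>_mod[OF PQ, of x] by (simp add: abs_minus_commute)
  show "\<bar>- s1 x P - - s1 x Q\<bar> \<le> \<omega> d" using s1_mod[OF PQ, of x] by (simp add: abs_minus_commute)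
  show "\<bar>- D x P y - - D x Q y\<bar> \<le> \<omega> d" using D_mod[OF PQ, of x y] by (simp add: abs_minus_commute)
  show "\<bar>- Dy x P y - - Dy x Q y\<bar> \<le> \<omega> d" using Dy_mod[OF PQ, of x y] by (simp add: abs_minus_commute)
  show "\<bar>- \<sigma> x P - - \<sigma> x Q - ((\<integral>y. - \<delta> x Q y \<partial>P) - (\<integral>y. - \<delta> x Q y \<partial>Q))\<bar> \<le> \<omega> d * d"
    using \<sigma>_lin[OF PQ, of x] by simp
qed (use B \<sigma>_bound s1_bound D_bound Dy_bound \<delta> \<omega> in
    \<open>auto intro!: bdd_smooth_uminus s1_smooth D_smooth Dy_smooth[simplified] derivative_intros s1 Dy\<close>)

lemma weak_deriv_norm_le_W_norm: "i \<le> n \<Longrightarrow> weak_deriv_norm i f \<le> W_norm n f"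
  unfolding W_norm_def by (rule member_le_sum) auto

text \<open>An interpolation inequality: functions that are close and have quadratic remainders have
  close derivatives. The choice \<open>h = sqrt d\<close> yields a bound of order
  \<open>sqrt d\<close>; it is used once with measures and once with times as the parameter.\<close>

lemma lipschitz_if_deriv_modulus:
  assumes D: "\<And>x. x \<in> {P, Q} \<Longrightarrow> \<bar>(s :: 'p \<Rightarrow> real \<Rightarrow> real) x (y + h) - s x y - h * s' x y\<bar> \<le> L * h\<^sup>2"
    and d: "\<And>y. \<bar>s P y - s Q y\<bar> \<le> b * d" and h: "h > 0"
  shows "\<bar>s' P y - s' Q y\<bar> \<le> 2 * b * d / h + 2 * L * h"
proof -
  have "h * (s' P y - s' Q y) = - (s P (y + h) - s P y - h * s' P y) + (s Q (y + h) - s Q y - h * s' Q y)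
     + (s P (y + h) - s Q (y + h)) - (s P y - s Q y)" by (simp add: algebra_simps)
  then have "\<bar>h * (s' P y - s' Q y)\<bar> \<le> L * h\<^sup>2 + L * h\<^sup>2 + b * d + b * d"
    using D[of P] D[of Q] d[of "y + h"] d[of y] by auto
  then have "h * \<bar>s' P y - s' Q y\<bar> \<le> h * (2 * b * d / h + 2 * L * h)"
    using h by (simp only: abs_mult) (simp add: algebra_simps power2_eq_square)
  then show ?thesis using h by simp
qed

text \<open>Continuity of \<open>\<sigma>\<close>, \<open>D\<close> and \<open>Dy\<close> in the
  measure is assumed, but that of \<open>s1\<close> is not: it is interpolated from a Wasserstein
  bound on \<open>\<sigma>\<close> and the Lipschitz bound on \<open>s1\<close> in space. The
  Wasserstein bound and the first-order expansion of \<open>\<sigma>\<close> come from integrating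
  the linear derivative along mixtures.\<close>

theorem regularity_R_imp_regular_coeff:
  fixes lam :: real
  assumes lam: "1 / 2 < lam" and R: "regularity_R lam k \<sigma>"
  shows "\<exists>s1 D Dy \<delta> B \<omega>. regular_coeff \<sigma> s1 D Dy \<delta> B \<omega> k"
proof -
  from R obtain D Dy b1' b2' L b3 b4 b5 where
    "\<forall>x. has_Lions_deriv (\<sigma> x) (D x)"
    and "\<forall>x. \<forall>\<mu>\<in>P2. \<forall>y. (D x \<mu> has_real_derivative Dy x \<mu> y) (at y)"
    and "\<forall>x. \<forall>\<mu>\<in>P2. \<bar>\<sigma> x \<mu>\<bar> \<le> b1'"
    and "\<forall>x. \<forall>\<mu>\<in>P2. \<forall>y. \<bar>D x \<mu> y\<bar> \<le> b2'"
    and "\<forall>x1 x2 y1 y2. \<forall>\<mu>\<in>P2. \<forall>\<nu>\<in>P2.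
        \<bar>\<sigma> x1 \<mu> - \<sigma> x2 \<nu>\<bar> \<le> L * \<bar>x1 - x2\<bar> + L * neg_sobolev_dist lam \<mu> \<nu> \<and>
        \<bar>D x1 \<mu> y1 - D x2 \<nu> y2\<bar> \<le> L * \<bar>x1 - x2\<bar> + L * \<bar>y1 - y2\<bar> + L * neg_sobolev_dist lam \<mu> \<nu> \<and>
        \<bar>Dy x1 \<mu> y1 - Dy x2 \<nu> y2\<bar> \<le> L * \<bar>x1 - x2\<bar> + L * \<bar>y1 - y2\<bar> + L * neg_sobolev_dist lam \<mu> \<nu>"
    and L: "L > 0"
    and "\<forall>\<mu>\<in>P2. W_norm (k + 2) (\<lambda>x. \<sigma> x \<mu>) \<le> ennreal b3"
    and "\<forall>\<mu>\<in>P2. \<forall>y. W_norm (k + 1) (\<lambda>x. D x \<mu> y) \<le> ennreal b4"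
    and b5: "(SUP (\<mu>, y)\<in>P2 \<times> UNIV.
          (\<Sum>i=0..k+2. weak_deriv_norm i (\<lambda>x. \<sigma> x \<mu>)) +
          (\<Sum>i=0..k. weak_deriv_norm i (\<lambda>x. D x \<mu> y) + weak_deriv_norm i (\<lambda>x. Dy x \<mu> y))) \<le> ennreal b5"
    unfolding regularity_R_def by (elim exE conjE) (rule that; assumption)
  note Lions = this(1)[rule_format] and Dy = this(2)[rule_format] and b1' = this(3)[rule_format]
    and b2' = this(4)[rule_format] and lip = this(5)[rule_format] and b3 = this(7)[rule_format] and b4 = this(8)[rule_format]
  define b1 where "b1 = \<bar>b1'\<bar>"
  define b2 where "b2 = \<bar>b2'\<bar>"
  have b1: "\<bar>\<sigma> x \<mu>\<bar> \<le> b1" if "\<mu> \<in> P2" for x \<mu> using b1'[OF that, of x] by (simp add: b1_def)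
  have b2: "\<bar>D x \<mu> y\<bar> \<le> b2" if "\<mu> \<in> P2" for x \<mu> y using b2'[OF that, of x y] by (simp add: b2_def)
  have b12: "b1 \<ge> 0" "b2 \<ge> 0" by (simp_all add: b1_def b2_def)
  have ns0: "neg_sobolev_dist lam \<mu> \<mu> = 0" for \<mu> by (simp add: neg_sobolev_dist_def)
  have lipx: "\<bar>\<sigma> x \<mu> - \<sigma> x' \<mu>\<bar> \<le> L * \<bar>x - x'\<bar>"
    "\<bar>D x \<mu> y - D x' \<mu> y'\<bar> \<le> L * \<bar>x - x'\<bar> + L * \<bar>y - y'\<bar>"
    "\<bar>Dy x \<mu> y - Dy x' \<mu> y'\<bar> \<le> L * \<bar>x - x'\<bar> + L * \<bar>y - y'\<bar>" if "\<mu> \<in> P2" for x x' y y' \<mu>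
    using lip[OF that that, of x x' y y'] ns0 by auto
  have cx: "continuous_on UNIV (\<lambda>x. \<sigma> x \<mu>)" "continuous_on UNIV (\<lambda>x. D x \<mu> y)" "continuous_on UNIV (\<lambda>x. Dy x \<mu> y)"
    if "\<mu> \<in> P2" for \<mu> y
    using lipx[OF that] by (auto intro!: lipschitz_continuous_on[of _ L] intro: order.trans[OF lipx(2)[OF that, of _ y _ y]] order.trans[OF lipx(3)[OF that, of _ y _ y]])
  have "bdd_smooth (Suc k) P2 (\<lambda>\<mu> x. \<sigma> x \<mu>)"
  proof (rule bdd_smooth_if_weak_deriv_norm_bounded[of _ _ _ b3])
    fix \<mu> i assume "\<mu> \<in> P2" "i \<le> Suc (Suc k)"
    then show "weak_deriv_norm i (\<lambda>x. \<sigma> x \<mu>) \<le> ennreal b3"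
      using weak_deriv_norm_le_W_norm[of i "k + 2"] b3 by (auto intro: order.trans)
  qed (use cx in auto)
  then obtain f' where f': "\<And>\<mu> x. \<mu> \<in> P2 \<Longrightarrow> ((\<lambda>x. \<sigma> x \<mu>) has_real_derivative f' \<mu> x) (at x)" "bdd_smooth k P2 f'"
    by (rule bdd_smooth_SucE) blast
  define s1 where "s1 = (\<lambda>x \<mu>. f' \<mu> x)"
  obtain b6 where b6: "b6 > 0" "\<And>\<mu> x. \<mu> \<in> P2 \<Longrightarrow> \<bar>s1 x \<mu>\<bar> \<le> b6"
    unfolding s1_def using bdd_smooth_bounded[OF f'(2)] by blast
  obtain L1 where L1: "L1 > 0" "\<And>\<mu> x y. \<mu> \<in> P2 \<Longrightarrow> \<bar>s1 x \<mu> - s1 y \<mu>\<bar> \<le> L1 * \<bar>x - y\<bar>"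
    unfolding s1_def by (rule bdd_smooth_lipschitz[OF f'(2)]) blast
  have D_smooth: "bdd_smooth k (P2 \<times> UNIV) (\<lambda>p x. D x (fst p) (snd p))"
  proof (rule bdd_smooth_if_weak_deriv_norm_bounded[of _ _ _ b4])
    fix p :: "real measure \<times> real" and i assume "p \<in> P2 \<times> UNIV" "i \<le> Suc k"
    then show "weak_deriv_norm i (\<lambda>x. D x (fst p) (snd p)) \<le> ennreal b4"
      by (intro order.trans[OF weak_deriv_norm_le_W_norm[of i "k + 1"] b4]) auto
  qed (use cx in auto)
  \<comment> \<open>Each summand is bounded by the supremum in the last clause of the assumption,
    where \<open>Dy\<close> occurs up to order \<open>k\<close> only.\<close>
  have wDy: "weak_deriv_norm i (\<lambda>x. Dy x \<mu> y) \<le> ennreal b5" if "\<mu> \<in> P2" "i \<le> k" for \<mu> y i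
  proof -
    let ?g = "\<lambda>i. weak_deriv_norm i (\<lambda>x. D x \<mu> y) + weak_deriv_norm i (\<lambda>x. Dy x \<mu> y)"
    have "weak_deriv_norm i (\<lambda>x. Dy x \<mu> y) \<le> ?g i" by simp
    also have "\<dots> \<le> (\<Sum>i=0..k. ?g i)" by (rule member_le_sum) (use that in auto)
    also have "\<dots> \<le> (\<Sum>i=0..k+2. weak_deriv_norm i (\<lambda>x. \<sigma> x \<mu>)) + (\<Sum>i=0..k. ?g i)" by simp
    also have "\<dots> \<le> ennreal b5"
      by (rule order.trans[OF SUP_upper2[of "(\<mu>, y)"] b5]) (use that in auto)
    finally show ?thesis .
  qed
  \<comment> \<open>Weak derivatives up to order \<open>k\<close> give \<open>k - 1\<close>
    classical ones, the last of them Lipschitz.\<close>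
  have Dy_smooth: "bdd_smooth (k - 1) (P2 \<times> UNIV) (\<lambda>p x. Dy x (fst p) (snd p))" if "1 \<le> k"
    by (rule bdd_smooth_if_weak_deriv_norm_bounded[of _ _ _ b5]) (use that cx wDy in auto)
  have b7: "\<bar>Dy x \<mu> y\<bar> \<le> \<bar>b5\<bar> + 1" if \<mu>: "\<mu> \<in> P2" for x \<mu> y
  proof -
    obtain g where g: "has_weak_deriv 0 (\<lambda>x. Dy x \<mu> y) g" "AE x in lborel. \<bar>g x\<bar> \<le> \<bar>b5\<bar> + 1"
      using weak_deriv_norm_leD[OF wDy[OF \<mu>, of 0 y]] by auto
    show ?thesis
      by (rule continuous_AE_bounded[OF cx(3)[OF \<mu>]])
        (use has_weak_deriv_0_AE_eq[OF g(1)] g(2) in eventually_elim, simp)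
  qed
  from Lions have "\<forall>x. \<exists>\<delta>. has_linear_deriv (\<sigma> x) \<delta> \<and> (\<forall>\<mu>\<in>P2. \<forall>y. (\<delta> \<mu> has_real_derivative D x \<mu> y) (at y))"
    by (simp add: has_Lions_deriv_def)
  then obtain \<delta>0 where \<delta>0: "\<And>x. has_linear_deriv (\<sigma> x) (\<delta>0 x)"
    "\<And>x \<mu> y. \<mu> \<in> P2 \<Longrightarrow> (\<delta>0 x \<mu> has_real_derivative D x \<mu> y) (at y)" by metis
  \<comment> \<open>Subtracting a function of the measure alone does not change a difference of
    integrals over two probability measures. The normalised derivative grows at most linearly,
    uniformly in the measure, because \<open>D\<close> is bounded.\<close>
  define \<delta> where "\<delta> = (\<lambda>x \<mu> y. \<delta>0 x \<mu> y - \<delta>0 x \<mu> 0)"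
  have \<delta>: "(\<delta> x \<mu> has_real_derivative D x \<mu> y) (at y)" if "\<mu> \<in> P2" for x \<mu> y
    unfolding \<delta>_def using \<delta>0(2)[OF that] by (auto intro!: derivative_eq_intros)
  have \<delta>_lip: "\<bar>\<delta> x \<mu> y - \<delta> x \<mu> y'\<bar> \<le> b2 * \<bar>y - y'\<bar>" if "\<mu> \<in> P2" for x \<mu> y y'
    by (rule DERIV_bounded_imp_lipschitz[OF \<delta>[OF that] b2[OF that]])
  have \<delta>_int: "((\<lambda>r. (\<integral>y. \<delta> x (mix_measure r P Q) y \<partial>P) - (\<integral>y. \<delta> x (mix_measure r P Q) y \<partial>Q)) has_integral (\<sigma> x P - \<sigma> x Q)) {0..1}"
    if PQ: "P \<in> P2" "Q \<in> P2" for x P Q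
  proof -
    interpret P: prob_space P using P2D[OF PQ(1)] by blast
    interpret Q: prob_space Q using P2D[OF PQ(2)] by blast
    have "((\<lambda>r. (\<integral>y. \<delta>0 x (mix_measure r P Q) y \<partial>P) - (\<integral>y. \<delta>0 x (mix_measure r P Q) y \<partial>Q)) has_integral (\<sigma> x P - \<sigma> x Q)) {0..1}"
      using \<delta>0(1)[of x] PQ by (simp add: has_linear_deriv_def)
    then show ?thesis
    proof (rule has_integral_eq[rotated])
      fix r :: real assume "r \<in> {0..1}"
      then have m: "mix_measure r P Q \<in> P2" using PQ by (intro mix_measure_P2) auto
      have eq: "\<delta>0 x (mix_measure r P Q) = (\<lambda>y. \<delta> x (mix_measure r P Q) y + \<delta>0 x (mix_measure r P Q) 0)"
        by (simp add: \<delta>_def)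
      show "(\<integral>y. \<delta>0 x (mix_measure r P Q) y \<partial>P) - (\<integral>y. \<delta>0 x (mix_measure r P Q) y \<partial>Q) =
        (\<integral>y. \<delta> x (mix_measure r P Q) y \<partial>P) - (\<integral>y. \<delta> x (mix_measure r P Q) y \<partial>Q)"
        using integrable_lipschitz_P2[OF PQ(1) \<delta>_lip[OF m, of x]] integrable_lipschitz_P2[OF PQ(2) \<delta>_lip[OF m, of x]]
        by (subst (1 2) eq) (simp add: P.prob_space Q.prob_space)
    qed
  qed
  \<comment> \<open>The integrand along the mixtures is compared with a constant:
    \<open>c = 0\<close> gives the Lipschitz bound, and the value of the integrand at
    \<open>Q\<close> gives the first-order expansion.\<close>
  have bound: "\<bar>\<sigma> x P - \<sigma> x Q - c\<bar> \<le> e"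
    if PQ: "P \<in> P2" "Q \<in> P2" and e: "\<And>m. m \<in> P2 \<Longrightarrow> w1_le m Q d \<Longrightarrow> \<bar>(\<integral>y. \<delta> x m y \<partial>P) - (\<integral>y. \<delta> x m y \<partial>Q) - c\<bar> \<le> e" "e \<ge> 0"
    and w: "w1_le P Q d" for x P Q c e d
  proof -
    have "((\<lambda>r. c) has_integral c) {0..1::real}" using has_integral_const_real[of c 0 1] by simp
    then have "((\<lambda>r. ((\<integral>y. \<delta> x (mix_measure r P Q) y \<partial>P) - (\<integral>y. \<delta> x (mix_measure r P Q) y \<partial>Q)) - c) has_integral ((\<sigma> x P - \<sigma> x Q) - c)) {0..1}"
      by (intro has_integral_diff \<delta>_int PQ)
    then have "norm ((\<sigma> x P - \<sigma> x Q) - c) \<le> e * measure lborel {0..1::real}"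
    proof (rule has_integral_bound_real[OF e(2) finite.emptyI])
      fix r :: real assume "r \<in> {0..1} - {}"
      then show "norm ((\<integral>y. \<delta> x (mix_measure r P Q) y \<partial>P) - (\<integral>y. \<delta> x (mix_measure r P Q) y \<partial>Q) - c) \<le> e"
        unfolding real_norm_def using PQ w by (intro e(1) mix_measure_P2 w1_le_mix_right) auto
    qed
    then show ?thesis by simp
  qed
  \<comment> \<open>The first summand controls \<open>D\<close> and \<open>Dy\<close>; the second
    one, from the interpolation with step \<open>sqrt d\<close>, controls \<open>s1\<close>.\<close>
  define \<omega> where "\<omega> = (\<lambda>d. L * sobolev_modulus lam d + (2 * b2 + 2 * L1) * sqrt d)"
  define Z where "Z = b1 + b2 + b6 + L1 + \<bar>b5\<bar> + 1 + L"
  have Z: "b1 \<le> Z" "b2 \<le> Z" "b6 \<le> Z" "L1 \<le> Z" "\<bar>b5\<bar> + 1 \<le> Z" "L \<le> Z" "0 < Z"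
    using b12 b6(1) L1(1) L by (auto simp: Z_def)
  have sm0: "sobolev_modulus lam d \<ge> 0" for d by (simp add: sobolev_modulus_def integral_nonneg_AE)
  have ns: "L * neg_sobolev_dist lam P Q \<le> L * sobolev_modulus lam d" "L * sobolev_modulus lam d \<le> \<omega> d" if "P \<in> P2" "Q \<in> P2" "w1_le P Q d" for P Q d
  proof -
    show "L * neg_sobolev_dist lam P Q \<le> L * sobolev_modulus lam d"
      using neg_sobolev_dist_le_modulus[OF lam that] L by simp
    have "0 \<le> (2 * b2 + 2 * L1) * sqrt d" using w1_le_nonneg[OF that(3)] b12 L1(1) by simp
    then show "L * sobolev_modulus lam d \<le> \<omega> d" by (simp add: \<omega>_def)
  qed
  have \<sigma>_mod: "\<bar>\<sigma> x P - \<sigma> x Q\<bar> \<le> b2 * d" if "P \<in> P2" "Q \<in> P2" "w1_le P Q d" for P Q d x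
    using bound[OF that(1,2) _ _ that(3), of x 0 "b2 * d"] w1_leD[OF that(3) \<delta>_lip] w1_le_nonneg[OF that(3)] b12 by simp
  have "regular_coeff \<sigma> s1 D Dy \<delta> Z \<omega> k"
  proof
    show "0 < Z" by (rule Z)
    show "\<delta> x \<mu> 0 = 0" for x \<mu> by (simp add: \<delta>_def)
    show "bdd_smooth k P2 (\<lambda>\<mu> x. s1 x \<mu>)" using f'(2) by (simp add: s1_def)
    show "bdd_smooth k (P2 \<times> UNIV) (\<lambda>p x. D x (fst p) (snd p))" by (rule D_smooth)
    show "bdd_smooth (k - 1) (P2 \<times> UNIV) (\<lambda>p x. Dy x (fst p) (snd p))" if "1 \<le> k" by (rule Dy_smooth[OF that])
    show "(\<lambda>n. \<omega> (d n)) \<longlonglongrightarrow> 0" if "\<And>n::nat. 0 \<le> d n" "d \<longlonglongrightarrow> 0" for d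
    proof -
      have "(\<lambda>n. \<omega> (d n)) \<longlonglongrightarrow> L * 0 + (2 * b2 + 2 * L1) * sqrt 0"
        unfolding \<omega>_def by (intro tendsto_intros sobolev_modulus_tendsto_0 lam that)
      then show ?thesis by simp
    qed
  next
    fix x x' y y' :: real and \<mu> assume \<mu>: "\<mu> \<in> P2"
    show "\<bar>\<sigma> x \<mu>\<bar> \<le> Z" using b1[OF \<mu>, of x] Z by linarith
    show "((\<lambda>x. \<sigma> x \<mu>) has_real_derivative s1 x \<mu>) (at x)" using f'(1)[OF \<mu>] by (simp add: s1_def)
    show "\<bar>s1 x \<mu>\<bar> \<le> Z" using b6(2)[OF \<mu>, of x] Z by linarith
    show "\<bar>s1 x \<mu> - s1 x' \<mu>\<bar> \<le> Z * \<bar>x - x'\<bar>"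
      by (rule order.trans[OF L1(2)[OF \<mu>] mult_right_mono]) (use Z in auto)
    show "\<bar>D x \<mu> y\<bar> \<le> Z" using b2[OF \<mu>, of x y] Z by linarith
    show "\<bar>D x \<mu> y - D x' \<mu> y'\<bar> \<le> Z * \<bar>x - x'\<bar> + Z * \<bar>y - y'\<bar>"
      by (rule order.trans[OF lipx(2)[OF \<mu>] add_mono[OF mult_right_mono mult_right_mono]]) (use Z in auto)
    show "(D x \<mu> has_real_derivative Dy x \<mu> y) (at y)" by (rule Dy[OF \<mu>])
    show "\<bar>Dy x \<mu> y\<bar> \<le> Z" using b7[OF \<mu>, of x y] Z by linarith
    show "\<bar>Dy x \<mu> y - Dy x' \<mu> y'\<bar> \<le> Z * \<bar>x - x'\<bar> + Z * \<bar>y - y'\<bar>"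
      by (rule order.trans[OF lipx(3)[OF \<mu>] add_mono[OF mult_right_mono mult_right_mono]]) (use Z in auto)
    show "(\<delta> x \<mu> has_real_derivative D x \<mu> y) (at y)" by (rule \<delta>[OF \<mu>])
  next
    fix P Q d x y assume PQ: "P \<in> P2" "Q \<in> P2" "w1_le P Q d"
    have d: "0 \<le> d" by (rule w1_le_nonneg[OF PQ(3)])
    show "\<bar>\<sigma> x P - \<sigma> x Q\<bar> \<le> Z * d"
      by (rule order.trans[OF \<sigma>_mod[OF PQ] mult_right_mono]) (use Z d in auto)
    show "\<bar>D x P y - D x Q y\<bar> \<le> \<omega> d" "\<bar>Dy x P y - Dy x Q y\<bar> \<le> \<omega> d"
      using lip[OF PQ(1,2), of x x y y] ns[OF PQ] by auto
    show "\<bar>s1 x P - s1 x Q\<bar> \<le> \<omega> d"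
    \<comment> \<open>The interpolation step \<open>sqrt d\<close> must be positive, so
      \<open>d = 0\<close> is settled by uniqueness of derivatives.\<close>
    proof (cases "d = 0")
      case True
      then have "(\<lambda>x. \<sigma> x P) = (\<lambda>x. \<sigma> x Q)" using \<sigma>_mod[OF PQ] by (auto simp: fun_eq_iff)
      then have "s1 x P = s1 x Q" using f'(1)[OF PQ(1)] f'(1)[OF PQ(2)] DERIV_unique unfolding s1_def by metis
      then show ?thesis using sm0[of d] L True by (simp add: \<omega>_def)
    next
      case False
      then have h: "sqrt d > 0" "d / sqrt d = sqrt d" using d by (auto simp: real_div_sqrt)
      have "\<bar>s1 x P - s1 x Q\<bar> \<le> 2 * b2 * d / sqrt d + 2 * L1 * sqrt d"
      proof (rule lipschitz_if_deriv_modulus[where s = "\<lambda>\<mu> x. \<sigma> x \<mu>" and s' = "\<lambda>\<mu> x. s1 x \<mu>" and P = P and Q = Q])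
        fix m assume "m \<in> {P, Q}"
        then have m: "m \<in> P2" using PQ by auto
        show "\<bar>\<sigma> (x + sqrt d) m - \<sigma> x m - sqrt d * s1 x m\<bar> \<le> L1 * (sqrt d)\<^sup>2"
          using DERIV_remainder_bound[of "\<lambda>x. \<sigma> x m" "\<lambda>x. s1 x m" L1 "x + sqrt d" x] f'(1)[OF m] L1(2)[OF m]
          by (simp add: s1_def)
      qed (use \<sigma>_mod[OF PQ] h in auto)
      also have "2 * b2 * d / sqrt d = 2 * b2 * sqrt d" by (simp only: times_divide_eq_right[symmetric] h)
      also have "\<dots> + 2 * L1 * sqrt d = (2 * b2 + 2 * L1) * sqrt d" by (simp add: algebra_simps)
      also have "\<dots> \<le> \<omega> d" using sm0[of d] L by (simp add: \<omega>_def)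
      finally show ?thesis .
    qed
    show "\<bar>\<sigma> x P - \<sigma> x Q - ((\<integral>y. \<delta> x Q y \<partial>P) - (\<integral>y. \<delta> x Q y \<partial>Q))\<bar> \<le> \<omega> d * d"
    proof (rule bound[OF PQ(1,2) _ _ PQ(3)])
      show "0 \<le> \<omega> d * d" using sm0[of d] L L1(1) b12 d by (simp add: \<omega>_def)
      fix m assume m: "m \<in> P2" "w1_le m Q d"
      have "(\<integral>y. \<delta> x m y \<partial>P) - (\<integral>y. \<delta> x m y \<partial>Q) - ((\<integral>y. \<delta> x Q y \<partial>P) - (\<integral>y. \<delta> x Q y \<partial>Q))
        = (\<integral>y. \<delta> x m y - \<delta> x Q y \<partial>P) - (\<integral>y. \<delta> x m y - \<delta> x Q y \<partial>Q)"
        using integrable_lipschitz_P2[OF PQ(1) \<delta>_lip[OF m(1), of x]] integrable_lipschitz_P2[OF PQ(2) \<delta>_lip[OF m(1), of x]]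
          integrable_lipschitz_P2[OF PQ(1) \<delta>_lip[OF PQ(2), of x]] integrable_lipschitz_P2[OF PQ(2) \<delta>_lip[OF PQ(2), of x]]
        by simp
      \<comment> \<open>The difference of the two linear derivatives has slope at most
        \<open>\<omega> d\<close> in \<open>y\<close>, and it is integrated against two measures at
        distance \<open>d\<close>.\<close>
      moreover have "\<bar>(\<integral>y. \<delta> x m y - \<delta> x Q y \<partial>P) - (\<integral>y. \<delta> x m y - \<delta> x Q y \<partial>Q)\<bar> \<le> \<omega> d * d"
      proof (rule w1_leD[OF PQ(3)], rule DERIV_bounded_imp_lipschitz)
        show "((\<lambda>y. \<delta> x m y - \<delta> x Q y) has_real_derivative D x m y - D x Q y) (at y)" for y
          by (intro derivative_intros \<delta> m PQ)
        show "\<bar>D x m y - D x Q y\<bar> \<le> \<omega> d" for y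
          using lip[OF m(1) PQ(2), of x x y y] ns[OF m(1) PQ(2) m(2)] by auto
      qed
      ultimately show "\<bar>(\<integral>y. \<delta> x m y \<partial>P) - (\<integral>y. \<delta> x m y \<partial>Q) - ((\<integral>y. \<delta> x Q y \<partial>P) - (\<integral>y. \<delta> x Q y \<partial>Q))\<bar> \<le> \<omega> d * d"
        by simp
    qed
  qed
  then show ?thesis by blast
qed

section \<open>Spatial regularity of the flow\<close>

lemma integral_restrict_lborel_Icc:
  fixes f :: "real \<Rightarrow> real"
  assumes "continuous_on {0..t} f"
  shows "(\<integral>s. f s \<partial>restrict_space lborel {0..t}) = integral {0..t} f"
proof -
  have "set_integrable lborel {0..t} f"
    using borel_integrable_compact[OF compact_Icc assms] by (simp add: set_integrable_def)
  then show ?thesis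
    by (subst integral_restrict_space) (auto simp: set_borel_integral_eq_integral(2)[symmetric] set_lebesgue_integral_def)
qed

text \<open>An instance of averaging: Lebesgue measure on \<open>{0..t}\<close> has mass at most
  \<open>T\<close> and depends on the index through \<open>t\<close>.\<close>

lemma bdd_smooth_time_integral:
  fixes f :: "'i \<times> real \<Rightarrow> real \<Rightarrow> real"
  assumes f: "bdd_smooth n (I \<times> {0..T}) f" and c: "\<And>i x. i \<in> I \<Longrightarrow> continuous_on {0..T} (\<lambda>s. f (i, s) x)"
  shows "bdd_smooth n (I \<times> {0..T}) (\<lambda>p x. integral {0..snd p} (\<lambda>s. f (fst p, s) x))"
proof -
  have cont: "continuous_on {0..t} (\<lambda>s. f (i, s) x)" if "i \<in> I" "t \<in> {0..T}" for i t x
    by (rule continuous_on_subset[OF c[OF that(1)]]) (use that in auto)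
  have sp: "space (restrict_space lborel {0..t}) = {0..t}" for t :: real by (simp add: space_restrict_space)
  have em: "emeasure (restrict_space lborel {0..t}) {0..t} = ennreal t" if "t \<ge> 0" for t :: real
    using that by (subst emeasure_restrict_space) auto
  have "bdd_smooth n (I \<times> {0..T}) (\<lambda>p x. \<integral>s. f (fst p, s) x \<partial>restrict_space lborel {0..snd p})"
  proof (rule bdd_smooth_average[where g = "\<lambda>q x. f (fst (fst q), snd q) x" and c = T and \<Omega>' = "{q. fst (fst q) \<in> I \<and> snd q \<in> {0..T}}", simplified fst_conv snd_conv])
    show "bdd_smooth n {q. fst (fst q) \<in> I \<and> snd q \<in> {0..T}} (\<lambda>q x. f (fst (fst q), snd q) x)"
      by (rule bdd_smooth_reindex[OF f, of _ "\<lambda>q. (fst (fst q), snd q)"]) auto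
    fix p assume p: "p \<in> I \<times> {0..T}"
    show "finite_measure (restrict_space lborel {0..snd p})"
      by (rule finite_measureI) (use em[of "snd p"] p in \<open>auto simp: sp\<close>)
    show "measure (restrict_space lborel {0..snd p}) (space (restrict_space lborel {0..snd p})) \<le> T"
      using em[of "snd p"] p by (auto simp: sp measure_def)
    show "(p, s) \<in> {q. fst (fst q) \<in> I \<and> snd q \<in> {0..T}}" if "s \<in> space (restrict_space lborel {0..snd p})" for s
      using p that by (auto simp: sp)
    show "(\<lambda>s. f (fst p, s) x) \<in> borel_measurable (restrict_space lborel {0..snd p})" for x
    proof -
      have "(\<lambda>s. f (fst p, s) x) \<in> borel_measurable (restrict_space borel {0..snd p})"
        by (rule borel_measurable_continuous_on_restrict[OF cont]) (use p in auto)
      then show ?thesis by (simp add: measurable_cong_sets[OF sets_restrict_space_cong[OF sets_lborel] refl])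
    qed
  qed
  then show ?thesis
    by (rule bdd_smooth_reindex[where h = "\<lambda>p. p"]) (auto intro!: integral_restrict_lborel_Icc[symmetric] cont)
qed

text \<open>Here neither map is Lipschitz; Lipschitz functions are integrable along them because the
  push-forwards are in \<open>P2\<close>.\<close>

lemma w1_le_distr_same:
  assumes P: "P \<in> P2" "distr P borel f \<in> P2" "distr P borel g \<in> P2"
    and m: "f \<in> borel_measurable borel" "g \<in> borel_measurable borel" and e: "\<And>x. \<bar>f x - g x\<bar> \<le> e"
  shows "w1_le (distr P borel f) (distr P borel g) e"
  unfolding w1_le_def
proof (intro allI impI)
  fix h c assume "\<forall>x y. \<bar>h x - h y\<bar> \<le> c * \<bar>x - y :: real\<bar>"
  then have h: "\<And>x y. \<bar>h x - h y\<bar> \<le> c * \<bar>x - y\<bar>" by blast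
  have hm[measurable]: "h \<in> borel_measurable borel" by (rule lipschitz_measurable[OF h])
  have fm[measurable]: "f \<in> borel_measurable P" "g \<in> borel_measurable P" using P2_measurable[OF P(1)] m by auto
  have i: "integrable P (\<lambda>x. h (f x))" "integrable P (\<lambda>x. h (g x))"
    using integrable_lipschitz_P2[OF P(2) h] integrable_lipschitz_P2[OF P(3) h]
      integrable_distr_eq[OF fm(1) hm] integrable_distr_eq[OF fm(2) hm] by auto
  have "(\<integral>x. h x \<partial>distr P borel f) - (\<integral>x. h x \<partial>distr P borel g) = (\<integral>x. h (f x) - h (g x) \<partial>P)"
    using integral_distr[OF fm(1) hm] integral_distr[OF fm(2) hm] i by simp
  moreover have "\<bar>\<integral>x. h (f x) - h (g x) \<partial>P\<bar> \<le> c * e"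
    using m hm by (intro integral_P2_bound[OF P(1)] borel_measurable_diff order.trans[OF h mult_left_mono[OF e lipschitz_const_nonneg[OF h]]])
      (auto intro: measurable_compose)
  ultimately show "\<bar>(\<integral>x. h x \<partial>distr P borel f) - (\<integral>x. h x \<partial>distr P borel g)\<bar> \<le> c * e" by simp
qed

context regular_coeff
begin

lemma D_diff:
  assumes "P \<in> P2" "Q \<in> P2" "w1_le P Q d"
  shows "\<bar>D x P y - D x' Q y'\<bar> \<le> B * \<bar>x - x'\<bar> + B * \<bar>y - y'\<bar> + \<omega> d"
  using D_lip[OF assms(1), of x y x' y'] D_mod[OF assms, of x' y'] by linarith

lemma Dy_diff:
  assumes "P \<in> P2" "Q \<in> P2" "w1_le P Q d"
  shows "\<bar>Dy x P y - Dy x' Q y'\<bar> \<le> B * \<bar>x - x'\<bar> + B * \<bar>y - y'\<bar> + \<omega> d"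
  using Dy_lip[OF assms(1), of x y x' y'] Dy_mod[OF assms, of x' y'] by linarith

lemma s1_diff:
  assumes "P \<in> P2" "Q \<in> P2" "w1_le P Q d"
  shows "\<bar>s1 x P - s1 x' Q\<bar> \<le> B * \<bar>x - x'\<bar> + \<omega> d"
  using s1_lip[OF assms(1), of x x'] s1_mod[OF assms, of x'] by linarith

lemma \<delta>_lip:
  assumes "P \<in> P2"
  shows "\<bar>\<delta> x P y - \<delta> x P y'\<bar> \<le> B * \<bar>y - y'\<bar>"
  by (rule DERIV_bounded_imp_lipschitz[OF \<delta>(1)[OF assms] D_bound[OF assms]])

lemma \<delta>_bound: "P \<in> P2 \<Longrightarrow> \<bar>\<delta> x P y\<bar> \<le> B * \<bar>y\<bar>"
  using \<delta>_lip[of P x y 0] \<delta>(2) by simp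

text \<open>Both derivatives vanish at \<open>y = 0\<close>, so their difference is controlled by
  the difference of \<open>D\<close> between 0 and \<open>y\<close>; hence the weight
  \<open>\<bar>y\<bar>\<close>.\<close>

lemma \<delta>_diff:
  assumes "P \<in> P2" "Q \<in> P2" "w1_le P Q d"
  shows "\<bar>\<delta> x P y - \<delta> x' Q y'\<bar> \<le> (B * \<bar>x - x'\<bar> + \<omega> d) * \<bar>y\<bar> + B * \<bar>y - y'\<bar>"
proof -
  have "\<bar>(\<delta> x P y - \<delta> x' Q y) - (\<delta> x P 0 - \<delta> x' Q 0)\<bar> \<le> (B * \<bar>x - x'\<bar> + \<omega> d) * \<bar>y - 0\<bar>"
  proof (rule DERIV_bounded_imp_lipschitz)
    show "((\<lambda>y. \<delta> x P y - \<delta> x' Q y) has_real_derivative D x P y - D x' Q y) (at y)" for y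
      by (intro derivative_intros \<delta> assms)
    show "\<bar>D x P y - D x' Q y\<bar> \<le> B * \<bar>x - x'\<bar> + \<omega> d" for y using D_diff[OF assms, of x y x' y] by simp
  qed
  then show ?thesis using \<delta>_lip[OF assms(2), of x' y y'] \<delta>(2) by simp
qed

end

section \<open>The flow and its first spatial derivative\<close>

locale flow = regular_coeff +
  fixes \<psi> :: "real \<Rightarrow> real measure \<Rightarrow> real \<Rightarrow> real" and T :: real
  assumes T: "0 < T" and flow: "forward_flow \<sigma> \<psi>"
begin

definition pf :: "real measure \<Rightarrow> real \<Rightarrow> real measure" where
  "pf \<mu> t = distr \<mu> borel (\<lambda>z. \<psi> z \<mu> t)"

lemma \<psi>_meas: "\<mu> \<in> P2 \<Longrightarrow> (\<lambda>x. \<psi> x \<mu> t) \<in> borel_measurable borel"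
  and pf_P2: "\<mu> \<in> P2 \<Longrightarrow> pf \<mu> t \<in> P2"
  and \<psi>_0: "\<mu> \<in> P2 \<Longrightarrow> \<psi> x \<mu> 0 = x"
  and \<psi>_ode: "\<mu> \<in> P2 \<Longrightarrow> (\<psi> x \<mu> has_real_derivative \<sigma> (\<psi> x \<mu> t) (pf \<mu> t)) (at t)"
  using flow by (auto simp: forward_flow_def pf_def)

lemma integral_pf:
  fixes f :: "real \<Rightarrow> real"
  assumes "\<mu> \<in> P2" "f \<in> borel_measurable borel"
  shows "(\<integral>x. f x \<partial>pf \<mu> t) = (\<integral>x. f (\<psi> x \<mu> t) \<partial>\<mu>)"
  unfolding pf_def by (rule integral_distr) (use P2_measurable[OF assms(1) \<psi>_meas[OF assms(1)]] assms in auto)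

lemma \<psi>_time_lip: "\<mu> \<in> P2 \<Longrightarrow> \<bar>\<psi> x \<mu> t - \<psi> x \<mu> s\<bar> \<le> B * \<bar>t - s\<bar>"
  by (rule DERIV_bounded_imp_lipschitz[OF \<psi>_ode \<sigma>_bound[OF pf_P2]])

lemma \<psi>_bound:
  assumes "\<mu> \<in> P2" "t \<in> {0..T}"
  shows "\<bar>\<psi> x \<mu> t\<bar> \<le> \<bar>x\<bar> + B * T"
proof -
  have "\<bar>\<psi> x \<mu> t - x\<bar> \<le> B * \<bar>t - 0\<bar>" using \<psi>_time_lip[OF assms(1), of x t 0] \<psi>_0[OF assms(1)] by simp
  also have "\<dots> \<le> B * T" using assms(2) B by (intro mult_left_mono) auto
  finally show ?thesis by linarith
qed

lemma pf_time: "\<mu> \<in> P2 \<Longrightarrow> w1_le (pf \<mu> t) (pf \<mu> s) (B * \<bar>t - s\<bar>)"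
  unfolding pf_def by (intro w1_le_distr_same \<psi>_meas \<psi>_time_lip) (auto simp: pf_P2[unfolded pf_def])

lemma \<sigma>_lip: "\<mu> \<in> P2 \<Longrightarrow> \<bar>\<sigma> x \<mu> - \<sigma> y \<mu>\<bar> \<le> B * \<bar>x - y\<bar>"
  by (rule DERIV_bounded_imp_lipschitz[OF s1 s1_bound])

definition Lx :: real where "Lx = 2 * exp (2 * B * T)"

lemma Lx: "Lx > 0" by (simp add: Lx_def)

text \<open>Both trajectories belong to the same initial measure and see the same
  \<open>pf \<mu> t\<close>, so the Gronwall argument runs for one pair of points; hence the
  singleton index set.\<close>

lemma \<psi>_lip:
  assumes \<mu>: "\<mu> \<in> P2" and t: "t \<in> {0..T}"
  shows "\<bar>\<psi> x \<mu> t - \<psi> y \<mu> t\<bar> \<le> Lx * \<bar>x - y\<bar>"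
proof -
  have "\<bar>\<psi> x \<mu> t - \<psi> y \<mu> t\<bar> \<le> 2 * (\<bar>x - y\<bar> + 0 * T) * exp (2 * B * t)"
  proof (rule sup_gronwall[where I = "{()}" and e = "\<lambda>_ t. \<psi> x \<mu> t - \<psi> y \<mu> t" and M = "\<bar>x - y\<bar> + 2 * B * T"
        and e' = "\<lambda>_ t. \<sigma> (\<psi> x \<mu> t) (pf \<mu> t) - \<sigma> (\<psi> y \<mu> t) (pf \<mu> t)"])
    fix s assume "s \<in> {0..T}"
    show "((\<lambda>t. \<psi> x \<mu> t - \<psi> y \<mu> t) has_real_derivative \<sigma> (\<psi> x \<mu> s) (pf \<mu> s) - \<sigma> (\<psi> y \<mu> s) (pf \<mu> s)) (at s within {0..T})"
      by (intro derivative_intros has_field_derivative_at_within[OF \<psi>_ode[OF \<mu>]])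
    have "B * \<bar>s - 0\<bar> \<le> B * T" using B \<open>s \<in> {0..T}\<close> by (intro mult_left_mono) auto
    then show "\<bar>\<psi> x \<mu> s - \<psi> y \<mu> s\<bar> \<le> \<bar>x - y\<bar> + 2 * B * T"
      using \<psi>_time_lip[OF \<mu>, of x s 0] \<psi>_time_lip[OF \<mu>, of y s 0] \<psi>_0[OF \<mu>] by (simp add: abs_le_iff) linarith
    fix b' assume "\<And>j. j \<in> {()} \<Longrightarrow> \<bar>\<psi> x \<mu> s - \<psi> y \<mu> s\<bar> \<le> b'"
    then have "B * \<bar>\<psi> x \<mu> s - \<psi> y \<mu> s\<bar> \<le> B * b'" using B by (intro mult_left_mono) auto
    then show "\<bar>\<sigma> (\<psi> x \<mu> s) (pf \<mu> s) - \<sigma> (\<psi> y \<mu> s) (pf \<mu> s)\<bar> \<le> 0 + B * b'"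
      using \<sigma>_lip[OF pf_P2[OF \<mu>], of "\<psi> x \<mu> s" s "\<psi> y \<mu> s"] by linarith
  qed (use \<psi>_0[OF \<mu>] B t in auto)
  also have "\<dots> = 2 * \<bar>x - y\<bar> * exp (2 * B * t)" by simp
  also have "\<dots> \<le> 2 * \<bar>x - y\<bar> * exp (2 * B * T)" using t B by (intro mult_left_mono) auto
  finally show ?thesis by (simp add: Lx_def mult_ac)
qed

lemma \<psi>_cont:
  assumes \<mu>: "\<mu> \<in> P2"
  shows "continuous_on (UNIV \<times> {0..T}) (\<lambda>p. \<psi> (fst p) \<mu> (snd p))"
  unfolding continuous_on_sequentially
proof (intro allI impI ballI)
  fix X and p :: "real \<times> real" assume p: "p \<in> UNIV \<times> {0..T}" and X: "(\<forall>n. X n \<in> UNIV \<times> {0..T}) \<and> X \<longlonglongrightarrow> p"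
  have "(\<lambda>n. \<psi> (fst (X n)) \<mu> (snd (X n))) \<longlonglongrightarrow> \<psi> (fst p) \<mu> (snd p)"
  proof (rule LIM_zero_cancel, rule Lim_null_comparison)
    have "(\<lambda>n. Lx * \<bar>fst (X n) - fst p\<bar> + B * \<bar>snd (X n) - snd p\<bar>) \<longlonglongrightarrow> Lx * \<bar>fst p - fst p\<bar> + B * \<bar>snd p - snd p\<bar>"
      using X by (intro tendsto_intros) auto
    then show "(\<lambda>n. Lx * \<bar>fst (X n) - fst p\<bar> + B * \<bar>snd (X n) - snd p\<bar>) \<longlonglongrightarrow> 0" by simp
    have "\<bar>\<psi> (fst (X n)) \<mu> (snd (X n)) - \<psi> (fst p) \<mu> (snd p)\<bar> \<le> Lx * \<bar>fst (X n) - fst p\<bar> + B * \<bar>snd (X n) - snd p\<bar>" for n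
    proof -
      have "snd (X n) \<in> {0..T}" using X by (metis mem_Times_iff)
      from \<psi>_lip[OF \<mu> this, of "fst (X n)" "fst p"] \<psi>_time_lip[OF \<mu>, of "fst p" "snd (X n)" "snd p"] show ?thesis by linarith
    qed
    then show "\<forall>\<^sub>F n in sequentially. norm (\<psi> (fst (X n)) \<mu> (snd (X n)) - \<psi> (fst p) \<mu> (snd p)) \<le> Lx * \<bar>fst (X n) - fst p\<bar> + B * \<bar>snd (X n) - snd p\<bar>"
      by simp
  qed
  then show "((\<lambda>p. \<psi> (fst p) \<mu> (snd p)) \<circ> X) \<longlonglongrightarrow> \<psi> (fst p) \<mu> (snd p)" by (simp add: comp_def)
qed

lemma \<psi>_cont': "\<mu> \<in> P2 \<Longrightarrow> continuous_on A f \<Longrightarrow> continuous_on A g \<Longrightarrow> g ` A \<subseteq> {0..T} \<Longrightarrow> continuous_on A (\<lambda>p. \<psi> (f p) \<mu> (g p))"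
  using continuous_on_compose2[OF \<psi>_cont, of \<mu> A "\<lambda>p. (f p, g p)"] by (auto intro!: continuous_intros)

text \<open>The weight \<open>1 + \<bar>y\<bar>\<close> admits \<open>\<delta>\<close>, whose
  continuity in the space and measure arguments is controlled only locally uniformly in
  \<open>y\<close>; along a convergent sequence the weight stays bounded.\<close>

lemma coeff_cont:
  fixes G :: "real \<Rightarrow> real measure \<Rightarrow> real \<Rightarrow> real"
  assumes \<mu>: "\<mu> \<in> P2"
    and G: "\<And>P Q d x y x' y'. P \<in> P2 \<Longrightarrow> Q \<in> P2 \<Longrightarrow> w1_le P Q d \<Longrightarrow>
       \<bar>G x P y - G x' Q y'\<bar> \<le> (B * \<bar>x - x'\<bar> + \<omega> d) * (1 + \<bar>y\<bar>) + B * \<bar>y - y'\<bar>"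
    and fgh: "continuous_on A f" "continuous_on A g" "continuous_on A h"
  shows "continuous_on (A :: 'c::metric_space set) (\<lambda>p. G (f p) (pf \<mu> (g p)) (h p))"
  unfolding continuous_on_sequentially
proof (intro allI impI ballI)
  fix X p assume p: "p \<in> A" and X: "(\<forall>n. X n \<in> A) \<and> X \<longlonglongrightarrow> p"
  then have lim: "(\<lambda>n. f (X n)) \<longlonglongrightarrow> f p" "(\<lambda>n. g (X n)) \<longlonglongrightarrow> g p" "(\<lambda>n. h (X n)) \<longlonglongrightarrow> h p"
    using fgh unfolding continuous_on_sequentially comp_def by blast+
  have "(\<lambda>n. G (f (X n)) (pf \<mu> (g (X n))) (h (X n))) \<longlonglongrightarrow> G (f p) (pf \<mu> (g p)) (h p)"
  proof (rule LIM_zero_cancel, rule Lim_null_comparison)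
    have "(\<lambda>n. B * \<bar>g (X n) - g p\<bar>) \<longlonglongrightarrow> B * \<bar>g p - g p\<bar>" by (intro tendsto_intros lim)
    then have "(\<lambda>n. \<omega> (B * \<bar>g (X n) - g p\<bar>)) \<longlonglongrightarrow> 0" using B by (intro \<omega>) auto
    then have "(\<lambda>n. (B * \<bar>f (X n) - f p\<bar> + \<omega> (B * \<bar>g (X n) - g p\<bar>)) * (1 + \<bar>h (X n)\<bar>) + B * \<bar>h (X n) - h p\<bar>)
       \<longlonglongrightarrow> (B * \<bar>f p - f p\<bar> + 0) * (1 + \<bar>h p\<bar>) + B * \<bar>h p - h p\<bar>"
      by (intro tendsto_intros lim)
    then show "(\<lambda>n. (B * \<bar>f (X n) - f p\<bar> + \<omega> (B * \<bar>g (X n) - g p\<bar>)) * (1 + \<bar>h (X n)\<bar>) + B * \<bar>h (X n) - h p\<bar>) \<longlonglongrightarrow> 0"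
      by simp
    show "\<forall>\<^sub>F n in sequentially. norm (G (f (X n)) (pf \<mu> (g (X n))) (h (X n)) - G (f p) (pf \<mu> (g p)) (h p))
        \<le> (B * \<bar>f (X n) - f p\<bar> + \<omega> (B * \<bar>g (X n) - g p\<bar>)) * (1 + \<bar>h (X n)\<bar>) + B * \<bar>h (X n) - h p\<bar>"
      by (intro always_eventually allI, unfold real_norm_def, intro G pf_P2 pf_time \<mu>)
  qed
  then show "((\<lambda>p. G (f p) (pf \<mu> (g p)) (h p)) \<circ> X) \<longlonglongrightarrow> G (f p) (pf \<mu> (g p)) (h p)" by (simp add: comp_def)
qed

lemma \<omega>_nonneg: "P \<in> P2 \<Longrightarrow> Q \<in> P2 \<Longrightarrow> w1_le P Q d \<Longrightarrow> 0 \<le> \<omega> d"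
  using order.trans[OF abs_ge_zero s1_mod] by blast

lemma s1_cont:
  assumes "\<mu> \<in> P2" "continuous_on A f" "continuous_on A g"
  shows "continuous_on (A :: 'c::metric_space set) (\<lambda>p. s1 (f p) (pf \<mu> (g p)))"
proof (rule coeff_cont[of \<mu> "\<lambda>x P y. s1 x P" A f g "\<lambda>_. 0", OF assms(1) _ assms(2,3)])
  fix P Q d and x y x' y' :: real assume PQ: "P \<in> P2" "Q \<in> P2" "w1_le P Q d"
  have "0 \<le> (B * \<bar>x - x'\<bar> + \<omega> d) * \<bar>y\<bar>" "0 \<le> B * \<bar>y - y'\<bar>" using \<omega>_nonneg[OF PQ] B by auto
  then show "\<bar>s1 x P - s1 x' Q\<bar> \<le> (B * \<bar>x - x'\<bar> + \<omega> d) * (1 + \<bar>y\<bar>) + B * \<bar>y - y'\<bar>"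
    using s1_diff[OF PQ, of x x'] by (simp only: distrib_left mult_1_right)
qed (intro continuous_intros)

lemma D_cont:
  assumes "\<mu> \<in> P2" "continuous_on A f" "continuous_on A g" "continuous_on A h"
  shows "continuous_on (A :: 'c::metric_space set) (\<lambda>p. D (f p) (pf \<mu> (g p)) (h p))"
proof (rule coeff_cont[OF assms(1) _ assms(2,3,4)])
  fix P Q d and x y x' y' :: real assume PQ: "P \<in> P2" "Q \<in> P2" "w1_le P Q d"
  have "0 \<le> (B * \<bar>x - x'\<bar> + \<omega> d) * \<bar>y\<bar>" using \<omega>_nonneg[OF PQ] B by auto
  then show "\<bar>D x P y - D x' Q y'\<bar> \<le> (B * \<bar>x - x'\<bar> + \<omega> d) * (1 + \<bar>y\<bar>) + B * \<bar>y - y'\<bar>"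
    using D_diff[OF PQ, of x y x' y'] by (simp only: distrib_left mult_1_right)
qed

lemma Dy_cont:
  assumes "\<mu> \<in> P2" "continuous_on A f" "continuous_on A g" "continuous_on A h"
  shows "continuous_on (A :: 'c::metric_space set) (\<lambda>p. Dy (f p) (pf \<mu> (g p)) (h p))"
proof (rule coeff_cont[OF assms(1) _ assms(2,3,4)])
  fix P Q d and x y x' y' :: real assume PQ: "P \<in> P2" "Q \<in> P2" "w1_le P Q d"
  have "0 \<le> (B * \<bar>x - x'\<bar> + \<omega> d) * \<bar>y\<bar>" using \<omega>_nonneg[OF PQ] B by auto
  then show "\<bar>Dy x P y - Dy x' Q y'\<bar> \<le> (B * \<bar>x - x'\<bar> + \<omega> d) * (1 + \<bar>y\<bar>) + B * \<bar>y - y'\<bar>"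
    using Dy_diff[OF PQ, of x y x' y'] by (simp only: distrib_left mult_1_right)
qed

lemma \<delta>_cont:
  assumes "\<mu> \<in> P2" "continuous_on A f" "continuous_on A g" "continuous_on A h"
  shows "continuous_on (A :: 'c::metric_space set) (\<lambda>p. \<delta> (f p) (pf \<mu> (g p)) (h p))"
proof (rule coeff_cont[OF assms(1) _ assms(2,3,4)])
  fix P Q d and x y x' y' :: real assume PQ: "P \<in> P2" "Q \<in> P2" "w1_le P Q d"
  have "0 \<le> B * \<bar>x - x'\<bar> + \<omega> d" using \<omega>_nonneg[OF PQ] B by auto
  then show "\<bar>\<delta> x P y - \<delta> x' Q y'\<bar> \<le> (B * \<bar>x - x'\<bar> + \<omega> d) * (1 + \<bar>y\<bar>) + B * \<bar>y - y'\<bar>"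
    using \<delta>_diff[OF PQ, of x y x' y'] by (simp only: distrib_left mult_1_right)
qed

lemma D_flow_lip:
  assumes "\<mu> \<in> P2" "t \<in> {0..T}"
  shows "\<bar>D x (pf \<mu> t) (\<psi> y \<mu> t) - D x (pf \<mu> t) (\<psi> y' \<mu> t)\<bar> \<le> B * (Lx * \<bar>y - y'\<bar>)"
    "\<bar>Dy x (pf \<mu> t) (\<psi> y \<mu> t) - Dy x (pf \<mu> t) (\<psi> y' \<mu> t)\<bar> \<le> B * (Lx * \<bar>y - y'\<bar>)"
proof -
  have "B * \<bar>\<psi> y \<mu> t - \<psi> y' \<mu> t\<bar> \<le> B * (Lx * \<bar>y - y'\<bar>)"
    using B by (intro mult_left_mono \<psi>_lip assms) auto
  then show "\<bar>D x (pf \<mu> t) (\<psi> y \<mu> t) - D x (pf \<mu> t) (\<psi> y' \<mu> t)\<bar> \<le> B * (Lx * \<bar>y - y'\<bar>)"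
    "\<bar>Dy x (pf \<mu> t) (\<psi> y \<mu> t) - Dy x (pf \<mu> t) (\<psi> y' \<mu> t)\<bar> \<le> B * (Lx * \<bar>y - y'\<bar>)"
    using D_lip[OF pf_P2[OF assms(1)], of x t "\<psi> y \<mu> t" x "\<psi> y' \<mu> t"] Dy_lip[OF pf_P2[OF assms(1)], of x t "\<psi> y \<mu> t" x "\<psi> y' \<mu> t"]
    by auto
qed

definition A :: "real measure \<Rightarrow> real \<Rightarrow> real \<Rightarrow> real" where
  "A \<mu> x t = integral {0..t} (\<lambda>s. s1 (\<psi> x \<mu> s) (pf \<mu> s))"

definition \<psi>1 :: "real measure \<Rightarrow> real \<Rightarrow> real \<Rightarrow> real" where
  "\<psi>1 \<mu> x t = exp (A \<mu> x t)"

lemma s1_flow_cont: "\<mu> \<in> P2 \<Longrightarrow> continuous_on {0..T} (\<lambda>s. s1 (\<psi> x \<mu> s) (pf \<mu> s))"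
  by (intro s1_cont \<psi>_cont' continuous_intros) auto

lemma A_deriv:
  "\<mu> \<in> P2 \<Longrightarrow> t \<in> {0..T} \<Longrightarrow> (A \<mu> x has_real_derivative s1 (\<psi> x \<mu> t) (pf \<mu> t)) (at t within {0..T})"
  unfolding A_def by (rule integral_has_real_derivative[OF s1_flow_cont])

lemma A_0: "A \<mu> x 0 = 0" by (simp add: A_def)

lemma A_bound:
  assumes "\<mu> \<in> P2" "t \<in> {0..T}"
  shows "\<bar>A \<mu> x t\<bar> \<le> B * T"
proof -
  have "\<bar>A \<mu> x t - A \<mu> x 0\<bar> \<le> B * t - B * 0"
    by (rule abs_diff_le_if_deriv_le[OF A_deriv[OF assms(1)] _ s1_bound[OF pf_P2[OF assms(1)]] assms(2)])
      (auto intro!: derivative_eq_intros)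
  also have "\<dots> \<le> B * T" using assms B by simp
  finally show ?thesis by (simp add: A_0)
qed

lemma \<psi>1_bound:
  assumes "\<mu> \<in> P2" "t \<in> {0..T}"
  shows "\<bar>\<psi>1 \<mu> x t\<bar> \<le> exp (B * T)"
  using A_bound[OF assms, of x] by (auto simp: \<psi>1_def)

lemma \<psi>1_time_deriv:
  "\<mu> \<in> P2 \<Longrightarrow> t \<in> {0..T} \<Longrightarrow> (\<psi>1 \<mu> x has_real_derivative s1 (\<psi> x \<mu> t) (pf \<mu> t) * \<psi>1 \<mu> x t) (at t within {0..T})"
  unfolding \<psi>1_def by (auto intro!: derivative_eq_intros A_deriv simp: mult.commute)

text \<open>The first-order remainder of the flow satisfies the linearised equation up to the Taylor
  remainder of \<open>\<sigma>\<close>, which is quadratic in \<open>y - x\<close> by the Lipschitz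
  bound on the flow.\<close>

lemma \<psi>_deriv:
  assumes \<mu>: "\<mu> \<in> P2" and t: "t \<in> {0..T}"
  shows "((\<lambda>x. \<psi> x \<mu> t) has_real_derivative \<psi>1 \<mu> x t) (at x)"
proof (rule DERIV_from_remainder_bound)
  fix y
  define a where "a = (\<lambda>s. s1 (\<psi> x \<mu> s) (pf \<mu> s))"
  define q where "q = B * (Lx * \<bar>y - x\<bar>)\<^sup>2"
  have "\<bar>\<psi> y \<mu> t - \<psi> x \<mu> t - (y - x) * \<psi>1 \<mu> x t\<bar> \<le> 2 * (0 + q * T) * exp (2 * B * t)"
  proof (rule sup_gronwall[where I = "{()}" and e = "\<lambda>_ t. \<psi> y \<mu> t - \<psi> x \<mu> t - (y - x) * \<psi>1 \<mu> x t"
        and M = "Lx * \<bar>y - x\<bar> + \<bar>y - x\<bar> * exp (B * T)"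
        and e' = "\<lambda>_ t. \<sigma> (\<psi> y \<mu> t) (pf \<mu> t) - \<sigma> (\<psi> x \<mu> t) (pf \<mu> t) - (y - x) * (a t * \<psi>1 \<mu> x t)"])
    fix s assume s: "s \<in> {0..T}"
    show "((\<lambda>t. \<psi> y \<mu> t - \<psi> x \<mu> t - (y - x) * \<psi>1 \<mu> x t) has_real_derivative
        \<sigma> (\<psi> y \<mu> s) (pf \<mu> s) - \<sigma> (\<psi> x \<mu> s) (pf \<mu> s) - (y - x) * (a s * \<psi>1 \<mu> x s)) (at s within {0..T})"
      unfolding a_def by (intro DERIV_diff DERIV_cmult has_field_derivative_at_within[OF \<psi>_ode[OF \<mu>]] \<psi>1_time_deriv[OF \<mu> s])
    have "\<bar>(y - x) * \<psi>1 \<mu> x s\<bar> \<le> \<bar>y - x\<bar> * exp (B * T)"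
      unfolding abs_mult using \<psi>1_bound[OF \<mu> s] by (intro mult_left_mono) auto
    then show "\<bar>\<psi> y \<mu> s - \<psi> x \<mu> s - (y - x) * \<psi>1 \<mu> x s\<bar> \<le> Lx * \<bar>y - x\<bar> + \<bar>y - x\<bar> * exp (B * T)"
      using \<psi>_lip[OF \<mu> s, of y x] by linarith
    fix b' assume b': "\<And>j. j \<in> {()} \<Longrightarrow> \<bar>\<psi> y \<mu> s - \<psi> x \<mu> s - (y - x) * \<psi>1 \<mu> x s\<bar> \<le> b'"
    have "\<bar>\<sigma> (\<psi> y \<mu> s) (pf \<mu> s) - \<sigma> (\<psi> x \<mu> s) (pf \<mu> s) - (\<psi> y \<mu> s - \<psi> x \<mu> s) * a s\<bar> \<le> B * (\<psi> y \<mu> s - \<psi> x \<mu> s)\<^sup>2"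
      unfolding a_def using pf_P2[OF \<mu>] by (intro DERIV_remainder_bound s1 s1_lip)
    also have "(\<psi> y \<mu> s - \<psi> x \<mu> s)\<^sup>2 \<le> (Lx * \<bar>y - x\<bar>)\<^sup>2"
      using \<psi>_lip[OF \<mu> s, of y x] by (metis abs_ge_zero power2_abs power_mono)
    finally have r: "\<bar>\<sigma> (\<psi> y \<mu> s) (pf \<mu> s) - \<sigma> (\<psi> x \<mu> s) (pf \<mu> s) - (\<psi> y \<mu> s - \<psi> x \<mu> s) * a s\<bar> \<le> q"
      using B by (simp add: q_def)
    have "\<bar>a s * (\<psi> y \<mu> s - \<psi> x \<mu> s - (y - x) * \<psi>1 \<mu> x s)\<bar> \<le> B * b'"
      unfolding abs_mult a_def using b' s1_bound[OF pf_P2[OF \<mu>]] B by (intro mult_mono) auto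
    then show "\<bar>\<sigma> (\<psi> y \<mu> s) (pf \<mu> s) - \<sigma> (\<psi> x \<mu> s) (pf \<mu> s) - (y - x) * (a s * \<psi>1 \<mu> x s)\<bar> \<le> q + B * b'"
      using r by (simp add: algebra_simps)
  qed (use \<psi>_0[OF \<mu>] B t in \<open>auto simp: \<psi>1_def A_0 q_def\<close>)
  also have "\<dots> \<le> 2 * (0 + q * T) * exp (2 * B * T)"
    using t B T by (intro mult_left_mono) (auto simp: q_def)
  also have "\<dots> = (2 * B * Lx\<^sup>2 * T * exp (2 * B * T)) * (y - x)\<^sup>2"
    by (simp add: q_def power_mult_distrib)
  finally show "\<bar>\<psi> y \<mu> t - \<psi> x \<mu> t - (y - x) * \<psi>1 \<mu> x t\<bar> \<le> (2 * B * Lx\<^sup>2 * T * exp (2 * B * T)) * (y - x)\<^sup>2" .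
qed

text \<open>Bootstrapping in \<open>\<partial>\<^sub>x\<psi> = exp (\<integral> s1 (\<psi>, \<mu>\<^sub>s) ds)\<close>.\<close>

lemma \<psi>1_smooth: "bdd_smooth k (P2 \<times> {0..T}) (\<lambda>p x. \<psi>1 (fst p) x (snd p))"
proof -
  have s1s: "bdd_smooth k (P2 \<times> {0..T}) (\<lambda>p x. s1 x (pf (fst p) (snd p)))"
    by (rule bdd_smooth_reindex[OF s1_smooth, of _ "\<lambda>p. pf (fst p) (snd p)"]) (auto intro: pf_P2)
  \<comment> \<open>Integration in time and \<open>exp\<close> preserve the order of
    smoothness.\<close>
  have lift: "bdd_smooth j (P2 \<times> {0..T}) (\<lambda>p x. \<psi>1 (fst p) x (snd p))"
    if "bdd_smooth j (P2 \<times> {0..T}) (\<lambda>p x. s1 (\<psi> x (fst p) (snd p)) (pf (fst p) (snd p)))" for j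
    unfolding \<psi>1_def A_def
    by (rule bdd_smooth_exp, rule bdd_smooth_time_integral[where f = "\<lambda>p x. s1 (\<psi> x (fst p) (snd p)) (pf (fst p) (snd p))", simplified fst_conv snd_conv])
      (use that in \<open>auto intro!: s1_flow_cont simp del: bdd_smooth.simps\<close>)
  have "bdd_smooth j (P2 \<times> {0..T}) (\<lambda>p x. \<psi>1 (fst p) x (snd p))" if "j \<le> k" for j
    using that
  proof (induction j)
    case 0
    \<comment> \<open>The Lipschitz bound on the flow is enough to start.\<close>
    show ?case
      by (rule lift, rule bdd_smooth_comp_0[where L = Lx, OF bdd_smooth_le[OF s1s]]) (auto intro: \<psi>_lip)
  next
    case (Suc j)
    \<comment> \<open>Order \<open>j\<close> of \<open>\<psi>1\<close> gives order
      \<open>j + 1\<close> of \<open>s1\<close> along the flow, and \<open>lift\<close> returns this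
      order to \<open>\<psi>1\<close>.\<close>
    show ?case
      by (rule lift, rule bdd_smooth_comp_Suc[OF bdd_smooth_le[OF s1s]]) (use Suc in \<open>auto intro: \<psi>_deriv simp del: bdd_smooth.simps\<close>)
  qed
  then show ?thesis by blast
qed

definition C\<psi> :: real where "C\<psi> = 2 * (B * Lx * T) * exp (4 * B * T)"

lemma C\<psi>: "C\<psi> \<ge> 0" using B Lx T by (simp add: C\<psi>_def)

text \<open>The distance of the push-forwards involves the displacement of all starting points, so
  the Gronwall argument runs for all \<open>x\<close> simultaneously. The space and the measure
  argument of \<open>\<sigma>\<close> contribute \<open>B\<close> each.\<close>

lemma \<psi>_stable:
  assumes PQ: "P \<in> P2" "Q \<in> P2" "w1_le P Q d" and t: "t \<in> {0..T}"
  shows "\<bar>\<psi> x P t - \<psi> x Q t\<bar> \<le> C\<psi> * d"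
proof -
  have d: "d \<ge> 0" by (rule w1_le_nonneg[OF PQ(3)])
  have "\<bar>\<psi> x P t - \<psi> x Q t\<bar> \<le> 2 * (0 + (B * Lx * d) * T) * exp (2 * (2 * B) * t)"
  proof (rule sup_gronwall[where I = UNIV and e = "\<lambda>x t. \<psi> x P t - \<psi> x Q t" and M = "2 * B * T"
        and e' = "\<lambda>x t. \<sigma> (\<psi> x P t) (pf P t) - \<sigma> (\<psi> x Q t) (pf Q t)"])
    fix x s assume s: "s \<in> {0..T}"
    show "((\<lambda>t. \<psi> x P t - \<psi> x Q t) has_real_derivative \<sigma> (\<psi> x P s) (pf P s) - \<sigma> (\<psi> x Q s) (pf Q s)) (at s within {0..T})"
      by (intro derivative_intros has_field_derivative_at_within[OF \<psi>_ode] PQ)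
    have "B * \<bar>s - 0\<bar> \<le> B * T" using B s by (intro mult_left_mono) auto
    then show "\<bar>\<psi> x P s - \<psi> x Q s\<bar> \<le> 2 * B * T"
      using \<psi>_time_lip[OF PQ(1), of x s 0] \<psi>_time_lip[OF PQ(2), of x s 0] \<psi>_0[OF PQ(1)] \<psi>_0[OF PQ(2)] by (simp add: abs_le_iff)
    fix b' assume b': "\<And>j. j \<in> UNIV \<Longrightarrow> \<bar>\<psi> j P s - \<psi> j Q s\<bar> \<le> b'"
    have "w1_le (pf P s) (pf Q s) (Lx * d + b')"
      unfolding pf_def by (rule w1_le_distr[OF PQ(3,1,2)]) (use b' \<psi>_lip[OF PQ(1) s] \<psi>_meas[OF PQ(2)] in auto)
    then have "\<bar>\<sigma> (\<psi> x P s) (pf P s) - \<sigma> (\<psi> x P s) (pf Q s)\<bar> \<le> B * (Lx * d + b')"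
      by (intro \<sigma>_mod pf_P2 PQ)
    moreover have "\<bar>\<sigma> (\<psi> x P s) (pf Q s) - \<sigma> (\<psi> x Q s) (pf Q s)\<bar> \<le> B * b'"
      using \<sigma>_lip[OF pf_P2[OF PQ(2)]] b' B by (meson UNIV_I mult_left_mono order.trans less_imp_le)
    ultimately show "\<bar>\<sigma> (\<psi> x P s) (pf P s) - \<sigma> (\<psi> x Q s) (pf Q s)\<bar> \<le> B * Lx * d + 2 * B * b'"
      by (simp add: algebra_simps)
  qed (use \<psi>_0 PQ B t Lx d in auto)
  also have "\<dots> \<le> 2 * (0 + (B * Lx * d) * T) * exp (4 * B * T)"
    using t B T Lx d by (intro mult_left_mono) auto
  also have "\<dots> = C\<psi> * d" by (simp add: C\<psi>_def)
  finally show ?thesis .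
qed

lemma pf_stable:
  assumes PQ: "P \<in> P2" "Q \<in> P2" "w1_le P Q d" and t: "t \<in> {0..T}"
  shows "w1_le (pf P t) (pf Q t) ((Lx + C\<psi>) * d)"
proof -
  have "w1_le (pf P t) (pf Q t) (Lx * d + C\<psi> * d)"
    unfolding pf_def by (rule w1_le_distr[OF PQ(3,1,2)]) (use \<psi>_stable[OF PQ t] \<psi>_lip[OF PQ(1) t] \<psi>_meas[OF PQ(2)] in auto)
  then show ?thesis by (simp add: distrib_right)
qed

end

section \<open>The linearised flow\<close>

context flow
begin

lemma \<omega>_0: "\<omega> 0 = 0"
  using \<omega>[of "\<lambda>_. 0"] by (simp add: LIMSEQ_const_iff)

lemma A_smooth: "bdd_smooth k (P2 \<times> {0..T}) (\<lambda>p x. A (fst p) x (snd p))"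
proof -
  have s1s: "bdd_smooth k (P2 \<times> {0..T}) (\<lambda>p x. s1 x (pf (fst p) (snd p)))"
    by (rule bdd_smooth_reindex[OF s1_smooth, of _ "\<lambda>p. pf (fst p) (snd p)"]) (auto intro: pf_P2)
  have "bdd_smooth k (P2 \<times> {0..T}) (\<lambda>p x. s1 (\<psi> x (fst p) (snd p)) (pf (fst p) (snd p)))"
    by (rule bdd_smooth_comp[OF s1s \<psi>1_smooth]) (auto intro: \<psi>_deriv)
  then show ?thesis
    unfolding A_def
    by (intro bdd_smooth_time_integral[where f = "\<lambda>p x. s1 (\<psi> x (fst p) (snd p)) (pf (fst p) (snd p))", simplified fst_conv snd_conv])
      (auto intro!: s1_flow_cont simp del: bdd_smooth.simps)
qed

text \<open>The linearised equation, with its coefficients frozen outside \<open>[0, T]\<close>.\<close>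

definition cl :: "real \<Rightarrow> real" where "cl t = max 0 (min T t)"

lemma cl: "cl t \<in> {0..T}" "t \<in> {0..T} \<Longrightarrow> cl t = t"
  using T by (auto simp: cl_def)

lemma cl_cont: "continuous_on S f \<Longrightarrow> continuous_on S (\<lambda>x. cl (f x))"
  unfolding cl_def by (intro continuous_intros)

definition cA :: "real measure \<Rightarrow> real \<Rightarrow> real \<Rightarrow> real" where
  "cA \<mu> x t = s1 (\<psi> x \<mu> (cl t)) (pf \<mu> (cl t))"

definition cK :: "real measure \<Rightarrow> real \<Rightarrow> real \<Rightarrow> real \<Rightarrow> real" where
  "cK \<mu> x z t = D (\<psi> x \<mu> (cl t)) (pf \<mu> (cl t)) (\<psi> z \<mu> (cl t))"

lemma lin_eq: "\<mu> \<in> P2 \<Longrightarrow> lin_eq \<mu> T (cA \<mu>) (cK \<mu>) B"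
proof
  assume \<mu>: "\<mu> \<in> P2"
  have cl': "(\<lambda>p. cl (f p)) ` S \<subseteq> {0..T}" for f :: "'q \<Rightarrow> real" and S using cl by auto
  show "continuous_on UNIV (\<lambda>(x, t). cA \<mu> x t)"
    unfolding cA_def case_prod_unfold by (intro s1_cont \<psi>_cont' cl_cont continuous_intros \<mu> cl')
  show "continuous_on UNIV (\<lambda>(x, z, t). cK \<mu> x z t)"
    unfolding cK_def case_prod_unfold by (intro D_cont \<psi>_cont' cl_cont continuous_intros \<mu> cl')
qed (auto simp: cA_def cK_def T B intro: s1_bound D_bound pf_P2)

lemma lin_sol_ode:
  assumes "lin_sol \<mu> T (cA \<mu>) (cK \<mu>) S U" "t \<in> {0..T}"
  shows "(U x has_real_derivative s1 (\<psi> x \<mu> t) (pf \<mu> t) * U x t + S x t +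
     (\<integral>z. D (\<psi> x \<mu> t) (pf \<mu> t) (\<psi> z \<mu> t) * U z t \<partial>\<mu>)) (at t within {0..T})"
  using assms by (simp add: lin_sol_def cA_def cK_def cl)

text \<open>Variation of constants: \<open>U\<close> is \<open>exp A\<close> times the time integral
  of \<open>exp (- A)\<close> times the sum of source and nonlocal term. In the nonlocal term
  \<open>x\<close> enters only through the kernel, while \<open>U\<close> is evaluated at the
  integration variable; so a bound on \<open>U\<close> suffices there and the argument is not
  circular.\<close>

lemma lin_sol_smooth:
  fixes S U :: "'i \<Rightarrow> real \<Rightarrow> real \<Rightarrow> real"
  assumes m: "\<And>i. i \<in> I \<Longrightarrow> m i \<in> P2"
    and U: "\<And>i. i \<in> I \<Longrightarrow> lin_sol (m i) T (cA (m i)) (cK (m i)) (S i) (U i)"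
    and S: "bdd_smooth n (I \<times> {0..T}) (\<lambda>p x. S (fst p) x (snd p))" and n: "n \<le> k"
    and Sc: "\<And>i x. i \<in> I \<Longrightarrow> continuous_on {0..T} (\<lambda>t. S i x t)"
  shows "bdd_smooth n (I \<times> {0..T}) (\<lambda>p x. U (fst p) x (snd p))"
proof -
  obtain s where s: "s > 0" "\<And>p x. p \<in> I \<times> {0..T} \<Longrightarrow> \<bar>S (fst p) x (snd p)\<bar> \<le> s"
    using bdd_smooth_bounded[OF S] by blast
  define MU where "MU = 2 * s * T * exp (4 * B * T)"
  have MU: "\<bar>U i x t\<bar> \<le> MU" if "i \<in> I" "t \<in> {0..T}" for i x t
    unfolding MU_def
    by (rule lin_eq.lin_sol_bound[OF lin_eq[OF m[OF that(1)]] U[OF that(1)] _ that(2)]) (use s(2)[of "(i, _)"] that in auto)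
  have Uc: "continuous_on UNIV (\<lambda>z. U i z t)" if "i \<in> I" "t \<in> {0..T}" for i t
    by (rule lin_eq.lin_sol_measurable(1)[OF lin_eq[OF m[OF that(1)]] U[OF that(1)] that(2)])
  define J where "J = (\<lambda>i x t. \<integral>z. cK (m i) x z t * U i z t \<partial>m i)"
  define R where "R = (\<lambda>i x t. S i x t + J i x t)"
  have g1: "bdd_smooth n ((I \<times> {0..T}) \<times> UNIV) (\<lambda>q x. D (\<psi> x (m (fst (fst q))) (snd (fst q))) (pf (m (fst (fst q))) (snd (fst q))) (\<psi> (snd q) (m (fst (fst q))) (snd (fst q))))"
  proof (rule bdd_smooth_comp[where g = "\<lambda>q x. \<psi> x (m (fst (fst q))) (snd (fst q))" and g' = "\<lambda>q x. \<psi>1 (m (fst (fst q))) x (snd (fst q))"])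
    show "bdd_smooth n ((I \<times> {0..T}) \<times> UNIV) (\<lambda>q x. D x (pf (m (fst (fst q))) (snd (fst q))) (\<psi> (snd q) (m (fst (fst q))) (snd (fst q))))"
      by (rule bdd_smooth_reindex[OF bdd_smooth_le[OF D_smooth n], of _ "\<lambda>q. (pf (m (fst (fst q))) (snd (fst q)), \<psi> (snd q) (m (fst (fst q))) (snd (fst q)))"])
        (auto intro!: pf_P2 m)
    show "bdd_smooth n ((I \<times> {0..T}) \<times> UNIV) (\<lambda>q x. \<psi>1 (m (fst (fst q))) x (snd (fst q)))"
      by (rule bdd_smooth_reindex[OF bdd_smooth_le[OF \<psi>1_smooth n], of _ "\<lambda>q. (m (fst (fst q)), snd (fst q))"]) (auto intro: m)
  qed (auto intro!: \<psi>_deriv m)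
  have Js: "bdd_smooth n (I \<times> {0..T}) (\<lambda>p x. \<integral>z. D (\<psi> x (m (fst p)) (snd p)) (pf (m (fst p)) (snd p)) (\<psi> z (m (fst p)) (snd p)) * U (fst p) z (snd p) \<partial>m (fst p))"
  proof (rule bdd_smooth_average[where g = "\<lambda>q x. D (\<psi> x (m (fst (fst q))) (snd (fst q))) (pf (m (fst (fst q))) (snd (fst q))) (\<psi> (snd q) (m (fst (fst q))) (snd (fst q))) * U (fst (fst q)) (snd q) (snd (fst q))"
        and \<Omega>' = "(I \<times> {0..T}) \<times> UNIV" and c = 1, simplified fst_conv snd_conv])
    \<comment> \<open>The factor \<open>U\<close> is constant in \<open>x\<close>; it depends on the
      index and the integration variable.\<close>
    show "bdd_smooth n ((I \<times> {0..T}) \<times> UNIV) (\<lambda>q x. D (\<psi> x (m (fst (fst q))) (snd (fst q))) (pf (m (fst (fst q))) (snd (fst q))) (\<psi> (snd q) (m (fst (fst q))) (snd (fst q))) * U (fst (fst q)) (snd q) (snd (fst q)))"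
      by (rule bdd_smooth_mult[OF g1 bdd_smooth_const[of _ _ MU]]) (auto intro!: MU)
    fix p assume p: "p \<in> I \<times> {0..T}"
    then have mp: "m (fst p) \<in> P2" by (auto intro: m)
    interpret prob_space "m (fst p)" using P2D(1)[OF mp] .
    show "finite_measure (m (fst p))" by (rule finite_measure_axioms)
    show "prob (space (m (fst p))) \<le> 1" by simp
    show "(p, z) \<in> (I \<times> {0..T}) \<times> UNIV" for z using p by simp
    show "(\<lambda>z. D (\<psi> x (m (fst p)) (snd p)) (pf (m (fst p)) (snd p)) (\<psi> z (m (fst p)) (snd p)) * U (fst p) z (snd p)) \<in> borel_measurable (m (fst p))" for x
    proof (rule P2_measurable[OF mp], rule borel_measurable_continuous_onI)
      show "continuous_on UNIV (\<lambda>z. D (\<psi> x (m (fst p)) (snd p)) (pf (m (fst p)) (snd p)) (\<psi> z (m (fst p)) (snd p)) * U (fst p) z (snd p))"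
        using p by (intro continuous_on_mult Uc D_cont[OF mp, of UNIV "\<lambda>_. \<psi> x (m (fst p)) (snd p)" "\<lambda>_. snd p"] \<psi>_cont'[OF mp] continuous_intros) auto
    qed
  qed
  have Rs: "bdd_smooth n (I \<times> {0..T}) (\<lambda>p x. R (fst p) x (snd p))"
    unfolding R_def
    by (rule bdd_smooth_add[OF S bdd_smooth_reindex[OF Js, of _ "\<lambda>p. p"]]) (auto simp: J_def cK_def cl)
  have As: "bdd_smooth n (I \<times> {0..T}) (\<lambda>p x. A (m (fst p)) x (snd p))"
    by (rule bdd_smooth_reindex[OF bdd_smooth_le[OF A_smooth n], of _ "\<lambda>p. (m (fst p), snd p)"]) (auto intro: m)
  have Rc: "continuous_on {0..T} (\<lambda>t. exp (- A (m i) x t) * R i x t)" if i: "i \<in> I" for i x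
  proof (intro continuous_intros)
    show "continuous_on {0..T} (A (m i) x)"
      using A_deriv[OF m[OF i]] by (meson DERIV_continuous continuous_on_eq_continuous_within)
    have "continuous_on (UNIV \<times> {0..T}) (\<lambda>(x, t). J i x t)"
      unfolding J_def using U[OF i] MU[OF i] by (intro lin_eq.KU_integral_continuous[OF lin_eq[OF m[OF i]]]) (auto simp: lin_sol_def)
    then have "continuous_on {0..T} (\<lambda>t. (\<lambda>(x, t). J i x t) (x, t))"
      by (rule continuous_on_compose2) (auto intro!: continuous_intros)
    then show "continuous_on {0..T} (R i x)"
      unfolding R_def using Sc[OF i] by (auto intro!: continuous_intros)
  qed
  have rep: "U i x t = exp (A (m i) x t) * integral {0..t} (\<lambda>s. exp (- A (m i) x s) * R i x s)" if i: "i \<in> I" and t: "t \<in> {0..T}" for i x t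
  proof -
    have "((\<lambda>s. exp (- A (m i) x s) * R i x s) has_integral exp (- A (m i) x t) * U i x t - exp (- A (m i) x 0) * U i x 0) {0..t}"
    proof (rule fundamental_theorem_of_calculus)
      fix s assume "s \<in> {0..t}"
      then have s: "s \<in> {0..T}" using t by auto
      have "(U i x has_real_derivative s1 (\<psi> x (m i) s) (pf (m i) s) * U i x s + R i x s) (at s within {0..T})"
        using lin_sol_ode[OF U[OF i] s, of x] s by (simp add: R_def J_def cK_def cl add.assoc)
      \<comment> \<open>The integrating factor cancels the local term, since \<open>A\<close> has
        the local coefficient as its time derivative.\<close>
      then have "((\<lambda>s. exp (- A (m i) x s) * U i x s) has_real_derivative exp (- A (m i) x s) * R i x s) (at s within {0..T})"
        by (auto intro!: derivative_eq_intros A_deriv[OF m[OF i] s] simp: algebra_simps)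
      then have "((\<lambda>s. exp (- A (m i) x s) * U i x s) has_real_derivative exp (- A (m i) x s) * R i x s) (at s within {0..t})"
        by (rule DERIV_subset) (use t in auto)
      then show "((\<lambda>s. exp (- A (m i) x s) * U i x s) has_vector_derivative exp (- A (m i) x s) * R i x s) (at s within {0..t})"
        by (simp add: has_real_derivative_iff_has_vector_derivative)
    qed (use t in auto)
    moreover have "U i x 0 = 0" using U[OF i] by (simp add: lin_sol_def)
    ultimately have "integral {0..t} (\<lambda>s. exp (- A (m i) x s) * R i x s) = exp (- A (m i) x t) * U i x t"
      by (simp add: integral_unique)
    then show ?thesis by (simp flip: mult.assoc exp_add)
  qed
  have "bdd_smooth n (I \<times> {0..T}) (\<lambda>p x. exp (A (m (fst p)) x (snd p)) * integral {0..snd p} (\<lambda>s. exp (- A (m (fst p)) x s) * R (fst p) x s))"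
  proof (rule bdd_smooth_mult[OF bdd_smooth_exp[OF As]])
    show "bdd_smooth n (I \<times> {0..T}) (\<lambda>p x. integral {0..snd p} (\<lambda>s. exp (- A (m (fst p)) x s) * R (fst p) x s))"
      by (rule bdd_smooth_time_integral[where f = "\<lambda>p x. exp (- A (m (fst p)) x (snd p)) * R (fst p) x (snd p)", simplified fst_conv snd_conv])
        (intro bdd_smooth_mult bdd_smooth_exp bdd_smooth_uminus As Rs Rc)+
  qed
  then show ?thesis
    by (rule bdd_smooth_reindex[where h = "\<lambda>p. p"]) (auto intro: rep)
qed

definition S0 :: "real measure \<Rightarrow> real \<Rightarrow> real \<Rightarrow> real \<Rightarrow> real" where
  "S0 \<mu> y x t = \<delta> (\<psi> x \<mu> t) (pf \<mu> t) (\<psi> y \<mu> t)"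

definition S1 :: "real measure \<Rightarrow> real \<Rightarrow> real \<Rightarrow> real \<Rightarrow> real" where
  "S1 \<mu> y x t = D (\<psi> x \<mu> t) (pf \<mu> t) (\<psi> y \<mu> t) * \<psi>1 \<mu> y t"

text \<open>\<open>U0\<close> and \<open>U1\<close> turn out to be \<open>\<delta>\<^sub>\<mu>\<psi>\<close> and \<open>D\<^sub>\<mu>\<psi>\<close>.\<close>

definition U0 :: "real measure \<Rightarrow> real \<Rightarrow> real \<Rightarrow> real \<Rightarrow> real" where
  "U0 \<mu> y = (SOME U. lin_sol \<mu> T (cA \<mu>) (cK \<mu>) (S0 \<mu> y) U)"

definition U1 :: "real measure \<Rightarrow> real \<Rightarrow> real \<Rightarrow> real \<Rightarrow> real" where
  "U1 \<mu> y = (SOME U. lin_sol \<mu> T (cA \<mu>) (cK \<mu>) (S1 \<mu> y) U)"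

section \<open>Bounds and regularity of the solutions \<open>U0\<close> and
  \<open>U1\<close>\<close>

lemma S0_bound:
  assumes "\<mu> \<in> P2" "t \<in> {0..T}"
  shows "\<bar>S0 \<mu> y x t\<bar> \<le> B * (\<bar>y\<bar> + B * T)"
  unfolding S0_def using B by (intro order.trans[OF \<delta>_bound[OF pf_P2[OF assms(1)]] mult_left_mono[OF \<psi>_bound[OF assms]]]) auto

lemma S0_cont: "\<mu> \<in> P2 \<Longrightarrow> continuous_on (UNIV \<times> {0..T}) (\<lambda>(x, t). S0 \<mu> y x t)"
  unfolding S0_def case_prod_unfold by (intro \<delta>_cont \<psi>_cont' continuous_intros) auto

lemma S0_y:
  assumes "\<mu> \<in> P2" "t \<in> {0..T}"
  shows "\<bar>S0 \<mu> y x t - S0 \<mu> y' x t\<bar> \<le> (B * Lx) * \<bar>y - y'\<bar>"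
  unfolding S0_def using order.trans[OF \<delta>_lip[OF pf_P2[OF assms(1)]] mult_left_mono[OF \<psi>_lip[OF assms, of y y']]] B
  by (simp add: mult.assoc)

lemma S0_x:
  assumes "\<mu> \<in> P2" "t \<in> {0..T}"
  shows "\<bar>S0 \<mu> y x t - S0 \<mu> y x' t\<bar> \<le> (B * Lx * (\<bar>y\<bar> + B * T)) * \<bar>x - x'\<bar>"
proof -
  have "\<bar>S0 \<mu> y x t - S0 \<mu> y x' t\<bar> \<le> B * \<bar>\<psi> x \<mu> t - \<psi> x' \<mu> t\<bar> * \<bar>\<psi> y \<mu> t\<bar>"
    using \<delta>_diff[OF pf_P2[OF assms(1)] pf_P2[OF assms(1)] w1_le_refl, of "\<psi> x \<mu> t" t "\<psi> y \<mu> t" "\<psi> x' \<mu> t" "\<psi> y \<mu> t"]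
    by (simp add: S0_def \<omega>_0)
  also have "\<dots> \<le> B * (Lx * \<bar>x - x'\<bar>) * (\<bar>y\<bar> + B * T)"
    using B Lx by (intro mult_mono \<psi>_lip \<psi>_bound assms) auto
  finally show ?thesis by (simp add: mult_ac)
qed

lemma \<psi>1_cont:
  assumes "\<mu> \<in> P2" "continuous_on S f" "f ` S \<subseteq> {0..T}"
  shows "continuous_on S (\<lambda>p. \<psi>1 \<mu> y (f p))"
proof -
  have "continuous_on {0..T} (\<psi>1 \<mu> y)"
    using \<psi>1_time_deriv[OF assms(1)] by (meson DERIV_continuous continuous_on_eq_continuous_within)
  then show ?thesis using assms(2,3) by (rule continuous_on_compose2)
qed

lemma S1_cont: "\<mu> \<in> P2 \<Longrightarrow> continuous_on (UNIV \<times> {0..T}) (\<lambda>(x, t). S1 \<mu> y x t)"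
  unfolding S1_def case_prod_unfold by (intro continuous_on_mult D_cont \<psi>_cont' \<psi>1_cont continuous_intros) auto

lemma S1_bound:
  assumes "\<mu> \<in> P2" "t \<in> {0..T}"
  shows "\<bar>S1 \<mu> y x t\<bar> \<le> B * exp (B * T)"
  unfolding S1_def abs_mult using B by (intro mult_mono D_bound pf_P2 \<psi>1_bound assms) auto

lemma U0: "\<mu> \<in> P2 \<Longrightarrow> lin_sol \<mu> T (cA \<mu>) (cK \<mu>) (S0 \<mu> y) (U0 \<mu> y)"
  using lin_eq.lin_sol_exists[OF lin_eq S0_cont S0_bound] unfolding U0_def by (rule someI_ex)

lemma U1: "\<mu> \<in> P2 \<Longrightarrow> lin_sol \<mu> T (cA \<mu>) (cK \<mu>) (S1 \<mu> y) (U1 \<mu> y)"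
  using lin_eq.lin_sol_exists[OF lin_eq S1_cont S1_bound] unfolding U1_def by (rule someI_ex)

lemma S0_deriv:
  assumes "\<mu> \<in> P2" "t \<in> {0..T}"
  shows "((\<lambda>y. S0 \<mu> y x t) has_real_derivative S1 \<mu> y x t) (at y)"
  unfolding S0_def S1_def by (rule DERIV_chain2[OF \<delta>(1)[OF pf_P2[OF assms(1)]] \<psi>_deriv[OF assms]])

lemma \<psi>1_lip: "\<exists>L>0. \<forall>\<mu>\<in>P2. \<forall>t\<in>{0..T}. \<forall>y y'. \<bar>\<psi>1 \<mu> y t - \<psi>1 \<mu> y' t\<bar> \<le> L * \<bar>y - y'\<bar>"
  by (rule bdd_smooth_lipschitz[OF \<psi>1_smooth]) fastforce

lemma S1_lip: "\<exists>L. \<forall>\<mu>\<in>P2. \<forall>t\<in>{0..T}. \<forall>x y y'. \<bar>S1 \<mu> y x t - S1 \<mu> y' x t\<bar> \<le> L * \<bar>y - y'\<bar>"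
proof -
  obtain L where L: "\<And>\<mu> t y y'. \<mu> \<in> P2 \<Longrightarrow> t \<in> {0..T} \<Longrightarrow> \<bar>\<psi>1 \<mu> y t - \<psi>1 \<mu> y' t\<bar> \<le> L * \<bar>y - y'\<bar>"
    using \<psi>1_lip by blast
  have "\<bar>S1 \<mu> y x t - S1 \<mu> y' x t\<bar> \<le> (B * L + B * Lx * exp (B * T)) * \<bar>y - y'\<bar>" if "\<mu> \<in> P2" "t \<in> {0..T}" for \<mu> t x y y'
  proof -
    from abs_mult_diff_le[OF D_bound[OF pf_P2[OF that(1)]] \<psi>1_bound[OF that, of y'] L[OF that, of y y'] D_flow_lip(1)[OF that, of "\<psi> x \<mu> t" y y']]
    show ?thesis unfolding S1_def by (simp add: algebra_simps)
  qed
  then show ?thesis by blast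
qed

lemma U0_deriv:
  assumes "\<mu> \<in> P2" "t \<in> {0..T}"
  shows "((\<lambda>y. U0 \<mu> y x t) has_real_derivative U1 \<mu> y x t) (at y)"
proof -
  obtain L where L: "\<And>t x y y'. t \<in> {0..T} \<Longrightarrow> \<bar>S1 \<mu> y x t - S1 \<mu> y' x t\<bar> \<le> L * \<bar>y - y'\<bar>"
    using S1_lip assms(1) by blast
  show ?thesis
    by (rule lin_eq.lin_sol_deriv_param[OF lin_eq[OF assms(1)] U0[OF assms(1)] U1[OF assms(1)] S0_deriv[OF assms(1)] L assms(2)])
qed

text \<open>The source \<open>S1\<close> is bounded uniformly in \<open>y\<close>, whereas the bound
  for \<open>S0\<close> grows linearly; this is the gain from differentiating in \<open>y\<close>.
  The factor \<open>\<psi>1 \<mu> y t\<close> of \<open>S1\<close> is constant in \<open>x\<close>,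
  so the regularity in \<open>x\<close> is that of \<open>D\<close> along the flow.\<close>

lemma U1_smooth: "bdd_smooth k ((P2 \<times> UNIV) \<times> {0..T}) (\<lambda>p x. U1 (fst (fst p)) (snd (fst p)) x (snd p))"
proof (rule lin_sol_smooth[where I = "P2 \<times> UNIV" and m = fst and S = "\<lambda>i. S1 (fst i) (snd i)" and U = "\<lambda>i. U1 (fst i) (snd i)", OF _ _ _ order.refl])
  have "bdd_smooth k ((P2 \<times> UNIV) \<times> {0..T}) (\<lambda>p x. D (\<psi> x (fst (fst p)) (snd p)) (pf (fst (fst p)) (snd p)) (\<psi> (snd (fst p)) (fst (fst p)) (snd p)))"
  proof (rule bdd_smooth_comp[where g = "\<lambda>q x. \<psi> x (fst (fst q)) (snd q)" and g' = "\<lambda>q x. \<psi>1 (fst (fst q)) x (snd q)"])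
    show "bdd_smooth k ((P2 \<times> UNIV) \<times> {0..T}) (\<lambda>p x. D x (pf (fst (fst p)) (snd p)) (\<psi> (snd (fst p)) (fst (fst p)) (snd p)))"
      by (rule bdd_smooth_reindex[OF D_smooth, of _ "\<lambda>p. (pf (fst (fst p)) (snd p), \<psi> (snd (fst p)) (fst (fst p)) (snd p))"]) (auto intro: pf_P2)
    show "bdd_smooth k ((P2 \<times> UNIV) \<times> {0..T}) (\<lambda>q x. \<psi>1 (fst (fst q)) x (snd q))"
      by (rule bdd_smooth_reindex[OF \<psi>1_smooth, of _ "\<lambda>p. (fst (fst p), snd p)"]) auto
  qed (auto intro!: \<psi>_deriv)
  then show "bdd_smooth k ((P2 \<times> UNIV) \<times> {0..T}) (\<lambda>p x. S1 (fst (fst p)) (snd (fst p)) x (snd p))"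
    unfolding S1_def by (rule bdd_smooth_mult[OF _ bdd_smooth_const[of _ _ "exp (B * T)"]]) (auto intro!: \<psi>1_bound)
  show "continuous_on {0..T} (\<lambda>t. S1 (fst i) (snd i) x t)" if "i \<in> P2 \<times> UNIV" for i x
    unfolding S1_def using that by (intro continuous_on_mult D_cont \<psi>_cont' \<psi>1_cont continuous_intros) auto
qed (auto intro: U1)

text \<open>\<open>U2\<close> solves the equation with the derivative of \<open>S1\<close> in
  \<open>y\<close> as its source. This source contains \<open>Dy\<close>, which has one order less
  than \<open>D\<close>, and the second spatial derivative \<open>\<psi>2\<close> of the flow, which
  exists for \<open>k \<ge> 1\<close>.\<close>

lemma U1_y_deriv:
  assumes k: "1 \<le> k"
  obtains U2 where "\<And>\<mu> t x y. \<mu> \<in> P2 \<Longrightarrow> t \<in> {0..T} \<Longrightarrow> ((\<lambda>y. U1 \<mu> y x t) has_real_derivative U2 \<mu> y x t) (at y)"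
    "bdd_smooth (k - 1) ((P2 \<times> UNIV) \<times> {0..T}) (\<lambda>p x. U2 (fst (fst p)) (snd (fst p)) x (snd p))"
proof -
  have "bdd_smooth (Suc (k - 1)) (P2 \<times> {0..T}) (\<lambda>p x. \<psi>1 (fst p) x (snd p))"
    using \<psi>1_smooth k by simp
  then obtain \<psi>2' where \<psi>2': "\<And>p x. p \<in> P2 \<times> {0..T} \<Longrightarrow> ((\<lambda>x. \<psi>1 (fst p) x (snd p)) has_real_derivative \<psi>2' p x) (at x)"
    "bdd_smooth (k - 1) (P2 \<times> {0..T}) \<psi>2'"
    by (rule bdd_smooth_SucE) blast
  define \<psi>2 where "\<psi>2 = (\<lambda>\<mu> y t. \<psi>2' (\<mu>, t) y)"
  have \<psi>2: "((\<lambda>y. \<psi>1 \<mu> y t) has_real_derivative \<psi>2 \<mu> y t) (at y)" if "\<mu> \<in> P2" "t \<in> {0..T}" for \<mu> y t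
    using \<psi>2'(1)[of "(\<mu>, t)"] that by (simp add: \<psi>2_def)
  obtain b2 where b2: "b2 > 0" "\<And>\<mu> y t. \<mu> \<in> P2 \<Longrightarrow> t \<in> {0..T} \<Longrightarrow> \<bar>\<psi>2 \<mu> y t\<bar> \<le> b2"
    unfolding \<psi>2_def by (rule bdd_smooth_bounded[OF \<psi>2'(2)]) fastforce
  obtain L2 where L2: "L2 > 0" "\<And>\<mu> y y' t. \<mu> \<in> P2 \<Longrightarrow> t \<in> {0..T} \<Longrightarrow> \<bar>\<psi>2 \<mu> y t - \<psi>2 \<mu> y' t\<bar> \<le> L2 * \<bar>y - y'\<bar>"
    unfolding \<psi>2_def by (rule bdd_smooth_lipschitz[OF \<psi>2'(2)]) fastforce
  obtain L1 where L1: "L1 > 0" "\<And>\<mu> t y y'. \<mu> \<in> P2 \<Longrightarrow> t \<in> {0..T} \<Longrightarrow> \<bar>\<psi>1 \<mu> y t - \<psi>1 \<mu> y' t\<bar> \<le> L1 * \<bar>y - y'\<bar>"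
    using \<psi>1_lip by blast
  \<comment> \<open>\<open>\<psi>1\<close> is Lipschitz in time and \<open>\<psi>2\<close> in space; by interpolation \<open>\<psi>2\<close> is Hoelder continuous in time.\<close>
  have \<psi>2_cont: "continuous_on {0..T} (\<psi>2 \<mu> y)" if \<mu>: "\<mu> \<in> P2" for \<mu> y
    unfolding continuous_on_sequentially
  proof (intro allI impI ballI)
    fix X t assume t: "t \<in> {0..T}" and X: "(\<forall>n. X n \<in> {0..T}) \<and> X \<longlonglongrightarrow> t"
    define e where "e = B * exp (B * T)"
    have time: "\<bar>\<psi>1 \<mu> y s - \<psi>1 \<mu> y s'\<bar> \<le> e * \<bar>s - s'\<bar>" if "s \<in> {0..T}" "s' \<in> {0..T}" for s s' y
    proof (rule field_differentiable_bound[of "{0..T}", unfolded real_norm_def, OF _ \<psi>1_time_deriv[OF \<mu>] _ that])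
      show "\<bar>s1 (\<psi> y \<mu> t) (pf \<mu> t) * \<psi>1 \<mu> y t\<bar> \<le> e" if "t \<in> {0..T}" for t
        unfolding e_def abs_mult using B by (intro mult_mono s1_bound pf_P2 \<psi>1_bound \<mu> that) auto
    qed auto
    have "(\<lambda>n. \<psi>2 \<mu> y (X n)) \<longlonglongrightarrow> \<psi>2 \<mu> y t"
    proof (rule LIM_zero_cancel, rule Lim_null_comparison)
      have "(\<lambda>n. (2 * e + 2 * L2) * sqrt \<bar>X n - t\<bar>) \<longlonglongrightarrow> (2 * e + 2 * L2) * sqrt \<bar>t - t\<bar>"
        using X by (intro tendsto_intros) auto
      then show "(\<lambda>n. (2 * e + 2 * L2) * sqrt \<bar>X n - t\<bar>) \<longlonglongrightarrow> 0" by simp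
      have "\<bar>\<psi>2 \<mu> y (X n) - \<psi>2 \<mu> y t\<bar> \<le> (2 * e + 2 * L2) * sqrt \<bar>X n - t\<bar>" for n
      proof (cases "X n = t")
        case False
        define h where "h = sqrt \<bar>X n - t\<bar>"
        have h: "h > 0" "\<bar>X n - t\<bar> / h = h" using False by (auto simp: h_def real_div_sqrt)
        have "\<bar>\<psi>2 \<mu> y (X n) - \<psi>2 \<mu> y t\<bar> \<le> 2 * e * \<bar>X n - t\<bar> / h + 2 * L2 * h"
        proof (rule lipschitz_if_deriv_modulus[where s = "\<lambda>t y. \<psi>1 \<mu> y t" and s' = "\<lambda>t y. \<psi>2 \<mu> y t" and P = "X n" and Q = t])
          fix s assume "s \<in> {X n, t}"
          then have s: "s \<in> {0..T}" using X t by auto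
          show "\<bar>\<psi>1 \<mu> (y + h) s - \<psi>1 \<mu> y s - h * \<psi>2 \<mu> y s\<bar> \<le> L2 * h\<^sup>2"
            using DERIV_remainder_bound[OF \<psi>2[OF \<mu> s] L2(2)[OF \<mu> s], of "y + h" y] by simp
        qed (use time X t h in auto)
        also have "2 * e * \<bar>X n - t\<bar> / h = 2 * e * h" by (simp only: times_divide_eq_right[symmetric] h)
        finally show ?thesis by (simp add: h_def algebra_simps)
      qed simp
      then show "\<forall>\<^sub>F n in sequentially. norm (\<psi>2 \<mu> y (X n) - \<psi>2 \<mu> y t) \<le> (2 * e + 2 * L2) * sqrt \<bar>X n - t\<bar>" by simp
    qed
    then show "(\<psi>2 \<mu> y \<circ> X) \<longlonglongrightarrow> \<psi>2 \<mu> y t" by (simp add: comp_def)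
  qed
  define S2 where "S2 = (\<lambda>\<mu> y x t. Dy (\<psi> x \<mu> t) (pf \<mu> t) (\<psi> y \<mu> t) * (\<psi>1 \<mu> y t * \<psi>1 \<mu> y t)
      + D (\<psi> x \<mu> t) (pf \<mu> t) (\<psi> y \<mu> t) * \<psi>2 \<mu> y t)"
  have S2_deriv: "((\<lambda>y. S1 \<mu> y x t) has_real_derivative S2 \<mu> y x t) (at y)" if "\<mu> \<in> P2" "t \<in> {0..T}" for \<mu> x y t
  proof -
    have "((\<lambda>y. D (\<psi> x \<mu> t) (pf \<mu> t) (\<psi> y \<mu> t)) has_real_derivative Dy (\<psi> x \<mu> t) (pf \<mu> t) (\<psi> y \<mu> t) * \<psi>1 \<mu> y t) (at y)"
      by (rule DERIV_chain2[OF Dy[OF pf_P2[OF that(1)]] \<psi>_deriv[OF that]])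
    from DERIV_mult[OF this \<psi>2[OF that]] show ?thesis
      unfolding S1_def S2_def by (rule DERIV_cong) (simp add: algebra_simps)
  qed
  have S2_cont: "continuous_on (UNIV \<times> {0..T}) (\<lambda>(x, t). S2 \<mu> y x t)" "continuous_on {0..T} (\<lambda>t. S2 \<mu> y x t)" if "\<mu> \<in> P2" for \<mu> x y
    unfolding S2_def case_prod_unfold using that
    by (intro continuous_on_add continuous_on_mult D_cont Dy_cont \<psi>_cont' \<psi>1_cont continuous_on_compose2[OF \<psi>2_cont] continuous_intros; auto)+
  have S2_bound: "\<bar>S2 \<mu> y x t\<bar> \<le> B * (exp (B * T) * exp (B * T)) + B * b2" if "\<mu> \<in> P2" "t \<in> {0..T}" for \<mu> x y t
    unfolding S2_def using B that
    by (intro order.trans[OF abs_triangle_ineq] add_mono, unfold abs_mult) (intro mult_mono D_bound Dy_bound pf_P2 \<psi>1_bound b2; simp)+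
  \<comment> \<open>The product estimate \<open>abs_mult_diff_le\<close> for both summands of
    \<open>S2\<close>, the square of \<open>\<psi>1\<close> being treated first.\<close>
  define L where "L = B * (exp (B * T) * L1 + L1 * exp (B * T)) + B * Lx * (exp (B * T) * exp (B * T)) + (B * L2 + B * Lx * b2)"
  have S2_lip: "\<bar>S2 \<mu> y x t - S2 \<mu> y' x t\<bar> \<le> L * \<bar>y - y'\<bar>" if "\<mu> \<in> P2" "t \<in> {0..T}" for \<mu> x y y' t
  proof -
    note p = pf_P2[OF that(1)]
    note d = D_flow_lip(1)[OF that, of "\<psi> x \<mu> t" y y'] and dy = D_flow_lip(2)[OF that, of "\<psi> x \<mu> t" y y']
    have q: "\<bar>\<psi>1 \<mu> y t * \<psi>1 \<mu> y t - \<psi>1 \<mu> y' t * \<psi>1 \<mu> y' t\<bar> \<le> exp (B * T) * (L1 * \<bar>y - y'\<bar>) + L1 * \<bar>y - y'\<bar> * exp (B * T)"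
      by (rule abs_mult_diff_le[OF \<psi>1_bound[OF that] \<psi>1_bound[OF that] L1(2)[OF that] L1(2)[OF that]])
    have b: "\<bar>\<psi>1 \<mu> y' t * \<psi>1 \<mu> y' t\<bar> \<le> exp (B * T) * exp (B * T)"
      unfolding abs_mult by (intro mult_mono \<psi>1_bound that) auto
    show ?thesis
      using abs_mult_diff_le[OF Dy_bound[OF p] b q dy] abs_mult_diff_le[OF D_bound[OF p] b2(2)[OF that, of y'] L2(2)[OF that, of y y'] d]
      unfolding S2_def L_def by (simp only: distrib_left distrib_right mult_ac) linarith
  qed
  define U2 where "U2 = (\<lambda>\<mu> y. SOME U. lin_sol \<mu> T (cA \<mu>) (cK \<mu>) (S2 \<mu> y) U)"
  have U2: "lin_sol \<mu> T (cA \<mu>) (cK \<mu>) (S2 \<mu> y) (U2 \<mu> y)" if "\<mu> \<in> P2" for \<mu> y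
    using lin_eq.lin_sol_exists[OF lin_eq[OF that] S2_cont(1)[OF that] S2_bound[OF that]] unfolding U2_def by (rule someI_ex)
  show ?thesis
  proof (rule that)
    show "((\<lambda>y. U1 \<mu> y x t) has_real_derivative U2 \<mu> y x t) (at y)" if "\<mu> \<in> P2" "t \<in> {0..T}" for \<mu> t x y
      by (rule lin_eq.lin_sol_deriv_param[OF lin_eq[OF that(1)] U1[OF that(1)] U2[OF that(1)] S2_deriv[OF that(1)] S2_lip[OF that(1)] that(2)])
    show "bdd_smooth (k - 1) ((P2 \<times> UNIV) \<times> {0..T}) (\<lambda>p x. U2 (fst (fst p)) (snd (fst p)) x (snd p))"
    proof (rule lin_sol_smooth[where I = "P2 \<times> UNIV" and m = fst and S = "\<lambda>i. S2 (fst i) (snd i)" and U = "\<lambda>i. U2 (fst i) (snd i)"])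
      have \<psi>1s: "bdd_smooth (k - 1) ((P2 \<times> UNIV) \<times> {0..T}) (\<lambda>q x. \<psi>1 (fst (fst q)) x (snd q))"
        by (rule bdd_smooth_reindex[OF bdd_smooth_le[OF \<psi>1_smooth], of _ _ "\<lambda>p. (fst (fst p), snd p)"]) auto
      have 1: "bdd_smooth (k - 1) ((P2 \<times> UNIV) \<times> {0..T}) (\<lambda>p x. D (\<psi> x (fst (fst p)) (snd p)) (pf (fst (fst p)) (snd p)) (\<psi> (snd (fst p)) (fst (fst p)) (snd p)))"
        by (rule bdd_smooth_comp[OF bdd_smooth_reindex[OF bdd_smooth_le[OF D_smooth], of "k - 1" _ "\<lambda>p. (pf (fst (fst p)) (snd p), \<psi> (snd (fst p)) (fst (fst p)) (snd p))"] \<psi>1s])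
          (auto intro!: \<psi>_deriv pf_P2)
      have 2: "bdd_smooth (k - 1) ((P2 \<times> UNIV) \<times> {0..T}) (\<lambda>p x. Dy (\<psi> x (fst (fst p)) (snd p)) (pf (fst (fst p)) (snd p)) (\<psi> (snd (fst p)) (fst (fst p)) (snd p)))"
        by (rule bdd_smooth_comp[OF bdd_smooth_reindex[OF Dy_smooth[OF k], of _ "\<lambda>p. (pf (fst (fst p)) (snd p), \<psi> (snd (fst p)) (fst (fst p)) (snd p))"] \<psi>1s])
          (auto intro!: \<psi>_deriv pf_P2)
      have e: "\<bar>\<psi>1 \<mu> y t * \<psi>1 \<mu> y t\<bar> \<le> exp (B * T) * exp (B * T)" if "\<mu> \<in> P2" "t \<in> {0..T}" for \<mu> y t
        unfolding abs_mult by (intro mult_mono \<psi>1_bound that) auto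
      show "bdd_smooth (k - 1) ((P2 \<times> UNIV) \<times> {0..T}) (\<lambda>p x. S2 (fst (fst p)) (snd (fst p)) x (snd p))"
        unfolding S2_def
        by (intro bdd_smooth_add bdd_smooth_mult[OF 2 bdd_smooth_const[of _ _ "exp (B * T) * exp (B * T)"]] bdd_smooth_mult[OF 1 bdd_smooth_const[of _ _ b2]])
          (use order.trans[OF abs_ge_self e] b2 in auto)
    qed (auto intro: U2 S2_cont)
  qed
qed

end

text \<open>For derivatives in time there is only a Lipschitz bound with an integrable constant; so
  the difference quotients are treated by dominated convergence and not by quadratic
  remainders.\<close>

lemma has_real_derivative_integral_param:
  fixes U :: "'a \<Rightarrow> real \<Rightarrow> real"
  assumes D: "\<And>y. y \<in> space m \<Longrightarrow> (U y has_real_derivative U' y) (at t within S)" and t: "t \<in> S"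
    and lip: "\<And>y s. y \<in> space m \<Longrightarrow> s \<in> S \<Longrightarrow> \<bar>U y s - U y t\<bar> \<le> g y * \<bar>s - t\<bar>" and g: "integrable m g"
    and int: "\<And>s. s \<in> S \<Longrightarrow> integrable m (\<lambda>y. U y s)"
  shows "((\<lambda>s. \<integral>y. U y s \<partial>m) has_real_derivative (\<integral>y. U' y \<partial>m)) (at t within S)"
  unfolding has_field_derivative_iff tendsto_at_iff_sequentially
proof (intro allI impI)
  fix X assume X: "\<forall>n. X n \<in> S - {t}" "X \<longlonglongrightarrow> t"
  have lim: "(\<lambda>n. (U y (X n) - U y t) / (X n - t)) \<longlonglongrightarrow> U' y" if "y \<in> space m" for y
    using D[OF that] X unfolding has_field_derivative_iff tendsto_at_iff_sequentially comp_def by blast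
  have meas: "(\<lambda>y. (U y (X n) - U y t) / (X n - t)) \<in> borel_measurable m" for n
    using borel_measurable_integrable[OF int[of "X n"]] borel_measurable_integrable[OF int[OF t]] X(1) by auto
  have "(\<lambda>n. \<integral>y. (U y (X n) - U y t) / (X n - t) \<partial>m) \<longlonglongrightarrow> (\<integral>y. U' y \<partial>m)"
  proof (rule integral_dominated_convergence[OF _ meas g])
    show "U' \<in> borel_measurable m" by (rule borel_measurable_LIMSEQ_real[OF lim meas])
    show "AE y in m. (\<lambda>n. (U y (X n) - U y t) / (X n - t)) \<longlonglongrightarrow> U' y" using lim by auto
    show "AE y in m. norm ((U y (X n) - U y t) / (X n - t)) \<le> g y" for n
    proof (rule AE_I2)
      fix y assume "y \<in> space m"
      moreover have "X n \<in> S" "X n \<noteq> t" using X(1) by auto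
      ultimately show "norm ((U y (X n) - U y t) / (X n - t)) \<le> g y"
        using lip[of y "X n"] by (simp add: divide_le_eq)
    qed
  qed
  moreover have "(\<lambda>n. \<integral>y. (U y (X n) - U y t) / (X n - t) \<partial>m) = (\<lambda>n. ((\<integral>y. U y (X n) \<partial>m) - (\<integral>y. U y t \<partial>m)) / (X n - t))"
    using int[of "X n" for n] int[OF t] X(1) by (intro ext) simp
  ultimately show "((\<lambda>s. ((\<integral>y. U y s \<partial>m) - (\<integral>y. U y t \<partial>m)) / (s - t)) \<circ> X) \<longlonglongrightarrow> (\<integral>y. U' y \<partial>m)"
    unfolding comp_def by (simp only:)
qed

lemma mix_measure_0_1:
  assumes "sets P = sets borel" "sets Q = sets borel"
  shows "mix_measure 0 P Q = Q" "mix_measure 1 P Q = P"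
  by (rule measure_eqI; simp add: sets_mix_measure assms emeasure_mix_measure)+

section \<open>Averages of the linearised flow and its continuity in the measure\<close>

context flow
begin

definition G0 :: real where "G0 = 2 * B * T * exp (4 * B * T)"

lemma G0: "G0 \<ge> 0" using B T by (simp add: G0_def)

lemma U0_bound:
  assumes "\<mu> \<in> P2" "t \<in> {0..T}"
  shows "\<bar>U0 \<mu> y x t\<bar> \<le> G0 * (\<bar>y\<bar> + B * T)"
proof -
  have "\<bar>U0 \<mu> y x t\<bar> \<le> 2 * (B * (\<bar>y\<bar> + B * T)) * T * exp (4 * B * T)"
    by (rule lin_eq.lin_sol_bound[OF lin_eq[OF assms(1)] U0[OF assms(1)] S0_bound[OF assms(1)] assms(2)])
  also have "\<dots> = G0 * (\<bar>y\<bar> + B * T)" unfolding G0_def by (simp only: mult_ac)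
  finally show ?thesis .
qed

lemma U0_lip_y:
  assumes "\<mu> \<in> P2" "t \<in> {0..T}"
  shows "\<bar>U0 \<mu> y x t - U0 \<mu> y' x t\<bar> \<le> (2 * (B * Lx) * T * exp (4 * B * T)) * \<bar>y - y'\<bar>"
  by (rule lin_eq.lin_sol_lipschitz_param[OF lin_eq[OF assms(1)] U0[OF assms(1)] S0_y[OF assms(1)] assms(2)])

text \<open>The constant may depend on \<open>\<mu>\<close> and \<open>y\<close>, because the
  Lipschitz constant of \<open>S0\<close> in \<open>x\<close> grows with
  \<open>\<bar>y\<bar>\<close>; so \<open>lin_sol_smooth\<close> is applied at order 0 with a single
  index.\<close>

lemma U0_lip_x:
  assumes \<mu>: "\<mu> \<in> P2"
  obtains L where "L > 0" "\<And>x x' t. t \<in> {0..T} \<Longrightarrow> \<bar>U0 \<mu> y x t - U0 \<mu> y x' t\<bar> \<le> L * \<bar>x - x'\<bar>"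
proof -
  have "bdd_smooth 0 ({()} \<times> {0..T}) (\<lambda>p x. U0 \<mu> y x (snd p))"
  proof (rule lin_sol_smooth[where I = "{()}" and m = "\<lambda>_. \<mu>" and S = "\<lambda>_. S0 \<mu> y" and U = "\<lambda>_. U0 \<mu> y"])
    show "bdd_smooth 0 ({()} \<times> {0..T}) (\<lambda>p x. S0 \<mu> y x (snd p))"
      by (rule bdd_smooth_0I[of _ _ "B * (\<bar>y\<bar> + B * T)" "B * Lx * (\<bar>y\<bar> + B * T)"]) (auto intro!: S0_bound S0_x \<mu>)
    show "continuous_on {0..T} (\<lambda>t. S0 \<mu> y x t)" for x
      unfolding S0_def using \<mu> by (intro \<delta>_cont \<psi>_cont' continuous_intros) auto
  qed (use U0[OF \<mu>] \<mu> in auto)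
  then obtain L where L: "L > 0" "\<And>p x x'. p \<in> {()} \<times> {0..T} \<Longrightarrow> \<bar>U0 \<mu> y x (snd p) - U0 \<mu> y x' (snd p)\<bar> \<le> L * \<bar>x - x'\<bar>"
    by (rule bdd_smooth_lipschitz) blast
  have "\<bar>U0 \<mu> y x t - U0 \<mu> y x' t\<bar> \<le> L * \<bar>x - x'\<bar>" if "t \<in> {0..T}" for x x' t
    using L(2)[of "((), t)"] that by simp
  with L(1) show ?thesis by (rule that)
qed

lemma lin_sol_time_lip:
  assumes \<mu>: "\<mu> \<in> P2" and U: "lin_sol \<mu> T (cA \<mu>) (cK \<mu>) S U"
    and S: "\<And>x t. t \<in> {0..T} \<Longrightarrow> \<bar>S x t\<bar> \<le> s" and M: "\<And>x t. t \<in> {0..T} \<Longrightarrow> \<bar>U x t\<bar> \<le> M" and t: "t \<in> {0..T}" "t' \<in> {0..T}"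
  shows "\<bar>U x t - U x t'\<bar> \<le> (2 * B * M + s) * \<bar>t - t'\<bar>"
proof (rule field_differentiable_bound[of "{0..T}", unfolded real_norm_def, OF _ _ _ t])
  interpret lin_eq \<mu> T "cA \<mu>" "cK \<mu>" B by (rule lin_eq[OF \<mu>])
  fix r assume r: "r \<in> {0..T}"
  show "(U x has_real_derivative cA \<mu> x r * U x r + S x r + (\<integral>z. cK \<mu> x z r * U z r \<partial>\<mu>)) (at r within {0..T})"
    using U r by (simp add: lin_sol_def)
  have "\<bar>cA \<mu> x r * U x r\<bar> \<le> B * M" unfolding abs_mult using a_bound M[OF r] B by (intro mult_mono) auto
  moreover have "\<bar>\<integral>z. cK \<mu> x z r * U z r \<partial>\<mu>\<bar> \<le> B * M"
    by (intro KU_integral_bound(1) lin_sol_measurable(2)[OF U r] M[OF r])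
  ultimately show "\<bar>cA \<mu> x r * U x r + S x r + (\<integral>z. cK \<mu> x z r * U z r \<partial>\<mu>)\<bar> \<le> 2 * B * M + s"
    using S[OF r, of x] by linarith
qed auto

lemma U0_meas: "\<mu> \<in> P2 \<Longrightarrow> t \<in> {0..T} \<Longrightarrow> (\<lambda>y. U0 \<mu> y x t) \<in> borel_measurable borel"
  by (rule lipschitz_measurable[OF U0_lip_y])

text \<open>The equation is linear, so averaging over the source parameter \<open>y\<close> commutes
  with solving it. The nonlocal term requires exchanging the integrals over \<open>m\<close> and
  \<open>\<mu>\<close>.\<close>

lemma lin_sol_average:
  assumes \<mu>: "\<mu> \<in> P2" and m: "m \<in> P2"
  shows "lin_sol \<mu> T (cA \<mu>) (cK \<mu>) (\<lambda>x t. \<integral>y. S0 \<mu> y x t \<partial>m) (\<lambda>x t. \<integral>y. U0 \<mu> y x t \<partial>m)"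
  unfolding lin_sol_def
proof (intro conjI allI ballI)
  interpret m: prob_space m using P2D(1)[OF m] .
  interpret \<mu>: prob_space \<mu> using P2D(1)[OF \<mu>] .
  interpret lin_eq \<mu> T "cA \<mu>" "cK \<mu>" B by (rule lin_eq[OF \<mu>])
  \<comment> \<open>An integrable majorant: the linear growth of \<open>U0\<close> in
    \<open>y\<close> is covered by the finite first moment of \<open>m\<close>.\<close>
  define w where "w = (\<lambda>y::real. G0 * (\<bar>y\<bar> + B * T))"
  have w: "integrable m w" unfolding w_def using P2D(5)[OF m] by (intro integrable_mult_right Bochner_Integration.integrable_add) auto
  have Ui: "integrable m (\<lambda>y. U0 \<mu> y x t)" if "t \<in> {0..T}" for x t
    by (rule integrable_lipschitz_P2[OF m U0_lip_y[OF \<mu> that]])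
  have Si: "integrable m (\<lambda>y. S0 \<mu> y x t)" if "t \<in> {0..T}" for x t
    by (rule integrable_lipschitz_P2[OF m S0_y[OF \<mu> that]])
  show "(\<integral>y. U0 \<mu> y x 0 \<partial>m) = 0" for x
    using U0[OF \<mu>] by (simp add: lin_sol_def)
  have "continuous_on (UNIV \<times> {0..T}) (\<lambda>p. \<integral>y. U0 \<mu> y (fst p) (snd p) \<partial>m)"
  proof (rule continuous_on_integral_param[OF _ _ w])
    show "continuous_on (UNIV \<times> {0..T}) (\<lambda>p. U0 \<mu> y (fst p) (snd p))" for y
      using U0[OF \<mu>, of y] by (simp add: lin_sol_def case_prod_unfold)
    show "(\<lambda>y. U0 \<mu> y (fst p) (snd p)) \<in> borel_measurable m" if "p \<in> UNIV \<times> {0..T}" for p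
      using that by (intro P2_measurable[OF m] U0_meas \<mu>) auto
    show "\<bar>U0 \<mu> y (fst p) (snd p)\<bar> \<le> w y" if "p \<in> UNIV \<times> {0..T}" for p y
      unfolding w_def using that by (intro U0_bound \<mu>) auto
  qed
  then show "continuous_on (UNIV \<times> {0..T}) (\<lambda>(x, t). \<integral>y. U0 \<mu> y x t \<partial>m)" by (simp add: case_prod_unfold)
  show "\<exists>M. \<forall>x. \<forall>t\<in>{0..T}. \<bar>\<integral>y. U0 \<mu> y x t \<partial>m\<bar> \<le> M"
  proof (intro exI allI ballI)
    fix x t assume t: "t \<in> {0..T}"
    have "\<bar>\<integral>y. U0 \<mu> y x t \<partial>m\<bar> \<le> (\<integral>y. \<bar>U0 \<mu> y x t\<bar> \<partial>m)" by (rule integral_abs_bound)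
    also have "\<dots> \<le> (\<integral>y. w y \<partial>m)"
      using Ui[OF t] w U0_bound[OF \<mu> t] by (intro integral_mono integrable_abs) (auto simp: w_def)
    finally show "\<bar>\<integral>y. U0 \<mu> y x t \<partial>m\<bar> \<le> (\<integral>y. w y \<partial>m)" .
  qed
  fix x t assume t: "t \<in> {0..T}"
  let ?U' = "\<lambda>y. cA \<mu> x t * U0 \<mu> y x t + S0 \<mu> y x t + (\<integral>z. cK \<mu> x z t * U0 \<mu> y z t \<partial>\<mu>)"
  have D: "((\<lambda>t. \<integral>y. U0 \<mu> y x t \<partial>m) has_real_derivative (\<integral>y. ?U' y \<partial>m)) (at t within {0..T})"
  proof (rule has_real_derivative_integral_param[OF _ t _ _ Ui])
    show "(U0 \<mu> y x has_real_derivative ?U' y) (at t within {0..T})" for y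
      using U0[OF \<mu>, of y] t by (simp add: lin_sol_def)
    show "\<bar>U0 \<mu> y x s - U0 \<mu> y x t\<bar> \<le> (2 * B * w y + B * (\<bar>y\<bar> + B * T)) * \<bar>s - t\<bar>" if "s \<in> {0..T}" for y s
      unfolding w_def using t that by (intro lin_sol_time_lip[OF \<mu> U0[OF \<mu>]] S0_bound U0_bound \<mu>)
    show "integrable m (\<lambda>y. 2 * B * w y + B * (\<bar>y\<bar> + B * T))"
      using w P2D(5)[OF m] by (intro Bochner_Integration.integrable_add integrable_mult_right) auto
  qed
  interpret pair_sigma_finite m \<mu> ..
  define f where "f = (\<lambda>(y, z). cK \<mu> x z t * U0 \<mu> y z t)"
  have s: "sets (m \<Otimes>\<^sub>M \<mu>) = sets (borel :: (real \<times> real) measure)"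
    using sets_pair_measure_cong[OF P2D(2)[OF m] P2D(2)[OF \<mu>]] by (simp only: borel_prod)
  \<comment> \<open>Joint continuity supplies the joint measurability for Fubini. The Lipschitz
    bound in \<open>y\<close> is uniform in \<open>x\<close>, so it is enough to vary
    \<open>x\<close> at the fixed value \<open>fst p\<close> of \<open>y\<close>.\<close>
  have cont: "continuous_on UNIV (\<lambda>p. U0 \<mu> (fst p) (snd p) t)"
    unfolding continuous_on_sequentially
  proof (intro allI impI ballI)
    fix X and p :: "real \<times> real" assume X: "(\<forall>n. X n \<in> UNIV) \<and> X \<longlonglongrightarrow> p"
    obtain L where L: "\<And>x x' t. t \<in> {0..T} \<Longrightarrow> \<bar>U0 \<mu> (fst p) x t - U0 \<mu> (fst p) x' t\<bar> \<le> L * \<bar>x - x'\<bar>"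
      by (rule U0_lip_x[OF \<mu>]) blast
    define c where "c = 2 * (B * Lx) * T * exp (4 * B * T)"
    have "(\<lambda>n. U0 \<mu> (fst (X n)) (snd (X n)) t) \<longlonglongrightarrow> U0 \<mu> (fst p) (snd p) t"
    proof (rule LIM_zero_cancel, rule Lim_null_comparison)
      have "(\<lambda>n. c * \<bar>fst (X n) - fst p\<bar> + L * \<bar>snd (X n) - snd p\<bar>) \<longlonglongrightarrow> c * \<bar>fst p - fst p\<bar> + L * \<bar>snd p - snd p\<bar>"
        using X by (intro tendsto_intros) auto
      then show "(\<lambda>n. c * \<bar>fst (X n) - fst p\<bar> + L * \<bar>snd (X n) - snd p\<bar>) \<longlonglongrightarrow> 0" by simp
      have "\<bar>U0 \<mu> (fst (X n)) (snd (X n)) t - U0 \<mu> (fst p) (snd p) t\<bar> \<le> c * \<bar>fst (X n) - fst p\<bar> + L * \<bar>snd (X n) - snd p\<bar>" for n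
        using U0_lip_y[OF \<mu> t, of "fst (X n)" "snd (X n)" "fst p"] L[OF t, of "snd (X n)" "snd p"] unfolding c_def by linarith
      then show "\<forall>\<^sub>F n in sequentially. norm (U0 \<mu> (fst (X n)) (snd (X n)) t - U0 \<mu> (fst p) (snd p) t) \<le> c * \<bar>fst (X n) - fst p\<bar> + L * \<bar>snd (X n) - snd p\<bar>"
        by simp
    qed
    then show "((\<lambda>p. U0 \<mu> (fst p) (snd p) t) \<circ> X) \<longlonglongrightarrow> U0 \<mu> (fst p) (snd p) t" by (simp add: comp_def)
  qed
  have "continuous_on UNIV f"
    unfolding f_def case_prod_unfold by (intro continuous_on_mult cont continuous_on_compose2[OF K_cont_z] continuous_intros) auto
  then have fm[measurable]: "f \<in> borel_measurable (m \<Otimes>\<^sub>M \<mu>)"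
    using borel_measurable_continuous_onI measurable_cong_sets[OF s refl] by blast
  have fw: "\<bar>f (y, z)\<bar> \<le> B * w y" for y z
    unfolding f_def w_def using K_bound B by (auto simp: abs_mult intro!: mult_mono U0_bound \<mu> t)
  have iz: "integrable \<mu> (\<lambda>z. f (y, z))" for y
  proof (rule integrable_bounded_P2[OF \<mu> _ fw])
    show "(\<lambda>z. f (y, z)) \<in> borel_measurable borel"
      by (rule borel_measurable_continuous_onI[OF continuous_on_compose2[OF \<open>continuous_on UNIV f\<close>]]) (auto intro!: continuous_intros)
  qed
  have "integrable (m \<Otimes>\<^sub>M \<mu>) f"
  proof (rule Fubini_integrable[OF fm])
    show "integrable m (\<lambda>y. \<integral>z. norm (f (y, z)) \<partial>\<mu>)"
    proof (rule Bochner_Integration.integrable_bound)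
      show "integrable m (\<lambda>y. B * w y)" using w by simp
      show "(\<lambda>y. \<integral>z. norm (f (y, z)) \<partial>\<mu>) \<in> borel_measurable m" by measurable
      have "(\<integral>z. \<bar>f (y, z)\<bar> \<partial>\<mu>) \<le> (\<integral>z. B * w y \<partial>\<mu>)" for y
        using iz[of y] fw by (intro integral_mono integrable_abs) auto
      then show "AE y in m. norm (\<integral>z. norm (f (y, z)) \<partial>\<mu>) \<le> norm (B * w y)"
        by (auto simp: integral_nonneg_AE \<mu>.prob_space intro: order.trans[OF _ abs_ge_self])
    qed
    show "AE y in m. integrable \<mu> (\<lambda>z. f (y, z))" using iz by simp
  qed
  then have "integrable (m \<Otimes>\<^sub>M \<mu>) (\<lambda>(y, z). f (y, z))" by simp
  from Fubini_integral[OF this] integrable_fst[OF this]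
  have swap: "(\<integral>z. \<integral>y. f (y, z) \<partial>m \<partial>\<mu>) = (\<integral>y. \<integral>z. f (y, z) \<partial>\<mu> \<partial>m)" and iKU: "integrable m (\<lambda>y. \<integral>z. f (y, z) \<partial>\<mu>)" by auto
  have "(\<integral>z. cK \<mu> x z t * (\<integral>y. U0 \<mu> y z t \<partial>m) \<partial>\<mu>) = (\<integral>y. \<integral>z. cK \<mu> x z t * U0 \<mu> y z t \<partial>\<mu> \<partial>m)"
    using swap by (simp add: f_def)
  moreover have "(\<integral>y. ?U' y \<partial>m) = cA \<mu> x t * (\<integral>y. U0 \<mu> y x t \<partial>m) + (\<integral>y. S0 \<mu> y x t \<partial>m) + (\<integral>y. \<integral>z. cK \<mu> x z t * U0 \<mu> y z t \<partial>\<mu> \<partial>m)"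
    using Ui[OF t, of x] Si[OF t, of x] iKU by (simp add: f_def)
  ultimately show "((\<lambda>t. \<integral>y. U0 \<mu> y x t \<partial>m) has_real_derivative
      cA \<mu> x t * (\<integral>y. U0 \<mu> y x t \<partial>m) + (\<integral>y. S0 \<mu> y x t \<partial>m) + (\<integral>z. cK \<mu> x z t * (\<integral>y. U0 \<mu> y z t \<partial>m) \<partial>\<mu>)) (at t within {0..T})"
    using D by simp
qed

text \<open>At fixed \<open>y\<close> the difference of the solutions for \<open>M n\<close> and
  \<open>\<mu>\<close> solves the equation for \<open>M n\<close> with a source that collects the
  differences of all coefficients, and \<open>lin_sol_bound\<close> applies. Moving \<open>y\<close>
  is covered by a Lipschitz bound that does not depend on the measure.\<close>

lemma U0_seq_cont:
  assumes M: "\<And>n::nat. M n \<in> P2" and \<mu>: "\<mu> \<in> P2" and w: "\<And>n. w1_le (M n) \<mu> (d n)" and d: "d \<longlonglongrightarrow> 0"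
    and z: "z \<longlonglongrightarrow> y" and t: "t \<in> {0..T}"
  shows "(\<lambda>n. U0 (M n) (z n) x t) \<longlonglongrightarrow> U0 \<mu> y x t"
proof -
  interpret \<mu>: lin_eq \<mu> T "cA \<mu>" "cK \<mu>" B by (rule lin_eq[OF \<mu>])
  define b where "b = \<bar>y\<bar> + B * T"
  define MU where "MU = G0 * b"
  define q where "q = (\<lambda>n. B * (C\<psi> * d n) + \<omega> ((Lx + C\<psi>) * d n))"
  obtain L where L: "L > 0" "\<And>x x' t. t \<in> {0..T} \<Longrightarrow> \<bar>U0 \<mu> y x t - U0 \<mu> y x' t\<bar> \<le> L * \<bar>x - x'\<bar>"
    by (rule U0_lip_x[OF \<mu>]) blast
  have d0: "0 \<le> d n" for n by (rule w1_le_nonneg[OF w])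
  have b: "b \<ge> 0" "MU \<ge> 0" using B T G0 by (auto simp: b_def MU_def)
  \<comment> \<open>The contributions in order: the local coefficient, the source \<open>S0\<close>,
    the kernel, and the change of the integrating measure. For the last one the kernel at
    \<open>\<mu>\<close> times \<open>U0\<close> is tested as a Lipschitz function of
    \<open>z\<close>.\<close>
  define e where "e = (\<lambda>n. q n * MU + (q n * b + B * (C\<psi> * d n)) + (q n + B * (C\<psi> * d n)) * MU + (B * L + B * Lx * MU) * d n)"
  have lin: "lin_sol (M n) T (cA (M n)) (cK (M n))
     (\<lambda>x t. (cA (M n) x t - cA \<mu> x t) * U0 \<mu> y x t + (S0 (M n) y x t - S0 \<mu> y x t)
        + ((\<integral>z. cK (M n) x z t * U0 \<mu> y z t \<partial>M n) - (\<integral>z. cK \<mu> x z t * U0 \<mu> y z t \<partial>\<mu>)))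
     (\<lambda>x t. U0 (M n) y x t - U0 \<mu> y x t)" for n
    unfolding lin_sol_def
  proof (intro conjI allI ballI)
    interpret N: lin_eq "M n" T "cA (M n)" "cK (M n)" B by (rule lin_eq[OF M])
    show "U0 (M n) y x 0 - U0 \<mu> y x 0 = 0" for x using U0[OF M] U0[OF \<mu>] by (simp add: lin_sol_def)
    show "continuous_on (UNIV \<times> {0..T}) (\<lambda>(x, t). U0 (M n) y x t - U0 \<mu> y x t)"
      using U0[OF M, of n y] U0[OF \<mu>, of y] unfolding lin_sol_def case_prod_unfold by (auto intro!: continuous_intros)
    show "\<exists>K. \<forall>x. \<forall>t\<in>{0..T}. \<bar>U0 (M n) y x t - U0 \<mu> y x t\<bar> \<le> K"
    proof (intro exI allI ballI)
      fix x t assume t: "t \<in> {0..T}"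
      show "\<bar>U0 (M n) y x t - U0 \<mu> y x t\<bar> \<le> 2 * MU"
        using U0_bound[OF M t, of n y x] U0_bound[OF \<mu> t, of y x] unfolding MU_def b_def by linarith
    qed
    fix x t assume t: "t \<in> {0..T}"
    have i: "integrable (M n) (\<lambda>z. cK (M n) x z t * U0 (M n) y z t)" "integrable (M n) (\<lambda>z. cK (M n) x z t * U0 \<mu> y z t)"
      using N.KU_integral_bound(2)[OF N.lin_sol_measurable(2)[OF U0[OF M] t] U0_bound[OF M t]]
        N.KU_integral_bound(2)[OF \<mu>.lin_sol_measurable(2)[OF U0[OF \<mu>] t] U0_bound[OF \<mu> t]] by blast+
    have "(\<integral>z. cK (M n) x z t * (U0 (M n) y z t - U0 \<mu> y z t) \<partial>M n)
        = (\<integral>z. cK (M n) x z t * U0 (M n) y z t \<partial>M n) - (\<integral>z. cK (M n) x z t * U0 \<mu> y z t \<partial>M n)"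
      using i by (simp add: right_diff_distrib)
    moreover have "(U0 (M n) y x has_real_derivative cA (M n) x t * U0 (M n) y x t + S0 (M n) y x t + (\<integral>z. cK (M n) x z t * U0 (M n) y z t \<partial>M n)) (at t within {0..T})"
      "(U0 \<mu> y x has_real_derivative cA \<mu> x t * U0 \<mu> y x t + S0 \<mu> y x t + (\<integral>z. cK \<mu> x z t * U0 \<mu> y z t \<partial>\<mu>)) (at t within {0..T})"
      using U0[OF M, of n y] U0[OF \<mu>, of y] t by (auto simp: lin_sol_def)
    ultimately show "((\<lambda>t. U0 (M n) y x t - U0 \<mu> y x t) has_real_derivative
        cA (M n) x t * (U0 (M n) y x t - U0 \<mu> y x t) + ((cA (M n) x t - cA \<mu> x t) * U0 \<mu> y x t + (S0 (M n) y x t - S0 \<mu> y x t)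
        + ((\<integral>z. cK (M n) x z t * U0 \<mu> y z t \<partial>M n) - (\<integral>z. cK \<mu> x z t * U0 \<mu> y z t \<partial>\<mu>)))
        + (\<integral>z. cK (M n) x z t * (U0 (M n) y z t - U0 \<mu> y z t) \<partial>M n)) (at t within {0..T})"
      by (auto intro!: derivative_eq_intros simp: algebra_simps)
  qed
  have src: "\<bar>(cA (M n) x t - cA \<mu> x t) * U0 \<mu> y x t + (S0 (M n) y x t - S0 \<mu> y x t)
        + ((\<integral>z. cK (M n) x z t * U0 \<mu> y z t \<partial>M n) - (\<integral>z. cK \<mu> x z t * U0 \<mu> y z t \<partial>\<mu>))\<bar> \<le> e n" if t: "t \<in> {0..T}" for n x t
  proof -
    interpret N: lin_eq "M n" T "cA (M n)" "cK (M n)" B by (rule lin_eq[OF M])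
    note pp = pf_P2[OF M, of n t] pf_P2[OF \<mu>, of t] pf_stable[OF M \<mu> w t]
    have \<psi>d: "B * \<bar>\<psi> x (M n) t - \<psi> x \<mu> t\<bar> \<le> B * (C\<psi> * d n)" for x
      using B by (intro mult_left_mono \<psi>_stable[OF M \<mu> w t]) auto
    have q0: "0 \<le> q n" unfolding q_def using \<omega>_nonneg[OF pp] B C\<psi> d0[of n] by simp
    have U: "\<bar>U0 \<mu> y x t\<bar> \<le> MU" for x using U0_bound[OF \<mu> t] by (simp add: MU_def b_def)
    have Um: "(\<lambda>z. U0 \<mu> y z t) \<in> borel_measurable borel" by (rule \<mu>.lin_sol_measurable(2)[OF U0[OF \<mu>] t])
    have "\<bar>cA (M n) x t - cA \<mu> x t\<bar> \<le> q n"
      using s1_diff[OF pp, of "\<psi> x (M n) t" "\<psi> x \<mu> t"] \<psi>d[of x] t by (simp add: cA_def cl q_def)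
    then have 1: "\<bar>(cA (M n) x t - cA \<mu> x t) * U0 \<mu> y x t\<bar> \<le> q n * MU"
      unfolding abs_mult using U q0 by (intro mult_mono) auto
    have "\<bar>S0 (M n) y x t - S0 \<mu> y x t\<bar> \<le> (B * \<bar>\<psi> x (M n) t - \<psi> x \<mu> t\<bar> + \<omega> ((Lx + C\<psi>) * d n)) * \<bar>\<psi> y (M n) t\<bar> + B * \<bar>\<psi> y (M n) t - \<psi> y \<mu> t\<bar>"
      unfolding S0_def by (rule \<delta>_diff[OF pp])
    also have "\<dots> \<le> q n * b + B * (C\<psi> * d n)"
    proof (rule add_mono[OF mult_mono \<psi>d[of y]])
      show "B * \<bar>\<psi> x (M n) t - \<psi> x \<mu> t\<bar> + \<omega> ((Lx + C\<psi>) * d n) \<le> q n" using \<psi>d[of x] by (simp add: q_def)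
      show "\<bar>\<psi> y (M n) t\<bar> \<le> b" using \<psi>_bound[OF M t] by (simp add: b_def)
    qed (use q0 in auto)
    finally have 2: "\<bar>S0 (M n) y x t - S0 \<mu> y x t\<bar> \<le> q n * b + B * (C\<psi> * d n)" .
    have K: "\<bar>(cK (M n) x z t - cK \<mu> x z t) * U0 \<mu> y z t\<bar> \<le> (q n + B * (C\<psi> * d n)) * MU" for z
    proof -
      have "\<bar>cK (M n) x z t - cK \<mu> x z t\<bar> \<le> q n + B * (C\<psi> * d n)"
        using D_diff[OF pp, of "\<psi> x (M n) t" "\<psi> z (M n) t" "\<psi> x \<mu> t" "\<psi> z \<mu> t"] \<psi>d[of x] \<psi>d[of z] unfolding cK_def cl(2)[OF t] q_def by linarith
      then show ?thesis unfolding abs_mult using U q0 B C\<psi> d0[of n] by (intro mult_mono) auto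
    qed
    have i: "integrable (M n) (\<lambda>z. cK (M n) x z t * U0 \<mu> y z t)" by (rule N.KU_integral_bound(2)[OF Um U])
    have KUlip: "\<bar>cK \<mu> x z t * U0 \<mu> y z t - cK \<mu> x z' t * U0 \<mu> y z' t\<bar> \<le> (B * L + B * Lx * MU) * \<bar>z - z'\<bar>" for z z'
    proof -
      have "\<bar>cK \<mu> x z t - cK \<mu> x z' t\<bar> \<le> B * (Lx * \<bar>z - z'\<bar>)"
        using D_flow_lip(1)[OF \<mu> t, of "\<psi> x \<mu> t" z z'] t by (simp add: cK_def cl)
      from abs_mult_diff_le[OF \<mu>.K_bound U[of z'] L(2)[OF t, of z z'] this] show ?thesis by (simp add: algebra_simps)
    qed
    have i': "integrable (M n) (\<lambda>z. cK \<mu> x z t * U0 \<mu> y z t)" by (rule integrable_lipschitz_P2[OF M KUlip])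
    have "(\<integral>z. cK (M n) x z t * U0 \<mu> y z t \<partial>M n) - (\<integral>z. cK \<mu> x z t * U0 \<mu> y z t \<partial>M n) = (\<integral>z. (cK (M n) x z t - cK \<mu> x z t) * U0 \<mu> y z t \<partial>M n)"
      using i i' by (simp add: left_diff_distrib)
    moreover have "\<bar>\<integral>z. (cK (M n) x z t - cK \<mu> x z t) * U0 \<mu> y z t \<partial>M n\<bar> \<le> (q n + B * (C\<psi> * d n)) * MU"
      by (intro integral_P2_bound[OF M] K borel_measurable_times borel_measurable_diff Um borel_measurable_continuous_onI N.K_cont_z \<mu>.K_cont_z)
    moreover have "\<bar>(\<integral>z. cK \<mu> x z t * U0 \<mu> y z t \<partial>M n) - (\<integral>z. cK \<mu> x z t * U0 \<mu> y z t \<partial>\<mu>)\<bar> \<le> (B * L + B * Lx * MU) * d n"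
      by (rule w1_leD[OF w KUlip])
    ultimately have 3: "\<bar>(\<integral>z. cK (M n) x z t * U0 \<mu> y z t \<partial>M n) - (\<integral>z. cK \<mu> x z t * U0 \<mu> y z t \<partial>\<mu>)\<bar> \<le> (q n + B * (C\<psi> * d n)) * MU + (B * L + B * Lx * MU) * d n"
      by linarith
    show ?thesis using 1 2 3 unfolding e_def by linarith
  qed
  have E: "\<bar>U0 (M n) y x t - U0 \<mu> y x t\<bar> \<le> 2 * e n * T * exp (4 * B * T)" for n
    by (rule lin_eq.lin_sol_bound[OF lin_eq[OF M] lin src t])
  have "q \<longlonglongrightarrow> B * (C\<psi> * 0) + 0"
    unfolding q_def
  proof (intro tendsto_intros d \<omega>)
    show "0 \<le> (Lx + C\<psi>) * d n" for n using d0[of n] Lx C\<psi> by simp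
    have "(\<lambda>n. (Lx + C\<psi>) * d n) \<longlonglongrightarrow> (Lx + C\<psi>) * 0" by (intro tendsto_intros d)
    then show "(\<lambda>n. (Lx + C\<psi>) * d n) \<longlonglongrightarrow> 0" by simp
  qed
  then have q: "q \<longlonglongrightarrow> 0" by simp
  define c where "c = 2 * (B * Lx) * T * exp (4 * B * T)"
  show ?thesis
  proof (rule LIM_zero_cancel, rule Lim_null_comparison)
    have "(\<lambda>n. c * \<bar>z n - y\<bar> + 2 * e n * T * exp (4 * B * T)) \<longlonglongrightarrow> c * \<bar>y - y\<bar> +
       2 * (0 * MU + (0 * b + B * (C\<psi> * 0)) + (0 + B * (C\<psi> * 0)) * MU + (B * L + B * Lx * MU) * 0) * T * exp (4 * B * T)"
      unfolding e_def by (intro tendsto_intros z q d)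
    then show "(\<lambda>n. c * \<bar>z n - y\<bar> + 2 * e n * T * exp (4 * B * T)) \<longlonglongrightarrow> 0" by simp
    have "\<bar>U0 (M n) (z n) x t - U0 \<mu> y x t\<bar> \<le> c * \<bar>z n - y\<bar> + 2 * e n * T * exp (4 * B * T)" for n
      using U0_lip_y[OF M t, of n "z n" x y] E[of n] unfolding c_def by linarith
    then show "\<forall>\<^sub>F n in sequentially. norm (U0 (M n) (z n) x t - U0 \<mu> y x t) \<le> c * \<bar>z n - y\<bar> + 2 * e n * T * exp (4 * B * T)" by simp
  qed
qed

end

section \<open>The linear functional derivative of the flow\<close>

context flow
begin

text \<open>The remainder solves the equation linearised at \<open>\<nu>\<close>, with the error of
  the first-order expansion of the velocity as source. As \<open>w\<close> is proportional to
  \<open>\<bar>r - s\<bar>\<close>, every term of the bound is quadratic in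
  \<open>\<bar>r - s\<bar>\<close> except the one with \<open>\<omega>\<close>, which is still of
  smaller order than \<open>\<bar>r - s\<bar>\<close>.\<close>

lemma flow_mix_remainder:
  fixes m1 m2 :: "real measure" and r s :: real
  defines "w \<equiv> \<bar>r - s\<bar> * ((\<integral>y. \<bar>y\<bar> \<partial>m1) + (\<integral>y. \<bar>y\<bar> \<partial>m2))" and "\<nu> \<equiv> mix_measure s m1 m2"
  assumes m: "m1 \<in> P2" "m2 \<in> P2" and r: "0 \<le> r" "r \<le> 1" and s: "0 \<le> s" "s \<le> 1" and t: "t \<in> {0..T}"
  shows "\<bar>\<psi> x (mix_measure r m1 m2) t - \<psi> x \<nu> t - (r - s) * ((\<integral>y. U0 \<nu> y x t \<partial>m1) - (\<integral>y. U0 \<nu> y x t \<partial>m2))\<bar>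
    \<le> 2 * (2 * B * (C\<psi> * w)\<^sup>2 + \<omega> ((Lx + C\<psi>) * w) * ((Lx + C\<psi>) * w) + B * (C\<psi> * w) * ((Lx + C\<psi>) * w) + 2 * B * (C\<psi> * w) * \<bar>r - s\<bar>)
        * T * exp (4 * B * T)"
proof -
  define \<nu>' where "\<nu>' = mix_measure r m1 m2"
  \<comment> \<open>\<open>e\<close> bounds the displacement of trajectories between the two initial
    measures, and \<open>d\<close> the distance of the push-forwards.\<close>
  define e where "e = C\<psi> * w"
  define d where "d = (Lx + C\<psi>) * w"
  have \<nu>: "\<nu> \<in> P2" "\<nu>' \<in> P2" unfolding \<nu>_def \<nu>'_def by (auto intro!: mix_measure_P2 m r s)
  have w: "w1_le \<nu>' \<nu> w" unfolding \<nu>_def \<nu>'_def w_def by (rule w1_le_mix[OF m r s])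
  have w0: "0 \<le> w" by (rule w1_le_nonneg[OF w])
  then have e0: "0 \<le> e" using C\<psi> by (simp add: e_def)
  interpret lin_eq \<nu> T "cA \<nu>" "cK \<nu>" B by (rule lin_eq[OF \<nu>(1)])
  define V where "V = (\<lambda>x t. (\<integral>y. U0 \<nu> y x t \<partial>m1) - (\<integral>y. U0 \<nu> y x t \<partial>m2))"
  define SV where "SV = (\<lambda>x t. (\<integral>y. S0 \<nu> y x t \<partial>m1) - (\<integral>y. S0 \<nu> y x t \<partial>m2))"
  have V: "lin_sol \<nu> T (cA \<nu>) (cK \<nu>) SV V"
    using lin_sol_lincomb[OF lin_sol_average[OF \<nu>(1) m(1)] lin_sol_average[OF \<nu>(1) m(2)], of 1 "-1"]
    by (simp add: SV_def V_def)
  then obtain MV where MV: "\<And>x t. t \<in> {0..T} \<Longrightarrow> \<bar>V x t\<bar> \<le> MV" unfolding lin_sol_def by blast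
  have \<psi>d: "\<bar>\<psi> x \<nu>' t - \<psi> x \<nu> t\<bar> \<le> e" if "t \<in> {0..T}" for x t
    unfolding e_def by (rule \<psi>_stable[OF \<nu>(2,1) w that])
  define J where "J = (\<lambda>x t. \<integral>z. cK \<nu> x z t * (\<psi> z \<nu>' t - \<psi> z \<nu> t) \<partial>\<nu>)"
  \<comment> \<open>What is left of the difference of velocities after removing the terms that are
    linear at \<open>\<nu>\<close>.\<close>
  define Src where "Src = (\<lambda>x t. \<sigma> (\<psi> x \<nu>' t) (pf \<nu>' t) - \<sigma> (\<psi> x \<nu> t) (pf \<nu> t) - cA \<nu> x t * (\<psi> x \<nu>' t - \<psi> x \<nu> t) - (r - s) * SV x t - J x t)"
  have lin: "lin_sol \<nu> T (cA \<nu>) (cK \<nu>) Src (\<lambda>x t. \<psi> x \<nu>' t - \<psi> x \<nu> t - (r - s) * V x t)"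
    unfolding lin_sol_def
  proof (intro conjI allI ballI)
    show "\<psi> x \<nu>' 0 - \<psi> x \<nu> 0 - (r - s) * V x 0 = 0" for x
      using V \<nu> by (simp add: lin_sol_def \<psi>_0)
    show "continuous_on (UNIV \<times> {0..T}) (\<lambda>(x, t). \<psi> x \<nu>' t - \<psi> x \<nu> t - (r - s) * V x t)"
      using V \<psi>_cont[OF \<nu>(1)] \<psi>_cont[OF \<nu>(2)] unfolding lin_sol_def case_prod_unfold by (auto intro!: continuous_intros)
    show "\<exists>M. \<forall>x. \<forall>t\<in>{0..T}. \<bar>\<psi> x \<nu>' t - \<psi> x \<nu> t - (r - s) * V x t\<bar> \<le> M"
    proof (intro exI allI ballI)
      fix x t assume t: "t \<in> {0..T}"
      have "\<bar>(r - s) * V x t\<bar> \<le> \<bar>r - s\<bar> * MV" unfolding abs_mult using MV[OF t] by (intro mult_left_mono) auto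
      then show "\<bar>\<psi> x \<nu>' t - \<psi> x \<nu> t - (r - s) * V x t\<bar> \<le> e + \<bar>r - s\<bar> * MV" using \<psi>d[OF t, of x] by linarith
    qed
    fix x t assume t: "t \<in> {0..T}"
    have m\<psi>: "(\<lambda>z. \<psi> z \<nu>' t - \<psi> z \<nu> t) \<in> borel_measurable borel" by (intro borel_measurable_diff \<psi>_meas \<nu>)
    have "(\<integral>z. cK \<nu> x z t * (\<psi> z \<nu>' t - \<psi> z \<nu> t - (r - s) * V z t) \<partial>\<nu>)
        = (\<integral>z. cK \<nu> x z t * (\<psi> z \<nu>' t - \<psi> z \<nu> t) - (r - s) * (cK \<nu> x z t * V z t) \<partial>\<nu>)"
      by (rule Bochner_Integration.integral_cong) (auto simp: algebra_simps)
    also have "\<dots> = J x t - (r - s) * (\<integral>z. cK \<nu> x z t * V z t \<partial>\<nu>)"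
      unfolding J_def using KU_integral_bound(2)[OF m\<psi> \<psi>d[OF t]] KU_integral_bound(2)[OF lin_sol_measurable(2)[OF V t] MV[OF t]]
      by simp
    finally have I: "(\<integral>z. cK \<nu> x z t * (\<psi> z \<nu>' t - \<psi> z \<nu> t - (r - s) * V z t) \<partial>\<nu>) = J x t - (r - s) * (\<integral>z. cK \<nu> x z t * V z t \<partial>\<nu>)" .
    have "(V x has_real_derivative cA \<nu> x t * V x t + SV x t + (\<integral>z. cK \<nu> x z t * V z t \<partial>\<nu>)) (at t within {0..T})"
      using V t by (simp add: lin_sol_def)
    then have "((\<lambda>t. \<psi> x \<nu>' t - \<psi> x \<nu> t - (r - s) * V x t) has_real_derivative
        \<sigma> (\<psi> x \<nu>' t) (pf \<nu>' t) - \<sigma> (\<psi> x \<nu> t) (pf \<nu> t) - (r - s) * (cA \<nu> x t * V x t + SV x t + (\<integral>z. cK \<nu> x z t * V z t \<partial>\<nu>))) (at t within {0..T})"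
      by (intro DERIV_diff DERIV_cmult has_field_derivative_at_within[OF \<psi>_ode] \<nu>)
    then show "((\<lambda>t. \<psi> x \<nu>' t - \<psi> x \<nu> t - (r - s) * V x t) has_real_derivative
        cA \<nu> x t * (\<psi> x \<nu>' t - \<psi> x \<nu> t - (r - s) * V x t) + Src x t
        + (\<integral>z. cK \<nu> x z t * (\<psi> z \<nu>' t - \<psi> z \<nu> t - (r - s) * V z t) \<partial>\<nu>)) (at t within {0..T})"
      unfolding I Src_def by (simp add: algebra_simps)
  qed
  have src: "\<bar>Src x t\<bar> \<le> 2 * B * e\<^sup>2 + \<omega> d * d + B * e * d + 2 * B * e * \<bar>r - s\<bar>" if t: "t \<in> {0..T}" for x t
  proof -
    define X where "X = \<psi> x \<nu> t"
    define X' where "X' = \<psi> x \<nu>' t"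
    define P where "P = pf \<nu>' t"
    define Q where "Q = pf \<nu> t"
    have PQ: "P \<in> P2" "Q \<in> P2" "w1_le P Q d"
      unfolding P_def Q_def d_def using pf_P2 \<nu> pf_stable[OF \<nu>(2,1) w t] by auto
    have XX: "\<bar>X' - X\<bar> \<le> e" unfolding X_def X'_def by (rule \<psi>d[OF t])
    have sq: "B * u\<^sup>2 \<le> B * e\<^sup>2" if "\<bar>u\<bar> \<le> e" for u
      using that B e0 by (intro mult_left_mono) (auto simp: abs_le_square_iff[symmetric])
    \<comment> \<open>Taylor expansion in space at the measure \<open>Q\<close>.\<close>
    have 1: "\<bar>\<sigma> X' Q - \<sigma> X Q - cA \<nu> x t * (X' - X)\<bar> \<le> B * e\<^sup>2"
      using DERIV_remainder_bound[OF s1[OF PQ(2)] s1_lip[OF PQ(2)], of X' X] sq[OF XX]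
      by (simp add: cA_def cl(2)[OF t] X_def Q_def mult.commute)
    have 2: "\<bar>\<sigma> X' P - \<sigma> X' Q - ((\<integral>y. \<delta> X' Q y \<partial>P) - (\<integral>y. \<delta> X' Q y \<partial>Q))\<bar> \<le> \<omega> d * d"
      by (rule \<sigma>_lin[OF PQ])
    have \<delta>i: "integrable M (\<lambda>y. \<delta> x Q y)" if "M \<in> P2" for M x
      by (rule integrable_lipschitz_P2[OF that \<delta>_lip[OF PQ(2)]])
    \<comment> \<open>The expansion in the measure was taken at \<open>X'\<close>; returning to
      \<open>X\<close> costs a Lipschitz constant \<open>B * e\<close> against measures at distance
      \<open>d\<close>.\<close>
    have "\<bar>(\<delta> X' Q y - \<delta> X Q y) - (\<delta> X' Q y' - \<delta> X Q y')\<bar> \<le> (B * e) * \<bar>y - y'\<bar>" for y y'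
    proof (rule DERIV_bounded_imp_lipschitz)
      show "((\<lambda>y. \<delta> X' Q y - \<delta> X Q y) has_real_derivative D X' Q y - D X Q y) (at y)" for y
        by (intro derivative_intros \<delta> PQ)
      have "B * \<bar>X' - X\<bar> \<le> B * e" using XX B by (intro mult_left_mono) auto
      then show "\<bar>D X' Q y - D X Q y\<bar> \<le> B * e" for y using D_lip[OF PQ(2), of X' y X y] by simp
    qed
    from w1_leD[OF PQ(3) this]
    have 3: "\<bar>((\<integral>y. \<delta> X' Q y \<partial>P) - (\<integral>y. \<delta> X' Q y \<partial>Q)) - ((\<integral>y. \<delta> X Q y \<partial>P) - (\<integral>y. \<delta> X Q y \<partial>Q))\<bar> \<le> B * e * d"
      using \<delta>i PQ by (simp add: algebra_simps)
    \<comment> \<open>The integral over \<open>P\<close> is one over the initial measure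
      \<open>\<nu>'\<close>; there \<open>f\<close> follows the flow that belongs to
      \<open>\<nu>\<close>, and \<open>g\<close> is the change due to the displaced flow.\<close>
    define f where "f = (\<lambda>z. \<delta> X Q (\<psi> z \<nu> t))"
    define g where "g = (\<lambda>z. \<delta> X Q (\<psi> z \<nu>' t) - \<delta> X Q (\<psi> z \<nu> t))"
    have \<delta>m: "\<delta> X Q \<in> borel_measurable borel" by (rule lipschitz_measurable[OF \<delta>_lip[OF PQ(2)]])
    have fi: "integrable M f" if "M \<in> P2" for M
    proof (rule integrable_lipschitz_P2[OF that])
      have le: "B * \<bar>\<psi> y \<nu> t - \<psi> y' \<nu> t\<bar> \<le> B * (Lx * \<bar>y - y'\<bar>)" for y y'
        using B by (intro mult_left_mono \<psi>_lip \<nu> t) auto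
      then show "\<bar>f y - f y'\<bar> \<le> (B * Lx) * \<bar>y - y'\<bar>" for y y'
        using order.trans[OF \<delta>_lip[OF PQ(2), of X "\<psi> y \<nu> t" "\<psi> y' \<nu> t"] le] by (simp add: f_def mult.assoc)
    qed
    have gm: "g \<in> borel_measurable borel"
      unfolding g_def by (intro borel_measurable_diff measurable_compose[OF \<psi>_meas \<delta>m] \<nu>)
    have gB: "\<bar>g z\<bar> \<le> B * e" for z
      unfolding g_def by (rule order.trans[OF \<delta>_lip[OF PQ(2)] mult_left_mono[OF \<psi>d[OF t]]]) (use B in simp)
    have gi: "integrable M g" if "M \<in> P2" for M by (rule integrable_bounded_P2[OF that gm gB])
    note sm = P2D(2)[OF m(1)] P2D(2)[OF m(2)]
    have mix: "(\<integral>z. h z \<partial>\<nu>') - (\<integral>z. h z \<partial>\<nu>) = (r - s) * ((\<integral>z. h z \<partial>m1) - (\<integral>z. h z \<partial>m2))"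
      if "integrable m1 h" "integrable m2 h" for h
      unfolding \<nu>_def \<nu>'_def using integral_mix_measure(2)[OF sm that r] integral_mix_measure(2)[OF sm that s]
      by (simp add: algebra_simps)
    have "(\<integral>y. \<delta> X Q y \<partial>P) = (\<integral>z. f z + g z \<partial>\<nu>')"
      unfolding P_def using integral_pf[OF \<nu>(2) \<delta>m, of t] by (simp add: f_def g_def)
    moreover have "(\<integral>y. \<delta> X Q y \<partial>Q) = (\<integral>z. f z \<partial>\<nu>)"
      unfolding f_def Q_def[symmetric] using integral_pf[OF \<nu>(1) \<delta>m, of t] by (simp add: Q_def)
    moreover have "(\<integral>z. f z + g z \<partial>\<nu>') = (\<integral>z. f z \<partial>\<nu>') + (\<integral>z. g z \<partial>\<nu>')"
      using fi gi \<nu> by simp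
    moreover have "SV x t = (\<integral>z. f z \<partial>m1) - (\<integral>z. f z \<partial>m2)" by (simp add: SV_def S0_def f_def X_def Q_def)
    \<comment> \<open>The term with \<open>f\<close> produces the source \<open>SV\<close>. The term
      with \<open>g\<close> is evaluated at \<open>\<nu>\<close>, and the exchange of
      \<open>\<nu>'\<close> for \<open>\<nu>\<close> leaves a product of two small factors.\<close>
    ultimately have 4: "(\<integral>y. \<delta> X Q y \<partial>P) - (\<integral>y. \<delta> X Q y \<partial>Q)
        = (r - s) * SV x t + (\<integral>z. g z \<partial>\<nu>) + (r - s) * ((\<integral>z. g z \<partial>m1) - (\<integral>z. g z \<partial>m2))"
      using mix[OF fi[OF m(1)] fi[OF m(2)]] mix[OF gi[OF m(1)] gi[OF m(2)]] by simp
    have "\<bar>(\<integral>z. g z \<partial>m1) - (\<integral>z. g z \<partial>m2)\<bar> \<le> 2 * B * e"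
      using integral_P2_bound[OF m(1) gm gB] integral_P2_bound[OF m(2) gm gB] by linarith
    then have 5: "\<bar>(r - s) * ((\<integral>z. g z \<partial>m1) - (\<integral>z. g z \<partial>m2))\<bar> \<le> 2 * B * e * \<bar>r - s\<bar>"
      unfolding abs_mult using mult_left_mono[of _ "2 * B * e" "\<bar>r - s\<bar>"] by (simp only: mult.commute[of _ "\<bar>r - s\<bar>"] abs_ge_zero)
    have m\<psi>: "(\<lambda>z. \<psi> z \<nu>' t - \<psi> z \<nu> t) \<in> borel_measurable borel" by (intro borel_measurable_diff \<psi>_meas \<nu>)
    \<comment> \<open>Linearising \<open>g\<close> in the displacement yields the nonlocal term, up
      to a quadratic error.\<close>
    have "\<bar>g z - cK \<nu> x z t * (\<psi> z \<nu>' t - \<psi> z \<nu> t)\<bar> \<le> B * e\<^sup>2" for z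
    proof -
      have "\<bar>D X Q y - D X Q y'\<bar> \<le> B * \<bar>y - y'\<bar>" for y y' using D_lip[OF PQ(2), of X y X y'] by simp
      from DERIV_remainder_bound[OF \<delta>(1)[OF PQ(2)] this, of "\<psi> z \<nu>' t" "\<psi> z \<nu> t"] sq[OF \<psi>d[OF t, of z]] show ?thesis
        by (simp add: g_def cK_def cl(2)[OF t] X_def Q_def mult.commute)
    qed
    then have "\<bar>\<integral>z. g z - cK \<nu> x z t * (\<psi> z \<nu>' t - \<psi> z \<nu> t) \<partial>\<nu>\<bar> \<le> B * e\<^sup>2"
      by (rule integral_P2_bound[OF \<nu>(1) borel_measurable_diff[OF gm borel_measurable_times[OF borel_measurable_continuous_onI[OF K_cont_z] m\<psi>]]])
    then have 6: "\<bar>(\<integral>z. g z \<partial>\<nu>) - J x t\<bar> \<le> B * e\<^sup>2"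
      unfolding J_def using gi[OF \<nu>(1)] KU_integral_bound(2)[OF m\<psi> \<psi>d[OF t]] by simp
    have "Src x t = \<sigma> X' P - \<sigma> X Q - cA \<nu> x t * (X' - X) - (r - s) * SV x t - J x t"
      by (simp add: Src_def X_def X'_def P_def Q_def)
    moreover have "\<bar>((\<integral>y. \<delta> X Q y \<partial>P) - (\<integral>y. \<delta> X Q y \<partial>Q)) - (r - s) * SV x t - J x t\<bar> \<le> B * e\<^sup>2 + 2 * B * e * \<bar>r - s\<bar>"
      unfolding 4 using 5 6 by linarith
    moreover have "\<bar>\<sigma> X' P - \<sigma> X' Q - ((\<integral>y. \<delta> X Q y \<partial>P) - (\<integral>y. \<delta> X Q y \<partial>Q))\<bar> \<le> \<omega> d * d + B * e * d"
      using 2 3 by linarith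
    moreover have "2 * B * e\<^sup>2 = B * e\<^sup>2 + B * e\<^sup>2" by simp
    ultimately show ?thesis using 1 by linarith
  qed
  show ?thesis
    using lin_sol_bound[OF lin src t, of x] by (simp add: V_def \<nu>'_def e_def d_def)
qed

lemma flow_mix_deriv:
  assumes m: "m1 \<in> P2" "m2 \<in> P2" and s: "s \<in> {0..1}" and t: "t \<in> {0..T}"
  shows "((\<lambda>s. \<psi> x (mix_measure s m1 m2) t) has_real_derivative
     (\<integral>y. U0 (mix_measure s m1 m2) y x t \<partial>m1) - (\<integral>y. U0 (mix_measure s m1 m2) y x t \<partial>m2)) (at s within {0..1})"
  unfolding has_field_derivative_iff tendsto_at_iff_sequentially
proof (intro allI impI)
  fix X assume X: "\<forall>n. X n \<in> {0..1} - {s}" "X \<longlonglongrightarrow> s"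
  define V where "V = (\<integral>y. U0 (mix_measure s m1 m2) y x t \<partial>m1) - (\<integral>y. U0 (mix_measure s m1 m2) y x t \<partial>m2)"
  define w where "w = (\<integral>y. \<bar>y\<bar> \<partial>m1) + (\<integral>y. \<bar>y\<bar> \<partial>m2)"
  define h where "h = (\<lambda>n. \<bar>X n - s\<bar>)"
  define c where "c = 2 * T * exp (4 * B * T)"
  \<comment> \<open>The bound on the remainder divided by \<open>h n\<close>; every term keeps a
    factor that tends to 0.\<close>
  define \<rho> where "\<rho> = (\<lambda>n. c * (2 * B * (C\<psi> * w)\<^sup>2 * h n + \<omega> ((Lx + C\<psi>) * (h n * w)) * ((Lx + C\<psi>) * w)
     + B * (C\<psi> * w) * ((Lx + C\<psi>) * w) * h n + 2 * B * (C\<psi> * w) * h n))"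
  have "0 \<le> w" unfolding w_def by (intro add_nonneg_nonneg Bochner_Integration.integral_nonneg) auto
  have "(\<lambda>n. \<bar>X n - s\<bar>) \<longlonglongrightarrow> \<bar>s - s\<bar>" by (intro tendsto_intros X)
  then have h: "h \<longlonglongrightarrow> 0" by (simp add: h_def)
  have le: "\<bar>(\<psi> x (mix_measure (X n) m1 m2) t - \<psi> x (mix_measure s m1 m2) t) / (X n - s) - V\<bar> \<le> \<rho> n" for n
  proof -
    have n: "X n \<noteq> s" "0 \<le> X n" "X n \<le> 1" using X(1) by auto
    then have hn: "0 < h n" by (simp add: h_def)
    have "\<bar>\<psi> x (mix_measure (X n) m1 m2) t - \<psi> x (mix_measure s m1 m2) t - (X n - s) * V\<bar>
      \<le> 2 * (2 * B * (C\<psi> * (h n * w))\<^sup>2 + \<omega> ((Lx + C\<psi>) * (h n * w)) * ((Lx + C\<psi>) * (h n * w))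
         + B * (C\<psi> * (h n * w)) * ((Lx + C\<psi>) * (h n * w)) + 2 * B * (C\<psi> * (h n * w)) * h n) * T * exp (4 * B * T)"
      unfolding V_def h_def w_def by (rule flow_mix_remainder[OF m n(2,3) _ _ t]) (use s in auto)
    also have "\<dots> = \<rho> n * h n" unfolding \<rho>_def c_def by (simp add: power2_eq_square algebra_simps)
    finally have "\<bar>\<psi> x (mix_measure (X n) m1 m2) t - \<psi> x (mix_measure s m1 m2) t - (X n - s) * V\<bar> / h n \<le> \<rho> n"
      using hn by (simp add: divide_le_eq)
    moreover have "(\<psi> x (mix_measure (X n) m1 m2) t - \<psi> x (mix_measure s m1 m2) t) / (X n - s) - V
       = (\<psi> x (mix_measure (X n) m1 m2) t - \<psi> x (mix_measure s m1 m2) t - (X n - s) * V) / (X n - s)"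
      using n(1) by (simp add: field_simps)
    ultimately show ?thesis by (simp add: h_def abs_divide)
  qed
  have "(\<lambda>n. (Lx + C\<psi>) * (h n * w)) \<longlonglongrightarrow> (Lx + C\<psi>) * (0 * w)" by (intro tendsto_intros h)
  then have "(\<lambda>n. \<omega> ((Lx + C\<psi>) * (h n * w))) \<longlonglongrightarrow> 0"
    using \<open>0 \<le> w\<close> Lx C\<psi> by (intro \<omega>) (auto simp: h_def)
  then have "\<rho> \<longlonglongrightarrow> c * (2 * B * (C\<psi> * w)\<^sup>2 * 0 + 0 * ((Lx + C\<psi>) * w) + B * (C\<psi> * w) * ((Lx + C\<psi>) * w) * 0 + 2 * B * (C\<psi> * w) * 0)"
    unfolding \<rho>_def by (intro tendsto_intros h)
  then have \<rho>: "\<rho> \<longlonglongrightarrow> 0" by simp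
  have "(\<lambda>n. (\<psi> x (mix_measure (X n) m1 m2) t - \<psi> x (mix_measure s m1 m2) t) / (X n - s)) \<longlonglongrightarrow> V"
    by (rule LIM_zero_cancel, rule Lim_null_comparison[OF _ \<rho>]) (use le in simp)
  then show "((\<lambda>r. (\<psi> x (mix_measure r m1 m2) t - \<psi> x (mix_measure s m1 m2) t) / (r - s)) \<circ> X) \<longlonglongrightarrow>
      (\<integral>y. U0 (mix_measure s m1 m2) y x t \<partial>m1) - (\<integral>y. U0 (mix_measure s m1 m2) y x t \<partial>m2)"
    by (simp add: comp_def V_def)
qed

lemma flow_linear_deriv:
  assumes t: "t \<in> {0..T}"
  shows "has_linear_deriv (\<lambda>\<mu>. \<psi> x \<mu> t) (\<lambda>\<mu> y. U0 \<mu> y x t)"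
  unfolding has_linear_deriv_def
proof (intro conjI allI ballI impI)
  fix \<mu> M and y :: real and z :: "nat \<Rightarrow> real" assume \<mu>: "\<mu> \<in> P2" and M: "\<forall>n. M n \<in> P2" and W: "(\<lambda>n. W2 (M n) \<mu>) \<longlonglongrightarrow> 0" and z: "z \<longlonglongrightarrow> y"
  show "(\<lambda>n. U0 (M n) (z n) x t) \<longlonglongrightarrow> U0 \<mu> y x t"
  proof (rule U0_seq_cont[OF _ \<mu> _ _ z t])
    \<comment> \<open>\<open>W2_lessD\<close> asks for a strict inequality, hence the added null
      sequence.\<close>
    show "w1_le (M n) \<mu> (W2 (M n) \<mu> + inverse (real (Suc n)))" for n
      by (rule W2_lessD) (use M \<mu> in auto)
    show "(\<lambda>n. W2 (M n) \<mu> + inverse (real (Suc n))) \<longlonglongrightarrow> 0"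
      using tendsto_add[OF W LIMSEQ_inverse_real_of_nat] by simp
  qed (use M in simp)
next
  fix R
  show "\<exists>K. \<forall>\<mu>\<in>P2. (\<integral>x. x\<^sup>2 \<partial>\<mu>) \<le> R \<longrightarrow> (\<forall>y. \<bar>U0 \<mu> y x t\<bar> \<le> K * (1 + y\<^sup>2))"
  proof (intro exI ballI impI allI)
    fix \<mu> y assume "\<mu> \<in> P2"
    from U0_bound[OF this t] have "\<bar>U0 \<mu> y x t\<bar> \<le> G0 * (\<bar>y\<bar> + B * T)" .
    also have "\<dots> \<le> G0 * ((1 + B * T) * (1 + y\<^sup>2))"
    proof (rule mult_left_mono[OF _ G0])
      have "0 \<le> (\<bar>y\<bar> - 1)\<^sup>2" by simp
      then have "\<bar>y\<bar> \<le> 1 + y\<^sup>2" by (simp add: power2_eq_square algebra_simps)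
      moreover have "0 \<le> B * T * y\<^sup>2" using B T by simp
      ultimately show "\<bar>y\<bar> + B * T \<le> (1 + B * T) * (1 + y\<^sup>2)" by (simp add: algebra_simps)
    qed
    finally show "\<bar>U0 \<mu> y x t\<bar> \<le> (G0 * (1 + B * T)) * (1 + y\<^sup>2)" by (simp only: mult.assoc)
  qed
next
  fix m1 m2 assume m: "m1 \<in> P2" "m2 \<in> P2"
  \<comment> \<open>The derivative along mixtures exists on all of [0, 1], one-sidedly at the
    endpoints, so the fundamental theorem for the gauge integral yields integrability in
    \<open>s\<close> together with the formula.\<close>
  have "((\<lambda>s. (\<integral>y. U0 (mix_measure s m1 m2) y x t \<partial>m1) - (\<integral>y. U0 (mix_measure s m1 m2) y x t \<partial>m2)) has_integral
      (\<psi> x (mix_measure 1 m1 m2) t - \<psi> x (mix_measure 0 m1 m2) t)) {0..1}"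
    by (rule fundamental_theorem_of_calculus)
      (use flow_mix_deriv[OF m _ t] in \<open>auto simp: has_real_derivative_iff_has_vector_derivative[symmetric]\<close>)
  then show "((\<lambda>s. (\<integral>y. U0 (mix_measure s m1 m2) y x t \<partial>m1) - (\<integral>y. U0 (mix_measure s m1 m2) y x t \<partial>m2)) has_integral
      (\<psi> x m1 t - \<psi> x m2 t)) {0..1}"
    using mix_measure_0_1[OF P2D(2)[OF m(1)] P2D(2)[OF m(2)]] by simp
qed

section \<open>The uniform bounds combined into the estimate\<close>

theorem flow_estimate_ex: "\<exists>C>0. \<forall>m\<in>{0..T}. flow_estimate k \<psi> m (C * exp (C * \<bar>m\<bar>))"
proof -
  obtain C1 where C1: "\<And>p i. p \<in> P2 \<times> {0..T} \<Longrightarrow> i \<in> {1..k + 2} \<Longrightarrow> weak_deriv_norm i (\<lambda>x. \<psi> x (fst p) (snd p)) \<le> ennreal C1"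
    by (rule bdd_smooth_weak_deriv_norm_primitive[OF \<psi>1_smooth, of "\<lambda>p x. \<psi> x (fst p) (snd p)"]) (auto intro: \<psi>_deriv)
  obtain C2 where C2: "\<And>p i. p \<in> (P2 \<times> UNIV) \<times> {0..T} \<Longrightarrow> i \<le> Suc k \<Longrightarrow>
      weak_deriv_norm i (\<lambda>x. U1 (fst (fst p)) (snd (fst p)) x (snd p)) \<le> ennreal C2"
    by (rule bdd_smooth_weak_deriv_norm[OF U1_smooth]) blast
  obtain U2 C3 where U2: "\<And>\<mu> t x y. 1 \<le> k \<Longrightarrow> \<mu> \<in> P2 \<Longrightarrow> t \<in> {0..T} \<Longrightarrow> ((\<lambda>y. U1 \<mu> y x t) has_real_derivative U2 \<mu> y x t) (at y)"
    and C3: "\<And>p i. 1 \<le> k \<Longrightarrow> p \<in> (P2 \<times> UNIV) \<times> {0..T} \<Longrightarrow> i \<le> k \<Longrightarrow>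
      weak_deriv_norm i (\<lambda>x. U2 (fst (fst p)) (snd (fst p)) x (snd p)) \<le> ennreal C3"
  proof (cases "1 \<le> k")
    case True
    obtain U2 where U2: "\<And>\<mu> t x y. \<mu> \<in> P2 \<Longrightarrow> t \<in> {0..T} \<Longrightarrow> ((\<lambda>y. U1 \<mu> y x t) has_real_derivative U2 \<mu> y x t) (at y)"
      and s: "bdd_smooth (k - 1) ((P2 \<times> UNIV) \<times> {0..T}) (\<lambda>p x. U2 (fst (fst p)) (snd (fst p)) x (snd p))"
      by (rule U1_y_deriv[OF True]) blast
    obtain C3 where "\<And>p i. p \<in> (P2 \<times> UNIV) \<times> {0..T} \<Longrightarrow> i \<le> Suc (k - 1) \<Longrightarrow>
      weak_deriv_norm i (\<lambda>x. U2 (fst (fst p)) (snd (fst p)) x (snd p)) \<le> ennreal C3"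
      by (rule bdd_smooth_weak_deriv_norm[OF s]) blast
    with U2 True show ?thesis by (intro that[of U2 C3]) auto
  \<comment> \<open>For \<open>k = 0\<close> the estimate contains no second derivative, and an
    arbitrary function serves as default.\<close>
  qed (rule that[of "\<lambda>_ _ _ _. 0" 0], auto)
  define c where "c = max 0 (max C1 (max C2 C3))"
  \<comment> \<open>The number of summands times the common bound \<open>c\<close>:
    \<open>k + 1\<close> for the flow, and two for each of the \<open>k\<close> orders of the
    measure derivatives; the leading 1 makes \<open>C\<close> positive. The factor
    \<open>exp (C * \<bar>t\<bar>)\<close> is at least 1.\<close>
  define C where "C = 1 + real (k + 1) * c + real k * (2 * c)"
  have c: "0 \<le> c" "C1 \<le> c" "C2 \<le> c" "C3 \<le> c" by (auto simp: c_def)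
  then have C: "0 < C" by (simp add: C_def add_pos_nonneg)
  have "flow_estimate k \<psi> t (C * exp (C * \<bar>t\<bar>))" if t: "t \<in> {0..T}" for t
    unfolding flow_estimate_def
  proof (intro exI conjI allI impI ballI)
    show "has_Lions_deriv (\<lambda>\<mu>. \<psi> x \<mu> t) (\<lambda>\<mu> y. U1 \<mu> y x t)" for x
      unfolding has_Lions_deriv_def using flow_linear_deriv[OF t] U0_deriv t by blast
    show "((\<lambda>y. U1 \<mu> y x t) has_real_derivative U2 \<mu> y x t) (at y)" if "1 \<le> k" "\<mu> \<in> P2" for x \<mu> y
      by (rule U2[OF that t])
    show "(SUP (\<mu>, y)\<in>P2 \<times> UNIV. (\<Sum>i = 1..k + 1. weak_deriv_norm i (\<lambda>x. \<psi> x \<mu> t)) +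
        (\<Sum>i = 1..k. weak_deriv_norm i (\<lambda>x. U2 \<mu> y x t) + weak_deriv_norm i (\<lambda>x. U1 \<mu> y x t))) \<le> ennreal (C * exp (C * \<bar>t\<bar>))"
    proof (rule SUP_least, clarify)
      fix \<mu> y assume \<mu>: "\<mu> \<in> P2"
      have "(\<Sum>i = 1..k + 1. weak_deriv_norm i (\<lambda>x. \<psi> x \<mu> t)) \<le> (\<Sum>i = 1..k + 1. ennreal c)"
        by (intro sum_mono order.trans[OF C1[of "(\<mu>, t)", simplified fst_conv snd_conv]] ennreal_leI c) (use \<mu> t in auto)
      moreover have "(\<Sum>i = 1..k. weak_deriv_norm i (\<lambda>x. U2 \<mu> y x t) + weak_deriv_norm i (\<lambda>x. U1 \<mu> y x t)) \<le> (\<Sum>i = 1..k. ennreal c + ennreal c)"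
        by (intro sum_mono add_mono order.trans[OF C3[of "((\<mu>, y), t)", simplified fst_conv snd_conv]]
            order.trans[OF C2[of "((\<mu>, y), t)", simplified fst_conv snd_conv]] ennreal_leI c) (use \<mu> t in auto)
      ultimately have "(\<Sum>i = 1..k + 1. weak_deriv_norm i (\<lambda>x. \<psi> x \<mu> t)) +
        (\<Sum>i = 1..k. weak_deriv_norm i (\<lambda>x. U2 \<mu> y x t) + weak_deriv_norm i (\<lambda>x. U1 \<mu> y x t))
        \<le> (\<Sum>i = 1..k + 1. ennreal c) + (\<Sum>i = 1..k. ennreal c + ennreal c)" by (rule add_mono)
      also have "\<dots> = (\<Sum>i = 1..k + 1. ennreal c) + (\<Sum>i = 1..k. ennreal (2 * c))"
        using c(1) by (simp flip: ennreal_plus)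
      also have "\<dots> = ennreal ((\<Sum>i = 1..k + 1. c) + (\<Sum>i = 1..k. 2 * c))"
        using c(1) by (subst (1 2) sum_ennreal) (auto simp: ennreal_plus sum_nonneg simp del: sum_constant)
      also have "\<dots> \<le> ennreal (C * exp (C * \<bar>t\<bar>))"
      proof (rule ennreal_leI)
        have "(\<Sum>i = 1..k + 1. c) + (\<Sum>i = 1..k. 2 * c) \<le> C * 1" by (simp add: C_def)
        also have "\<dots> \<le> C * exp (C * \<bar>t\<bar>)" using C by (intro mult_left_mono) auto
        finally show "(\<Sum>i = 1..k + 1. c) + (\<Sum>i = 1..k. 2 * c) \<le> C * exp (C * \<bar>t\<bar>)" .
      qed
      finally show "(\<Sum>i = 1..k + 1. weak_deriv_norm i (\<lambda>x. \<psi> x \<mu> t)) +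
        (\<Sum>i = 1..k. weak_deriv_norm i (\<lambda>x. U2 \<mu> y x t) + weak_deriv_norm i (\<lambda>x. U1 \<mu> y x t)) \<le> ennreal (C * exp (C * \<bar>t\<bar>))" .
    qed
  qed
  with C show ?thesis by blast
qed

end

theorem theoremB1:
  fixes \<sigma>\<^sub>0 :: "real \<Rightarrow> real measure \<Rightarrow> real"
    and \<phi> \<psi> :: "real \<Rightarrow> real measure \<Rightarrow> real \<Rightarrow> real"
    and lam T :: real and k :: nat
  assumes "1 / 2 < lam"
    and "0 < T"
    and "regularity_R lam k \<sigma>\<^sub>0"
    and "backward_flow \<sigma>\<^sub>0 \<phi>"
    and "forward_flow \<sigma>\<^sub>0 \<psi>"
  shows "(\<exists>C>0. \<forall>m\<in>{0..T}. flow_estimate k \<phi> m (C * exp (C * \<bar>m\<bar>))) \<and>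
         (\<exists>C>0. \<forall>m\<in>{0..T}. flow_estimate k \<psi> m (C * exp (C * \<bar>m\<bar>)))"
proof -
  obtain s1 D Dy \<delta> B \<omega> where "regular_coeff \<sigma>\<^sub>0 s1 D Dy \<delta> B \<omega> k"
    using regularity_R_imp_regular_coeff[OF assms(1,3)] by blast
  then interpret regular_coeff \<sigma>\<^sub>0 s1 D Dy \<delta> B \<omega> k .
  interpret fwd: flow \<sigma>\<^sub>0 s1 D Dy \<delta> B \<omega> k \<psi> T
    by (intro flow.intro regular_coeff_axioms flow_axioms.intro assms)
  interpret bwd: flow "\<lambda>x \<mu>. - \<sigma>\<^sub>0 x \<mu>" "\<lambda>x \<mu>. - s1 x \<mu>" "\<lambda>x \<mu> y. - D x \<mu> y" "\<lambda>x \<mu> y. - Dy x \<mu> y"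
      "\<lambda>x \<mu> y. - \<delta> x \<mu> y" B \<omega> k \<phi> T
    by (intro flow.intro regular_coeff_uminus flow_axioms.intro assms(2) assms(4)[unfolded backward_flow_def])
  show ?thesis using bwd.flow_estimate_ex fwd.flow_estimate_ex by blast
qed

end
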